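(* Let $\gamma<0$ and $1<p<3$. Let $(L_n)$ be a sequence of positive numbers with $L_n\to0^+$ and, for each $n$, let $u_n\in H^1(\mathbb S)$ be a real-valued positive minimizer of $$\tilde e_{1,\gamma}(L_n)=\inf\{\tilde E_{L_n,\gamma}(u): u\in H^1(\mathbb S),\ \|u\|_{L^2(\mathbb S)}^2=1\}.$$ Then there exists a subsequence of $(u_n)$, still denoted by $(u_n)$, such that $$\lim_{n\to\infty}\|u_n-\tilde\phi_{\tilde\omega,\gamma}\|_{H^1(\mathbb S)}=0 .$$
   Context: $\mathbb S=\mathbb R\times[0,1]$, and $u(0,y)$ denotes the trace of $u\in H^1(\mathbb S)$ on $\{x=0\}$. For $L>0$, $$\tilde E_{L,\gamma}(u)=\int_0^1\int_{\mathbb R}\Big(\tfrac12|\partial_xu|^2+\tfrac1{2L^2}|\partial_yu|^2-\tfrac1{p+1}|u|^{p+1}\Big)dxdy+\tfrac\gamma2\int_0^1|u(0,y)|^2dy .$$ For $\omega>\gamma^2/4$, $$\phi_{\omega,\gamma}(x)=\Big(\tfrac{(p+1)\omega}{2}\,\mathrm{sech}^2\Big(\tfrac{(p-1)\sqrt\omega}{2}|x|-\tanh^{-1}\big(\tfrac{\gamma}{2\sqrt\omega}\big)\Big)\Big)^{\frac1{p-1}},$$ which is the unique positive solution of $-\phi''+\omega\phi+\gamma\delta_0\phi-|\phi|^{p-1}\phi=0$ on $\mathbb R$. The number $\tilde\omega=\tilde\omega(\gamma)>\gamma^2/4$ is the unique one such that $\|\phi_{\tilde\omega,\gamma}\|_{L^2(\mathbb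 R)}^2=1$; $\phi_{\tilde\omega,\gamma}$ is then the unique real-valued positive minimizer of $E^{1D}_\gamma(u)=\frac12\int_{\mathbb R}|u'|^2dx+\frac\gamma2|u(0)|^2-\frac1{p+1}\int_{\mathbb R}|u|^{p+1}dx$ over $u\in H^1(\mathbb R)$ with $\|u\|_{L^2(\mathbb R)}^2=1$. Its extension to the strip is $\tilde\phi_{\tilde\omega,\gamma}(x,y)=\phi_{\tilde\omega,\gamma}(x)$. *)

theory Defs
  imports "HOL-Analysis.Analysis"
begin

text \<open>Elements of the function spaces are represented by functions; two functions that agree
  almost everywhere represent the same element.\<close>

definition Ltwo :: "'a measure \<Rightarrow> ('a \<Rightarrow> complex) set" where
  "Ltwo M = {f \<in> borel_measurable M. integrable M (\<lambda>z. (norm (f z))\<^sup>2)}"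

definition Ltwo_norm :: "'a measure \<Rightarrow> ('a \<Rightarrow> complex) \<Rightarrow> real" where
  "Ltwo_norm M f = sqrt (LINT z|M. (norm (f z))\<^sup>2)"

definition strip :: "(real \<times> real) set" where
  "strip = UNIV \<times> {0..1}"

primrec times_cont_diff :: "nat \<Rightarrow> (real \<times> real \<Rightarrow> real) \<Rightarrow> bool" where
  "times_cont_diff 0 f \<longleftrightarrow> continuous_on UNIV f"
| "times_cont_diff (Suc k) f \<longleftrightarrow>
     (\<forall>z. f differentiable (at z)) \<and>
     (\<forall>v. times_cont_diff k (\<lambda>z. frechet_derivative f (at z) v))"

text \<open>Test functions are infinitely differentiable with compact support in the open strip.\<close>

definition test_functions :: "(real \<times> real \<Rightarrow> real) set" where
  "test_functions = {\<theta>. (\<forall>k. times_cont_diff k \<theta>) \<and>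
     (\<exists>K. compact K \<and> K \<subseteq> UNIV \<times> {0<..<1} \<and> (\<forall>z. z \<notin> K \<longrightarrow> \<theta> z = 0))}"

text \<open>\<open>g\<close> is a weak derivative of \<open>u\<close> in the direction \<open>v\<close>; \<open>v = (1, 0)\<close> is the
  \<open>x\<close>-derivative and \<open>v = (0, 1)\<close> the \<open>y\<close>-derivative.\<close>

definition has_weak_partial ::
  "(real \<times> real \<Rightarrow> complex) \<Rightarrow> real \<times> real \<Rightarrow> (real \<times> real \<Rightarrow> complex) \<Rightarrow> bool" where
  "has_weak_partial u v g \<longleftrightarrow>
     (\<forall>\<theta> \<in> test_functions.
        (LINT z|lebesgue_on strip. frechet_derivative \<theta> (at z) v *\<^sub>R u z)
          = - (LINT z|lebesgue_on strip. \<theta> z *\<^sub>R g z))"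

definition H1 :: "(real \<times> real \<Rightarrow> complex) set" where
  "H1 = {u \<in> Ltwo (lebesgue_on strip).
     (\<exists>g \<in> Ltwo (lebesgue_on strip). has_weak_partial u (1, 0) g) \<and>
     (\<exists>g \<in> Ltwo (lebesgue_on strip). has_weak_partial u (0, 1) g)}"

text \<open>On \<open>H1\<close> the choice is unique almost everywhere; outside \<open>H1\<close> the value is
  meaningless.\<close>

definition weak_partial ::
  "real \<times> real \<Rightarrow> (real \<times> real \<Rightarrow> complex) \<Rightarrow> (real \<times> real \<Rightarrow> complex)" where
  "weak_partial v u = (SOME g. g \<in> Ltwo (lebesgue_on strip) \<and> has_weak_partial u v g)"

definition H1_norm :: "(real \<times> real \<Rightarrow> complex) \<Rightarrow> real" where
  "H1_norm u = sqrt ((Ltwo_norm (lebesgue_on strip) u)\<^sup>2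
     + (Ltwo_norm (lebesgue_on strip) (weak_partial (1, 0) u))\<^sup>2
     + (Ltwo_norm (lebesgue_on strip) (weak_partial (0, 1) u))\<^sup>2)"

text \<open>The trace on \<open>{x = 0}\<close> is the continuous extension to \<open>H1\<close> of the restriction
  \<open>w \<mapsto> w(0, \<cdot>)\<close>, which is defined pointwise on the dense subspace of those \<open>w\<close> that are
  continuous on the closed strip.\<close>

definition has_trace :: "(real \<times> real \<Rightarrow> complex) \<Rightarrow> (real \<Rightarrow> complex) \<Rightarrow> bool" where
  "has_trace u g \<longleftrightarrow> g \<in> Ltwo (lebesgue_on {0..1}) \<and>
     (\<exists>w. (\<forall>k::nat. w k \<in> H1 \<and> continuous_on strip (w k)) \<and>
          (\<lambda>k. H1_norm (\<lambda>z. w k z - u z)) \<longlonglongrightarrow> 0 \<and>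
          (\<lambda>k. Ltwo_norm (lebesgue_on {0..1}) (\<lambda>y. w k (0, y) - g y)) \<longlonglongrightarrow> 0)"

definition strip_trace :: "(real \<times> real \<Rightarrow> complex) \<Rightarrow> (real \<Rightarrow> complex)" where
  "strip_trace u = (SOME g. has_trace u g)"

definition energy :: "real \<Rightarrow> real \<Rightarrow> real \<Rightarrow> (real \<times> real \<Rightarrow> complex) \<Rightarrow> real" where
  "energy p \<gamma> L u =
     (LINT z|lebesgue_on strip.
        1 / 2 * (norm (weak_partial (1, 0) u z))\<^sup>2
        + 1 / (2 * L\<^sup>2) * (norm (weak_partial (0, 1) u z))\<^sup>2
        - 1 / (p + 1) * norm (u z) powr (p + 1))
     + \<gamma> / 2 * (LINT y|lebesgue_on {0..1}. (norm (strip_trace u y))\<^sup>2)"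

definition admissible :: "(real \<times> real \<Rightarrow> complex) set" where
  "admissible = {u \<in> H1. (Ltwo_norm (lebesgue_on strip) u)\<^sup>2 = 1}"

text \<open>The infimum is taken in \<open>ereal\<close>, so that it is meaningful without first knowing that
  the energy is bounded from below.\<close>

definition min_energy :: "real \<Rightarrow> real \<Rightarrow> real \<Rightarrow> ereal" where
  "min_energy p \<gamma> L = (INF u \<in> admissible. ereal (energy p \<gamma> L u))"

definition minimizer :: "real \<Rightarrow> real \<Rightarrow> real \<Rightarrow> (real \<times> real \<Rightarrow> complex) \<Rightarrow> bool" where
  "minimizer p \<gamma> L u \<longleftrightarrow> u \<in> admissible \<and> ereal (energy p \<gamma> L u) = min_energy p \<gamma> L"

definition profile :: "real \<Rightarrow> real \<Rightarrow> real \<Rightarrow> real \<Rightarrow> real" where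
  "profile p \<gamma> \<omega> x =
     ((p + 1) * \<omega> / 2
       * (1 / cosh ((p - 1) * sqrt \<omega> / 2 * \<bar>x\<bar> - artanh (\<gamma> / (2 * sqrt \<omega>))))\<^sup>2)
     powr (1 / (p - 1))"

definition omega_tilde :: "real \<Rightarrow> real \<Rightarrow> real" where
  "omega_tilde p \<gamma> = (THE \<omega>. \<omega> > \<gamma>\<^sup>2 / 4 \<and>
     (Ltwo_norm lebesgue (\<lambda>x. complex_of_real (profile p \<gamma> \<omega> x)))\<^sup>2 = 1)"

definition strip_profile :: "real \<Rightarrow> real \<Rightarrow> real \<Rightarrow> real \<times> real \<Rightarrow> complex" where
  "strip_profile p \<gamma> \<omega> = (\<lambda>(x, y). complex_of_real (profile p \<gamma> \<omega> x))"

end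

theory Submission
  imports Defs "HOL-Computational_Algebra.Polynomial" "HOL-Real_Asymp.Real_Asymp"
begin

text \<open>
  Write \<open>p = 2q + 1\<close>. The line problem is solved by a calibration. Along the soliton the logarithmic
  derivative of \<open>\<phi>\<close> is a function \<open>T\<close> of the mass \<open>m(x) = \<integral>\<^bsub>-\<infinity>\<^esub>\<^bsup>x\<^esup> \<phi>\<^sup>2\<close>. For an arbitrary \<open>v\<close> on a
  half-line, integrating \<open>(v' - T(m) v)\<^sup>2 \<ge> 0\<close> with \<open>m\<close> the mass of \<open>v\<close> bounds its energy from
  below by a function of its mass and of its value at the defect. Gluing the two half-lines, a function
  of mass \<open>\<mu>\<close> has energy at least \<open>-2K(\<mu>/2) + T(\<mu>/2) v(0)\<^sup>2\<close> plus half of its squared defect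
  \<open>\<integral>(v' - slope v)\<^sup>2\<close>, and \<open>T(1/2) = -\<gamma>/2\<close> turns the point term into the delta interaction.

  On the strip this is applied to almost every slice \<open>u(\<cdot>, y)\<close>. Comparison with the extended
  profile bounds \<open>\<partial>\<^sub>x u\<^sub>n\<close> and gives \<open>\<parallel>\<partial>\<^sub>y u\<^sub>n\<parallel> = O(L\<^sub>n)\<close>, so the slice masses are uniformly
  close to \<open>1\<close> and the total defect of \<open>u\<^sub>n\<close> tends to \<open>0\<close>. Along a subsequence the defect of almost
  every slice vanishes in the limit; such slices almost solve the first order equation \<open>m' = R(m)\<close> of
  the soliton, hence converge pointwise to the profile by Gronwall. Since the masses agree, the
  convergence holds in \<open>L\<^sup>2\<close>, and the vanishing defect upgrades it to \<open>\<partial>\<^sub>x\<close>.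
\<close>

section \<open>Smooth bump functions and product test functions\<close>

text \<open>Weak compactness alone would leave two questions: mass could escape to infinity along
  the strip, and a weak limit would still have to be identified. The calibration is quantitative
  instead. Its remainder is the squared defect, so a slice whose energy nearly reaches the line
  minimum is itself close to the profile. Two signs matter. Since \<open>q < 1\<close>, the power
  \<open>s powr q\<close> is concave, and the nonlinear term is bounded by its tangent at the value
  that the soliton has at the same mass. Since \<open>\<gamma> < 0\<close>, \<open>T (1 / 2)\<close>
  is positive, and this penalises unequal masses on the two half-lines; it fixes the position of the
  limit, which the free problem leaves open up to translation. The same sign makes the free soliton
  heavier than \<open>1\<close>, so masses near \<open>1\<close> stay where \<open>T\<close> and
  \<open>K\<close> are meaningful. The other obstacle lies in the definitions: weak derivatives and
  traces are selected by \<open>SOME\<close>, while slices make sense only for a representative that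
  is absolutely continuous on almost every line, so the two have to be tied together before the line
  argument can start.\<close>

coinductive smooth :: "(real \<Rightarrow> real) \<Rightarrow> bool" where
  smoothI: "(\<And>x. (f has_real_derivative f' x) (at x)) \<Longrightarrow> smooth f' \<Longrightarrow> smooth f"

lemma smooth_derivE:
  assumes "smooth f"
  obtains f' where "\<And>x. (f has_real_derivative f' x) (at x)" "smooth f'"
  using assms by (cases rule: smooth.cases) auto

lemma smooth_continuous:
  assumes "smooth f" shows "continuous_on S f"
proof -
  obtain f' where "\<And>x. (f has_real_derivative f' x) (at x)" using smooth_derivE[OF assms] by blast
  then show ?thesis by (meson DERIV_isCont continuous_at_imp_continuous_on)
qed

lemma smooth_const: "smooth (\<lambda>x. c)"
proof (coinduction arbitrary: c)
  case smooth
  show ?case by (rule exI[of _ "\<lambda>x. c"], rule exI[of _ "\<lambda>x. 0"]) (auto intro: derivative_eq_intros)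
qed

text \<open>A single product is not closed under differentiation, but finite sums of products are:
  each pair splits into two pairs. Lists of pairs therefore form a class on which coinduction for
  \<open>smooth\<close> closes; products and differences come out as lists of length one and
  two.\<close>

lemma smooth_sum_products:
  assumes "\<forall>(f,g)\<in>set ps. smooth f \<and> smooth g"
  shows "smooth (\<lambda>x. \<Sum>(f,g)\<leftarrow>ps. f x * g x)"
  using assms
proof (coinduction arbitrary: ps)
  case smooth
  have "\<exists>qs. (\<forall>(f,g)\<in>set qs. smooth f \<and> smooth g) \<and>
    (\<forall>x. ((\<lambda>x. \<Sum>(f,g)\<leftarrow>ps. f x * g x) has_real_derivative (\<Sum>(f,g)\<leftarrow>qs. f x * g x)) (at x))"
    using smooth
  proof (induction ps)
    case Nil
    show ?case by (rule exI[of _ "[]"]) auto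
  next
    case (Cons p ps)
    obtain f g where p: "p = (f,g)" by (cases p)
    obtain f' where f': "\<And>x. (f has_real_derivative f' x) (at x)" "smooth f'"
      using Cons.prems p smooth_derivE[of f] by auto
    obtain g' where g': "\<And>x. (g has_real_derivative g' x) (at x)" "smooth g'"
      using Cons.prems p smooth_derivE[of g] by auto
    obtain qs where qs: "\<forall>(f,g)\<in>set qs. smooth f \<and> smooth g"
      "\<And>x. ((\<lambda>x. \<Sum>(f,g)\<leftarrow>ps. f x * g x) has_real_derivative (\<Sum>(f,g)\<leftarrow>qs. f x * g x)) (at x)"
      using Cons by auto
    show ?case
    proof (rule exI[of _ "(f',g) # (f,g') # qs"], intro conjI allI)
      show "\<forall>(f,g)\<in>set ((f',g) # (f,g') # qs). smooth f \<and> smooth g"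
        using f' g' qs Cons.prems p by auto
      fix x
      show "((\<lambda>x. \<Sum>(f,g)\<leftarrow>p # ps. f x * g x) has_real_derivative
         (\<Sum>(f,g)\<leftarrow>(f',g) # (f,g') # qs. f x * g x)) (at x)"
        unfolding p
        by (auto intro!: derivative_eq_intros f'(1) g'(1) qs(2))
    qed
  qed
  then obtain qs where "\<forall>(f,g)\<in>set qs. smooth f \<and> smooth g"
    "\<And>x. ((\<lambda>x. \<Sum>(f,g)\<leftarrow>ps. f x * g x) has_real_derivative (\<Sum>(f,g)\<leftarrow>qs. f x * g x)) (at x)"
    by blast
  then show ?case
    by (intro exI[of _ "\<lambda>x. \<Sum>(f,g)\<leftarrow>ps. f x * g x"] exI[of _ "\<lambda>x. \<Sum>(f,g)\<leftarrow>qs. f x * g x"]) blast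
qed

lemma smooth_mult: "smooth f \<Longrightarrow> smooth g \<Longrightarrow> smooth (\<lambda>x. f x * g x)"
  using smooth_sum_products[of "[(f,g)]"] by simp

lemma smooth_diff:
  assumes "smooth f" "smooth g" shows "smooth (\<lambda>x. f x - g x)"
  using smooth_sum_products[of "[(f,\<lambda>x. 1),(g,\<lambda>x. -1)]"] assms smooth_const by simp

lemma smooth_affine:
  assumes "smooth f" shows "smooth (\<lambda>x. c * f (a * x + b))"
  using assms
proof (coinduction arbitrary: f c)
  case smooth
  then obtain f' where f': "\<And>x. (f has_real_derivative f' x) (at x)" "smooth f'"
    using smooth_derivE by blast
  have "((\<lambda>x. c * f (a * x + b)) has_real_derivative (c * a) * f' (a * x + b)) (at x)" for x
    by (auto intro!: derivative_eq_intros DERIV_chain2[OF f'(1)])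
  with f'(2) show ?case
    by (intro exI[of _ "\<lambda>x. c * f (a * x + b)"] exI[of _ "\<lambda>x. (c * a) * f' (a * x + b)"]) blast
qed

lemma smooth_antiderivative:
  assumes "smooth f" "\<And>x. (F has_real_derivative f x) (at x)"
  shows "smooth F"
  using smooth.intros assms by blast

definition exp_bump :: "real \<Rightarrow> real" where
  "exp_bump x = (if x > 0 then exp (- 1 / x) else 0)"

lemma tendsto_poly_exp: "((\<lambda>t::real. poly P t * exp (- t)) \<longlongrightarrow> 0) at_top"
proof -
  have "((\<lambda>t::real. \<Sum>i\<le>degree P. coeff P i * (t ^ i / exp t)) \<longlongrightarrow> (\<Sum>i\<le>degree P. coeff P i * 0)) at_top"
    by (intro tendsto_intros tendsto_power_div_exp_0)
  moreover have "(\<lambda>t::real. \<Sum>i\<le>degree P. coeff P i * (t ^ i / exp t)) = (\<lambda>t. poly P t * exp (- t))"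
    by (auto simp: poly_altdef sum_distrib_right exp_minus divide_inverse mult.assoc)
  ultimately show ?thesis by simp
qed

text \<open>The functions \<open>poly P (1 / x) * exp (- 1 / x)\<close> form a class closed under
  differentiation, so the coinduction runs over \<open>P\<close>. The chain rule brings out a factor
  \<open>1 / x^2\<close>, which is the factor \<open>[:0,0,1:]\<close> in \<open>Q\<close>. At
  \<open>0\<close> the exponential beats every polynomial in \<open>1 / x\<close>.\<close>

lemma smooth_exp_bump: "smooth exp_bump"
proof -
  have "smooth (\<lambda>x. if x > 0 then poly P (1 / x) * exp (- 1 / x) else 0)" for P :: "real poly"
  proof (coinduction arbitrary: P)
    case smooth
    define h where "h P x = (if x > 0 then poly P (1 / x) * exp (- 1 / x) else 0)" for P and x :: real
    define Q where "Q = [:0,0,1:] * (P - pderiv P)"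
    have "(h P has_real_derivative h Q x) (at x)" for x
    proof -
      consider "x > 0" | "x < 0" | "x = 0" by linarith
      then show ?thesis
      proof cases
        case 1
        have i: "((\<lambda>x. 1 / x) has_real_derivative (- 1 / x\<^sup>2)) (at x)"
          using 1 by (auto intro!: derivative_eq_intros simp: power2_eq_square)
        have e: "((\<lambda>x. exp (- 1 / x)) has_real_derivative exp (- 1 / x) * (1 / x\<^sup>2)) (at x)"
          using 1 by (auto intro!: derivative_eq_intros simp: power2_eq_square)
        have "((\<lambda>x. poly P (1 / x)) has_real_derivative poly (pderiv P) (1 / x) * (- 1 / x\<^sup>2)) (at x)"
          by (rule DERIV_chain2[OF poly_DERIV i])
        from DERIV_mult[OF this e]
        have "((\<lambda>x. poly P (1 / x) * exp (- 1 / x)) has_real_derivative h Q x) (at x)"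
          by (rule DERIV_cong) (use 1 in \<open>simp add: h_def Q_def field_simps power2_eq_square\<close>)
        then show ?thesis
          by (rule DERIV_cong_ev[THEN iffD1, OF refl _ refl, rotated])
             (use eventually_nhds_in_open[of "{0<..}" x] 1 in \<open>auto elim!: eventually_mono simp: h_def\<close>)
      next
        case 2
        have "((\<lambda>x. 0) has_real_derivative h Q x) (at x)" using 2 by (auto simp: h_def)
        then show ?thesis
          by (rule DERIV_cong_ev[THEN iffD1, OF refl _ refl, rotated])
             (use eventually_nhds_in_open[of "{..<0}" x] 2 in \<open>auto elim!: eventually_mono simp: h_def\<close>)
      next
        case 3
        have r: "((\<lambda>y. h P y / y) \<longlongrightarrow> 0) (at_right 0)"
        proof -
          have "((\<lambda>t::real. poly (pCons 0 P) t * exp (- t)) \<longlongrightarrow> 0) at_top" by (rule tendsto_poly_exp)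
          then have "((\<lambda>y::real. poly (pCons 0 P) (inverse y) * exp (- inverse y)) \<longlongrightarrow> 0) (at_right 0)"
            by (rule filterlim_compose[OF _ filterlim_inverse_at_top_right])
          then show ?thesis
            by (rule Lim_transform_eventually)
               (auto simp: eventually_at_filter h_def field_simps)
        qed
        have l: "((\<lambda>y. h P y / y) \<longlongrightarrow> 0) (at_left 0)"
          by (rule tendsto_eventually) (auto simp: eventually_at_filter h_def)
        have "((\<lambda>y. h P y / y) \<longlongrightarrow> 0) (at 0)" using r l by (simp add: filterlim_split_at_real)
        then show ?thesis
          unfolding 3 has_field_derivative_iff by (simp add: h_def)
      qed
    qed
    then show ?case
      by (intro exI[of _ "h P"] exI[of _ "h Q"]) (auto simp: h_def fun_eq_iff)
  qed
  from this[of 1] show ?thesis by (simp add: exp_bump_def[abs_def] cong: if_cong)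
qed

lemma exp_bump_bounds: "0 \<le> exp_bump x" "exp_bump x \<le> 1" "x \<le> 0 \<Longrightarrow> exp_bump x = 0"
  "x > 0 \<Longrightarrow> exp_bump x > 0"
  by (auto simp: exp_bump_def)

text \<open>A steepened bump: as \<open>k\<close> grows it tends to the indicator of the open
  interval, while it vanishes outside the interval for every \<open>k\<close>. It is a smooth
  substitute for an indicator and is not normalised to integral one.\<close>

definition interval_bump :: "nat \<Rightarrow> real \<Rightarrow> real \<Rightarrow> real \<Rightarrow> real" where
  "interval_bump k a b x = exp_bump (real (Suc k) * (x - a)) * exp_bump (real (Suc k) * (b - x))"

lemma smooth_interval_bump: "smooth (interval_bump k a b)"
proof -
  have "smooth (\<lambda>x. (1 * exp_bump (real (Suc k) * x + (- real (Suc k) * a))) *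
     (1 * exp_bump ((- real (Suc k)) * x + real (Suc k) * b)))"
    by (intro smooth_mult smooth_affine smooth_exp_bump)
  moreover have "(\<lambda>x. (1 * exp_bump (real (Suc k) * x + (- real (Suc k) * a))) *
     (1 * exp_bump ((- real (Suc k)) * x + real (Suc k) * b))) = interval_bump k a b"
    unfolding interval_bump_def[abs_def]
    by (intro ext arg_cong2[where f="(*)"]) (simp_all add: algebra_simps)
  ultimately show ?thesis by simp
qed

lemma interval_bump_bounds:
  "0 \<le> interval_bump k a b x" "interval_bump k a b x \<le> 1"
  "\<not> (a < x \<and> x < b) \<Longrightarrow> interval_bump k a b x = 0"
proof -
  show "0 \<le> interval_bump k a b x" "interval_bump k a b x \<le> 1"
    by (simp_all add: interval_bump_def exp_bump_bounds mult_le_one)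
  assume "\<not> (a < x \<and> x < b)"
  then consider "x - a \<le> 0" | "b - x \<le> 0" by linarith
  then show "interval_bump k a b x = 0"
    by cases (auto simp: interval_bump_def exp_bump_bounds(3) mult_nonneg_nonpos)
qed

lemma exp_bump_tendsto:
  assumes "x > 0" shows "(\<lambda>k. exp_bump (real (Suc k) * x)) \<longlonglongrightarrow> 1"
proof -
  have "(\<lambda>k. exp (- (1 / x) * inverse (real (Suc k)))) \<longlonglongrightarrow> exp (- (1 / x) * 0)"
    by (intro tendsto_intros LIMSEQ_inverse_real_of_nat)
  moreover have "exp (- (1 / x) * inverse (real (Suc k))) = exp_bump (real (Suc k) * x)" for k
    using assms by (simp add: exp_bump_def zero_less_mult_iff divide_inverse del: of_nat_Suc)
  ultimately show ?thesis by simp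
qed

lemma interval_bump_tendsto:
  "(\<lambda>k. interval_bump k a b x) \<longlonglongrightarrow> indicator {a<..<b} x"
proof (cases "a < x \<and> x < b")
  case True
  then have "(\<lambda>k. interval_bump k a b x) \<longlonglongrightarrow> 1 * 1"
    unfolding interval_bump_def by (intro tendsto_mult exp_bump_tendsto) auto
  then show ?thesis using True by simp
next
  case False
  then show ?thesis by (auto simp: interval_bump_bounds(3))
qed

lemma has_derivative_product_fun:
  fixes f g :: "real \<Rightarrow> real"
  assumes "(f has_real_derivative f') (at (fst z))" "(g has_real_derivative g') (at (snd z))"
  shows "((\<lambda>z. f (fst z) * g (snd z)) has_derivative (\<lambda>v. fst v * (f' * g (snd z)) + snd v * (f (fst z) * g'))) (at z)"
proof -
  have 1: "((\<lambda>z. f (fst z)) has_derivative (\<lambda>v. f' * fst v)) (at z)"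
    using has_derivative_compose[OF has_derivative_fst[OF has_derivative_ident] assms(1)[unfolded has_field_derivative_def]]
    by simp
  have 2: "((\<lambda>z. g (snd z)) has_derivative (\<lambda>v. g' * snd v)) (at z)"
    using has_derivative_compose[OF has_derivative_snd[OF has_derivative_ident] assms(2)[unfolded has_field_derivative_def]]
    by simp
  show ?thesis
    by (rule has_derivative_eq_rhs[OF has_derivative_mult[OF 1 2]]) (auto simp: algebra_simps)
qed

text \<open>A directional derivative of \<open>f (fst z) * g (snd z)\<close> is a combination of two
  such products, with the components of the direction as coefficients. Lists with real coefficients
  are therefore stable under all directional derivatives, as the recursion in
  \<open>times_cont_diff\<close> requires.\<close>

lemma times_cont_diff_sum_products:
  assumes "\<forall>(c,f,g)\<in>set ps. smooth f \<and> smooth g"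
  shows "times_cont_diff k (\<lambda>z. \<Sum>(c,f,g)\<leftarrow>ps. c * (f (fst z) * g (snd z)))"
  using assms
proof (induction k arbitrary: ps)
  case 0
  then have "continuous_on UNIV (\<lambda>z. \<Sum>(c,f,g)\<leftarrow>ps. c * (f (fst z) * g (snd z)))"
  proof (induction ps)
    case (Cons p ps)
    obtain c f g where p: "p = (c,f,g)" by (cases p) auto
    have "continuous_on UNIV (\<lambda>z::real\<times>real. f (fst z))"
      by (rule continuous_on_compose2[OF smooth_continuous[of f UNIV]]) (use Cons p in \<open>auto intro!: continuous_intros\<close>)
    moreover have "continuous_on UNIV (\<lambda>z::real\<times>real. g (snd z))"
      by (rule continuous_on_compose2[OF smooth_continuous[of g UNIV]]) (use Cons p in \<open>auto intro!: continuous_intros\<close>)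
    ultimately show ?case using Cons p by (auto intro!: continuous_intros)
  qed auto
  then show ?case by simp
next
  case (Suc k)
  define h where "h ps = (\<lambda>z::real\<times>real. \<Sum>(c,f,g)\<leftarrow>ps. c * (f (fst z) * g (snd z)))"
    for ps :: "(real \<times> (real \<Rightarrow> real) \<times> (real \<Rightarrow> real)) list"
  have "\<exists>D. (\<forall>z. (h ps has_derivative D z) (at z)) \<and>
     (\<forall>v. \<exists>qs. (\<forall>(c,f,g)\<in>set qs. smooth f \<and> smooth g) \<and> (\<forall>z. D z v = h qs z))"
    using Suc.prems
  proof (induction ps)
    case Nil
    show ?case
      by (rule exI[of _ "\<lambda>z v. 0"], intro conjI allI, simp add: h_def, rule exI[of _ "[]"])
         (auto simp: h_def)
  next
    case (Cons p ps)
    obtain c f g where p: "p = (c,f,g)" by (cases p) auto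
    obtain f' where f': "\<And>x. (f has_real_derivative f' x) (at x)" "smooth f'"
      using Cons.prems p smooth_derivE[of f] by auto
    obtain g' where g': "\<And>x. (g has_real_derivative g' x) (at x)" "smooth g'"
      using Cons.prems p smooth_derivE[of g] by auto
    obtain D where D: "\<And>z. (h ps has_derivative D z) (at z)"
      "\<And>v. \<exists>qs. (\<forall>(c,f,g)\<in>set qs. smooth f \<and> smooth g) \<and> (\<forall>z. D z v = h qs z)"
      using Cons by auto
    let ?D = "\<lambda>z v. c * (fst v * (f' (fst z) * g (snd z)) + snd v * (f (fst z) * g' (snd z))) + D z v"
    have "(h (p # ps) has_derivative ?D z) (at z)" for z
    proof -
      have "((\<lambda>z. c * (f (fst z) * g (snd z)) + h ps z) has_derivative ?D z) (at z)"
        by (intro has_derivative_add has_derivative_mult_right has_derivative_product_fun f' g' D)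
      then show ?thesis by (simp add: h_def p)
    qed
    moreover have "\<exists>qs. (\<forall>(c,f,g)\<in>set qs. smooth f \<and> smooth g) \<and> (\<forall>z. ?D z v = h qs z)" for v
    proof -
      obtain qs where qs: "\<forall>(c,f,g)\<in>set qs. smooth f \<and> smooth g" "\<And>z. D z v = h qs z" using D(2) by blast
      show ?thesis
        by (rule exI[of _ "(c * fst v, f', g) # (c * snd v, f, g') # qs"])
           (use qs f' g' Cons.prems p in \<open>auto simp: h_def algebra_simps\<close>)
    qed
    ultimately show ?case by (intro exI[of _ ?D]) blast
  qed
  then obtain D where D: "\<And>z. (h ps has_derivative D z) (at z)"
      "\<And>v. \<exists>qs. (\<forall>(c,f,g)\<in>set qs. smooth f \<and> smooth g) \<and> (\<forall>z. D z v = h qs z)" by auto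
  have "times_cont_diff k (\<lambda>z. frechet_derivative (h ps) (at z) v)" for v
  proof -
    obtain qs where qs: "\<forall>(c,f,g)\<in>set qs. smooth f \<and> smooth g" "\<And>z. D z v = h qs z" using D(2) by blast
    have "(\<lambda>z. frechet_derivative (h ps) (at z) v) = h qs"
      by (intro ext) (simp only: frechet_derivative_at[OF D(1), symmetric] qs(2))
    then show ?thesis using Suc.IH[OF qs(1)] by (simp add: h_def)
  qed
  moreover have "h ps differentiable (at z)" for z unfolding differentiable_def using D(1)[of z] by blast
  ultimately show ?case by (simp add: h_def)
qed

lemma product_test_function:
  assumes "smooth f" "smooth g" and "0 < c" "d < 1"
    and "\<And>x. \<not> (a < x \<and> x < b) \<Longrightarrow> f x = 0" "\<And>x. \<not> (c < x \<and> x < d) \<Longrightarrow> g x = 0"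
  shows "(\<lambda>z. f (fst z) * g (snd z)) \<in> test_functions"
proof -
  have "times_cont_diff k (\<lambda>z. f (fst z) * g (snd z))" for k
    using times_cont_diff_sum_products[of "[(1,f,g)]" k] assms by simp
  moreover have "\<exists>K. compact K \<and> K \<subseteq> UNIV \<times> {0<..<1} \<and> (\<forall>z. z \<notin> K \<longrightarrow> f (fst z) * g (snd z) = 0)"
    using assms by (intro exI[of _ "{a..b} \<times> {c..d}"]) (auto intro!: compact_Times simp: not_less less_imp_le)
  ultimately show ?thesis by (auto simp: test_functions_def)
qed

lemma frechet_derivative_product_fun:
  assumes "\<And>x. (f has_real_derivative f' x) (at x)" "\<And>x. (g has_real_derivative g' x) (at x)"
  shows "frechet_derivative (\<lambda>z. f (fst z) * g (snd z)) (at z) v =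
    fst v * (f' (fst z) * g (snd z)) + snd v * (f (fst z) * g' (snd z))"
  by (simp only: frechet_derivative_at[OF has_derivative_product_fun[OF assms(1,2)], symmetric])

section \<open>Weak derivatives on almost every line\<close>

lemma borel_measurable_fst_real2 [measurable]: "fst \<in> borel_measurable (borel :: (real \<times> real) measure)"
  by (intro borel_measurable_continuous_onI continuous_intros)

lemma borel_measurable_snd_real2 [measurable]: "snd \<in> borel_measurable (borel :: (real \<times> real) measure)"
  by (intro borel_measurable_continuous_onI continuous_intros)

lemma lborel2_fubini_snd:
  fixes f :: "real \<times> real \<Rightarrow> 'a::{banach, second_countable_topology}"
  assumes "integrable lborel f"
  shows "AE t in lborel. integrable lborel (\<lambda>s. f (s, t))"
    and "integrable lborel (\<lambda>t. LINT s|lborel. f (s, t))"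
    and "(LINT t|lborel. LINT s|lborel. f (s, t)) = integral\<^sup>L lborel f"
  using lborel_pair.AE_integrable_snd[of "\<lambda>s t. f (s,t)"] lborel_pair.integrable_snd[of "\<lambda>s t. f (s,t)"]
    lborel_pair.integral_snd[of "\<lambda>s t. f (s,t)"] assms
  by (simp_all add: lborel_prod)

lemma lborel2_fubini_fst:
  fixes f :: "real \<times> real \<Rightarrow> 'a::{banach, second_countable_topology}"
  assumes "integrable lborel f"
  shows "AE s in lborel. integrable lborel (\<lambda>t. f (s, t))"
    and "integrable lborel (\<lambda>s. LINT t|lborel. f (s, t))"
    and "(LINT s|lborel. LINT t|lborel. f (s, t)) = integral\<^sup>L lborel f"
  using lborel_pair.AE_integrable_fst[of "\<lambda>s t. f (s,t)"] lborel_pair.integrable_fst[of "\<lambda>s t. f (s,t)"]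
    lborel_pair.integral_fst[of "\<lambda>s t. f (s,t)"] assms
  by (simp_all add: lborel_prod)

lemma lborel2_swap:
  fixes f :: "real \<times> real \<Rightarrow> 'a::{banach, second_countable_topology}"
  shows "integrable lborel (\<lambda>z. f (snd z, fst z)) \<longleftrightarrow> integrable lborel f"
    and "f \<in> borel_measurable borel \<Longrightarrow> (LINT z|lborel. f (snd z, fst z)) = integral\<^sup>L lborel f"
proof -
  show "integrable lborel (\<lambda>z. f (snd z, fst z)) \<longleftrightarrow> integrable lborel f"
    using lborel_pair.integrable_product_swap_iff[of f] by (simp add: lborel_prod case_prod_unfold)
  assume "f \<in> borel_measurable borel"
  then show "(LINT z|lborel. f (snd z, fst z)) = integral\<^sup>L lborel f"
    using lborel_pair.integral_product_swap[of f] by (simp add: lborel_prod case_prod_unfold)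
qed

lemma lborel2_integrable_snd:
  fixes f :: "real \<times> real \<Rightarrow> 'a::{banach, second_countable_topology}"
  assumes m: "f \<in> borel_measurable borel" and "AE t in lborel. integrable lborel (\<lambda>s. f (s, t))"
    and "integrable lborel (\<lambda>t. LINT s|lborel. norm (f (s, t)))"
  shows "integrable lborel f"
proof -
  have "(\<lambda>z. f (snd z, fst z)) \<in> borel_measurable borel" using m by measurable
  then have "integrable (lborel \<Otimes>\<^sub>M lborel) (\<lambda>z. f (snd z, fst z))"
    by (intro lborel_pair.Fubini_integrable) (use assms in \<open>auto simp: lborel_prod\<close>)
  then show ?thesis using lborel2_swap(1)[of f] by (simp add: lborel_prod)
qed

lemma lborel2_integrable_product:
  fixes f :: "real \<Rightarrow> real" and g :: "real \<Rightarrow> 'a::{banach, second_countable_topology}"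
  assumes f: "integrable lborel f" and g: "integrable lborel g"
  shows "integrable lborel (\<lambda>z. f (fst z) *\<^sub>R g (snd z))"
proof (rule lborel2_integrable_snd)
  show "(\<lambda>z. f (fst z) *\<^sub>R g (snd z)) \<in> borel_measurable borel"
    proof -
    have [measurable]: "f \<in> borel_measurable borel" "g \<in> borel_measurable borel"
      using borel_measurable_integrable[OF f] borel_measurable_integrable[OF g] by simp_all
    show ?thesis by measurable
  qed
qed (use f g in auto)

lemma lborel2_AE:
  assumes "Measurable.pred borel P"
  shows "(AE z in lborel. P z) \<longleftrightarrow> (AE t in lborel. AE s in lborel. P (s, t))"
    and "(AE z in lborel. P z) \<longleftrightarrow> (AE s in lborel. AE t in lborel. P (s, t))"
proof -
  have m: "{x \<in> space (lborel \<Otimes>\<^sub>M lborel). P (fst x, snd x)} \<in> sets (lborel \<Otimes>\<^sub>M lborel)"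
    unfolding lborel_prod using assms by (simp add: pred_def)
  show 2: "(AE z in lborel. P z) \<longleftrightarrow> (AE s in lborel. AE t in lborel. P (s, t))"
    using lborel_pair.AE_pair_iff[of "\<lambda>s t. P (s,t)", OF m] unfolding lborel_prod by simp
  show "(AE z in lborel. P z) \<longleftrightarrow> (AE t in lborel. AE s in lborel. P (s, t))"
    using lborel_pair.AE_commute[of "\<lambda>s t. P (s,t)", OF m] unfolding 2 by simp
qed

text \<open>\<open>P\<close> is an arbitrary predicate here, so the slices are taken of a Borel null
  set that contains the exceptional set.\<close>

lemma lborel2_AE_slices:
  assumes "AE z in lborel. P z"
  shows "AE t in lborel. AE s in lborel. P (s, t)" "AE s in lborel. AE t in lborel. P (s, t)"
proof -
  obtain N where N: "{z \<in> space lborel. \<not> P z} \<subseteq> N" "emeasure lborel N = 0" "N \<in> sets lborel"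
    using assms by (rule AE_E)
  have *: "AE z in lborel. z \<notin> N" using N AE_not_in[of N lborel] by (simp add: null_setsI)
  have p: "Measurable.pred borel (\<lambda>z. z \<notin> N)" using N(3) by (simp add: pred_def Compl_eq[symmetric])
  show "AE t in lborel. AE s in lborel. P (s, t)"
    using *[unfolded lborel2_AE(1)[OF p]] N(1) by (auto elim!: eventually_mono)
  show "AE s in lborel. AE t in lborel. P (s, t)"
    using *[unfolded lborel2_AE(2)[OF p]] N(1) by (auto elim!: eventually_mono)
qed

section \<open>From weak derivatives to absolutely continuous slices\<close>

lemma indefinite_integral_eq:
  fixes h :: "real \<Rightarrow> real"
  assumes c: "continuous_on UNIV h" and z: "\<And>x. \<not> (A < x \<and> x < B) \<Longrightarrow> h x = 0" and "A \<le> B"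
  defines "J \<equiv> \<lambda>x. LINT s:{..x}|lborel. h s"
  shows "integrable lborel h" "(J has_real_derivative h x) (at x)" "x \<le> A \<Longrightarrow> J x = 0" "x \<ge> B \<Longrightarrow> J x = (LINT s|lborel. h s)"
proof -
  have i: "set_integrable lborel {A..B} h"
    by (rule borel_integrable_compact[of "{A..B}" h, unfolded set_integrable_def[symmetric]])
       (auto intro: continuous_on_subset[OF c])
  have "(\<lambda>x. indicator {A..B} x *\<^sub>R h x) = h" proof
    fix x show "indicator {A..B} x *\<^sub>R h x = h x" using z[of x] by (cases "A < x \<and> x < B") auto
  qed
  then show int: "integrable lborel h" using i by (simp add: set_integrable_def)
  show "x \<le> A \<Longrightarrow> J x = 0"
    unfolding J_def set_lebesgue_integral_def
    by (intro integral_eq_zero_AE AE_I2) (auto simp: indicator_def z)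
  show "x \<ge> B \<Longrightarrow> J x = (LINT s|lborel. h s)"
    unfolding J_def set_lebesgue_integral_def
    by (intro Bochner_Integration.integral_cong) (auto simp: indicator_def z)
  \<comment> \<open>A base point to the left of \<open>x\<close> and of the support: the oriented
    integral from it agrees with \<open>J\<close> near \<open>x\<close>.\<close>
  define A' where "A' = min A x - 1"
  have "((\<lambda>u. LBINT y=A'..u. h y) has_vector_derivative h x) (at x within {A'..x+1})"
    by (rule interval_integral_FTC2) (auto simp: A'_def intro: continuous_on_subset[OF c])
  moreover have "at x within {A'..x+1} = at x"
    by (rule at_within_interior) (auto simp: A'_def)
  ultimately have d: "((\<lambda>u. LBINT y=A'..u. h y) has_real_derivative h x) (at x)"
    by (simp add: has_real_derivative_iff_has_vector_derivative)
  have e: "(LBINT y=A'..u. h y) = J u" if "u > A'" for u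
  proof -
    have "(LBINT y=A'..u. h y) = (LINT s:{A'<..<u}|lborel. h s)"
      using that by (simp add: interval_lebesgue_integral_def einterval_eq)
    also have "\<dots> = J u"
      unfolding J_def set_lebesgue_integral_def
    proof (rule integral_cong_AE)
      show "AE y in lborel. indicator {A'<..<u} y *\<^sub>R h y = indicator {..u} y *\<^sub>R h y"
        using AE_lborel_singleton[of u] by eventually_elim (auto simp: indicator_def A'_def intro!: z)
    qed (use int in auto)
    finally show ?thesis .
  qed
  show "(J has_real_derivative h x) (at x)"
    by (rule DERIV_cong_ev[THEN iffD1, OF refl _ refl d])
       (rule eventually_mono[OF eventually_nhds_in_open[of "{A'<..}" x]], auto simp: A'_def e[unfolded A'_def])
qed

text \<open>By Lebesgue differentiation almost every value \<open>f t\<close> is the limit of the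
  means over \<open>{t..t+h}\<close>, and all of these vanish for small \<open>h\<close>.\<close>

lemma AE_zero_of_interval_integrals:
  fixes f :: "real \<Rightarrow> 'a::euclidean_space"
  assumes f: "integrable lborel f"
    and z: "\<And>x y. c < x \<Longrightarrow> x < y \<Longrightarrow> y < d \<Longrightarrow> (LINT t:{x<..<y}|lborel. f t) = 0"
  shows "AE t in lborel. t \<in> {c<..<d} \<longrightarrow> f t = 0"
proof -
  have si: "set_integrable lborel S f" if "S \<in> sets borel" for S
    using f that by (simp add: set_integrable_def integrable_mult_indicator)
  have "f integrable_on cbox a b" for a b
    by (rule set_borel_integral_eq_integral(1)[OF si]) auto
  then obtain N where N: "negligible N" "\<And>x e. \<lbrakk>x \<notin> N; 0 < e\<rbrakk> \<Longrightarrow>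
     \<exists>d>0. \<forall>h. 0 < h \<and> h < d \<longrightarrow> norm (integral (cbox x (x + h *\<^sub>R One)) f /\<^sub>R h ^ DIM(real) - f x) < e"
    using integrable_ccontinuous_explicit[of f] by blast
  have "f t = 0" if t: "t \<in> {c<..<d}" "t \<notin> N" for t
  proof (rule ccontr)
    assume "f t \<noteq> 0"
    then obtain r where r: "r > 0" "\<And>h. 0 < h \<Longrightarrow> h < r \<Longrightarrow> norm (integral (cbox t (t + h *\<^sub>R One)) f /\<^sub>R h ^ DIM(real) - f t) < norm (f t)"
      using N(2)[OF t(2), of "norm (f t)"] by auto
    define h where "h = min (r/2) ((d - t)/2)"
    have h: "0 < h" "h < r" "t + h < d" using r(1) t by (auto simp: h_def min_def field_simps)
    have "integral {t..t+h} f = (LINT s:{t..t+h}|lborel. f s)"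
      by (rule set_borel_integral_eq_integral(2)[OF si, symmetric]) auto
    also have "\<dots> = (LINT s:{t<..<t+h}|lborel. f s)"
      unfolding set_lebesgue_integral_def
    proof (rule integral_cong_AE)
      show "AE s in lborel. indicator {t..t+h} s *\<^sub>R f s = indicator {t<..<t+h} s *\<^sub>R f s"
        using AE_lborel_singleton[of t] AE_lborel_singleton[of "t+h"] by eventually_elim (auto simp: indicator_def)
    qed (use f in auto)
    also have "\<dots> = 0" using z[of t "t+h"] h t by auto
    finally show False using r(2)[of h] h by (simp add: Basis_real_def)
  qed
  moreover have "AE t in lebesgue. t \<notin> N"
    using N(1) by (simp add: negligible_iff_null_sets AE_not_in)
  ultimately have "AE t in lebesgue. t \<in> {c<..<d} \<longrightarrow> f t = 0" by auto
  then show ?thesis by (simp add: AE_completion_iff)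
qed

text \<open>The null sets on which a slice identity fails depend on the interval, and only countably
  many can be united. Rational endpoints suffice, since both endpoints can be approached from inside
  under dominated convergence.\<close>

lemma interval_integrals_zero_of_rat:
  fixes f :: "real \<Rightarrow> 'a::{banach, second_countable_topology}"
  assumes f: "integrable lborel f"
    and z: "\<And>x y. x \<in> \<rat> \<Longrightarrow> y \<in> \<rat> \<Longrightarrow> c < x \<Longrightarrow> x < y \<Longrightarrow> y < d \<Longrightarrow> (LINT t:{x<..<y}|lborel. f t) = 0"
    and xy: "c < x" "x < y" "y < d"
  shows "(LINT t:{x<..<y}|lborel. f t) = 0"
proof -
  define m where "m = (x + y) / 2"
  have m: "x < m" "m < y" using xy by (auto simp: m_def)
  have "\<exists>r. r \<in> \<rat> \<and> x < r \<and> r < x + (m - x) / real (Suc n)" for n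
    using Rats_dense_in_real[of x "x + (m - x) / real (Suc n)"] m by (auto simp del: of_nat_Suc)
  then obtain p where p: "\<And>n. p n \<in> \<rat>" "\<And>n. x < p n" "\<And>n. p n < x + (m - x) / real (Suc n)" by metis
  have "\<exists>r. r \<in> \<rat> \<and> y - (y - m) / real (Suc n) < r \<and> r < y" for n
    using Rats_dense_in_real[of "y - (y - m) / real (Suc n)" y] m by (auto simp del: of_nat_Suc)
  then obtain q where q: "\<And>n. q n \<in> \<rat>" "\<And>n. q n < y" "\<And>n. y - (y - m) / real (Suc n) < q n" by metis
  have pm: "p n < m" for n
  proof -
    have "(m - x) / real (Suc n) \<le> m - x" using m by (simp add: field_simps mult_right_mono)
    then show ?thesis using p(3)[of n] by linarith
  qed
  have qm: "m < q n" for n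
  proof -
    have "(y - m) / real (Suc n) \<le> y - m" using m by (simp add: field_simps mult_right_mono)
    then show ?thesis using q(3)[of n] by linarith
  qed
  have pl: "p \<longlonglongrightarrow> x"
  proof (rule tendsto_sandwich[where f="\<lambda>_. x"])
    show "(\<lambda>n. x + (m - x) / real (Suc n)) \<longlonglongrightarrow> x" by real_asymp
  qed (use p in \<open>auto intro!: always_eventually less_imp_le simp del: of_nat_Suc\<close>)
  have ql: "q \<longlonglongrightarrow> y"
  proof (rule tendsto_sandwich[where h="\<lambda>_. y"])
    show "(\<lambda>n. y - (y - m) / real (Suc n)) \<longlonglongrightarrow> y" by real_asymp
  qed (use q in \<open>auto intro!: always_eventually less_imp_le simp del: of_nat_Suc\<close>)
  have "(\<lambda>n. LINT t:{p n<..<q n}|lborel. f t) \<longlonglongrightarrow> (LINT t:{x<..<y}|lborel. f t)"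
    unfolding set_lebesgue_integral_def
  proof (rule integral_dominated_convergence[where w="\<lambda>t. norm (f t)"])
    show "AE t in lborel. (\<lambda>i. indicator {p i<..<q i} t *\<^sub>R f t) \<longlonglongrightarrow> indicator {x<..<y} t *\<^sub>R f t"
    proof (rule AE_I2)
      fix t
      have "\<forall>\<^sub>F i in sequentially. indicator {p i<..<q i} t *\<^sub>R f t = indicator {x<..<y} t *\<^sub>R f t"
      proof (cases "t \<in> {x<..<y}")
        case True
        then have "\<forall>\<^sub>F i in sequentially. p i < t" "\<forall>\<^sub>F i in sequentially. t < q i"
          using order_tendstoD[OF pl] order_tendstoD[OF ql] by auto
        then show ?thesis by eventually_elim (use True in auto)
      next
        case False
        then have "t \<notin> {p i<..<q i}" for i using p(2)[of i] q(2)[of i] by auto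
        then show ?thesis using False by auto
      qed
      then show "(\<lambda>i. indicator {p i<..<q i} t *\<^sub>R f t) \<longlonglongrightarrow> indicator {x<..<y} t *\<^sub>R f t"
        by (rule tendsto_eventually)
    qed
  qed (use f in \<open>auto simp: indicator_def\<close>)
  moreover have "(LINT t:{p n<..<q n}|lborel. f t) = 0" for n
    by (rule z, rule p(1), rule q(1)) (use p(1,2)[of n] q(1,2)[of n] pm[of n] qm[of n] xy in linarith)+
  ultimately show ?thesis by (simp add: LIMSEQ_const_iff)
qed

text \<open>Fubini over the half-plane \<open>r \<le> s\<close>. It turns the primitive of an
  indicator, which appears as test function in the weak formulation, into an integral of tails of
  \<open>G\<close>.\<close>

lemma integral_ramp:
  fixes G :: "real \<Rightarrow> 'a::{banach, second_countable_topology}"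
  assumes G: "integrable lborel G" and ab: "a < b"
  shows "(LINT s|lborel. (LINT r:{..s}|lborel. indicator {a<..<b} r :: real) *\<^sub>R G s)
     = (LINT r:{a<..<b}|lborel. (LINT s:{r..}|lborel. G s))"
proof -
  let ?f = "\<lambda>z::real\<times>real. indicator {z. fst z \<le> snd z} z *\<^sub>R ((indicator {a<..<b} (fst z) :: real) *\<^sub>R G (snd z))"
  have [measurable]: "G \<in> borel_measurable borel" using G by simp
  have c: "closed {z::real\<times>real. fst z \<le> snd z}" by (intro closed_Collect_le continuous_intros)
  have m: "{z::real\<times>real. fst z \<le> snd z} \<in> sets borel" using c by (rule borel_closed)
  have i: "integrable lborel ?f"
    by (intro integrable_mult_indicator lborel2_integrable_product G)
       (use m ab in auto)
  have "(LINT t|lborel. LINT s|lborel. ?f (s, t)) = (LINT s|lborel. LINT t|lborel. ?f (s, t))"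
    using lborel2_fubini_snd(3)[OF i] lborel2_fubini_fst(3)[OF i] by simp
  also have "(\<lambda>t. LINT s|lborel. ?f (s, t)) = (\<lambda>s. (LINT r:{..s}|lborel. indicator {a<..<b} r :: real) *\<^sub>R G s)"
  proof
    fix t
    have ii: "integrable lborel (\<lambda>r. indicator {..t} r *\<^sub>R (indicator {a<..<b} r :: real))"
      by (intro integrable_mult_indicator) (use ab in auto)
    have "(LINT s|lborel. ?f (s, t)) = (LINT s|lborel. (indicator {..t} s *\<^sub>R (indicator {a<..<b} s :: real)) *\<^sub>R G t)"
      by (intro Bochner_Integration.integral_cong) (auto simp: indicator_def)
    also have "\<dots> = (LINT r:{..t}|lborel. indicator {a<..<b} r :: real) *\<^sub>R G t"
      unfolding set_lebesgue_integral_def using ii by (rule Bochner_Integration.integral_scaleR_left)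
    finally show "(LINT s|lborel. ?f (s, t)) = (LINT r:{..t}|lborel. indicator {a<..<b} r :: real) *\<^sub>R G t" .
  qed
  also have "(LINT s|lborel. LINT t|lborel. ?f (s, t)) = (LINT r:{a<..<b}|lborel. (LINT s:{r..}|lborel. G s))"
    unfolding set_lebesgue_integral_def
    by (subst integral_scaleR_right[symmetric], intro Bochner_Integration.integral_cong) (auto simp: indicator_def)
  finally show ?thesis .
qed

lemma interval_bump_limits:
  assumes ab: "a < b"
  shows "(\<lambda>k. LINT s|lborel. interval_bump k a b s) \<longlonglongrightarrow> b - a" (is ?lim1)
    and "(\<lambda>k. LINT s:{..x}|lborel. interval_bump k a b s) \<longlonglongrightarrow> (LINT s:{..x}|lborel. indicator {a<..<b} s :: real)" (is ?lim2)
    and "\<bar>LINT s|lborel. interval_bump k a b s\<bar> \<le> b - a" (is ?b1)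
    and "\<bar>LINT s:{..x}|lborel. interval_bump k a b s\<bar> \<le> b - a" (is ?b2)
    and "0 < (LINT s|lborel. interval_bump k a b s)" (is ?pos)
proof -
  have int: "integrable lborel (interval_bump k a b)" for k
    by (rule indefinite_integral_eq(1)[of _ a b])
       (use smooth_continuous[OF smooth_interval_bump] ab in \<open>auto intro: interval_bump_bounds\<close>)
  note [measurable] = borel_measurable_integrable[OF int]
  have ii: "integrable lborel (indicator {a<..<b} :: real \<Rightarrow> real)" using ab by simp
  have le: "norm (interval_bump k a b s) \<le> indicator {a<..<b} s" for k s
    using interval_bump_bounds(1,2)[of k a b s] interval_bump_bounds(3)[of a s b k] by (auto simp: indicator_def)
  have "(\<lambda>k. LINT s|lborel. interval_bump k a b s) \<longlonglongrightarrow> (LINT s|lborel. indicator {a<..<b} s)"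
    by (rule integral_dominated_convergence[OF _ _ ii]) (use interval_bump_tendsto le in auto)
  then show ?lim1 using ab by simp
  have le': "norm (indicator {..x} s *\<^sub>R interval_bump k a b s) \<le> indicator {a<..<b} s" for k s
    using le[of k s] by (cases "s \<le> x") simp_all
  have lim: "(\<lambda>k. indicator {..x} s *\<^sub>R interval_bump k a b s) \<longlonglongrightarrow> indicator {..x} s *\<^sub>R indicator {a<..<b} s" for s
    by (intro tendsto_intros interval_bump_tendsto)
  show ?lim2 unfolding set_lebesgue_integral_def
    by (rule integral_dominated_convergence[OF _ _ ii AE_I2[OF lim] AE_I2[OF le']]) measurable
  have "norm (LINT s|lborel. interval_bump k a b s) \<le> (LINT s|lborel. indicator {a<..<b} s)"
    by (rule Bochner_Integration.integral_norm_bound_integral[OF int ii le])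
  then show ?b1 using ab by simp
  have "norm (LINT s|lborel. indicator {..x} s *\<^sub>R interval_bump k a b s) \<le> (LINT s|lborel. indicator {a<..<b} s)"
    by (rule Bochner_Integration.integral_norm_bound_integral[OF integrable_mult_indicator[OF _ int] ii])
       (use le' in auto)
  then show ?b2 using ab by (simp add: set_lebesgue_integral_def)
  have "(LINT s|lborel. interval_bump k a b s) \<noteq> 0"
  proof
    assume "(LINT s|lborel. interval_bump k a b s) = 0"
    then have "AE s in lborel. interval_bump k a b s = 0"
      using integral_nonneg_eq_0_iff_AE[OF int] interval_bump_bounds by auto
    then have "AE s in lborel. s \<notin> {a<..<b}"
    proof eventually_elim
      case (elim s)
      then show ?case using exp_bump_bounds(4)[of "real (Suc k) * (s - a)"] exp_bump_bounds(4)[of "real (Suc k) * (b - s)"]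
        by (auto simp: interval_bump_def zero_less_mult_iff simp del: of_nat_Suc)
    qed
    then have "emeasure lborel {a<..<b} = 0"
      using AE_iff_null_sets[of "{a<..<b}" lborel] by auto
    then show False using ab by simp
  qed
  moreover have "(LINT s|lborel. interval_bump k a b s) \<ge> 0"
    by (rule Bochner_Integration.integral_nonneg) (rule interval_bump_bounds)
  ultimately show ?pos by linarith
qed

text \<open>Products \<open>f (fst z) * g (snd z)\<close> test the identity. If \<open>f'\<close> is
  a difference of two bumps balanced to integral zero, then \<open>f\<close> has compact support.
  Letting the bumps tend to indicators and using all intervals in \<open>t\<close>, one finds that
  on almost every line the mean of \<open>F + V\<close> over an interval, with \<open>V\<close> the
  tail integral of \<open>G\<close>, does not depend on the interval. Hence \<open>F + V\<close> is
  constant there.\<close>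

lemma weak_derivative_slices:
  fixes F G :: "real \<times> real \<Rightarrow> complex"
  assumes F: "integrable lborel F" and G: "integrable lborel G" and ab: "a < b" and cd: "c < d"
    and weak: "\<And>f f' g a' b' c' d'. \<lbrakk>a < a'; b' < b; c < c'; d' < d;
        \<And>x. (f has_real_derivative f' x) (at x); smooth f; smooth g;
        \<And>x. \<not> (a' < x \<and> x < b') \<Longrightarrow> f x = 0; \<And>x. \<not> (c' < x \<and> x < d') \<Longrightarrow> g x = 0\<rbrakk> \<Longrightarrow>
      (LINT z|lborel. (f' (fst z) * g (snd z)) *\<^sub>R F z) = - (LINT z|lborel. (f (fst z) * g (snd z)) *\<^sub>R G z)"
  shows "AE t in lborel. t \<in> {c<..<d} \<longrightarrow>
    (\<exists>C. AE s in lborel. s \<in> {a<..<b} \<longrightarrow> F (s,t) = C - (LINT r:{s..}|lborel. G (r,t)))"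
proof -
  have Fm[measurable]: "F \<in> borel_measurable borel" and Gm[measurable]: "G \<in> borel_measurable borel" using F G by auto
  define chi where "chi a1 b1 s = (indicator {a1<..<b1} s :: real)" for a1 b1 s :: real
  define ramp where "ramp a1 b1 s = (LINT r:{..s}|lborel. indicator {a1<..<b1} r :: real)" for a1 b1 s :: real
  have [measurable]: "chi a1 b1 \<in> borel_measurable borel" for a1 b1 unfolding chi_def by measurable
  have rampc: "ramp a1 b1 \<in> borel_measurable borel" if "a1 < b1" for a1 b1
  proof (rule borel_measurable_LIMSEQ_metric)
    show "(\<lambda>k. LINT s:{..x}|lborel. interval_bump k a1 b1 s) \<longlonglongrightarrow> ramp a1 b1 x" for x
      unfolding ramp_def using interval_bump_limits(2)[OF that] .
    show "(\<lambda>x. LINT s:{..x}|lborel. interval_bump k a1 b1 s) \<in> borel_measurable borel" for k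
    proof -
      have "((\<lambda>x. LINT s:{..x}|lborel. interval_bump k a1 b1 s) has_real_derivative interval_bump k a1 b1 x) (at x)" for x
        by (rule indefinite_integral_eq(2)[of _ a1 b1])
          (use that in \<open>auto intro: interval_bump_bounds smooth_continuous smooth_interval_bump\<close>)
      then show ?thesis
        by (intro borel_measurable_continuous_onI DERIV_continuous_on) auto
    qed
  qed
  have main: "(LINT t:{c'<..<d'}|lborel. LINT s|lborel.
      ((b2-a2) * chi a1 b1 s - (b1-a1) * chi a2 b2 s) *\<^sub>R F (s,t) + ((b2-a2) * ramp a1 b1 s - (b1-a1) * ramp a2 b2 s) *\<^sub>R G (s,t)) = 0"
    and main_int: "integrable lborel (\<lambda>z. ((b2-a2) * chi a1 b1 (fst z) - (b1-a1) * chi a2 b2 (fst z)) *\<^sub>R F z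
         + ((b2-a2) * ramp a1 b1 (fst z) - (b1-a1) * ramp a2 b2 (fst z)) *\<^sub>R G z)"
    if h: "a < a1" "a1 < b1" "b1 < b" "a < a2" "a2 < b2" "b2 < b" "c < c'" "c' < d'" "d' < d" for a1 b1 a2 b2 c' d'
  proof -
    have [measurable]: "ramp a1 b1 \<in> borel_measurable borel" "ramp a2 b2 \<in> borel_measurable borel"
      using rampc h by auto
    define D where "D = (b2-a2) * (b1-a1)"
    define I where "I a1 b1 k = (LINT s|lborel. interval_bump k a1 b1 s)" for a1 b1 k
    define J where "J a1 b1 k x = (LINT s:{..x}|lborel. interval_bump k a1 b1 s)" for a1 b1 k x
    \<comment> \<open>Each bump is weighted by the integral of the other, so \<open>f'\<close> has
      integral zero and its primitive \<open>f\<close> vanishes to the right of both intervals as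
      well as to the left.\<close>
    define f' where "f' k x = I a2 b2 k * interval_bump k a1 b1 x - I a1 b1 k * interval_bump k a2 b2 x" for k x
    define f where "f k x = I a2 b2 k * J a1 b1 k x - I a1 b1 k * J a2 b2 k x" for k x
    let ?g = "\<lambda>k. interval_bump k c' d'"
    have eta: "continuous_on UNIV (interval_bump k p q)" "\<And>x. \<not> (p < x \<and> x < q) \<Longrightarrow> interval_bump k p q x = 0" for k p q
      by (auto intro: interval_bump_bounds smooth_continuous smooth_interval_bump)
    have dJ: "(J p q k has_real_derivative interval_bump k p q x) (at x)" if "p < q" for p q k x
      unfolding J_def by (rule indefinite_integral_eq(2)[OF eta]) (use that in auto)
    have J0: "J p q k x = 0" if "p < q" "x \<le> p" for p q k x
      unfolding J_def by (rule indefinite_integral_eq(3)[of "interval_bump k p q" p q]) (use that eta in auto)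
    have J1: "J p q k x = I p q k" if "p < q" "q \<le> x" for p q k x
      unfolding J_def I_def by (rule indefinite_integral_eq(4)[of "interval_bump k p q" p q]) (use that eta in auto)
    have df: "(f k has_real_derivative f' k x) (at x)" for k x
      unfolding f_def f'_def by (auto intro!: derivative_eq_intros dJ h)
    have sf': "smooth (f' k)" for k
      unfolding f'_def
      using smooth_affine[OF smooth_interval_bump, of "I a2 b2 k" k a1 b1 1 0] smooth_affine[OF smooth_interval_bump, of "I a1 b1 k" k a2 b2 1 0]
      by (intro smooth_diff) auto
    have sf: "smooth (f k)" for k using sf' df by (rule smooth_antiderivative)
    have fz: "f k x = 0" if x: "\<not> (min a1 a2 < x \<and> x < max b1 b2)" for k x
    proof (cases "x \<le> min a1 a2")
      case True
      then have "J a1 b1 k x = 0" "J a2 b2 k x = 0"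
        using J0 h by auto
      then show ?thesis by (simp add: f_def)
    next
      case False
      then have "J a1 b1 k x = I a1 b1 k" "J a2 b2 k x = I a2 b2 k"
        using J1 h x by auto
      then show ?thesis by (simp add: f_def)
    qed
    have [measurable]: "f k \<in> borel_measurable borel" "f' k \<in> borel_measurable borel" "?g k \<in> borel_measurable borel" for k
      by (auto intro!: borel_measurable_continuous_onI smooth_continuous sf sf' smooth_interval_bump)
    have eq: "(LINT z|lborel. (f' k (fst z) * ?g k (snd z)) *\<^sub>R F z) = - (LINT z|lborel. (f k (fst z) * ?g k (snd z)) *\<^sub>R G z)" for k
    proof (rule weak[where a'="min a1 a2" and b'="max b1 b2" and c'=c' and d'=d'])
      show "(f k has_real_derivative f' k x) (at x)" for x by (rule df)
    qed (use h fz eta smooth_interval_bump sf in auto)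
    have Ibound: "\<bar>I p q k\<bar> \<le> q - p" "\<bar>J p q k x\<bar> \<le> q - p" if "p < q" for p q k x
      using interval_bump_limits(3,4)[OF that] by (auto simp: I_def J_def)
    have f'b: "\<bar>f' k x\<bar> \<le> (b2 - a2) + (b1 - a1)" for k x
    proof -
      have "\<bar>I a2 b2 k * interval_bump k a1 b1 x\<bar> \<le> (b2 - a2) * 1" "\<bar>I a1 b1 k * interval_bump k a2 b2 x\<bar> \<le> (b1 - a1) * 1"
        unfolding abs_mult by (intro mult_mono Ibound h; use interval_bump_bounds(1,2) h in auto)+
      from add_mono[OF this] show ?thesis unfolding f'_def by (intro order_trans[OF abs_triangle_ineq4]) simp
    qed
    have fb: "\<bar>f k x\<bar> \<le> D + D" for k x
    proof -
      have "\<bar>I a2 b2 k * J a1 b1 k x\<bar> \<le> (b2 - a2) * (b1 - a1)" "\<bar>I a1 b1 k * J a2 b2 k x\<bar> \<le> (b1 - a1) * (b2 - a2)"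
        unfolding abs_mult by (intro mult_mono Ibound h; use h in auto)+
      from add_mono[OF this] show ?thesis unfolding f_def D_def by (intro order_trans[OF abs_triangle_ineq4]) (simp add: mult.commute)
    qed
    have f'l: "(\<lambda>k. f' k x) \<longlonglongrightarrow> (b2-a2) * chi a1 b1 x - (b1-a1) * chi a2 b2 x" for x
      unfolding f'_def chi_def I_def by (intro tendsto_intros interval_bump_limits interval_bump_tendsto h)
    have fl: "(\<lambda>k. f k x) \<longlonglongrightarrow> (b2-a2) * ramp a1 b1 x - (b1-a1) * ramp a2 b2 x" for x
      unfolding f_def ramp_def I_def J_def by (intro tendsto_intros interval_bump_limits h)
    let ?lf' = "\<lambda>x. (b2-a2) * chi a1 b1 x - (b1-a1) * chi a2 b2 x"
    let ?lf = "\<lambda>x. (b2-a2) * ramp a1 b1 x - (b1-a1) * ramp a2 b2 x"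
    have b1: "norm ((f' k (fst z) * ?g k (snd z)) *\<^sub>R F z) \<le> norm (((b2 - a2) + (b1 - a1)) *\<^sub>R F z)" for k z
    proof -
      have "\<bar>f' k (fst z) * ?g k (snd z)\<bar> \<le> ((b2 - a2) + (b1 - a1)) * 1" unfolding abs_mult
        by (intro mult_mono f'b; use interval_bump_bounds(1,2) h in auto)
      then show ?thesis unfolding norm_scaleR by (intro mult_right_mono) auto
    qed
    have b2: "norm ((f k (fst z) * ?g k (snd z)) *\<^sub>R G z) \<le> norm ((D + D) *\<^sub>R G z)" for k z
    proof -
      have D0: "D \<ge> 0" using h by (simp add: D_def)
      have "\<bar>f k (fst z) * ?g k (snd z)\<bar> \<le> (D + D) * 1" unfolding abs_mult
        by (intro mult_mono fb; use interval_bump_bounds(1,2) D0 in auto)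
      then show ?thesis unfolding norm_scaleR by (intro mult_right_mono) auto
    qed
    have iF: "integrable lborel (\<lambda>z. norm (((b2 - a2) + (b1 - a1)) *\<^sub>R F z))" and iG: "integrable lborel (\<lambda>z. norm ((D + D) *\<^sub>R G z))"
      using F G by auto
    have l1: "AE z in lborel. (\<lambda>k. (f' k (fst z) * ?g k (snd z)) *\<^sub>R F z) \<longlonglongrightarrow> (?lf' (fst z) * indicator {c'<..<d'} (snd z)) *\<^sub>R F z"
      by (intro AE_I2 tendsto_intros f'l interval_bump_tendsto)
    have l2: "AE z in lborel. (\<lambda>k. (f k (fst z) * ?g k (snd z)) *\<^sub>R G z) \<longlonglongrightarrow> (?lf (fst z) * indicator {c'<..<d'} (snd z)) *\<^sub>R G z"
      by (intro AE_I2 tendsto_intros fl interval_bump_tendsto)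
    have L1: "(\<lambda>k. LINT z|lborel. (f' k (fst z) * ?g k (snd z)) *\<^sub>R F z) \<longlonglongrightarrow> (LINT z|lborel. (?lf' (fst z) * indicator {c'<..<d'} (snd z)) *\<^sub>R F z)"
      and I1: "integrable lborel (\<lambda>z. (?lf' (fst z) * indicator {c'<..<d'} (snd z)) *\<^sub>R F z)"
      by (rule integral_dominated_convergence[OF _ _ iF l1 AE_I2[OF b1]] integrable_dominated_convergence[OF _ _ iF l1 AE_I2[OF b1]]; measurable)+
    have L2: "(\<lambda>k. LINT z|lborel. (f k (fst z) * ?g k (snd z)) *\<^sub>R G z) \<longlonglongrightarrow> (LINT z|lborel. (?lf (fst z) * indicator {c'<..<d'} (snd z)) *\<^sub>R G z)"
      and I2: "integrable lborel (\<lambda>z. (?lf (fst z) * indicator {c'<..<d'} (snd z)) *\<^sub>R G z)"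
      by (rule integral_dominated_convergence[OF _ _ iG l2 AE_I2[OF b2]] integrable_dominated_convergence[OF _ _ iG l2 AE_I2[OF b2]]; measurable)+
    have "(LINT z|lborel. (?lf' (fst z) * indicator {c'<..<d'} (snd z)) *\<^sub>R F z) = - (LINT z|lborel. (?lf (fst z) * indicator {c'<..<d'} (snd z)) *\<^sub>R G z)"
      by (rule LIMSEQ_unique[OF L1]) (use tendsto_minus[OF L2] eq in simp)
    then have "(LINT z|lborel. (?lf' (fst z) * indicator {c'<..<d'} (snd z)) *\<^sub>R F z + (?lf (fst z) * indicator {c'<..<d'} (snd z)) *\<^sub>R G z) = 0"
      by (subst Bochner_Integration.integral_add[OF I1 I2]) simp
    also have "(LINT z|lborel. (?lf' (fst z) * indicator {c'<..<d'} (snd z)) *\<^sub>R F z + (?lf (fst z) * indicator {c'<..<d'} (snd z)) *\<^sub>R G z) =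
      (LINT t|lborel. LINT s|lborel. (?lf' s * indicator {c'<..<d'} t) *\<^sub>R F (s,t) + (?lf s * indicator {c'<..<d'} t) *\<^sub>R G (s,t))"
      using lborel2_fubini_snd(3)[OF Bochner_Integration.integrable_add[OF I1 I2]] by simp
    also have "\<dots> = (LINT t:{c'<..<d'}|lborel. LINT s|lborel. ?lf' s *\<^sub>R F (s,t) + ?lf s *\<^sub>R G (s,t))"
      unfolding set_lebesgue_integral_def
      by (subst integral_scaleR_right[symmetric], intro Bochner_Integration.integral_cong) (auto simp: indicator_def)
    finally show "(LINT t:{c'<..<d'}|lborel. LINT s|lborel. ?lf' s *\<^sub>R F (s,t) + ?lf s *\<^sub>R G (s,t)) = 0" .
    have lf'b: "\<bar>?lf' x\<bar> \<le> (b2 - a2) + (b1 - a1)" for x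
      using LIMSEQ_le_const2[OF tendsto_rabs[OF f'l]] f'b by blast
    have lfb: "\<bar>?lf x\<bar> \<le> D + D" for x
      using LIMSEQ_le_const2[OF tendsto_rabs[OF fl]] fb by blast
    show "integrable lborel (\<lambda>z. ?lf' (fst z) *\<^sub>R F z + ?lf (fst z) *\<^sub>R G z)"
    proof (rule Bochner_Integration.integrable_add)
      show "integrable lborel (\<lambda>z. ?lf' (fst z) *\<^sub>R F z)"
        by (rule Bochner_Integration.integrable_bound[OF iF]) (use lf'b h in \<open>auto intro!: mult_right_mono order_trans[OF lf'b]\<close>)
      show "integrable lborel (\<lambda>z. ?lf (fst z) *\<^sub>R G z)"
        by (rule Bochner_Integration.integrable_bound[OF iG]) (use lfb in \<open>auto intro!: mult_right_mono order_trans[OF lfb]\<close>)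
    qed
  qed
  \<comment> \<open>The middle third is a fixed reference interval, with which all other intervals
    are compared.\<close>
  define a2 where "a2 = (2*a+b)/3"
  define b2 where "b2 = (a+2*b)/3"
  have h2: "a < a2" "a2 < b2" "b2 < b" using ab by (auto simp: a2_def b2_def)
  define psi where "psi a1 b1 t = (LINT s|lborel. ((b2-a2) * chi a1 b1 s - (b1-a1) * chi a2 b2 s) *\<^sub>R F (s,t) + ((b2-a2) * ramp a1 b1 s - (b1-a1) * ramp a2 b2 s) *\<^sub>R G (s,t))" for a1 b1 t
  have psi0: "AE t in lborel. t \<in> {c<..<d} \<longrightarrow> psi a1 b1 t = 0" if "a < a1" "a1 < b1" "b1 < b" for a1 b1
  proof (rule AE_zero_of_interval_integrals)
    obtain c' d' where "c < c'" "c' < d'" "d' < d" using cd by (meson dense)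
    then show "integrable lborel (psi a1 b1)"
      using lborel2_fubini_snd(2)[OF main_int[of a1 b1 a2 b2 c' d']] that h2 unfolding psi_def by simp
    show "(LINT t:{x<..<y}|lborel. psi a1 b1 t) = 0" if "c < x" "x < y" "y < d" for x y
      unfolding psi_def by (rule main) (use that \<open>a < a1\<close> \<open>a1 < b1\<close> \<open>b1 < b\<close> h2 in auto)
  qed
  \<comment> \<open>Rational endpoints, so that a single null set of \<open>t\<close> serves all
    intervals.\<close>
  have "AE t in lborel. \<forall>q\<in>(\<rat>\<times>\<rat>). a < fst q \<and> fst q < snd q \<and> snd q < b \<longrightarrow> t \<in> {c<..<d} \<longrightarrow> psi (fst q) (snd q) t = 0"
  proof (subst AE_ball_countable)
    show "countable (\<rat>\<times>\<rat> :: (real\<times>real) set)" by (intro countable_SIGMA countable_rat)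
    show "\<forall>q\<in>\<rat>\<times>\<rat>. AE t in lborel. a < fst q \<and> fst q < snd q \<and> snd q < b \<longrightarrow> t \<in> {c<..<d} \<longrightarrow> psi (fst q) (snd q) t = 0"
      using psi0 by (auto simp: AE_conjI)
  qed
  then show ?thesis using lborel2_fubini_snd(1)[OF F] lborel2_fubini_snd(1)[OF G]
  proof eventually_elim
    case (elim t)
    define V where "V s = (LINT r:{s..}|lborel. G (r,t))" for s
    have Fi: "integrable lborel (\<lambda>s. F (s,t))" and Gi: "integrable lborel (\<lambda>s. G (s,t))" using elim by auto
    have Vm: "V \<in> borel_measurable borel"
    proof -
      have [measurable]: "{z::real\<times>real. snd z \<ge> fst z} \<in> sets borel"
        by (intro borel_closed closed_Collect_le continuous_intros)
      have "(\<lambda>s. LINT r|lborel. indicator {z. snd z \<ge> fst z} (s,r) *\<^sub>R G (r,t)) \<in> borel_measurable borel"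
        by (rule lborel.borel_measurable_lebesgue_integral) measurable
      also have "(\<lambda>s. LINT r|lborel. indicator {z. snd z \<ge> fst z} (s,r) *\<^sub>R G (r,t)) = V"
        by (intro ext) (auto simp: V_def set_lebesgue_integral_def indicator_def intro!: Bochner_Integration.integral_cong)
      finally show ?thesis .
    qed
    have Vb: "norm (V s) \<le> (LINT r|lborel. norm (G (r,t)))" for s
      unfolding V_def set_lebesgue_integral_def
      by (rule Bochner_Integration.integral_norm_bound_integral[OF integrable_mult_indicator[OF _ Gi] integrable_norm[OF Gi]])
         (auto simp: indicator_def)
    have chiV: "integrable lborel (\<lambda>s. chi a1 b1 s *\<^sub>R V s)" if "a1 < b1" for a1 b1
    proof -
      have "integrable lborel (indicator {a1<..<b1} :: real \<Rightarrow> real)" using that by simp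
      then have i: "integrable lborel (\<lambda>s. indicator {a1<..<b1} s * (LINT r|lborel. norm (G (r,t))))"
        by (intro integrable_mult_left) auto
      show ?thesis unfolding chi_def
        by (rule Bochner_Integration.integrable_bound[OF i]) (use Vm in \<open>auto simp: indicator_def intro: order_trans[OF Vb]\<close>)
    qed
    have chiF: "integrable lborel (\<lambda>s. chi a1 b1 s *\<^sub>R F (s,t))" for a1 b1
      unfolding chi_def using Fi by (intro integrable_mult_indicator) auto
    define S where "S a1 b1 = (LINT s|lborel. chi a1 b1 s *\<^sub>R (F (s,t) + V s))" for a1 b1
    have key: "(b2-a2) *\<^sub>R S a1 b1 = (b1-a1) *\<^sub>R S a2 b2" if t: "t \<in> {c<..<d}" and q: "a1 \<in> \<rat>" "b1 \<in> \<rat>" "a < a1" "a1 < b1" "b1 < b" for a1 b1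
    proof -
      have rG: "integrable lborel (\<lambda>s. ramp p q s *\<^sub>R G (s,t))" if "p < q" for p q
      proof -
        have "\<bar>ramp p q s\<bar> \<le> q - p" for s
          unfolding ramp_def by (rule LIMSEQ_le_const2[OF tendsto_rabs[OF interval_bump_limits(2)[OF that]]]) (use interval_bump_limits(4)[OF that] in blast)
        then have b: "norm (ramp p q s *\<^sub>R G (s,t)) \<le> norm ((q - p) *\<^sub>R G (s,t))" for s
          unfolding norm_scaleR using that by (intro mult_right_mono) auto
        have [measurable]: "ramp p q \<in> borel_measurable borel" using rampc that by auto
        show ?thesis
          by (rule Bochner_Integration.integrable_bound[OF integrable_scaleR_right[OF Gi] _ AE_I2[OF b]]) measurable
      qed
      have r: "(LINT s|lborel. ramp p q s *\<^sub>R G (s,t)) = (LINT s|lborel. chi p q s *\<^sub>R V s)" if "p < q" for p q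
        unfolding ramp_def chi_def V_def integral_ramp[OF Gi that] by (simp only: set_lebesgue_integral_def)
      have "psi a1 b1 t = 0" using elim(1) t q by auto
      moreover have "psi a1 b1 t = ((b2-a2) *\<^sub>R (LINT s|lborel. chi a1 b1 s *\<^sub>R F (s,t)) - (b1-a1) *\<^sub>R (LINT s|lborel. chi a2 b2 s *\<^sub>R F (s,t)))
         + ((b2-a2) *\<^sub>R (LINT s|lborel. ramp a1 b1 s *\<^sub>R G (s,t)) - (b1-a1) *\<^sub>R (LINT s|lborel. ramp a2 b2 s *\<^sub>R G (s,t)))"
      proof -
        note ii = chiF[of a1 b1] chiF[of a2 b2] rG[OF q(4)] rG[OF h2(2)]
        have "psi a1 b1 t = (LINT s|lborel. ((b2-a2) *\<^sub>R (chi a1 b1 s *\<^sub>R F (s,t)) - (b1-a1) *\<^sub>R (chi a2 b2 s *\<^sub>R F (s,t)))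
         + ((b2-a2) *\<^sub>R (ramp a1 b1 s *\<^sub>R G (s,t)) - (b1-a1) *\<^sub>R (ramp a2 b2 s *\<^sub>R G (s,t))))"
          unfolding psi_def by (intro Bochner_Integration.integral_cong refl) (simp only: scaleR_left_diff_distrib scaleR_scaleR)
        then show ?thesis using ii by (simp del: scaleR_scaleR scaleR_conv_of_real)
      qed
      moreover have "S p q = (LINT s|lborel. chi p q s *\<^sub>R F (s,t)) + (LINT s|lborel. chi p q s *\<^sub>R V s)" if "p < q" for p q
        unfolding S_def scaleR_add_right using chiF chiV[OF that] by simp
      ultimately show ?thesis using r[OF q(4)] r[OF h2(2)] q(4) h2(2) by (simp add: algebra_simps)
    qed
    show ?case
    proof
      assume t: "t \<in> {c<..<d}"
      \<comment> \<open>The mean of \<open>F + V\<close> over the reference interval.\<close>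
      define C where "C = S a2 b2 /\<^sub>R (b2 - a2)"
      define Z where "Z s = chi a b s *\<^sub>R (F (s,t) + V s - C)" for s
      have Zi: "integrable lborel Z"
        unfolding Z_def scaleR_diff_right scaleR_add_right using chiF chiV[OF ab] ab
        by (intro Bochner_Integration.integrable_diff Bochner_Integration.integrable_add) (auto simp: chi_def)
      have "AE s in lborel. s \<in> {a<..<b} \<longrightarrow> Z s = 0"
      proof (rule AE_zero_of_interval_integrals[OF Zi], rule interval_integrals_zero_of_rat[OF Zi])
        fix x y :: real assume q: "x \<in> \<rat>" "y \<in> \<rat>" "a < x" "x < y" "y < b"
        have "(LINT s:{x<..<y}|lborel. Z s) = (LINT s|lborel. chi x y s *\<^sub>R (F (s,t) + V s) - chi x y s *\<^sub>R C)"
          unfolding set_lebesgue_integral_def Z_def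
          by (intro Bochner_Integration.integral_cong) (use q in \<open>auto simp: chi_def indicator_def\<close>)
        also have "\<dots> = S x y - (LINT s|lborel. chi x y s *\<^sub>R C)"
          unfolding S_def scaleR_add_right using chiF chiV[OF q(4)] q(4)
          by (intro Bochner_Integration.integral_diff) (auto simp: chi_def)
        also have "(LINT s|lborel. chi x y s *\<^sub>R C) = (y - x) *\<^sub>R C" using q(4) by (simp add: chi_def)
        also have "S x y = (y - x) *\<^sub>R C"
        proof -
          have "(b2-a2) *\<^sub>R S x y = (b2-a2) *\<^sub>R ((y-x) *\<^sub>R C)"
            unfolding key[OF t q] C_def using h2(2) by simp
          then show ?thesis using h2(2) by (simp add: scaleR_cancel_left del: scaleR_scaleR)
        qed
        finally show "(LINT s:{x<..<y}|lborel. Z s) = 0" by simp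
      qed auto
      then have "AE s in lborel. s \<in> {a<..<b} \<longrightarrow> F (s,t) = C - (LINT r:{s..}|lborel. G (r,t))"
        by eventually_elim (auto simp: Z_def chi_def V_def algebra_simps)
      then show "\<exists>C. AE s in lborel. s \<in> {a<..<b} \<longrightarrow> F (s,t) = C - (LINT r:{s..}|lborel. G (r,t))" by blast
    qed
  qed
qed

section \<open>From \<open>lebesgue_on\<close> to Borel functions under
  \<open>lborel\<close>\<close>

lemma AE_lebesgue_on_iff:
  assumes "S \<in> sets borel"
  shows "(AE z in lebesgue_on S. P z) \<longleftrightarrow> (AE z in lborel. z \<in> S \<longrightarrow> P z)"
  using assms by (subst AE_restrict_space_iff) (auto simp: AE_completion_iff)

lemma borel_measurable_lebesgue_onI:
  assumes "f \<in> borel_measurable borel"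
  shows "f \<in> borel_measurable (lebesgue_on S)"
  using assms by (intro measurable_restrict_space1 measurable_completion) auto

lemma integrable_lebesgue_on_iff:
  fixes f :: "'a::euclidean_space \<Rightarrow> 'b::{banach, second_countable_topology}"
  assumes "S \<in> sets borel" "f \<in> borel_measurable borel"
  shows "integrable (lebesgue_on S) f \<longleftrightarrow> integrable lborel (\<lambda>z. indicator S z *\<^sub>R f z)"
    and "(LINT z|lebesgue_on S. f z) = (LINT z|lborel. indicator S z *\<^sub>R f z)"
  using assms by (auto simp: integrable_restrict_space integral_restrict_space integrable_completion integral_completion)

text \<open>Measurability for the completed measure gives a Borel function that agrees almost
  everywhere; this is applied to real and imaginary part separately.\<close>

lemma borel_representative:
  fixes f :: "'a::euclidean_space \<Rightarrow> complex"
  assumes S: "S \<in> sets borel" and f: "f \<in> borel_measurable (lebesgue_on S)"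
  obtains f' where "f' \<in> borel_measurable borel" "\<And>z. z \<notin> S \<Longrightarrow> f' z = 0" "AE z in lebesgue_on S. f z = f' z"
proof -
  have m: "(\<lambda>z. indicator S z *\<^sub>R f z) \<in> borel_measurable lebesgue"
    using f S by (subst (asm) borel_measurable_restrict_space_iff) auto
  obtain g where g: "g \<in> borel_measurable lborel" "AE z in lborel. Re (indicator S z *\<^sub>R f z) = g z"
    using completion_ex_borel_measurable_real[of "\<lambda>z. Re (indicator S z *\<^sub>R f z)" lborel] measurable_compose[OF m borel_measurable_Re] by blast
  obtain h where h: "h \<in> borel_measurable lborel" "AE z in lborel. Im (indicator S z *\<^sub>R f z) = h z"
    using completion_ex_borel_measurable_real[of "\<lambda>z. Im (indicator S z *\<^sub>R f z)" lborel] measurable_compose[OF m borel_measurable_Im] by blast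
  have [measurable]: "g \<in> borel_measurable borel" "h \<in> borel_measurable borel" using g h by auto
  show ?thesis
  proof (rule that[of "\<lambda>z. indicator S z *\<^sub>R Complex (g z) (h z)"])
    show "(\<lambda>z. indicator S z *\<^sub>R Complex (g z) (h z)) \<in> borel_measurable borel"
      unfolding Complex_eq using S by measurable
    show "AE z in lebesgue_on S. f z = indicator S z *\<^sub>R Complex (g z) (h z)"
      unfolding AE_lebesgue_on_iff[OF S] using g(2) h(2)
    proof eventually_elim
      case (elim z)
      then show ?case by (cases "z \<in> S") (simp_all add: complex_eq_iff)
    qed
  qed auto
qed

lemma Ltwo_representative:
  fixes f :: "'a::euclidean_space \<Rightarrow> complex"
  assumes S: "S \<in> sets borel" and f: "f \<in> Ltwo (lebesgue_on S)"
  obtains f' where "f' \<in> borel_measurable borel" "\<And>z. z \<notin> S \<Longrightarrow> f' z = 0" "AE z in lebesgue_on S. f z = f' z"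
    "integrable lborel (\<lambda>z. (norm (f' z))\<^sup>2)"
proof -
  have fm: "f \<in> borel_measurable (lebesgue_on S)" and fi: "integrable (lebesgue_on S) (\<lambda>z. (norm (f z))\<^sup>2)"
    using f by (simp_all add: Ltwo_def)
  obtain f' where f': "f' \<in> borel_measurable borel" "\<And>z. z \<notin> S \<Longrightarrow> f' z = 0" "AE z in lebesgue_on S. f z = f' z"
    by (rule borel_representative[OF S fm]) blast
  have m: "(\<lambda>z. (norm (f' z))\<^sup>2) \<in> borel_measurable borel" using f'(1) by measurable
  have "integrable (lebesgue_on S) (\<lambda>z. (norm (f' z))\<^sup>2)"
  proof (rule integrable_cong_AE_imp[OF fi borel_measurable_lebesgue_onI[OF m]])
    show "AE z in lebesgue_on S. (norm (f z))\<^sup>2 = (norm (f' z))\<^sup>2" using f'(3) by eventually_elim simp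
  qed
  then have "integrable lborel (\<lambda>z. indicator S z *\<^sub>R (norm (f' z))\<^sup>2)"
    using integrable_lebesgue_on_iff(1)[OF S m] by simp
  moreover have "(\<lambda>z. indicator S z *\<^sub>R (norm (f' z))\<^sup>2) = (\<lambda>z. (norm (f' z))\<^sup>2)"
    using f'(2) by (auto simp: indicator_def fun_eq_iff)
  ultimately have "integrable lborel (\<lambda>z. (norm (f' z))\<^sup>2)" by simp
  from that[OF f' this] show ?thesis .
qed

lemma Ltwo_of_representative:
  fixes f f' :: "'a::euclidean_space \<Rightarrow> complex"
  assumes S: "S \<in> sets borel" and f': "f' \<in> borel_measurable borel" "\<And>z. z \<notin> S \<Longrightarrow> f' z = 0"
    and i: "integrable lborel (\<lambda>z. (norm (f' z))\<^sup>2)"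
  shows "f' \<in> Ltwo (lebesgue_on S)"
proof -
  have m: "(\<lambda>z. (norm (f' z))\<^sup>2) \<in> borel_measurable borel" using f'(1) by measurable
  moreover have "(\<lambda>z. indicator S z *\<^sub>R (norm (f' z))\<^sup>2) = (\<lambda>z. (norm (f' z))\<^sup>2)"
    using f'(2) by (auto simp: indicator_def fun_eq_iff)
  ultimately show ?thesis
    using integrable_lebesgue_on_iff(1)[OF S m] i borel_measurable_lebesgue_onI[OF f'(1)] by (auto simp: Ltwo_def)
qed

lemma integral_of_representative:
  fixes f f' :: "'a::euclidean_space \<Rightarrow> 'b::{banach, second_countable_topology}"
  assumes S: "S \<in> sets borel" and f: "f \<in> borel_measurable (lebesgue_on S)"
    and f': "f' \<in> borel_measurable borel" "\<And>z. z \<notin> S \<Longrightarrow> f' z = 0" and eq: "AE z in lebesgue_on S. f z = f' z"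
  shows "(LINT z|lebesgue_on S. f z) = (LINT z|lborel. f' z)"
    and "integrable (lebesgue_on S) f \<longleftrightarrow> integrable lborel f'"
proof -
  have e: "(\<lambda>z. indicator S z *\<^sub>R f' z) = f'" using f'(2) by (auto simp: indicator_def fun_eq_iff)
  have "(LINT z|lebesgue_on S. f z) = (LINT z|lebesgue_on S. f' z)"
    by (rule integral_cong_AE[OF f borel_measurable_lebesgue_onI[OF f'(1)] eq])
  then show "(LINT z|lebesgue_on S. f z) = (LINT z|lborel. f' z)"
    using integrable_lebesgue_on_iff(2)[OF S f'(1)] e by simp
  have "integrable (lebesgue_on S) f \<longleftrightarrow> integrable (lebesgue_on S) f'"
    by (rule integrable_cong_AE[OF f borel_measurable_lebesgue_onI[OF f'(1)] eq])
  then show "integrable (lebesgue_on S) f \<longleftrightarrow> integrable lborel f'"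
    using integrable_lebesgue_on_iff(1)[OF S f'(1)] e by simp
qed

lemma Ltwo_norm_representative:
  fixes f f' :: "'a::euclidean_space \<Rightarrow> complex"
  assumes S: "S \<in> sets borel" and f: "f \<in> borel_measurable (lebesgue_on S)"
    and f': "f' \<in> borel_measurable borel" "\<And>z. z \<notin> S \<Longrightarrow> f' z = 0" and eq: "AE z in lebesgue_on S. f z = f' z"
  shows "(Ltwo_norm (lebesgue_on S) f)\<^sup>2 = (LINT z|lborel. (norm (f' z))\<^sup>2)"
proof -
  have "(LINT z|lebesgue_on S. (norm (f z))\<^sup>2) = (LINT z|lborel. (norm (f' z))\<^sup>2)"
  proof (rule integral_of_representative(1)[OF S])
    show "(\<lambda>z. (norm (f z))\<^sup>2) \<in> borel_measurable (lebesgue_on S)" using f by measurable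
    show "(\<lambda>z. (norm (f' z))\<^sup>2) \<in> borel_measurable borel" using f' by measurable
    show "AE z in lebesgue_on S. (norm (f z))\<^sup>2 = (norm (f' z))\<^sup>2" using eq by auto
  qed (use f' in auto)
  then show ?thesis by (simp add: Ltwo_norm_def Bochner_Integration.integral_nonneg)
qed

lemma square_integrable_imp_set_integrable:
  fixes f :: "'a \<Rightarrow> 'b::{banach, second_countable_topology}"
  assumes f: "f \<in> borel_measurable M" "integrable M (\<lambda>z. (norm (f z))\<^sup>2)" and A: "A \<in> sets M" "emeasure M A < \<infinity>"
  shows "set_integrable M A f"
  unfolding set_integrable_def
proof (rule Bochner_Integration.integrable_bound)
  show "integrable M (\<lambda>z. indicator A z + (norm (f z))\<^sup>2)" using f(2) A by auto
  show "AE z in M. norm (indicator A z *\<^sub>R f z) \<le> norm (indicator A z + (norm (f z))\<^sup>2)"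
  proof (rule AE_I2)
    fix z
    have "norm (f z) \<le> 1 + (norm (f z))\<^sup>2"
      using sum_squares_bound[of "norm (f z)" 1] norm_ge_zero[of "f z"] unfolding power_one mult_1_right by linarith
    then show "norm (indicator A z *\<^sub>R f z) \<le> norm (indicator A z + (norm (f z))\<^sup>2)"
      by (cases "z \<in> A") auto
  qed
  show "(\<lambda>x. indicat_real A x *\<^sub>R f x) \<in> borel_measurable M" using f(1) A by measurable
qed

text \<open>The representative is \<open>V (s, t) = cc t + P s t\<close>, with \<open>P\<close> the
  primitive of \<open>G\<close> from \<open>0\<close>. The integration constant is recovered as the
  mean of \<open>F - P\<close> over \<open>{0<..<1}\<close>, which makes it measurable in
  \<open>t\<close>; the first side of every rectangle has to contain this interval, hence
  \<open>a n \<le> 0\<close> and \<open>1 \<le> b n\<close>. Exhausting rectangles are used because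
  square integrability gives integrability on bounded sets. Both coordinate directions are
  instances, with different rectangles.\<close>

lemma AC_representative:
  fixes F G :: "real \<times> real \<Rightarrow> complex" and a b c d :: "nat \<Rightarrow> real"
  assumes Fm[measurable]: "F \<in> borel_measurable borel" and Gm[measurable]: "G \<in> borel_measurable borel"
    and F2: "integrable lborel (\<lambda>z. (norm (F z))\<^sup>2)" and G2: "integrable lborel (\<lambda>z. (norm (G z))\<^sup>2)"
    and ab: "\<And>n. a n \<le> 0" "\<And>n. 1 \<le> b n" and cd: "\<And>n. c n < d n"
    and inc: "\<And>m n. m \<le> n \<Longrightarrow> c n \<le> c m \<and> d m \<le> d n \<and> a n \<le> a m \<and> b m \<le> b n"
    and weak: "\<And>n f f' g a' b' c' d'. \<lbrakk>a n < a'; b' < b n; c n < c'; d' < d n;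
        \<And>x. (f has_real_derivative f' x) (at x); smooth f; smooth g;
        \<And>x. \<not> (a' < x \<and> x < b') \<Longrightarrow> f x = 0; \<And>x. \<not> (c' < x \<and> x < d') \<Longrightarrow> g x = 0\<rbrakk> \<Longrightarrow>
      (LINT z|lborel. (f' (fst z) * g (snd z)) *\<^sub>R F z) = - (LINT z|lborel. (f (fst z) * g (snd z)) *\<^sub>R G z)"
  obtains V where "V \<in> borel_measurable borel"
    "AE t in lborel. t \<in> (\<Union>n. {c n<..<d n}) \<longrightarrow> (AE s in lborel. s \<in> (\<Union>n. {a n<..<b n}) \<longrightarrow> V (s, t) = F (s, t))"
    "AE t in lborel. \<forall>x y. x \<le> y \<longrightarrow> set_integrable lborel {x<..y} (\<lambda>r. G (r, t)) \<and>
        V (y, t) = V (x, t) + (LINT r:{x<..y}|lborel. G (r, t))"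
    "\<And>s t. (\<And>r. F (r, t) = 0) \<Longrightarrow> (\<And>r. G (r, t) = 0) \<Longrightarrow> V (s, t) = 0"
proof -
  define k where "k s r = (indicator {0<..s} r - indicator {s<..0} r :: real)" for s r :: real
  define P where "P s t = (LINT r|lborel. k s r *\<^sub>R G (r, t))" for s t
  have km[measurable]: "(\<lambda>w. k (fst (fst w)) (snd w)) \<in> borel_measurable (borel :: ((real \<times> real) \<times> real) measure)"
  proof -
    have m1: "{w::(real \<times> real) \<times> real. 0 < snd w} \<in> sets borel" "{w::(real \<times> real) \<times> real. fst (fst w) < snd w} \<in> sets borel"
      by (intro borel_open open_Collect_less continuous_intros)+
    have m2: "{w::(real \<times> real) \<times> real. snd w \<le> fst (fst w)} \<in> sets borel" "{w::(real \<times> real) \<times> real. snd w \<le> 0} \<in> sets borel"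
      by (intro borel_closed closed_Collect_le continuous_intros)+
    have "(\<lambda>w::(real \<times> real) \<times> real. k (fst (fst w)) (snd w)) = (\<lambda>w. indicator ({w. 0 < snd w} \<inter> {w. snd w \<le> fst (fst w)}) w
        - indicator ({w. fst (fst w) < snd w} \<inter> {w. snd w \<le> 0}) w)"
      by (auto simp: k_def indicator_def fun_eq_iff)
    then show ?thesis
      by (simp only:) (intro borel_measurable_diff borel_measurable_indicator sets.Int m1 m2)
  qed
  have Pm[measurable]: "(\<lambda>z. P (fst z) (snd z)) \<in> borel_measurable borel"
  proof -
    have "(\<lambda>w. k (fst (fst w)) (snd w) *\<^sub>R G (snd w, snd (fst w))) \<in> borel_measurable ((borel :: (real\<times>real) measure) \<Otimes>\<^sub>M lborel)"
    proof -
      have "(\<lambda>w. k (fst (fst w)) (snd w)) \<in> borel_measurable ((borel :: (real\<times>real) measure) \<Otimes>\<^sub>M borel)"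
        using km by (simp add: borel_prod)
      then show ?thesis by measurable
    qed
    then show ?thesis unfolding P_def
      using lborel.borel_measurable_lebesgue_integral[of "\<lambda>z r. k (fst z) r *\<^sub>R G (r, snd z)" borel] by (simp add: case_prod_unfold)
  qed
  define cc where "cc t = (LINT s:{0<..<1}|lborel. (F (s,t) - P s t))" for t
  have ccm[measurable]: "cc \<in> borel_measurable borel"
  proof -
    have "(\<lambda>w. indicator {0<..<1} (snd w) *\<^sub>R (F (snd w, fst w) - P (snd w) (fst w))) \<in> borel_measurable (borel \<Otimes>\<^sub>M lborel)"
    proof -
      have "(\<lambda>w. P (snd w) (fst w)) \<in> borel_measurable (borel \<Otimes>\<^sub>M lborel)"
        using measurable_compose[OF _ Pm, of "\<lambda>w. (snd w, fst w)" "borel \<Otimes>\<^sub>M lborel"] by simp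
      then show ?thesis by measurable
    qed
    then show ?thesis unfolding cc_def set_lebesgue_integral_def
      using lborel.borel_measurable_lebesgue_integral[of "\<lambda>t s. indicator {0<..<1} s *\<^sub>R (F (s, t) - P s t)" borel] by (simp add: case_prod_unfold)
  qed
  define V where "V z = cc (snd z) + P (fst z) (snd z)" for z
  have slices: "AE t in lborel. integrable lborel (\<lambda>s. (norm (F (s,t)))\<^sup>2) \<and> integrable lborel (\<lambda>s. (norm (G (s,t)))\<^sup>2)"
    using lborel2_fubini_snd(1)[OF F2] lborel2_fubini_snd(1)[OF G2] by auto
  have Gloc: "set_integrable lborel A (\<lambda>r. G (r,t))" if "integrable lborel (\<lambda>s. (norm (G (s,t)))\<^sup>2)" "bounded A" "A \<in> sets borel" for t A
    using that emeasure_bounded_finite[of A]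
    by (intro square_integrable_imp_set_integrable) (auto simp: less_top[symmetric])
  have kint: "integrable lborel (\<lambda>r. k s r *\<^sub>R G (r,t))" if "integrable lborel (\<lambda>s. (norm (G (s,t)))\<^sup>2)" for s t
    using Gloc[OF that, of "{0<..s}"] Gloc[OF that, of "{s<..0}"]
    by (simp add: k_def set_integrable_def scaleR_left_diff_distrib)
  have Pdiff: "P y t = P x t + (LINT r:{x<..y}|lborel. G (r, t))" if "integrable lborel (\<lambda>s. (norm (G (s,t)))\<^sup>2)" "x \<le> y" for x y t
  proof -
    have "P x t + (LINT r:{x<..y}|lborel. G (r, t)) = (LINT r|lborel. k x r *\<^sub>R G (r,t) + indicator {x<..y} r *\<^sub>R G (r,t))"
      unfolding P_def set_lebesgue_integral_def using kint[OF that(1)] Gloc[OF that(1), of "{x<..y}"]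
      by (simp add: set_integrable_def)
    also have "\<dots> = P y t" unfolding P_def
      by (intro Bochner_Integration.integral_cong) (use that(2) in \<open>auto simp: k_def indicator_def\<close>)
    finally show ?thesis by simp
  qed
  have rect: "AE t in lborel. t \<in> {c n<..<d n} \<longrightarrow> (\<exists>C. AE s in lborel. s \<in> {a n<..<b n} \<longrightarrow> F (s,t) = C + P s t)" for n
  proof -
    define R where "R = {a n<..<b n} \<times> {c n<..<d n}"
    have Rm[measurable]: "R \<in> sets borel" unfolding R_def by (intro borel_open open_Times) auto
    have Rb: "emeasure lborel R < \<infinity>"
      using emeasure_bounded_finite[of R] unfolding R_def by (simp add: bounded_Times)
    have wk: "(LINT z|lborel. (f' (fst z) * g (snd z)) *\<^sub>R (indicator R z *\<^sub>R F z)) = - (LINT z|lborel. (f (fst z) * g (snd z)) *\<^sub>R (indicator R z *\<^sub>R G z))"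
      if h: "a n < a'" "b' < b n" "c n < c'" "d' < d n" "\<And>x. (f has_real_derivative f' x) (at x)" "smooth f" "smooth g"
        "\<And>x. \<not> (a' < x \<and> x < b') \<Longrightarrow> f x = 0" "\<And>x. \<not> (c' < x \<and> x < d') \<Longrightarrow> g x = 0" for f f' g a' b' c' d'
    proof -
      \<comment> \<open>This allows \<open>F\<close> to be cut off at the rectangle: outside the
        support \<open>f\<close> is locally zero, hence so is \<open>f'\<close>.\<close>
      have f'0: "f' x = 0" if x: "\<not> (a n < x \<and> x < b n)" for x
      proof -
        have "open (- {a'..b'})" "x \<in> - {a'..b'}" using x h(1,2) by auto
        then have "eventually (\<lambda>y. f y = 0) (nhds x)"
          using eventually_nhds_in_open[of "- {a'..b'}" x] by (auto elim!: eventually_mono intro!: h(8))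
        then have "(f has_real_derivative 0) (at x)"
          by (subst DERIV_cong_ev[OF refl _ refl]) auto
        then show ?thesis using DERIV_unique h(5) by blast
      qed
      have e1: "(f' (fst z) * g (snd z)) *\<^sub>R (indicator R z *\<^sub>R F z) = (f' (fst z) * g (snd z)) *\<^sub>R F z" for z
      proof (cases "z \<in> R")
        case False
        then have "f' (fst z) = 0 \<or> g (snd z) = 0" using f'0 h(9)[of "snd z"] h(3,4) unfolding R_def by (cases z) force
        then show ?thesis by auto
      qed auto
      have e2: "(f (fst z) * g (snd z)) *\<^sub>R (indicator R z *\<^sub>R G z) = (f (fst z) * g (snd z)) *\<^sub>R G z" for z
      proof (cases "z \<in> R")
        case False
        then have "f (fst z) = 0 \<or> g (snd z) = 0" using h(8)[of "fst z"] h(9)[of "snd z"] h(1-4) unfolding R_def by (cases z) force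
        then show ?thesis by auto
      qed auto
      show ?thesis unfolding e1 e2 by (rule weak[OF h])
    qed
    have "AE t in lborel. t \<in> {c n<..<d n} \<longrightarrow>
      (\<exists>C. AE s in lborel. s \<in> {a n<..<b n} \<longrightarrow> indicator R (s,t) *\<^sub>R F (s,t) = C - (LINT r:{s..}|lborel. indicator R (r,t) *\<^sub>R G (r,t)))"
    proof (rule weak_derivative_slices)
      show "integrable lborel (\<lambda>z. indicator R z *\<^sub>R F z)" "integrable lborel (\<lambda>z. indicator R z *\<^sub>R G z)"
        using square_integrable_imp_set_integrable[of F lborel R] square_integrable_imp_set_integrable[of G lborel R] F2 G2 Rb
        by (auto simp: set_integrable_def)
      show "a n < b n" using ab[of n] by linarith
      show "c n < d n" by (rule cd)
    qed (rule wk)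
    then show ?thesis using slices
    proof eventually_elim
      case (elim t)
      show ?case
      proof
        assume t: "t \<in> {c n<..<d n}"
        then obtain C where C: "AE s in lborel. s \<in> {a n<..<b n} \<longrightarrow> indicator R (s,t) *\<^sub>R F (s,t) = C - (LINT r:{s..}|lborel. indicator R (r,t) *\<^sub>R G (r,t))"
          using elim by auto
        have G: "integrable lborel (\<lambda>s. (norm (G (s,t)))\<^sup>2)" using elim by auto
        have e: "(LINT r:{s..}|lborel. indicator R (r,t) *\<^sub>R G (r,t)) = P (b n) t - P s t" if s: "s \<in> {a n<..<b n}" for s
        proof -
          have "(LINT r:{s..}|lborel. indicator R (r,t) *\<^sub>R G (r,t)) = (LINT r:{s<..b n}|lborel. G (r,t))"
            unfolding set_lebesgue_integral_def
          proof (rule integral_cong_AE)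
            show "AE r in lborel. indicator {s..} r *\<^sub>R indicator R (r,t) *\<^sub>R G (r,t) = indicator {s<..b n} r *\<^sub>R G (r,t)"
              using AE_lborel_singleton[of s] AE_lborel_singleton[of "b n"]
              by eventually_elim (use s t in \<open>auto simp: indicator_def R_def\<close>)
          qed measurable
          then show ?thesis using Pdiff[OF G, of s "b n"] s by simp
        qed
        have "AE s in lborel. s \<in> {a n<..<b n} \<longrightarrow> F (s,t) = (C - P (b n) t) + P s t"
          using C by eventually_elim (use t e in \<open>auto simp: R_def algebra_simps\<close>)
        then show "\<exists>C. AE s in lborel. s \<in> {a n<..<b n} \<longrightarrow> F (s,t) = C + P s t" by blast
      qed
    qed
  qed
  then have "AE t in lborel. \<forall>n. t \<in> {c n<..<d n} \<longrightarrow> (\<exists>C. AE s in lborel. s \<in> {a n<..<b n} \<longrightarrow> F (s,t) = C + P s t)"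
    by (simp add: AE_all_countable)
  then have 2: "AE t in lborel. t \<in> (\<Union>n. {c n<..<d n}) \<longrightarrow> (AE s in lborel. s \<in> (\<Union>n. {a n<..<b n}) \<longrightarrow> V (s, t) = F (s, t))"
  proof eventually_elim
    case (elim t)
    have eq: "AE s in lborel. s \<in> {a n<..<b n} \<longrightarrow> V (s, t) = F (s,t)" if t: "t \<in> {c n<..<d n}" for n
    proof -
      obtain C where C: "AE s in lborel. s \<in> {a n<..<b n} \<longrightarrow> F (s,t) = C + P s t" using elim t by blast
      have "cc t = (LINT s:{0<..<1::real}|lborel. C)"
        unfolding cc_def set_lebesgue_integral_def
      proof (rule integral_cong_AE)
        show "AE s in lborel. indicator {0<..<1} s *\<^sub>R (F (s, t) - P s t) = indicator {0<..<1} s *\<^sub>R C"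
          using C
        proof eventually_elim
          case (elim s)
          then show ?case using ab[of n] by (cases "s \<in> {0<..<1}") auto
        qed
        have "(\<lambda>s. P s t) \<in> borel_measurable borel" 
          using measurable_compose[OF _ Pm, of "\<lambda>s. (s, t)" borel] by simp
        then show "(\<lambda>s. indicator {0<..<1} s *\<^sub>R (F (s, t) - P s t)) \<in> borel_measurable lborel" by measurable
      qed measurable
      then have "cc t = C" by (simp add: set_lebesgue_integral_def)
      then show ?thesis using C by (auto simp: V_def)
    qed
    show ?case
    proof
      assume "t \<in> (\<Union>n. {c n<..<d n})"
      then obtain m where m: "t \<in> {c m<..<d m}" by auto
      \<comment> \<open>The rectangles increase, so every later one still has \<open>t\<close> in
        its second side, and countably many null sets of \<open>s\<close> are united.\<close>
      have "AE s in lborel. \<forall>n\<ge>m. s \<in> {a n<..<b n} \<longrightarrow> V (s, t) = F (s,t)"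
      proof (subst AE_all_countable, intro allI AE_impI eq)
        fix n assume "m \<le> n"
        then show "t \<in> {c n<..<d n}" using inc[of m n] m by auto
      qed
      then show "AE s in lborel. s \<in> (\<Union>n. {a n<..<b n}) \<longrightarrow> V (s, t) = F (s, t)"
      proof eventually_elim
        case (elim s)
        show ?case
        proof
          assume "s \<in> (\<Union>n. {a n<..<b n})"
          then obtain n where "s \<in> {a n<..<b n}" by auto
          then have "s \<in> {a (max m n)<..<b (max m n)}" using inc[of n "max m n"] by auto
          then show "V (s, t) = F (s, t)" using elim[rule_format, of "max m n"] by simp
        qed
      qed
    qed
  qed
  have 3: "AE t in lborel. \<forall>x y. x \<le> y \<longrightarrow> set_integrable lborel {x<..y} (\<lambda>r. G (r, t)) \<and>
        V (y, t) = V (x, t) + (LINT r:{x<..y}|lborel. G (r, t))"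
    using slices
  proof eventually_elim
    case (elim t)
    then have G: "integrable lborel (\<lambda>s. (norm (G (s,t)))\<^sup>2)" by simp
    show ?case
    proof (intro allI impI conjI)
      fix x y :: real assume xy: "x \<le> y"
      show "set_integrable lborel {x<..y} (\<lambda>r. G (r, t))" by (rule Gloc[OF G]) auto
      show "V (y, t) = V (x, t) + (LINT r:{x<..y}|lborel. G (r, t))"
        using Pdiff[OF G xy] by (simp add: V_def)
    qed
  qed
  have Vm: "V \<in> borel_measurable borel" unfolding V_def[abs_def] by measurable
  have z: "V (s, t) = 0" if "\<And>r. F (r, t) = 0" "\<And>r. G (r, t) = 0" for s t
    using that by (simp add: V_def cc_def P_def set_lebesgue_integral_def)
  show ?thesis by (rule that[OF Vm 2 3]) (rule z)
qed

section \<open>Absolutely continuous functions on the line\<close>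

text \<open>Local absolute continuity of \<open>v\<close> with density \<open>g\<close>. The
  intervals are half-open so that adjacent ones are disjoint and their integrals add.\<close>

definition indefinite_integral_of :: "(real \<Rightarrow> 'a::euclidean_space) \<Rightarrow> (real \<Rightarrow> 'a) \<Rightarrow> bool" where
  "indefinite_integral_of g v \<longleftrightarrow>
    (\<forall>x y. x \<le> y \<longrightarrow> set_integrable lborel {x<..y} g \<and> v y = v x + (LINT r:{x<..y}|lborel. g r))"

lemma indefinite_integral_ofD:
  assumes "indefinite_integral_of g v" "x \<le> y"
  shows "set_integrable lborel {x<..y} g" "v y = v x + (LINT r:{x<..y}|lborel. g r)"
  using assms by (auto simp: indefinite_integral_of_def)

lemma LINT_Ioc_eq_Icc:
  fixes g :: "real \<Rightarrow> 'a::{banach, second_countable_topology}"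
  assumes "set_integrable lborel {a..b} g"
  shows "(LINT r:{a<..b}|lborel. g r) = (LINT r:{a..b}|lborel. g r)"
proof -
  have m: "(\<lambda>x. indicator {a..b} x *\<^sub>R g x) \<in> borel_measurable lborel" using assms by (simp add: set_integrable_def)
  have e: "(\<lambda>x. indicator {a<..b} x *\<^sub>R g x) = (\<lambda>x. indicator {a<..b} x *\<^sub>R (indicator {a..b} x *\<^sub>R g x))"
    by (auto simp: indicator_def fun_eq_iff)
  show ?thesis unfolding set_lebesgue_integral_def
  proof (rule integral_cong_AE)
    show "AE x in lborel. indicator {a<..b} x *\<^sub>R g x = indicator {a..b} x *\<^sub>R g x"
      using AE_lborel_singleton[of a] by eventually_elim (auto simp: indicator_def)
    show "(\<lambda>x. indicator {a<..b} x *\<^sub>R g x) \<in> borel_measurable lborel"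
      unfolding e using m by measurable
  qed (rule m)
qed

lemma indefinite_integral_of_Icc:
  assumes "indefinite_integral_of g v" "x \<le> y"
  shows "set_integrable lborel {x..y} g" "v y = v x + (LINT r:{x..y}|lborel. g r)" "v y = v x + integral {x..y} g"
    "g absolutely_integrable_on {x..y}"
proof -
  show i: "set_integrable lborel {x..y} g"
    using indefinite_integral_ofD(1)[OF assms(1), of "x - 1" y] assms(2)
    by (auto intro: set_integrable_subset)
  show *: "v y = v x + (LINT r:{x..y}|lborel. g r)"
    using indefinite_integral_ofD(2)[OF assms] LINT_Ioc_eq_Icc[OF i] by simp
  show "v y = v x + integral {x..y} g" using * set_borel_integral_eq_integral(2)[OF i] by simp
  show "g absolutely_integrable_on {x..y}"
    using i unfolding set_integrable_def by (simp add: integrable_completion)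
qed

lemma indefinite_integral_of_continuous:
  assumes "indefinite_integral_of g v"
  shows "continuous_on S v"
proof -
  have "isCont v x" for x
  proof -
    have "g integrable_on {x-1..x+1}"
      using set_borel_integral_eq_integral(1)[OF indefinite_integral_of_Icc(1)[OF assms, of "x-1" "x+1"]] by simp
    then have "continuous_on {x-1..x+1} (\<lambda>y. v (x-1) + integral {x-1..y} g)"
      by (intro continuous_intros indefinite_integral_continuous_1)
    then have "continuous_on {x-1..x+1} v"
      by (rule continuous_on_eq) (simp add: indefinite_integral_of_Icc(3)[OF assms, of "x-1", symmetric])
    then show ?thesis by (rule continuous_on_interior) auto
  qed
  then show ?thesis by (simp add: continuous_at_imp_continuous_on)
qed

lemma LINT_Ioc_affine_uminus:
  fixes g :: "real \<Rightarrow> 'a::{banach, second_countable_topology}"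
  shows "set_integrable lborel {x..y} g \<longleftrightarrow> set_integrable lborel {-y..-x} (\<lambda>r. g (- r))"
    and "(LINT r:{x..y}|lborel. g r) = (LINT r:{-y..-x}|lborel. g (- r))"
proof -
  have e: "(\<lambda>r. indicator {x..y} (0 + -1 * r) *\<^sub>R g (0 + -1 * r)) = (\<lambda>r. indicator {-y..-x} r *\<^sub>R g (- r))"
    by (auto simp: indicator_def fun_eq_iff)
  show "set_integrable lborel {x..y} g \<longleftrightarrow> set_integrable lborel {-y..-x} (\<lambda>r. g (- r))"
    using lborel_integrable_real_affine_iff[of "-1" "\<lambda>r. indicator {x..y} r *\<^sub>R g r" 0] unfolding set_integrable_def e by simp
  show "(LINT r:{x..y}|lborel. g r) = (LINT r:{-y..-x}|lborel. g (- r))"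
    using lborel_integral_real_affine[of "-1" "\<lambda>r. indicator {x..y} r *\<^sub>R g r" 0] unfolding set_lebesgue_integral_def e by simp
qed

lemma indefinite_integral_of_IccI:
  assumes "\<And>x y. x \<le> y \<Longrightarrow> set_integrable lborel {x..y} g"
    and "\<And>x y. x \<le> y \<Longrightarrow> v y = v x + (LINT r:{x..y}|lborel. g r)"
  shows "indefinite_integral_of g v"
  unfolding indefinite_integral_of_def
proof (intro allI impI conjI)
  fix x y :: real assume "x \<le> y"
  show "set_integrable lborel {x<..y} g" by (rule set_integrable_subset[OF assms(1)[OF \<open>x \<le> y\<close>]]) auto
  show "v y = v x + (LINT r:{x<..y}|lborel. g r)" using assms(2)[OF \<open>x \<le> y\<close>] LINT_Ioc_eq_Icc[OF assms(1)[OF \<open>x \<le> y\<close>]] by simp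
qed

lemma indefinite_integral_of_reflect:
  assumes "indefinite_integral_of g v"
  shows "indefinite_integral_of (\<lambda>x. - g (- x)) (\<lambda>x. v (- x))"
proof (rule indefinite_integral_of_IccI)
  fix x y :: real assume xy: "x \<le> y"
  have i: "set_integrable lborel {x..y} (\<lambda>r. g (- r))"
    using LINT_Ioc_affine_uminus(1)[of "-y" "-x" g] indefinite_integral_of_Icc(1)[OF assms, of "-y" "-x"] xy by simp
  then show "set_integrable lborel {x..y} (\<lambda>r. - g (- r))" by (simp add: set_integrable_def)
  have "(LINT r:{x..y}|lborel. - g (- r)) = - (LINT r:{x..y}|lborel. g (- r))"
    by (simp add: set_lebesgue_integral_def)
  then show "v (- y) = v (- x) + (LINT r:{x..y}|lborel. - g (- r))"
    using LINT_Ioc_affine_uminus(2)[of "-y" "-x" g] indefinite_integral_of_Icc(2)[OF assms, of "-y" "-x"] xy by simp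
qed

lemma indefinite_integral_of_Re:
  assumes "indefinite_integral_of g v"
  shows "indefinite_integral_of (\<lambda>x. Re (g x)) (\<lambda>x. Re (v x))"
proof (rule indefinite_integral_of_IccI)
  fix x y :: real assume xy: "x \<le> y"
  note i = indefinite_integral_of_Icc(1)[OF assms xy]
  have e: "(\<lambda>r. indicator {x..y} r *\<^sub>R Re (g r)) = (\<lambda>r. Re (indicator {x..y} r *\<^sub>R g r))" by auto
  show "set_integrable lborel {x..y} (\<lambda>x. Re (g x))"
    using i unfolding set_integrable_def e by (rule integrable_Re)
  have "(LINT r:{x..y}|lborel. Re (g r)) = Re (LINT r:{x..y}|lborel. g r)"
    using i unfolding set_integrable_def set_lebesgue_integral_def e by (rule integral_Re)
  then show "Re (v y) = Re (v x) + (LINT r:{x..y}|lborel. Re (g r))"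
    using indefinite_integral_of_Icc(2)[OF assms xy] by simp
qed

lemma indefinite_integral_of_DERIV:
  assumes "\<And>x. (v has_real_derivative g x) (at x)" "continuous_on UNIV g"
  shows "indefinite_integral_of g v"
proof (rule indefinite_integral_of_IccI)
  fix x y :: real assume xy: "x \<le> y"
  show "set_integrable lborel {x..y} g" unfolding set_integrable_def
    by (rule borel_integrable_compact) (use assms(2) in \<open>auto intro: continuous_on_subset\<close>)
  have "isCont g z" for z using assms(2) by (simp add: continuous_on_eq_continuous_at)
  then have "(LINT r|lborel. g r * indicator {x..y} r) = v y - v x"
    by (intro integral_FTC_Icc_real xy assms(1))
  then show "v y = v x + (LINT r:{x..y}|lborel. g r)"
    by (simp add: set_lebesgue_integral_def mult.commute)
qed

text \<open>Fubini over the two half-planes into which the diagonal, a null set, cuts the plane. It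
  is integration by parts for primitives, without any pointwise derivative.\<close>

lemma integral_triangle_split:
  fixes f g :: "real \<Rightarrow> real"
  assumes f: "integrable lborel f" and g: "integrable lborel g"
  shows "integrable lborel (\<lambda>s. f s * (LINT r:{..s}|lborel. g r))"
    and "(LINT s|lborel. f s * (LINT r:{..s}|lborel. g r)) + (LINT s|lborel. (LINT r:{..s}|lborel. f r) * g s) = (LINT s|lborel. f s) * (LINT s|lborel. g s)"
proof -
  define A where "A = {z::real\<times>real. snd z \<le> fst z}"
  define B where "B = {z::real\<times>real. fst z \<le> snd z}"
  have Am[measurable]: "A \<in> sets borel" "B \<in> sets borel" unfolding A_def B_def by (intro borel_closed closed_Collect_le continuous_intros)+
  have i: "integrable lborel (\<lambda>z. f (fst z) * g (snd z))" using lborel2_integrable_product[OF f g] by simp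
  have iA: "integrable lborel (\<lambda>z. indicator A z *\<^sub>R (f (fst z) * g (snd z)))" and iB: "integrable lborel (\<lambda>z. indicator B z *\<^sub>R (f (fst z) * g (snd z)))"
    by (intro integrable_mult_indicator i; simp)+
  have eA: "(LINT t|lborel. indicator A (s,t) *\<^sub>R (f (fst (s,t)) * g (snd (s,t)))) = f s * (LINT r:{..s}|lborel. g r)" for s
  proof -
    have "(LINT t|lborel. indicator A (s,t) *\<^sub>R (f (fst (s,t)) * g (snd (s,t)))) = (LINT t|lborel. f s * (indicator {..s} t *\<^sub>R g t))"
      by (intro Bochner_Integration.integral_cong) (auto simp: A_def indicator_def)
    then show ?thesis by (simp add: set_lebesgue_integral_def)
  qed
  have eB: "(LINT s|lborel. indicator B (s,t) *\<^sub>R (f (fst (s,t)) * g (snd (s,t)))) = (LINT r:{..t}|lborel. f r) * g t" for t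
  proof -
    have "(LINT s|lborel. indicator B (s,t) *\<^sub>R (f (fst (s,t)) * g (snd (s,t)))) = (LINT s|lborel. (indicator {..t} s *\<^sub>R f s) * g t)"
      by (intro Bochner_Integration.integral_cong) (auto simp: B_def indicator_def)
    then show ?thesis by (simp add: set_lebesgue_integral_def)
  qed
  show "integrable lborel (\<lambda>s. f s * (LINT r:{..s}|lborel. g r))"
    using lborel2_fubini_fst(2)[OF iA] unfolding eA .
  have "(LINT s|lborel. f s * (LINT r:{..s}|lborel. g r)) = (LINT z|lborel. indicator A z *\<^sub>R (f (fst z) * g (snd z)))"
    using lborel2_fubini_fst(3)[OF iA] unfolding eA .
  moreover have "(LINT s|lborel. (LINT r:{..s}|lborel. f r) * g s) = (LINT z|lborel. indicator B z *\<^sub>R (f (fst z) * g (snd z)))"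
    using lborel2_fubini_snd(3)[OF iB] unfolding eB .
  moreover have "(LINT z|lborel. indicator A z *\<^sub>R (f (fst z) * g (snd z))) + (LINT z|lborel. indicator B z *\<^sub>R (f (fst z) * g (snd z))) = (LINT z|lborel. f (fst z) * g (snd z))"
  proof -
    have "(LINT z|lborel. indicator A z *\<^sub>R (f (fst z) * g (snd z))) + (LINT z|lborel. indicator B z *\<^sub>R (f (fst z) * g (snd z))) =
        (LINT z|lborel. indicator A z *\<^sub>R (f (fst z) * g (snd z)) + indicator B z *\<^sub>R (f (fst z) * g (snd z)))"
      using iA iB by simp
    also have "\<dots> = (LINT z|lborel. f (fst z) * g (snd z))"
    proof (rule integral_cong_AE)
      have p: "Measurable.pred borel (\<lambda>z::real\<times>real. fst z \<noteq> snd z)" by measurable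
      have "AE z::real\<times>real in lborel. fst z \<noteq> snd z"
        unfolding lborel2_AE(1)[OF p] by (simp add: AE_lborel_singleton)
      then show "AE z in lborel. indicator A z *\<^sub>R (f (fst z) * g (snd z)) + indicator B z *\<^sub>R (f (fst z) * g (snd z)) = f (fst z) * g (snd z)"
        by eventually_elim (auto simp: A_def B_def indicator_def)
    qed (use iA iB i in auto)
    finally show ?thesis .
  qed
  moreover have "(LINT z|lborel. f (fst z) * g (snd z)) = (LINT s|lborel. f s) * (LINT s|lborel. g s)"
    using lborel2_fubini_fst(3)[OF i] by simp
  ultimately show "(LINT s|lborel. f s * (LINT r:{..s}|lborel. g r)) + (LINT s|lborel. (LINT r:{..s}|lborel. f r) * g s) = (LINT s|lborel. f s) * (LINT s|lborel. g s)"
    by simp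
qed

text \<open>Both factors are expanded around the left endpoint \<open>x\<close>; the mixed term is
  then a product of two primitives, which \<open>integral_triangle_split\<close> evaluates.\<close>

lemma indefinite_integral_of_mult:
  fixes f g u v :: "real \<Rightarrow> real"
  assumes u: "indefinite_integral_of f u" and v: "indefinite_integral_of g v"
  shows "indefinite_integral_of (\<lambda>x. f x * v x + u x * g x) (\<lambda>x. u x * v x)"
  unfolding indefinite_integral_of_def
proof (intro allI impI)
  fix x y :: real assume xy: "x \<le> y"
  define F where "F r = indicator {x<..y} r *\<^sub>R f r" for r
  define G where "G r = indicator {x<..y} r *\<^sub>R g r" for r
  have Fi: "integrable lborel F" and Gi: "integrable lborel G"
    using indefinite_integral_ofD(1)[OF u xy] indefinite_integral_ofD(1)[OF v xy] by (simp_all add: F_def[abs_def] G_def[abs_def] set_integrable_def)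
  have us: "u s = u x + (LINT r:{..s}|lborel. F r)" and vs: "v s = v x + (LINT r:{..s}|lborel. G r)" if "s \<in> {x<..y}" for s
  proof -
    have "(LINT r:{..s}|lborel. F r) = (LINT r:{x<..s}|lborel. f r)" "(LINT r:{..s}|lborel. G r) = (LINT r:{x<..s}|lborel. g r)"
      unfolding set_lebesgue_integral_def by (intro Bochner_Integration.integral_cong; use that in \<open>auto simp: F_def G_def indicator_def\<close>)+
    then show "u s = u x + (LINT r:{..s}|lborel. F r)" "v s = v x + (LINT r:{..s}|lborel. G r)"
      using indefinite_integral_ofD(2)[OF u, of x s] indefinite_integral_ofD(2)[OF v, of x s] that by auto
  qed
  have e: "indicator {x<..y} s *\<^sub>R (f s * v s + u s * g s) = (v x * F s + u x * G s) + (F s * (LINT r:{..s}|lborel. G r) + (LINT r:{..s}|lborel. F r) * G s)" for s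
  proof (cases "s \<in> {x<..y}")
    case True
    then have "F s = f s" "G s = g s" by (simp_all add: F_def G_def)
    then show ?thesis unfolding us[OF True] vs[OF True] using True by (simp add: algebra_simps)
  next
    case False
    then have "F s = 0" "G s = 0" by (simp_all add: F_def G_def)
    then show ?thesis using False by simp
  qed
  have i2: "integrable lborel (\<lambda>s. F s * (LINT r:{..s}|lborel. G r))" "integrable lborel (\<lambda>s. (LINT r:{..s}|lborel. F r) * G s)"
    using integral_triangle_split(1)[OF Fi Gi] integral_triangle_split(1)[OF Gi Fi] by (simp_all add: mult.commute)
  have "set_integrable lborel {x<..y} (\<lambda>x. f x * v x + u x * g x)"
    unfolding set_integrable_def e using i2 Fi Gi by auto
  moreover have "(LINT s:{x<..y}|lborel. f s * v s + u s * g s) = (v x * (LINT s|lborel. F s) + u x * (LINT s|lborel. G s)) + (LINT s|lborel. F s) * (LINT s|lborel. G s)"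
    unfolding set_lebesgue_integral_def e integral_triangle_split(2)[OF Fi Gi, unfolded set_lebesgue_integral_def, symmetric]
    using i2 Fi Gi by (simp add: set_lebesgue_integral_def)
  moreover have "u y = u x + (LINT s|lborel. F s)" "v y = v x + (LINT s|lborel. G s)"
    using indefinite_integral_ofD(2)[OF u xy] indefinite_integral_ofD(2)[OF v xy] by (simp_all add: F_def G_def set_lebesgue_integral_def)
  ultimately show "set_integrable lborel {x<..y} (\<lambda>x. f x * v x + u x * g x) \<and>
      u y * v y = u x * v x + (LINT r:{x<..y}|lborel. f r * v r + u r * g r)"
    by (simp add: algebra_simps)
qed

lemma continuous_AE_zero_imp_zero:
  fixes f :: "real \<Rightarrow> 'a::real_normed_vector"
  assumes "continuous_on UNIV f" "AE x in lborel. x \<in> {a<..<b} \<longrightarrow> f x = 0" and x: "x \<in> {a<..<b}"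
  shows "f x = 0"
proof (rule ccontr)
  assume "f x \<noteq> 0"
  define S where "S = f -` (- {0}) \<inter> {a<..<b}"
  have "open S"
    unfolding S_def by (intro open_Int open_vimage[OF _ assms(1)] open_Compl closed_singleton open_greaterThanLessThan)
  moreover have "x \<in> S" using x \<open>f x \<noteq> 0\<close> by (auto simp: S_def)
  moreover have "S \<in> null_sets lborel"
  proof (rule AE_iff_null_sets[THEN iffD2])
    show "S \<in> sets lborel" using \<open>open S\<close> by simp
    show "AE x in lborel. x \<notin> S" using assms(2) by eventually_elim (auto simp: S_def)
  qed
  ultimately show False
    using open_not_negligible[of S] by (auto simp: negligible_iff_null_sets null_sets_completionI)
qed

section \<open>Representatives of functions in the Sobolev space\<close>

lemma strip_borel [measurable, simp]: "strip \<in> sets borel"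
  unfolding strip_def by (intro borel_closed closed_Times) auto

text \<open>Meant for functions extended by zero to the plane. Test functions are supported in the
  open strip, so the extension adds no boundary terms.\<close>

definition lborel_weak_partial ::
  "(real \<times> real \<Rightarrow> complex) \<Rightarrow> real \<times> real \<Rightarrow> (real \<times> real \<Rightarrow> complex) \<Rightarrow> bool" where
  "lborel_weak_partial F v G \<longleftrightarrow>
     (\<forall>\<theta> \<in> test_functions. (LINT z|lborel. frechet_derivative \<theta> (at z) v *\<^sub>R F z) = - (LINT z|lborel. \<theta> z *\<^sub>R G z))"

lemma test_function_continuous:
  assumes "\<theta> \<in> test_functions"
  shows "continuous_on UNIV \<theta>" "continuous_on UNIV (\<lambda>z. frechet_derivative \<theta> (at z) v)"
    "\<theta> differentiable (at z)" "(\<theta> has_derivative frechet_derivative \<theta> (at z)) (at z)"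
proof -
  have t: "times_cont_diff k \<theta>" for k using assms by (simp add: test_functions_def)
  show "continuous_on UNIV \<theta>" using t[of 0] by simp
  show "continuous_on UNIV (\<lambda>z. frechet_derivative \<theta> (at z) v)" using t[of "Suc 0"] unfolding times_cont_diff.simps by blast
  show "\<theta> differentiable (at z)" using t[of "Suc 0"] unfolding times_cont_diff.simps by blast
  then show "(\<theta> has_derivative frechet_derivative \<theta> (at z)) (at z)" by (simp add: frechet_derivative_works)
qed

lemma test_function_support:
  assumes "\<theta> \<in> test_functions"
  obtains K where "compact K" "K \<subseteq> UNIV \<times> {0<..<1}" "\<And>z. z \<notin> K \<Longrightarrow> \<theta> z = 0"
    "\<And>z v. z \<notin> K \<Longrightarrow> frechet_derivative \<theta> (at z) v = 0"
proof -
  obtain K where K: "compact K" "K \<subseteq> UNIV \<times> {0<..<1}" "\<And>z. z \<notin> K \<Longrightarrow> \<theta> z = 0"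
    using assms by (auto simp: test_functions_def)
  have "frechet_derivative \<theta> (at z) v = 0" if "z \<notin> K" for z v
  proof -
    have "open (- K)" using K(1) by (simp add: compact_imp_closed open_Compl)
    then have "((\<lambda>z. 0) has_derivative frechet_derivative \<theta> (at z)) (at z)"
      by (rule has_derivative_transform_within_open[OF test_function_continuous(4)[OF assms]]) (use that K(3) in auto)
    then have "frechet_derivative \<theta> (at z) = (\<lambda>v. 0)"
      using has_derivative_unique has_derivative_const by blast
    then show ?thesis by simp
  qed
  then show ?thesis using K by (intro that[of K])
qed

lemma continuous_compact_support_mult_integrable:
  fixes h :: "'a::euclidean_space \<Rightarrow> real" and F :: "'a \<Rightarrow> complex"
  assumes h: "continuous_on UNIV h" "compact K" "\<And>z. z \<notin> K \<Longrightarrow> h z = 0"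
    and F: "F \<in> borel_measurable borel" "integrable lborel (\<lambda>z. (norm (F z))\<^sup>2)"
  shows "integrable lborel (\<lambda>z. h z *\<^sub>R F z)"
proof (rule Bochner_Integration.integrable_bound)
  have "integrable lborel (\<lambda>z. indicator K z *\<^sub>R (h z)\<^sup>2)"
    using h(2) by (intro borel_integrable_compact) (auto intro!: continuous_intros continuous_on_subset[OF h(1)])
  moreover have "(\<lambda>z. indicator K z *\<^sub>R (h z)\<^sup>2) = (\<lambda>z. (h z)\<^sup>2)" using h(3) by (auto simp: indicator_def fun_eq_iff)
  ultimately show "integrable lborel (\<lambda>z. (h z)\<^sup>2 + (norm (F z))\<^sup>2)" using F(2) by auto
  show "AE z in lborel. norm (h z *\<^sub>R F z) \<le> norm ((h z)\<^sup>2 + (norm (F z))\<^sup>2)"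
  proof (rule AE_I2)
    fix z
    have "2 * \<bar>h z\<bar> * norm (F z) \<le> (h z)\<^sup>2 + (norm (F z))\<^sup>2" using sum_squares_bound[of "\<bar>h z\<bar>" "norm (F z)"] by simp
    moreover have "0 \<le> \<bar>h z\<bar> * norm (F z)" by simp
    ultimately have "\<bar>h z\<bar> * norm (F z) \<le> (h z)\<^sup>2 + (norm (F z))\<^sup>2" by linarith
    then show "norm (h z *\<^sub>R F z) \<le> norm ((h z)\<^sup>2 + (norm (F z))\<^sup>2)" by simp
  qed
  have [measurable]: "h \<in> borel_measurable borel" using h(1) by (rule borel_measurable_continuous_onI)
  show "(\<lambda>z. h z *\<^sub>R F z) \<in> borel_measurable lborel" using F(1) by measurable
qed

lemma test_function_mult_integrable:
  fixes F :: "real \<times> real \<Rightarrow> complex"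
  assumes \<theta>: "\<theta> \<in> test_functions" and F: "F \<in> borel_measurable borel" "integrable lborel (\<lambda>z. (norm (F z))\<^sup>2)"
  shows "integrable lborel (\<lambda>z. \<theta> z *\<^sub>R F z)" "integrable lborel (\<lambda>z. frechet_derivative \<theta> (at z) v *\<^sub>R F z)"
proof -
  obtain K where K: "compact K" "\<And>z. z \<notin> K \<Longrightarrow> \<theta> z = 0" "\<And>z v. z \<notin> K \<Longrightarrow> frechet_derivative \<theta> (at z) v = 0"
    using test_function_support[OF \<theta>] by metis
  show "integrable lborel (\<lambda>z. \<theta> z *\<^sub>R F z)"
    by (rule continuous_compact_support_mult_integrable[OF test_function_continuous(1)[OF \<theta>] K(1) K(2) F])
  show "integrable lborel (\<lambda>z. frechet_derivative \<theta> (at z) v *\<^sub>R F z)"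
    by (rule continuous_compact_support_mult_integrable[OF test_function_continuous(2)[OF \<theta>] K(1) K(3) F])
qed

lemma has_weak_partial_iff:
  assumes u: "u \<in> borel_measurable (lebesgue_on strip)" "F \<in> borel_measurable borel" "\<And>z. z \<notin> strip \<Longrightarrow> F z = 0" "AE z in lebesgue_on strip. u z = F z"
    and g: "g \<in> borel_measurable (lebesgue_on strip)" "G \<in> borel_measurable borel" "\<And>z. z \<notin> strip \<Longrightarrow> G z = 0" "AE z in lebesgue_on strip. g z = G z"
  shows "has_weak_partial u v g \<longleftrightarrow> lborel_weak_partial F v G"
proof -
  have "(LINT z|lebesgue_on strip. frechet_derivative \<theta> (at z) v *\<^sub>R u z) = (LINT z|lborel. frechet_derivative \<theta> (at z) v *\<^sub>R F z)" 
    "(LINT z|lebesgue_on strip. \<theta> z *\<^sub>R g z) = (LINT z|lborel. \<theta> z *\<^sub>R G z)" if \<theta>: "\<theta> \<in> test_functions" for \<theta>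
  proof -
    have m[measurable]: "\<theta> \<in> borel_measurable borel" "(\<lambda>z. frechet_derivative \<theta> (at z) v) \<in> borel_measurable borel"
      by (rule borel_measurable_continuous_onI[OF test_function_continuous(1)[OF \<theta>]] borel_measurable_continuous_onI[OF test_function_continuous(2)[OF \<theta>]])+
    note m' = borel_measurable_lebesgue_onI[OF m(1), of strip] borel_measurable_lebesgue_onI[OF m(2), of strip]
    show "(LINT z|lebesgue_on strip. frechet_derivative \<theta> (at z) v *\<^sub>R u z) = (LINT z|lborel. frechet_derivative \<theta> (at z) v *\<^sub>R F z)" 
      by (rule integral_of_representative(1)[OF strip_borel])
         (use u m' in \<open>auto intro!: borel_measurable_scaleR elim: eventually_mono\<close>)
    show "(LINT z|lebesgue_on strip. \<theta> z *\<^sub>R g z) = (LINT z|lborel. \<theta> z *\<^sub>R G z)"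
      by (rule integral_of_representative(1)[OF strip_borel])
         (use g m' in \<open>auto intro!: borel_measurable_scaleR elim: eventually_mono\<close>)
  qed
  then show ?thesis by (simp add: has_weak_partial_def lborel_weak_partial_def)
qed

lemma lborel_weak_partial_diff:
  assumes "lborel_weak_partial F v G" "lborel_weak_partial F' v G'"
    and "F \<in> borel_measurable borel" "integrable lborel (\<lambda>z. (norm (F z))\<^sup>2)"
    and "G \<in> borel_measurable borel" "integrable lborel (\<lambda>z. (norm (G z))\<^sup>2)"
    and "F' \<in> borel_measurable borel" "integrable lborel (\<lambda>z. (norm (F' z))\<^sup>2)"
    and "G' \<in> borel_measurable borel" "integrable lborel (\<lambda>z. (norm (G' z))\<^sup>2)"
  shows "lborel_weak_partial (\<lambda>z. F z - F' z) v (\<lambda>z. G z - G' z)"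
  unfolding lborel_weak_partial_def
proof
  fix \<theta> assume \<theta>: "\<theta> \<in> test_functions"
  show "(LINT z|lborel. frechet_derivative \<theta> (at z) v *\<^sub>R (F z - F' z)) = - (LINT z|lborel. \<theta> z *\<^sub>R (G z - G' z))"
    using assms(1,2)[unfolded lborel_weak_partial_def, THEN bspec, OF \<theta>]
      test_function_mult_integrable[OF \<theta> assms(3,4)] test_function_mult_integrable[OF \<theta> assms(5,6)]
      test_function_mult_integrable[OF \<theta> assms(7,8)] test_function_mult_integrable[OF \<theta> assms(9,10)]
    by (simp add: scaleR_diff_right)
qed

lemma norm_diff_square_le: "(norm (a - b))\<^sup>2 \<le> 2 * (norm a)\<^sup>2 + 2 * (norm (b::'a::real_normed_vector))\<^sup>2"
proof -
  have "(norm (a - b))\<^sup>2 \<le> (norm a + norm b)\<^sup>2" by (intro power_mono norm_triangle_ineq4) auto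
  also have "\<dots> \<le> 2 * (norm a)\<^sup>2 + 2 * (norm b)\<^sup>2" using sum_squares_bound[of "norm a" "norm b"] by (simp add: power2_sum)
  finally show ?thesis .
qed

lemma square_integrable_diff:
  fixes f g :: "'a \<Rightarrow> 'b::{banach, second_countable_topology}"
  assumes [measurable]: "f \<in> borel_measurable M" "g \<in> borel_measurable M"
    and i: "integrable M (\<lambda>z. (norm (f z))\<^sup>2)" "integrable M (\<lambda>z. (norm (g z))\<^sup>2)"
  shows "integrable M (\<lambda>z. (norm (f z - g z))\<^sup>2)"
proof (rule Bochner_Integration.integrable_bound)
  show "integrable M (\<lambda>z. 2 * (norm (f z))\<^sup>2 + 2 * (norm (g z))\<^sup>2)" using i by auto
  show "AE z in M. norm ((norm (f z - g z))\<^sup>2) \<le> norm (2 * (norm (f z))\<^sup>2 + 2 * (norm (g z))\<^sup>2)"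
    using norm_diff_square_le[of "f _" "g _"] by (intro AE_I2) auto
qed measurable

text \<open>The rectangles with sides \<open>(-(n+1), n+1)\<close> and \<open>(0, 1)\<close> exhaust
  the open strip. On lines outside the strip both functions vanish, and the representative is then
  zero as well; the two boundary lines form a null set.\<close>

lemma weak_partial_x_slices:
  assumes F: "F \<in> borel_measurable borel" "\<And>z. z \<notin> strip \<Longrightarrow> F z = 0" "integrable lborel (\<lambda>z. (norm (F z))\<^sup>2)"
    and G: "G \<in> borel_measurable borel" "\<And>z. z \<notin> strip \<Longrightarrow> G z = 0" "integrable lborel (\<lambda>z. (norm (G z))\<^sup>2)"
    and w: "lborel_weak_partial F (1, 0) G"
  obtains V where "V \<in> borel_measurable borel" "\<And>z. z \<notin> strip \<Longrightarrow> V z = 0" "AE z in lborel. V z = F z"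
    "AE t in lborel. indefinite_integral_of (\<lambda>s. G (s, t)) (\<lambda>s. V (s, t))"
proof -
  have weak: "(LINT z|lborel. (f' (fst z) * g (snd z)) *\<^sub>R F z) = - (LINT z|lborel. (f (fst z) * g (snd z)) *\<^sub>R G z)"
    if "- (real n + 1) < a'" "b' < real n + 1" and h: "0 < c'" "d' < 1" "\<And>x. (f has_real_derivative f' x) (at x)" "smooth f" "smooth g"
        "\<And>x. \<not> (a' < x \<and> x < b') \<Longrightarrow> f x = 0" "\<And>x. \<not> (c' < x \<and> x < d') \<Longrightarrow> g x = 0" for n f f' g a' b' c' d'
  proof -
    obtain g' where g': "\<And>x. (g has_real_derivative g' x) (at x)" using smooth_derivE[OF h(5)] by blast
    have tf: "(\<lambda>z. f (fst z) * g (snd z)) \<in> test_functions"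
      by (rule product_test_function[OF h(4,5,1,2,6,7)])
    show ?thesis using w[unfolded lborel_weak_partial_def, THEN bspec, OF tf]
      by (simp add: frechet_derivative_product_fun[of f f' g g', OF h(3) g'])
  qed
  obtain V where V: "V \<in> borel_measurable borel"
    "AE t in lborel. t \<in> (\<Union>n::nat. {0<..<1}) \<longrightarrow> (AE s in lborel. s \<in> (\<Union>n. {- (real n + 1)<..<real n + 1}) \<longrightarrow> V (s, t) = F (s, t))"
    "AE t in lborel. \<forall>x y. x \<le> y \<longrightarrow> set_integrable lborel {x<..y} (\<lambda>r. G (r, t)) \<and>
        V (y, t) = V (x, t) + (LINT r:{x<..y}|lborel. G (r, t))"
    "\<And>s t. (\<And>r. F (r, t) = 0) \<Longrightarrow> (\<And>r. G (r, t) = 0) \<Longrightarrow> V (s, t) = 0"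
    by (rule AC_representative[OF F(1) G(1) F(3) G(3), where a="\<lambda>n. - (real n + 1)" and b="\<lambda>n. real n + 1" and c="\<lambda>n. 0" and d="\<lambda>n. 1", OF _ _ _ _ weak])
       auto
  have V0: "V z = 0" if "z \<notin> strip" for z
  proof -
    have "(r, snd z) \<notin> strip" for r using that by (cases z) (auto simp: strip_def)
    then show ?thesis using V(4)[of "snd z" "fst z"] F(2) G(2) by simp
  qed
  have U: "(\<Union>n. {- (real n + 1)<..<real n + 1}) = UNIV"
  proof -
    have "\<exists>n. - (real n + 1) < x \<and> x < real n + 1" for x
    proof -
      obtain n where "\<bar>x\<bar> < real n" using reals_Archimedean2 by blast
      then show ?thesis by (intro exI[of _ n]) linarith
    qed
    then show ?thesis by auto
  qed
  have p: "Measurable.pred borel (\<lambda>z. V z = F z)" using V(1) F(1) by measurable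
  have "AE z in lborel. V z = F z"
    unfolding lborel2_AE(1)[OF p] using V(2) AE_lborel_singleton[of 0] AE_lborel_singleton[of 1]
  proof eventually_elim
    case (elim t)
    show ?case
    proof (cases "t \<in> {0<..<1}")
      case True
      then show ?thesis using elim unfolding U by simp
    next
      case False
      then have "(s, t) \<notin> strip" for s using elim by (auto simp: strip_def)
      then show ?thesis using V0 F(2) by auto
    qed
  qed
  moreover have "AE t in lborel. indefinite_integral_of (\<lambda>s. G (s, t)) (\<lambda>s. V (s, t))"
    using V(3) unfolding indefinite_integral_of_def .
  ultimately show ?thesis using that[OF V(1) V0] by simp
qed

text \<open>The coordinates are exchanged so that the same one-dimensional argument applies. In
  contrast to the horizontal case the representative agrees with \<open>F\<close> on the strip only:
  \<open>G\<close> vanishes above and below it, so \<open>V\<close> continues there as a constant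
  and not by zero.\<close>

lemma weak_partial_y_slices:
  assumes F: "F \<in> borel_measurable borel" "\<And>z. z \<notin> strip \<Longrightarrow> F z = 0" "integrable lborel (\<lambda>z. (norm (F z))\<^sup>2)"
    and G: "G \<in> borel_measurable borel" "\<And>z. z \<notin> strip \<Longrightarrow> G z = 0" "integrable lborel (\<lambda>z. (norm (G z))\<^sup>2)"
    and w: "lborel_weak_partial F (0, 1) G"
  obtains V where "V \<in> borel_measurable borel" "AE z in lborel. z \<in> strip \<longrightarrow> V z = F z"
    "AE s in lborel. indefinite_integral_of (\<lambda>t. G (s, t)) (\<lambda>t. V (s, t))"
proof -
  define F' where "F' z = F (snd z, fst z)" for z
  define G' where "G' z = G (snd z, fst z)" for z
  have m: "F' \<in> borel_measurable borel" "G' \<in> borel_measurable borel"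
    using F(1) G(1) unfolding F'_def[abs_def] G'_def[abs_def] by measurable
  have i: "integrable lborel (\<lambda>z. (norm (F' z))\<^sup>2)" "integrable lborel (\<lambda>z. (norm (G' z))\<^sup>2)"
    using F(3) G(3) lborel2_swap(1)[of "\<lambda>z. (norm (F z))\<^sup>2"] lborel2_swap(1)[of "\<lambda>z. (norm (G z))\<^sup>2"] by (simp_all add: F'_def G'_def)
  have weak: "(LINT z|lborel. (f' (fst z) * g (snd z)) *\<^sub>R F' z) = - (LINT z|lborel. (f (fst z) * g (snd z)) *\<^sub>R G' z)"
    if h: "0 < a'" "b' < 1" and "- (real n + 1) < c'" "d' < real n + 1" and h': "\<And>x. (f has_real_derivative f' x) (at x)" "smooth f" "smooth g"
        "\<And>x. \<not> (a' < x \<and> x < b') \<Longrightarrow> f x = 0" "\<And>x. \<not> (c' < x \<and> x < d') \<Longrightarrow> g x = 0" for n f f' g a' b' c' d'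
  proof -
    note h = h h'

    obtain g' where g': "\<And>x. (g has_real_derivative g' x) (at x)" using smooth_derivE[OF h(5)] by blast
    obtain f'' where f'': "\<And>x. (f has_real_derivative f'' x) (at x)" "smooth f''" using smooth_derivE[OF h(4)] by blast
    have "f'' = f'" using DERIV_unique[OF f''(1) h(3)] by blast
    then have [measurable]: "f' \<in> borel_measurable borel" "f \<in> borel_measurable borel" "g \<in> borel_measurable borel"
      using f''(2) h(4,5) by (auto intro!: borel_measurable_continuous_onI smooth_continuous)
    have tf: "(\<lambda>z. g (fst z) * f (snd z)) \<in> test_functions"
      by (rule product_test_function[OF h(5,4,1,2,7,6)])
    have "(LINT z|lborel. (g (fst z) * f' (snd z)) *\<^sub>R F z) = - (LINT z|lborel. (g (fst z) * f (snd z)) *\<^sub>R G z)"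
      using w[unfolded lborel_weak_partial_def, THEN bspec, OF tf]
      by (simp add: frechet_derivative_product_fun[of g g' f f', OF g' h(3)])
    moreover have "(LINT z|lborel. (f' (fst z) * g (snd z)) *\<^sub>R F' z) = (LINT z|lborel. (g (fst z) * f' (snd z)) *\<^sub>R F z)"
      using lborel2_swap(2)[of "\<lambda>z. (g (fst z) * f' (snd z)) *\<^sub>R F z"] F(1) by (simp add: F'_def mult.commute)
    moreover have "(LINT z|lborel. (f (fst z) * g (snd z)) *\<^sub>R G' z) = (LINT z|lborel. (g (fst z) * f (snd z)) *\<^sub>R G z)"
      using lborel2_swap(2)[of "\<lambda>z. (g (fst z) * f (snd z)) *\<^sub>R G z"] G(1) by (simp add: G'_def mult.commute)
    ultimately show ?thesis by simp
  qed
  obtain V where V: "V \<in> borel_measurable borel"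
    "AE t in lborel. t \<in> (\<Union>n. {- (real n + 1)<..<real n + 1}) \<longrightarrow> (AE s in lborel. s \<in> (\<Union>n::nat. {0<..<1}) \<longrightarrow> V (s, t) = F' (s, t))"
    "AE t in lborel. \<forall>x y. x \<le> y \<longrightarrow> set_integrable lborel {x<..y} (\<lambda>r. G' (r, t)) \<and>
        V (y, t) = V (x, t) + (LINT r:{x<..y}|lborel. G' (r, t))"
    by (rule AC_representative[OF m i, where c="\<lambda>n. - (real n + 1)" and d="\<lambda>n. real n + 1" and a="\<lambda>n. 0" and b="\<lambda>n. 1", OF _ _ _ _ weak])
       auto
  have U: "(\<Union>n. {- (real n + 1)<..<real n + 1}) = UNIV"
  proof -
    have "\<exists>n. - (real n + 1) < x \<and> x < real n + 1" for x
    proof -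
      obtain n where "\<bar>x\<bar> < real n" using reals_Archimedean2 by blast
      then show ?thesis by (intro exI[of _ n]) linarith
    qed
    then show ?thesis by auto
  qed
  define W where "W z = V (snd z, fst z)" for z
  have Wm[measurable]: "W \<in> borel_measurable borel" unfolding W_def[abs_def] using V(1) by measurable
  have p: "Measurable.pred borel (\<lambda>z. z \<in> strip \<longrightarrow> W z = F z)" using F(1) by measurable
  have "AE z in lborel. z \<in> strip \<longrightarrow> W z = F z"
    unfolding lborel2_AE(2)[OF p] using V(2)
  proof eventually_elim
    case (elim s)
    then have "AE t in lborel. t \<in> {0<..<1} \<longrightarrow> V (t, s) = F' (t, s)" unfolding U by simp
    then show ?case using AE_lborel_singleton[of 0] AE_lborel_singleton[of 1]
      by eventually_elim (auto simp: strip_def W_def F'_def)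
  qed
  moreover have "AE s in lborel. indefinite_integral_of (\<lambda>t. G (s, t)) (\<lambda>t. W (s, t))"
    using V(3) unfolding indefinite_integral_of_def W_def G'_def by simp
  ultimately show ?thesis using that[OF Wm] by simp
qed

lemma indefinite_integral_of_zero:
  fixes g :: "real \<Rightarrow> complex"
  assumes "indefinite_integral_of g (\<lambda>_. 0)"
  shows "AE x in lborel. g x = 0"
proof -
  have "AE x in lborel. x \<in> {- real n<..<real n} \<longrightarrow> g x = 0" for n :: nat
  proof -
    have i: "integrable lborel (\<lambda>x. indicator {- real n<..real n} x *\<^sub>R g x)"
      using indefinite_integral_ofD(1)[OF assms, of "- real n" "real n"] by (simp add: set_integrable_def)
    have "AE x in lborel. x \<in> {- real n<..<real n} \<longrightarrow> indicator {- real n<..real n} x *\<^sub>R g x = 0"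
    proof (rule AE_zero_of_interval_integrals[OF i])
      fix x y assume xy: "- real n < x" "x < y" "y < real n"
      have "(LINT t:{x<..<y}|lborel. indicator {- real n<..real n} t *\<^sub>R g t) = (LINT t:{x<..y}|lborel. g t)"
        unfolding set_lebesgue_integral_def
      proof (rule integral_cong_AE)
        show "AE t in lborel. indicator {x<..<y} t *\<^sub>R indicator {- real n<..real n} t *\<^sub>R g t = indicator {x<..y} t *\<^sub>R g t"
          using AE_lborel_singleton[of y] by eventually_elim (use xy in \<open>auto simp: indicator_def\<close>)
        show "(\<lambda>t. indicator {x<..<y} t *\<^sub>R indicator {- real n<..real n} t *\<^sub>R g t) \<in> borel_measurable lborel"
          using borel_measurable_integrable[OF i] by measurable
        show "(\<lambda>t. indicator {x<..y} t *\<^sub>R g t) \<in> borel_measurable lborel"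
          using indefinite_integral_ofD(1)[OF assms, of x y] xy by (auto simp: set_integrable_def)
      qed
      then show "(LINT t:{x<..<y}|lborel. indicator {- real n<..real n} t *\<^sub>R g t) = 0"
        using indefinite_integral_ofD(2)[OF assms, of x y] xy by simp
    qed
    then show ?thesis by eventually_elim auto
  qed
  then have "AE x in lborel. \<forall>n::nat. x \<in> {- real n<..<real n} \<longrightarrow> g x = 0" unfolding AE_all_countable by blast
  then show ?thesis
  proof eventually_elim
    case (elim x)
    obtain n where "\<bar>x\<bar> < real n" using reals_Archimedean2 by blast
    then have "x \<in> {- real n<..<real n}" by auto
    then show ?case using elim by blast
  qed
qed

lemma indefinite_integral_of_AE_zero:
  fixes g v :: "real \<Rightarrow> complex"
  assumes "indefinite_integral_of g v" "AE x in lborel. x \<in> {a<..<b} \<longrightarrow> v x = 0" "x \<in> {a<..<b}"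
  shows "v x = 0"
  by (rule continuous_AE_zero_imp_zero[OF indefinite_integral_of_continuous[OF assms(1)] assms(2,3)])

text \<open>The difference of two weak derivatives is a weak derivative of zero. On almost every
  line its primitive is continuous and zero almost everywhere inside the strip, hence zero, and so
  is its density. This is what makes the choice in \<open>weak_partial\<close> harmless.\<close>

lemma weak_partial_unique:
  assumes F: "F \<in> borel_measurable borel" "\<And>z. z \<notin> strip \<Longrightarrow> F z = 0" "integrable lborel (\<lambda>z. (norm (F z))\<^sup>2)"
    and G: "G \<in> borel_measurable borel" "\<And>z. z \<notin> strip \<Longrightarrow> G z = 0" "integrable lborel (\<lambda>z. (norm (G z))\<^sup>2)"
    and G': "G' \<in> borel_measurable borel" "\<And>z. z \<notin> strip \<Longrightarrow> G' z = 0" "integrable lborel (\<lambda>z. (norm (G' z))\<^sup>2)"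
    and w: "lborel_weak_partial F v G" "lborel_weak_partial F v G'" and v: "v = (1,0) \<or> v = (0,1)"
  shows "AE z in lborel. G z = G' z"
proof -
  define D where "D z = G z - G' z" for z
  have Dm[measurable]: "D \<in> borel_measurable borel" unfolding D_def[abs_def] using G(1) G'(1) by measurable
  have D: "\<And>z. z \<notin> strip \<Longrightarrow> D z = 0" "integrable lborel (\<lambda>z. (norm (D z))\<^sup>2)"
    unfolding D_def using G G' square_integrable_diff[of G lborel G'] by auto
  have wD: "lborel_weak_partial (\<lambda>z. 0) v D"
    using lborel_weak_partial_diff[OF w F(1,3) G(1,3) F(1,3) G'(1,3)] by (simp add: D_def[abs_def])
  have p: "Measurable.pred borel (\<lambda>z. D z = 0)" by measurable
  have "AE z in lborel. D z = 0"
    using v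
  proof
    assume v: "v = (1,0)"
    obtain V where V: "V \<in> borel_measurable borel" "AE z in lborel. V z = 0"
      "AE t in lborel. indefinite_integral_of (\<lambda>s. D (s, t)) (\<lambda>s. V (s, t))"
      by (rule weak_partial_x_slices[of "\<lambda>_. 0" D, OF _ _ _ Dm D wD[unfolded v]]) auto
    show ?thesis unfolding lborel2_AE(1)[OF p] using V(3) lborel2_AE_slices(1)[OF V(2)]
    proof eventually_elim
      case (elim t)
      have "V (s, t) = 0" for s
        by (rule indefinite_integral_of_AE_zero[OF elim(1), of "s - 1" "s + 1"]) (use elim(2) in auto)
      then show ?case using elim(1) indefinite_integral_of_zero[of "\<lambda>s. D (s,t)"] by simp
    qed
  next
    assume v: "v = (0,1)"
    obtain V where V: "V \<in> borel_measurable borel" "AE z in lborel. z \<in> strip \<longrightarrow> V z = 0"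
      "AE s in lborel. indefinite_integral_of (\<lambda>t. D (s, t)) (\<lambda>t. V (s, t))"
      by (rule weak_partial_y_slices[of "\<lambda>_. 0" D, OF _ _ _ Dm D wD[unfolded v]]) auto
    show ?thesis unfolding lborel2_AE(2)[OF p] using V(3) lborel2_AE_slices(2)[OF V(2)]
    proof eventually_elim
      case (elim s)
      have "D (s, t) = 0" if "t \<notin> {0..1}" for t using D(1) that by (simp add: strip_def)
      then have D0: "(LINT r:{x<..y}|lborel. D (s, r)) = 0" if "{x<..y} \<inter> {0..1} = {}" for x y
        unfolding set_lebesgue_integral_def
      proof (intro integral_eq_zero_AE AE_I2)
        fix r show "indicator {x<..y} r *\<^sub>R D (s, r) = 0"
        proof (cases "r \<in> {x<..y}")
          case True
          then have "r \<notin> {0..1}" using that by blast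
          then show ?thesis using D(1)[of "(s, r)"] by (simp add: strip_def)
        qed simp
      qed
      have V01: "V (s, t) = 0" if "t \<in> {0<..<1}" for t
        by (rule indefinite_integral_of_AE_zero[OF elim(1) _ that]) (use elim(2) in \<open>auto simp: strip_def elim: eventually_mono\<close>)
      have cont: "continuous_on UNIV (\<lambda>t. V (s, t))" by (rule indefinite_integral_of_continuous[OF elim(1)])
      \<comment> \<open>The slice identity gives zeros in the open interval; continuity adds the
        endpoints, from which \<open>V\<close> continues with zero increments.\<close>
      have V0: "V (s, t) = 0" if "t \<in> {0..1}" for t
      proof -
        have "closure {0<..<1::real} = {0..1}" by simp
        moreover have "closed ((\<lambda>t. V (s, t)) -` {0})" by (rule closed_vimage[OF closed_singleton cont])
        moreover have "{0<..<1} \<subseteq> (\<lambda>t. V (s, t)) -` {0}" using V01 by blast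
        ultimately have "{0..1} \<subseteq> (\<lambda>t. V (s, t)) -` {0}" using closure_minimal[of "{0<..<1::real}"] by metis
        then show ?thesis using that by blast
      qed
      have "V (s, t) = 0" for t
      proof -
        consider "t < 0" | "t \<in> {0..1}" | "t > 1" by fastforce
        then show ?thesis
        proof cases
          case 1
          have "(LINT r:{t<..0}|lborel. D (s, r)) = 0"
            unfolding set_lebesgue_integral_def
          proof (rule integral_eq_zero_AE)
            show "AE r in lborel. indicator {t<..0} r *\<^sub>R D (s, r) = 0"
              using AE_lborel_singleton[of 0] by eventually_elim (use D(1) in \<open>auto simp: strip_def indicator_def\<close>)
          qed
          then show ?thesis using indefinite_integral_ofD(2)[OF elim(1), of t 0] V0[of 0] 1 by simp
        next
          case 3
          have "{1<..t} \<inter> {0..1} = {}" by auto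
          then show ?thesis using indefinite_integral_ofD(2)[OF elim(1), of 1 t] V0[of 1] D0[of 1 t] 3 by simp
        qed (rule V0)
      qed
      then show ?case using elim(1) indefinite_integral_of_zero[of "\<lambda>t. D (s,t)"] by simp
    qed
  qed
  then show ?thesis by (auto simp: D_def)
qed

text \<open>The representatives are Borel, defined on the whole plane and zero outside the strip, so that all
  integrals can be taken with respect to \<open>lborel\<close>.\<close>

definition H1_rep ::
  "(real \<times> real \<Rightarrow> complex) \<Rightarrow> (real \<times> real \<Rightarrow> complex) \<Rightarrow> (real \<times> real \<Rightarrow> complex) \<Rightarrow> (real \<times> real \<Rightarrow> complex) \<Rightarrow> bool" where
  "H1_rep u U G H \<longleftrightarrow> u \<in> borel_measurable (lebesgue_on strip) \<and> (AE z in lebesgue_on strip. u z = U z) \<and>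
    (\<forall>F\<in>{U, G, H}. F \<in> borel_measurable borel \<and> (\<forall>z. z \<notin> strip \<longrightarrow> F z = 0) \<and> integrable lborel (\<lambda>z. (norm (F z))\<^sup>2)) \<and>
    lborel_weak_partial U (1, 0) G \<and> lborel_weak_partial U (0, 1) H"

lemma H1_repD:
  assumes "H1_rep u U G H"
  shows "u \<in> borel_measurable (lebesgue_on strip)" "AE z in lebesgue_on strip. u z = U z"
    "U \<in> borel_measurable borel" "\<And>z. z \<notin> strip \<Longrightarrow> U z = 0" "integrable lborel (\<lambda>z. (norm (U z))\<^sup>2)"
    "G \<in> borel_measurable borel" "\<And>z. z \<notin> strip \<Longrightarrow> G z = 0" "integrable lborel (\<lambda>z. (norm (G z))\<^sup>2)"
    "H \<in> borel_measurable borel" "\<And>z. z \<notin> strip \<Longrightarrow> H z = 0" "integrable lborel (\<lambda>z. (norm (H z))\<^sup>2)"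
    "lborel_weak_partial U (1, 0) G" "lborel_weak_partial U (0, 1) H"
  using assms unfolding H1_rep_def by blast+

lemma H1_rep_exists:
  assumes "u \<in> H1"
  obtains U G H where "H1_rep u U G H"
proof -
  from assms obtain g h where u: "u \<in> Ltwo (lebesgue_on strip)" and g: "g \<in> Ltwo (lebesgue_on strip)" "has_weak_partial u (1, 0) g"
    and h: "h \<in> Ltwo (lebesgue_on strip)" "has_weak_partial u (0, 1) h"
    unfolding H1_def by blast
  obtain U where U: "U \<in> borel_measurable borel" "\<And>z. z \<notin> strip \<Longrightarrow> U z = 0" "AE z in lebesgue_on strip. u z = U z" "integrable lborel (\<lambda>z. (norm (U z))\<^sup>2)"
    by (rule Ltwo_representative[OF strip_borel u]) blast
  obtain G where G: "G \<in> borel_measurable borel" "\<And>z. z \<notin> strip \<Longrightarrow> G z = 0" "AE z in lebesgue_on strip. g z = G z" "integrable lborel (\<lambda>z. (norm (G z))\<^sup>2)"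
    by (rule Ltwo_representative[OF strip_borel g(1)]) blast
  obtain H where H: "H \<in> borel_measurable borel" "\<And>z. z \<notin> strip \<Longrightarrow> H z = 0" "AE z in lebesgue_on strip. h z = H z" "integrable lborel (\<lambda>z. (norm (H z))\<^sup>2)"
    by (rule Ltwo_representative[OF strip_borel h(1)]) blast
  have m: "u \<in> borel_measurable (lebesgue_on strip)" "g \<in> borel_measurable (lebesgue_on strip)" "h \<in> borel_measurable (lebesgue_on strip)"
    using u g(1) h(1) by (simp_all add: Ltwo_def)
  have "lborel_weak_partial U (1, 0) G" "lborel_weak_partial U (0, 1) H"
    using has_weak_partial_iff[OF m(1) U(1,2,3) m(2) G(1,2,3)] has_weak_partial_iff[OF m(1) U(1,2,3) m(3) H(1,2,3)] g(2) h(2) by auto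
  then have "H1_rep u U G H" unfolding H1_rep_def using m U G H by blast
  then show ?thesis by (rule that)
qed

text \<open>Links the \<open>SOME\<close> in \<open>weak_partial\<close> to the representatives:
  whichever function is selected agrees with them almost everywhere by uniqueness.\<close>

lemma H1_rep_weak_partial:
  assumes r: "H1_rep u U G H"
  shows "u \<in> H1" "weak_partial (1,0) u \<in> Ltwo (lebesgue_on strip)" "weak_partial (0,1) u \<in> Ltwo (lebesgue_on strip)"
    "AE z in lebesgue_on strip. weak_partial (1,0) u z = G z" "AE z in lebesgue_on strip. weak_partial (0,1) u z = H z"
proof -
  note R = H1_repD[OF r]
  have L: "G \<in> Ltwo (lebesgue_on strip)" "H \<in> Ltwo (lebesgue_on strip)"
    using Ltwo_of_representative[OF strip_borel R(6,7,8)] Ltwo_of_representative[OF strip_borel R(9,10,11)] by auto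
  then have m: "G \<in> borel_measurable (lebesgue_on strip)" "H \<in> borel_measurable (lebesgue_on strip)" by (simp_all add: Ltwo_def)
  have hw: "has_weak_partial u (1,0) G" "has_weak_partial u (0,1) H"
    using has_weak_partial_iff[OF R(1,3,4,2) m(1) R(6,7)] has_weak_partial_iff[OF R(1,3,4,2) m(2) R(9,10)] R(12,13) by auto
  have "integrable (lebesgue_on strip) (\<lambda>z. (norm (u z))\<^sup>2)"
  proof (subst integral_of_representative(2)[OF strip_borel])
    show "(\<lambda>z. (norm (u z))\<^sup>2) \<in> borel_measurable (lebesgue_on strip)" using R(1) by measurable
    show "(\<lambda>z. (norm (U z))\<^sup>2) \<in> borel_measurable borel" using R(3) by measurable
    show "AE z in lebesgue_on strip. (norm (u z))\<^sup>2 = (norm (U z))\<^sup>2" using R(2) by eventually_elim simp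
  qed (use R(4,5) in auto)
  then show "u \<in> H1" using L hw R(1) unfolding H1_def Ltwo_def by blast
  have P: "weak_partial v u \<in> Ltwo (lebesgue_on strip) \<and> has_weak_partial u v (weak_partial v u)"
    if "g \<in> Ltwo (lebesgue_on strip)" "has_weak_partial u v g" for v g
    unfolding weak_partial_def by (rule someI[of _ g]) (use that in blast)
  show l: "weak_partial (1,0) u \<in> Ltwo (lebesgue_on strip)" "weak_partial (0,1) u \<in> Ltwo (lebesgue_on strip)"
    using P[OF L(1) hw(1)] P[OF L(2) hw(2)] by auto
  have uniq: "AE z in lebesgue_on strip. weak_partial v u z = K z"
    if v: "v = (1,0) \<or> v = (0,1)" and K: "K \<in> borel_measurable borel" "\<And>z. z \<notin> strip \<Longrightarrow> K z = 0" "integrable lborel (\<lambda>z. (norm (K z))\<^sup>2)"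
      "lborel_weak_partial U v K" and w: "weak_partial v u \<in> Ltwo (lebesgue_on strip)" "has_weak_partial u v (weak_partial v u)" for v K
  proof -
    obtain W where W: "W \<in> borel_measurable borel" "\<And>z. z \<notin> strip \<Longrightarrow> W z = 0" "AE z in lebesgue_on strip. weak_partial v u z = W z" "integrable lborel (\<lambda>z. (norm (W z))\<^sup>2)"
      by (rule Ltwo_representative[OF strip_borel w(1)]) blast
    have "weak_partial v u \<in> borel_measurable (lebesgue_on strip)" using w(1) by (simp add: Ltwo_def)
    then have wk: "lborel_weak_partial U v W"
      using has_weak_partial_iff[OF R(1,3,4,2) _ W(1,2,3)] w(2) by auto
    have "AE z in lborel. W z = K z"
      by (rule weak_partial_unique[OF R(3,4,5) W(1,2,4) K(1,2,3) wk K(4) v])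
    then have "AE z in lebesgue_on strip. W z = K z" unfolding AE_lebesgue_on_iff[OF strip_borel] by eventually_elim simp
    with W(3) show ?thesis by eventually_elim simp
  qed
  show "AE z in lebesgue_on strip. weak_partial (1,0) u z = G z"
    by (rule uniq[OF _ R(6,7,8) R(12)]) (use P[OF L(1) hw(1)] in auto)
  show "AE z in lebesgue_on strip. weak_partial (0,1) u z = H z"
    by (rule uniq[OF _ R(9,10,11) R(13)]) (use P[OF L(2) hw(2)] in auto)
qed

lemma H1_rep_norm:
  assumes r: "H1_rep u U G H"
  shows "(Ltwo_norm (lebesgue_on strip) u)\<^sup>2 = (LINT z|lborel. (norm (U z))\<^sup>2)"
    "(H1_norm u)\<^sup>2 = (LINT z|lborel. (norm (U z))\<^sup>2) + (LINT z|lborel. (norm (G z))\<^sup>2) + (LINT z|lborel. (norm (H z))\<^sup>2)"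
proof -
  note R = H1_repD[OF r] and W = H1_rep_weak_partial[OF r]
  have m: "weak_partial (1,0) u \<in> borel_measurable (lebesgue_on strip)" "weak_partial (0,1) u \<in> borel_measurable (lebesgue_on strip)"
    using W(2,3) by (simp_all add: Ltwo_def)
  show *: "(Ltwo_norm (lebesgue_on strip) u)\<^sup>2 = (LINT z|lborel. (norm (U z))\<^sup>2)"
    by (rule Ltwo_norm_representative[OF strip_borel R(1,3,4,2)])
  show "(H1_norm u)\<^sup>2 = (LINT z|lborel. (norm (U z))\<^sup>2) + (LINT z|lborel. (norm (G z))\<^sup>2) + (LINT z|lborel. (norm (H z))\<^sup>2)"
    unfolding H1_norm_def using * Ltwo_norm_representative[OF strip_borel m(1) R(6,7) W(4)] Ltwo_norm_representative[OF strip_borel m(2) R(9,10) W(5)]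
    by (simp add: real_sqrt_pow2)
qed

lemma H1_rep_diff:
  assumes r: "H1_rep u U G H" and r': "H1_rep u' U' G' H'"
  shows "H1_rep (\<lambda>z. u z - u' z) (\<lambda>z. U z - U' z) (\<lambda>z. G z - G' z) (\<lambda>z. H z - H' z)"
proof -
  note R = H1_repD[OF r] and R' = H1_repD[OF r']
  have "(\<lambda>z. u z - u' z) \<in> borel_measurable (lebesgue_on strip)" using R(1) R'(1) by measurable
  moreover have "AE z in lebesgue_on strip. u z - u' z = U z - U' z" using R(2) R'(2) by eventually_elim simp
  moreover have "(\<lambda>z. U z - U' z) \<in> borel_measurable borel" using R(3) R'(3) by measurable
  moreover have "(\<lambda>z. G z - G' z) \<in> borel_measurable borel" using R(6) R'(6) by measurable
  moreover have "(\<lambda>z. H z - H' z) \<in> borel_measurable borel" using R(9) R'(9) by measurable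
  moreover have "integrable lborel (\<lambda>z. (norm (U z - U' z))\<^sup>2)" "integrable lborel (\<lambda>z. (norm (G z - G' z))\<^sup>2)" "integrable lborel (\<lambda>z. (norm (H z - H' z))\<^sup>2)"
    using R R' by (simp_all add: square_integrable_diff)
  ultimately show ?thesis
    unfolding H1_rep_def
    using R(4,7,10) R'(4,7,10) lborel_weak_partial_diff[OF R(12) R'(12) R(3,5) R(6,8) R'(3,5) R'(6,8)]
      lborel_weak_partial_diff[OF R(13) R'(13) R(3,5) R(9,11) R'(3,5) R'(9,11)] by simp
qed

section \<open>Horizontal averages and the trace\<close>

text \<open>The bound on the norms keeps mass from being lost in the limit: by Scheffe's lemma the
  squared norms converge in mean. Up to twice that error the squared difference is dominated by
  \<open>4 * (norm (g x))\<^sup>2\<close>, and dominated convergence handles the truncated part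
  \<open>h\<close>. The lemma serves both for averages and for the minimizers, whose mass equals
  that of their limit.\<close>

lemma L2_Scheffe:
  fixes f :: "nat \<Rightarrow> 'a \<Rightarrow> 'b::{banach, second_countable_topology}"
  assumes m[measurable]: "\<And>n. f n \<in> borel_measurable M" "g \<in> borel_measurable M"
    and i: "\<And>n. integrable M (\<lambda>x. (norm (f n x))\<^sup>2)" "integrable M (\<lambda>x. (norm (g x))\<^sup>2)"
    and l: "AE x in M. (\<lambda>n. f n x) \<longlonglongrightarrow> g x"
    and le: "\<And>n. (LINT x|M. (norm (f n x))\<^sup>2) \<le> (LINT x|M. (norm (g x))\<^sup>2)"
  shows "(\<lambda>n. LINT x|M. (norm (f n x - g x))\<^sup>2) \<longlonglongrightarrow> 0"
proof -
  have nn: "(\<integral>\<^sup>+ x. norm ((norm (f n x))\<^sup>2) \<partial>M) \<le> (\<integral>\<^sup>+ x. norm ((norm (g x))\<^sup>2) \<partial>M)" for n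
    using i le[of n] by (simp add: nn_integral_eq_integral ennreal_leI)
  have "(\<lambda>n. \<integral>\<^sup>+ x. norm ((norm (f n x))\<^sup>2 - (norm (g x))\<^sup>2) \<partial>M) \<longlonglongrightarrow> 0"
  proof (rule Scheffe_lemma2[OF _ i(2) _ nn])
    show "AE x in M. (\<lambda>n. (norm (f n x))\<^sup>2) \<longlonglongrightarrow> (norm (g x))\<^sup>2"
      using l by eventually_elim (intro tendsto_intros)
  qed measurable
  moreover have ib: "integrable M (\<lambda>x. \<bar>(norm (f n x))\<^sup>2 - (norm (g x))\<^sup>2\<bar>)" for n using i by auto
  ultimately have A: "(\<lambda>n. LINT x|M. \<bar>(norm (f n x))\<^sup>2 - (norm (g x))\<^sup>2\<bar>) \<longlonglongrightarrow> 0"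
    by (simp add: nn_integral_eq_integral ennreal_tendsto_0_iff)
  define h where "h n x = min ((norm (f n x - g x))\<^sup>2) (4 * (norm (g x))\<^sup>2)" for n x
  have ih: "integrable M (h n)" for n
    by (rule Bochner_Integration.integrable_bound[of _ "\<lambda>x. 4 * (norm (g x))\<^sup>2"]) (use i in \<open>auto simp: h_def[abs_def]\<close>)
  have B: "(\<lambda>n. LINT x|M. h n x) \<longlonglongrightarrow> (LINT x|M. 0)"
  proof (rule integral_dominated_convergence[where w="\<lambda>x. 4 * (norm (g x))\<^sup>2"])
    show "AE x in M. (\<lambda>n. h n x) \<longlonglongrightarrow> 0"
      using l
    proof eventually_elim
      case (elim x)
      have "(\<lambda>n. min ((norm (f n x - g x))\<^sup>2) (4 * (norm (g x))\<^sup>2)) \<longlonglongrightarrow> min ((norm (g x - g x))\<^sup>2) (4 * (norm (g x))\<^sup>2)"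
        using elim by (intro tendsto_intros)
      then show ?case by (simp add: h_def)
    qed
  qed (use i in \<open>auto simp: h_def[abs_def]\<close>)
  have C: "(\<lambda>n. (LINT x|M. h n x) + 2 * (LINT x|M. \<bar>(norm (f n x))\<^sup>2 - (norm (g x))\<^sup>2\<bar>)) \<longlonglongrightarrow> 0"
    using tendsto_add[OF B tendsto_mult[OF tendsto_const A]] by simp
  have "(LINT x|M. (norm (f n x - g x))\<^sup>2) \<le> (LINT x|M. h n x) + 2 * (LINT x|M. \<bar>(norm (f n x))\<^sup>2 - (norm (g x))\<^sup>2\<bar>)" for n
  proof -
    have "(LINT x|M. (norm (f n x - g x))\<^sup>2) \<le> (LINT x|M. h n x + 2 * \<bar>(norm (f n x))\<^sup>2 - (norm (g x))\<^sup>2\<bar>)"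
    proof (rule integral_mono)
      show "integrable M (\<lambda>x. (norm (f n x - g x))\<^sup>2)" using i by (intro square_integrable_diff) auto
      show "integrable M (\<lambda>x. h n x + 2 * \<bar>(norm (f n x))\<^sup>2 - (norm (g x))\<^sup>2\<bar>)" using ih ib by auto
      show "(norm (f n x - g x))\<^sup>2 \<le> h n x + 2 * \<bar>(norm (f n x))\<^sup>2 - (norm (g x))\<^sup>2\<bar>" for x
      proof -
        have "a \<le> min a (4 * q) + 2 * \<bar>p - q\<bar>" if "a \<le> 2 * p + 2 * q" for a p q :: real
          using that unfolding min_def by (simp add: abs_if)
        then show ?thesis using norm_diff_square_le[of "f n x" "g x"] unfolding h_def by blast
      qed
    qed
    then show ?thesis using ih ib by simp
  qed
  then show ?thesis
    by (intro tendsto_sandwich[OF _ _ tendsto_const C] always_eventually allI) (auto intro: Bochner_Integration.integral_nonneg)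
qed

text \<open>For \<open>h > 0\<close> the mean over a horizontal segment of length \<open>h\<close>.
  Averaging in x alone preserves the strip, so it commutes with both weak derivatives and requires
  no extension across the boundary lines.\<close>

definition x_average :: "real \<Rightarrow> (real \<times> real \<Rightarrow> complex) \<Rightarrow> real \<times> real \<Rightarrow> complex" where
  "x_average h f z = (LINT r:{0<..<1}|lborel. f (fst z + h * r, snd z))"

lemma x_average_measurable [measurable]:
  assumes [measurable]: "f \<in> borel_measurable borel"
  shows "x_average h f \<in> borel_measurable borel"
proof -
  have "(\<lambda>w. indicator {0<..<1} (snd w) *\<^sub>R f (fst (fst w) + h * snd w, snd (fst w))) \<in> borel_measurable ((borel :: (real\<times>real) measure) \<Otimes>\<^sub>M lborel)"
    by measurable
  then show ?thesis
    unfolding x_average_def[abs_def] set_lebesgue_integral_def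
    using lborel.borel_measurable_lebesgue_integral[of "\<lambda>z r. indicator {0<..<1} r *\<^sub>R f (fst z + h * r, snd z)" borel] by (simp add: case_prod_unfold)
qed

lemma integral_square_le:
  fixes f :: "real \<Rightarrow> real"
  assumes "set_integrable lborel {0<..<1} f" "set_integrable lborel {0<..<1} (\<lambda>r. (f r)\<^sup>2)"
  shows "(LINT r:{0<..<1}|lborel. f r)\<^sup>2 \<le> (LINT r:{0<..<1}|lborel. (f r)\<^sup>2)"
proof -
  define c where "c = (LINT r:{0<..<1}|lborel. f r)"
  have k: "set_integrable lborel {0<..<1::real} (\<lambda>r. c\<^sup>2)" by (simp add: set_integrable_def)
  have "0 \<le> (LINT r:{0<..<1}|lborel. (f r - c)\<^sup>2)"
    unfolding set_lebesgue_integral_def by (intro Bochner_Integration.integral_nonneg) auto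
  also have "\<dots> = (LINT r:{0<..<1}|lborel. ((f r)\<^sup>2 - (2 * c) * f r) + c\<^sup>2)"
    by (intro set_lebesgue_integral_cong) (auto simp: power2_diff algebra_simps)
  also have "\<dots> = (LINT r:{0<..<1}|lborel. (f r)\<^sup>2) - 2 * c * (LINT r:{0<..<1}|lborel. f r) + (LINT r:{0<..<1::real}|lborel. c\<^sup>2)"
    using assms k by (simp add: set_integral_add set_integral_diff)
  also have "(LINT r:{0<..<1::real}|lborel. c\<^sup>2) = c\<^sup>2" by (simp add: set_lebesgue_integral_def)
  finally show ?thesis unfolding c_def by (simp add: power2_eq_square)
qed

lemma nn_integral_shift:
  fixes f :: "'a::euclidean_space \<Rightarrow> ennreal"
  assumes [measurable]: "f \<in> borel_measurable borel"
  shows "(\<integral>\<^sup>+z. f (z + c) \<partial>lborel) = (\<integral>\<^sup>+z. f z \<partial>lborel)"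
  by (subst (2) lborel_distr_plus[of c, symmetric], subst nn_integral_distr) (auto simp: add.commute)

lemma integral_shift:
  fixes f :: "'a::euclidean_space \<Rightarrow> 'b::{banach, second_countable_topology}"
  assumes [measurable]: "f \<in> borel_measurable borel"
  shows "(LINT z|lborel. f (z + c)) = (LINT z|lborel. f z)" "integrable lborel (\<lambda>z. f (z + c)) \<longleftrightarrow> integrable lborel f"
proof -
  show "(LINT z|lborel. f (z + c)) = (LINT z|lborel. f z)"
    by (subst (2) lborel_distr_plus[of c, symmetric], subst integral_distr) (auto simp: add.commute)
  show "integrable lborel (\<lambda>z. f (z + c)) \<longleftrightarrow> integrable lborel f"
    by (subst (2) lborel_distr_plus[of c, symmetric], subst integrable_distr_eq) (auto simp: add.commute)
qed

text \<open>Jensen's inequality for the mean over \<open>{0<..<1}\<close>. In extended reals it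
  holds at every point, also where the right-hand side is infinite.\<close>

lemma x_average_norm_le:
  assumes [measurable]: "f \<in> borel_measurable borel"
  shows "ennreal ((norm (x_average h f z))\<^sup>2) \<le> (\<integral>\<^sup>+r. indicator {0<..<1} r * ennreal ((norm (f (z + (h * r, 0))))\<^sup>2) \<partial>lborel)"
proof (cases "set_integrable lborel {0<..<1} (\<lambda>r. (norm (f (z + (h * r, 0))))\<^sup>2)")
  case True
  define \<phi> where "\<phi> r = f (z + (h * r, 0))" for r
  have \<phi>m[measurable]: "\<phi> \<in> borel_measurable borel" unfolding \<phi>_def[abs_def] by measurable
  have T: "integrable lborel (\<lambda>r. indicator {0<..<1} r *\<^sub>R (norm (\<phi> r))\<^sup>2)" using True unfolding \<phi>_def set_integrable_def .
  have "integrable lborel (\<lambda>r. (norm (indicator {0<..<1} r *\<^sub>R \<phi> r))\<^sup>2)"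
    by (rule Bochner_Integration.integrable_cong[THEN iffD1, OF refl _ T]) (auto simp: indicator_def)
  then have "set_integrable lborel {0<..<1} (\<lambda>r. indicator {0<..<1} r *\<^sub>R \<phi> r)"
    by (intro square_integrable_imp_set_integrable) auto
  then have "integrable lborel (\<lambda>r. indicator {0<..<1} r *\<^sub>R (indicator {0<..<1::real} r *\<^sub>R \<phi> r))"
    unfolding set_integrable_def .
  then have i1: "set_integrable lborel {0<..<1} \<phi>"
    unfolding set_integrable_def
    by (rule Bochner_Integration.integrable_cong[THEN iffD1, OF refl, rotated]) (auto simp: indicator_def)
  then have i2: "set_integrable lborel {0<..<1} (\<lambda>r. norm (\<phi> r))" by (rule set_integrable_norm)
  have "x_average h f z = (LINT r:{0<..<1}|lborel. \<phi> r)" unfolding x_average_def \<phi>_def by (cases z) simp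
  then have "norm (x_average h f z) \<le> (LINT r:{0<..<1}|lborel. norm (\<phi> r))" using set_integral_norm_bound[OF i1] by simp
  then have "(norm (x_average h f z))\<^sup>2 \<le> (LINT r:{0<..<1}|lborel. norm (\<phi> r))\<^sup>2" by (intro power_mono) auto
  also have "\<dots> \<le> (LINT r:{0<..<1}|lborel. (norm (\<phi> r))\<^sup>2)"
    by (rule integral_square_le[OF i2]) (use T in \<open>simp add: set_integrable_def\<close>)
  finally have "ennreal ((norm (x_average h f z))\<^sup>2) \<le> ennreal (LINT r:{0<..<1}|lborel. (norm (\<phi> r))\<^sup>2)" by (rule ennreal_leI)
  also have "\<dots> = (\<integral>\<^sup>+r. ennreal (indicator {0<..<1} r *\<^sub>R (norm (\<phi> r))\<^sup>2) \<partial>lborel)"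
    unfolding set_lebesgue_integral_def using T by (intro nn_integral_eq_integral[symmetric]) auto
  also have "\<dots> = (\<integral>\<^sup>+r. indicator {0<..<1} r * ennreal ((norm (f (z + (h * r, 0))))\<^sup>2) \<partial>lborel)"
    by (intro nn_integral_cong) (auto simp: \<phi>_def indicator_def)
  finally show ?thesis .
next
  case False
  have "(\<integral>\<^sup>+r. indicator {0<..<1} r * ennreal ((norm (f (z + (h * r, 0))))\<^sup>2) \<partial>lborel) = \<infinity>"
  proof (rule ccontr)
    assume "\<not> ?thesis"
    then have "(\<integral>\<^sup>+r. ennreal (norm (indicator {0<..<1} r *\<^sub>R (norm (f (z + (h * r, 0))))\<^sup>2)) \<partial>lborel) < \<infinity>"
      by (simp add: less_top[symmetric] ennreal_mult' ennreal_indicator)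
    then have "integrable lborel (\<lambda>r. indicator {0<..<1} r *\<^sub>R (norm (f (z + (h * r, 0))))\<^sup>2)"
      by (intro integrableI_bounded) auto
    then show False using False by (simp add: set_integrable_def)
  qed
  then show ?thesis by simp
qed

text \<open>Jensen's inequality is integrated by Tonelli; by translation invariance all the
  integrals that are averaged over \<open>r\<close> are equal.\<close>

lemma x_average_L2:
  assumes [measurable]: "f \<in> borel_measurable borel" and i: "integrable lborel (\<lambda>z. (norm (f z))\<^sup>2)"
  shows "integrable lborel (\<lambda>z. (norm (x_average h f z))\<^sup>2)"
    "(LINT z|lborel. (norm (x_average h f z))\<^sup>2) \<le> (LINT z|lborel. (norm (f z))\<^sup>2)"
proof -
  have le: "(\<integral>\<^sup>+z. ennreal ((norm (x_average h f z))\<^sup>2) \<partial>lborel) \<le> ennreal (LINT z|lborel. (norm (f z))\<^sup>2)"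
  proof -
    have "(\<integral>\<^sup>+z. ennreal ((norm (x_average h f z))\<^sup>2) \<partial>lborel) \<le>
        (\<integral>\<^sup>+z. \<integral>\<^sup>+r. indicator {0<..<1} r * ennreal ((norm (f (z + (h * r, 0))))\<^sup>2) \<partial>lborel \<partial>lborel)"
      by (intro nn_integral_mono x_average_norm_le) auto
    also have "\<dots> = (\<integral>\<^sup>+r. \<integral>\<^sup>+z. indicator {0<..<1} r * ennreal ((norm (f (z + (h * r, 0))))\<^sup>2) \<partial>lborel \<partial>lborel)"
    proof -
      have "(\<lambda>w. indicator {0<..<1} (fst w) * ennreal ((norm (f (snd w + (h * fst w, 0))))\<^sup>2)) \<in> borel_measurable (lborel \<Otimes>\<^sub>M lborel)"
        by measurable
      then show ?thesis
        by (intro lborel_pair.Fubini'[symmetric]) (simp add: case_prod_unfold)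
    qed
    also have "\<dots> = (\<integral>\<^sup>+r. indicator {0<..<1::real} r * (\<integral>\<^sup>+z. ennreal ((norm (f z))\<^sup>2) \<partial>lborel) \<partial>lborel)"
      by (intro nn_integral_cong) (simp add: nn_integral_cmult nn_integral_shift[of "\<lambda>z. ennreal ((norm (f z))\<^sup>2)"])
    also have "\<dots> = (\<integral>\<^sup>+z. ennreal ((norm (f z))\<^sup>2) \<partial>lborel)" by (simp add: nn_integral_multc)
    also have "\<dots> = ennreal (LINT z|lborel. (norm (f z))\<^sup>2)" using i by (intro nn_integral_eq_integral) auto
    finally show ?thesis .
  qed
  show ii: "integrable lborel (\<lambda>z. (norm (x_average h f z))\<^sup>2)"
    using le by (intro integrableI_bounded) (auto intro: le_less_trans)
  show "(LINT z|lborel. (norm (x_average h f z))\<^sup>2) \<le> (LINT z|lborel. (norm (f z))\<^sup>2)"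
    using le ennreal_le_iff[of "LINT z|lborel. (norm (f z))\<^sup>2" "LINT z|lborel. (norm (x_average h f z))\<^sup>2"]
    unfolding nn_integral_eq_integral[OF ii AE_I2[OF zero_le_power2]] by (simp add: Bochner_Integration.integral_nonneg)
qed

lemma test_function_shift:
  assumes \<theta>: "\<theta> \<in> test_functions"
  shows "(\<lambda>z. \<theta> (z + (s, 0))) \<in> test_functions"
    "frechet_derivative (\<lambda>z. \<theta> (z + (s, 0))) (at z) v = frechet_derivative \<theta> (at (z + (s, 0))) v"
proof -
  have fd: "frechet_derivative (\<lambda>z. f (z + c)) (at z) = frechet_derivative f (at (z + c))" "(\<lambda>z. f (z + c)) differentiable (at z)"
    if "\<And>z. f differentiable (at z)" for f :: "real \<times> real \<Rightarrow> real" and c z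
  proof -
    have "(f has_derivative frechet_derivative f (at (z + c))) (at (z + c))"
      using that by (simp add: frechet_derivative_works[symmetric])
    then have "((\<lambda>z. f (z + c)) has_derivative frechet_derivative f (at (z + c))) (at z)"
      by (rule has_derivative_compose[rotated]) (auto intro!: derivative_eq_intros)
    then show "frechet_derivative (\<lambda>z. f (z + c)) (at z) = frechet_derivative f (at (z + c))" "(\<lambda>z. f (z + c)) differentiable (at z)"
      by (simp_all add: frechet_derivative_at[symmetric] differentiableI)
  qed
  have t: "times_cont_diff k (\<lambda>z. f (z + c))" if "times_cont_diff k f" for k f and c :: "real \<times> real"
    using that
  proof (induction k arbitrary: f)
    case 0
    then show ?case by (auto intro!: continuous_on_compose2[of UNIV f] continuous_intros)
  next
    case (Suc k)
    have d: "\<And>z. f differentiable (at z)" and n: "\<And>v. times_cont_diff k (\<lambda>z. frechet_derivative f (at z) v)"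
      using Suc.prems unfolding times_cont_diff.simps by blast+
    show ?case unfolding times_cont_diff.simps fd(1)[OF d] using fd(2)[OF d] Suc.IH[OF n] by blast
  qed
  show "frechet_derivative (\<lambda>z. \<theta> (z + (s, 0))) (at z) v = frechet_derivative \<theta> (at (z + (s, 0))) v"
    using fd(1)[of \<theta> "(s,0)" z] test_function_continuous(3)[OF \<theta>] by simp
  obtain K where K: "compact K" "K \<subseteq> UNIV \<times> {0<..<1}" "\<And>z. z \<notin> K \<Longrightarrow> \<theta> z = 0" using \<theta> by (auto simp: test_functions_def)
  have "compact ((\<lambda>z. z - (s,0)) ` K)" by (intro compact_continuous_image continuous_intros K)
  moreover have "(\<lambda>z. z - (s,0)) ` K \<subseteq> UNIV \<times> {0<..<1}" using K(2) by auto
  moreover have "\<theta> (z + (s, 0)) = 0" if "z \<notin> (\<lambda>z. z - (s,0)) ` K" for z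
  proof (rule K(3), rule notI)
    assume "z + (s, 0) \<in> K"
    then have "(z + (s,0)) - (s,0) \<in> (\<lambda>z. z - (s,0)) ` K" by blast
    then show False using that by simp
  qed
  ultimately show "(\<lambda>z. \<theta> (z + (s, 0))) \<in> test_functions"
    using t \<theta> unfolding test_functions_def by blast
qed

text \<open>Fubini and a shift move the averaging onto the weight. Horizontal shifts of test
  functions are again test functions, and this is how averages inherit weak derivatives.\<close>

lemma x_average_weighted:
  fixes \<theta> :: "real \<times> real \<Rightarrow> real"
  assumes \<theta>: "continuous_on UNIV \<theta>" "compact K" "\<And>z. z \<notin> K \<Longrightarrow> \<theta> z = 0"
    and [measurable]: "f \<in> borel_measurable borel" and i: "integrable lborel (\<lambda>z. (norm (f z))\<^sup>2)"
  shows "(LINT z|lborel. \<theta> z *\<^sub>R x_average h f z) = (LINT r:{0<..<1}|lborel. LINT z|lborel. \<theta> (z - (h * r, 0)) *\<^sub>R f z)"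
proof -
  have [measurable]: "\<theta> \<in> borel_measurable borel" using \<theta>(1) by (rule borel_measurable_continuous_onI)
  define \<Psi> where "\<Psi> r z = indicator {0<..<1} r *\<^sub>R (\<theta> z *\<^sub>R f (z + (h * r, 0)))" for r z
  have t2: "integrable lborel (\<lambda>z. (\<theta> z)\<^sup>2)"
  proof -
    have "integrable lborel (\<lambda>z. indicator K z *\<^sub>R (\<theta> z)\<^sup>2)"
      using \<theta>(2) by (intro borel_integrable_compact) (auto intro!: continuous_intros continuous_on_subset[OF \<theta>(1)])
    moreover have "(\<lambda>z. indicator K z *\<^sub>R (\<theta> z)\<^sup>2) = (\<lambda>z. (\<theta> z)\<^sup>2)" using \<theta>(3) by (auto simp: indicator_def fun_eq_iff)
    ultimately show ?thesis by simp
  qed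
  have sf: "integrable lborel (\<lambda>z. (norm (f (z + c)))\<^sup>2)" "(LINT z|lborel. (norm (f (z + c)))\<^sup>2) = (LINT z|lborel. (norm (f z))\<^sup>2)" for c
    using integral_shift[of "\<lambda>z. (norm (f z))\<^sup>2" c] i by auto
  have b: "norm (\<theta> z *\<^sub>R f (z + c)) \<le> (\<theta> z)\<^sup>2 + (norm (f (z + c)))\<^sup>2" for z c
  proof -
    have "2 * \<bar>\<theta> z\<bar> * norm (f (z + c)) \<le> (\<theta> z)\<^sup>2 + (norm (f (z + c)))\<^sup>2" using sum_squares_bound[of "\<bar>\<theta> z\<bar>" "norm (f (z + c))"] by simp
    moreover have "0 \<le> \<bar>\<theta> z\<bar> * norm (f (z + c))" by simp
    ultimately have "\<bar>\<theta> z\<bar> * norm (f (z + c)) \<le> (\<theta> z)\<^sup>2 + (norm (f (z + c)))\<^sup>2" by linarith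
    then show ?thesis by simp
  qed
  have i1: "integrable lborel (\<lambda>z. \<theta> z *\<^sub>R f (z + c))" for c
    by (rule Bochner_Integration.integrable_bound[OF Bochner_Integration.integrable_add[OF t2 sf(1)[of c]]]) (use b in \<open>auto intro: order_trans[OF b]\<close>)
  have pm: "case_prod \<Psi> \<in> borel_measurable (lborel \<Otimes>\<^sub>M lborel)"
    unfolding \<Psi>_def case_prod_unfold by measurable
  have pi: "integrable (lborel \<Otimes>\<^sub>M lborel) (case_prod \<Psi>)"
  proof (rule lborel_pair.Fubini_integrable[OF pm])
    show "AE r in lborel. integrable lborel (\<lambda>z. case_prod \<Psi> (r, z))" unfolding \<Psi>_def case_prod_conv by (intro AE_I2 integrable_scaleR_right i1)
    define B where "B = (LINT z|lborel. (\<theta> z)\<^sup>2) + (LINT z|lborel. (norm (f z))\<^sup>2)"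
    have B: "(LINT z|lborel. norm (\<theta> z *\<^sub>R f (z + c))) \<le> B" for c
    proof -
      have "(LINT z|lborel. norm (\<theta> z *\<^sub>R f (z + c))) \<le> (LINT z|lborel. (\<theta> z)\<^sup>2 + (norm (f (z + c)))\<^sup>2)"
        by (rule integral_mono[OF integrable_norm[OF i1] Bochner_Integration.integrable_add[OF t2 sf(1)] b])
      then show ?thesis using t2 sf[of c] by (simp add: B_def)
    qed
    show "integrable lborel (\<lambda>r. LINT z|lborel. norm (case_prod \<Psi> (r, z)))"
    proof (rule Bochner_Integration.integrable_bound[of _ "\<lambda>r. indicator {0<..<1} r * B"])
      show "(\<lambda>r. LINT z|lborel. norm (case_prod \<Psi> (r, z))) \<in> borel_measurable lborel"
        using pm by measurable
      show "AE r in lborel. norm (LINT z|lborel. norm (case_prod \<Psi> (r, z))) \<le> norm (indicator {0<..<1} r * B)"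
      proof -
        have "(LINT z|lborel. \<bar>\<theta> z\<bar> * norm (f (z + c))) \<le> \<bar>B\<bar>" for c using B[of c] by simp
        then show ?thesis by (intro AE_I2) (auto simp: \<Psi>_def indicator_def Bochner_Integration.integral_nonneg)
      qed
    qed auto
  qed
  have "(LINT z|lborel. \<theta> z *\<^sub>R x_average h f z) = (LINT z|lborel. LINT r|lborel. \<Psi> r z)"
  proof (rule Bochner_Integration.integral_cong[OF refl])
    fix z
    have "\<theta> z *\<^sub>R x_average h f z = (LINT r|lborel. \<theta> z *\<^sub>R (indicator {0<..<1} r *\<^sub>R f (fst z + h * r, snd z)))"
      unfolding x_average_def set_lebesgue_integral_def by (rule integral_scaleR_right[symmetric])
    also have "\<dots> = (LINT r|lborel. \<Psi> r z)"
      by (rule Bochner_Integration.integral_cong[OF refl]) (cases z, simp add: \<Psi>_def)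
    finally show "\<theta> z *\<^sub>R x_average h f z = (LINT r|lborel. \<Psi> r z)" .
  qed
  also have "\<dots> = (LINT r|lborel. LINT z|lborel. \<Psi> r z)" by (rule lborel_pair.Fubini_integral[OF pi])
  also have "\<dots> = (LINT r:{0<..<1}|lborel. LINT z|lborel. \<theta> (z - (h * r, 0)) *\<^sub>R f z)"
    unfolding set_lebesgue_integral_def
  proof (rule Bochner_Integration.integral_cong[OF refl])
    fix r
    have "(LINT z|lborel. \<theta> z *\<^sub>R f (z + (h * r, 0))) = (LINT z|lborel. \<theta> (z - (h * r, 0)) *\<^sub>R f z)"
      using integral_shift(1)[of "\<lambda>z. \<theta> (z - (h * r, 0)) *\<^sub>R f z" "(h * r, 0)"] by simp
    then show "(LINT z|lborel. \<Psi> r z) = indicator {0<..<1} r *\<^sub>R (LINT z|lborel. \<theta> (z - (h * r, 0)) *\<^sub>R f z)"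
      unfolding \<Psi>_def integral_scaleR_right by simp
  qed
  finally show ?thesis .
qed

lemma x_average_weak_partial:
  assumes F: "F \<in> borel_measurable borel" "integrable lborel (\<lambda>z. (norm (F z))\<^sup>2)"
    and G: "G \<in> borel_measurable borel" "integrable lborel (\<lambda>z. (norm (G z))\<^sup>2)"
    and w: "lborel_weak_partial F v G"
  shows "lborel_weak_partial (x_average h F) v (x_average h G)"
  unfolding lborel_weak_partial_def
proof
  fix \<theta> assume \<theta>: "\<theta> \<in> test_functions"
  obtain K where K: "compact K" "\<And>z. z \<notin> K \<Longrightarrow> \<theta> z = 0" "\<And>z v. z \<notin> K \<Longrightarrow> frechet_derivative \<theta> (at z) v = 0"
    using test_function_support[OF \<theta>] by metis
  have "(LINT z|lborel. frechet_derivative \<theta> (at (z - (h * r, 0))) v *\<^sub>R F z) = - (LINT z|lborel. \<theta> (z - (h * r, 0)) *\<^sub>R G z)" for r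
    using w[unfolded lborel_weak_partial_def, THEN bspec, OF test_function_shift(1)[OF \<theta>, of "- (h * r)"]]
    by (simp add: test_function_shift(2)[OF \<theta>] diff_conv_add_uminus del: add_uminus_conv_diff)
  moreover have "(LINT z|lborel. frechet_derivative \<theta> (at z) v *\<^sub>R x_average h F z) =
      (LINT r:{0<..<1}|lborel. LINT z|lborel. frechet_derivative \<theta> (at (z - (h * r, 0))) v *\<^sub>R F z)"
    by (rule x_average_weighted[OF test_function_continuous(2)[OF \<theta>] K(1,3) F])
  moreover have "(LINT z|lborel. \<theta> z *\<^sub>R x_average h G z) = (LINT r:{0<..<1}|lborel. LINT z|lborel. \<theta> (z - (h * r, 0)) *\<^sub>R G z)"
    by (rule x_average_weighted[OF test_function_continuous(1)[OF \<theta>] K(1,2) G])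
  ultimately show "(LINT z|lborel. frechet_derivative \<theta> (at z) v *\<^sub>R x_average h F z) = - (LINT z|lborel. \<theta> z *\<^sub>R x_average h G z)"
    by (simp add: set_lebesgue_integral_def)
qed

text \<open>Lebesgue differentiation, after the substitution that turns the mean over
  \<open>{0<..<1}\<close> into \<open>1 / h\<close> times the integral over
  \<open>{x..x+h}\<close>.\<close>

lemma average_tendsto_AE:
  fixes \<phi> :: "real \<Rightarrow> complex"
  assumes [measurable]: "\<phi> \<in> borel_measurable borel" and i: "integrable lborel (\<lambda>x. (norm (\<phi> x))\<^sup>2)"
  shows "AE x in lborel. (\<lambda>k. LINT r:{0<..<1}|lborel. \<phi> (x + (1 / real (Suc k)) * r)) \<longlonglongrightarrow> \<phi> x"
proof -
  have si: "set_integrable lborel {a..b} \<phi>" for a b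
    by (rule square_integrable_imp_set_integrable) (use i in \<open>auto simp: emeasure_lborel_Icc_eq\<close>)
  have "\<phi> integrable_on cbox a b" for a b
    using set_borel_integral_eq_integral(1)[OF si[of a b]] by simp
  then obtain N where N: "negligible N" "\<And>x e. \<lbrakk>x \<notin> N; 0 < e\<rbrakk> \<Longrightarrow>
     \<exists>d>0. \<forall>h. 0 < h \<and> h < d \<longrightarrow> norm (integral (cbox x (x + h *\<^sub>R One)) \<phi> /\<^sub>R h ^ DIM(real) - \<phi> x) < e"
    using integrable_ccontinuous_explicit[of \<phi>] by blast
  have e: "(LINT r:{0<..<1}|lborel. \<phi> (x + h * r)) = integral {x..x+h} \<phi> /\<^sub>R h" if h: "h > 0" for x h
  proof -
    have "(LINT s|lborel. indicator {x<..<x+h} s *\<^sub>R \<phi> s) = h *\<^sub>R (LINT r|lborel. indicator {x<..<x+h} (x + h * r) *\<^sub>R \<phi> (x + h * r))"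
      using lborel_integral_real_affine[of h "\<lambda>s. indicator {x<..<x+h} s *\<^sub>R \<phi> s" x] h by simp
    also have "(LINT r|lborel. indicator {x<..<x+h} (x + h * r) *\<^sub>R \<phi> (x + h * r)) = (LINT r:{0<..<1}|lborel. \<phi> (x + h * r))"
      unfolding set_lebesgue_integral_def
      by (intro Bochner_Integration.integral_cong) (use h in \<open>auto simp: indicator_def zero_less_mult_iff\<close>)
    finally have "h *\<^sub>R (LINT r:{0<..<1}|lborel. \<phi> (x + h * r)) = (LINT s:{x<..<x+h}|lborel. \<phi> s)" by (simp add: set_lebesgue_integral_def)
    also have "\<dots> = (LINT s:{x..x+h}|lborel. \<phi> s)"
      unfolding set_lebesgue_integral_def
    proof (rule integral_cong_AE)
      show "AE s in lborel. indicator {x<..<x+h} s *\<^sub>R \<phi> s = indicator {x..x+h} s *\<^sub>R \<phi> s"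
        using AE_lborel_singleton[of x] AE_lborel_singleton[of "x+h"] by eventually_elim (auto simp: indicator_def)
    qed measurable
    also have "\<dots> = integral {x..x+h} \<phi>" by (rule set_borel_integral_eq_integral(2)[OF si])
    finally show ?thesis using h by (simp add: divideR_right)
  qed
  have "(\<lambda>k. LINT r:{0<..<1}|lborel. \<phi> (x + (1 / real (Suc k)) * r)) \<longlonglongrightarrow> \<phi> x" if x: "x \<notin> N" for x
  proof (rule LIMSEQ_I)
    fix e :: real assume "e > 0"
    then obtain d where d: "d > 0" "\<And>h. 0 < h \<Longrightarrow> h < d \<Longrightarrow> norm (integral (cbox x (x + h *\<^sub>R One)) \<phi> /\<^sub>R h ^ DIM(real) - \<phi> x) < e"
      using N(2)[OF x] by blast
    obtain n where n: "inverse (real (Suc n)) < d" using reals_Archimedean[OF d(1)] by blast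
    have "norm ((LINT r:{0<..<1}|lborel. \<phi> (x + (1 / real (Suc k)) * r)) - \<phi> x) < e" if "k \<ge> n" for k
    proof -
      have "1 / real (Suc k) \<le> inverse (real (Suc n))" using that by (simp add: field_simps)
      then have h: "0 < 1 / real (Suc k)" "1 / real (Suc k) < d" using n by auto
      show ?thesis unfolding e[OF h(1)] using d(2)[OF h] by (simp add: Basis_real_def)
    qed
    then show "\<exists>no. \<forall>k\<ge>no. norm ((LINT r:{0<..<1}|lborel. \<phi> (x + (1 / real (Suc k)) * r)) - \<phi> x) < e" by blast
  qed
  moreover have "AE t in lebesgue. t \<notin> N"
    using N(1) by (simp add: negligible_iff_null_sets AE_not_in)
  ultimately have "AE x in lebesgue. (\<lambda>k. LINT r:{0<..<1}|lborel. \<phi> (x + (1 / real (Suc k)) * r)) \<longlonglongrightarrow> \<phi> x" by auto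
  then show ?thesis by (simp add: AE_completion_iff)
qed

lemma pred_LIMSEQ:
  fixes f :: "nat \<Rightarrow> 'a \<Rightarrow> 'b::{real_normed_vector, second_countable_topology}"
  assumes [measurable]: "\<And>n. f n \<in> borel_measurable M" "g \<in> borel_measurable M"
  shows "Measurable.pred M (\<lambda>z. (\<lambda>n. f n z) \<longlonglongrightarrow> g z)"
proof -
  have "(\<lambda>z. (\<lambda>n. f n z) \<longlonglongrightarrow> g z) = (\<lambda>z. \<forall>m. \<exists>N. \<forall>n\<ge>N. norm (f n z - g z) < inverse (real (Suc m)))"
  proof (intro ext iffI)
    fix z assume p: "\<forall>m. \<exists>N. \<forall>n\<ge>N. norm (f n z - g z) < inverse (real (Suc m))"
    show "(\<lambda>n. f n z) \<longlonglongrightarrow> g z"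
    proof (rule LIMSEQ_I)
      fix e :: real assume "e > 0"
      then obtain m where "inverse (real (Suc m)) < e" using reals_Archimedean by blast
      then show "\<exists>N. \<forall>n\<ge>N. norm (f n z - g z) < e" using p by (meson less_trans)
    qed
  next
    fix z assume l: "(\<lambda>n. f n z) \<longlonglongrightarrow> g z"
    have "0 < inverse (real (Suc m))" for m by simp
    from LIMSEQ_D[OF l this] show "\<forall>m. \<exists>N. \<forall>n\<ge>N. norm (f n z - g z) < inverse (real (Suc m))" by blast
  qed
  moreover have "Measurable.pred M (\<lambda>z. \<forall>m. \<exists>N. \<forall>n\<ge>N. norm (f n z - g z) < inverse (real (Suc m)))" by measurable
  ultimately show ?thesis by simp
qed

lemma x_average_tendsto_AE:
  assumes [measurable]: "f \<in> borel_measurable borel" and i: "integrable lborel (\<lambda>z. (norm (f z))\<^sup>2)"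
  shows "AE z in lborel. (\<lambda>k. x_average (1 / real (Suc k)) f z) \<longlonglongrightarrow> f z"
proof -
  have pm: "Measurable.pred borel (\<lambda>z. (\<lambda>k. x_average (1 / real (Suc k)) f z) \<longlonglongrightarrow> f z)"
    by (rule pred_LIMSEQ) measurable
  show ?thesis
    unfolding lborel2_AE(1)[OF pm] using lborel2_fubini_snd(1)[OF i]
  proof eventually_elim
    case (elim t)
    have "AE x in lborel. (\<lambda>k. LINT r:{0<..<1}|lborel. f (x + (1 / real (Suc k)) * r, t)) \<longlonglongrightarrow> f (x, t)"
      by (rule average_tendsto_AE) (use elim in auto)
    then show ?case by (simp add: x_average_def)
  qed
qed

lemma x_average_tendsto_L2:
  assumes [measurable]: "f \<in> borel_measurable borel" and i: "integrable lborel (\<lambda>z. (norm (f z))\<^sup>2)"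
  shows "(\<lambda>k. LINT z|lborel. (norm (x_average (1 / real (Suc k)) f z - f z))\<^sup>2) \<longlonglongrightarrow> 0"
  by (rule L2_Scheffe) (use i x_average_L2[OF assms] x_average_tendsto_AE[OF assms] in auto)

lemma lborel_weak_partial_cong:
  assumes w: "lborel_weak_partial F v G" and [measurable]: "F \<in> borel_measurable borel" "F' \<in> borel_measurable borel"
    and e: "AE z in lborel. F' z = F z"
  shows "lborel_weak_partial F' v G"
  unfolding lborel_weak_partial_def
proof
  fix \<theta> assume \<theta>: "\<theta> \<in> test_functions"
  have [measurable]: "(\<lambda>z. frechet_derivative \<theta> (at z) v) \<in> borel_measurable borel"
    by (rule borel_measurable_continuous_onI[OF test_function_continuous(2)[OF \<theta>]])
  have "(LINT z|lborel. frechet_derivative \<theta> (at z) v *\<^sub>R F' z) = (LINT z|lborel. frechet_derivative \<theta> (at z) v *\<^sub>R F z)"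
    by (rule integral_cong_AE) (use e in \<open>auto elim: eventually_mono\<close>)
  then show "(LINT z|lborel. frechet_derivative \<theta> (at z) v *\<^sub>R F' z) = - (LINT z|lborel. \<theta> z *\<^sub>R G z)"
    using w \<theta> by (simp add: lborel_weak_partial_def)
qed

lemma H1_rep_cong:
  assumes r: "H1_rep u U G H" and [measurable]: "V \<in> borel_measurable borel" and V0: "\<And>z. z \<notin> strip \<Longrightarrow> V z = 0"
    and e: "AE z in lborel. V z = U z"
  shows "H1_rep u V G H"
proof -
  note R = H1_repD[OF r]
  have "AE z in lebesgue_on strip. V z = U z" unfolding AE_lebesgue_on_iff[OF strip_borel] using e by eventually_elim simp
  with R(2) have "AE z in lebesgue_on strip. u z = V z" by eventually_elim simp
  moreover have "integrable lborel (\<lambda>z. (norm (V z))\<^sup>2)"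
    by (rule integrable_cong_AE_imp[OF R(5)]) (use e in \<open>auto elim: eventually_mono\<close>)
  ultimately show ?thesis
    unfolding H1_rep_def using R V0 lborel_weak_partial_cong[OF R(12) R(3) _ e] lborel_weak_partial_cong[OF R(13) R(3) _ e] by auto
qed

section \<open>The trace as the value at \<open>x = 0\<close>\<close>

definition x_slices :: "(real \<times> real \<Rightarrow> complex) \<Rightarrow> (real \<times> real \<Rightarrow> complex) \<Rightarrow> bool" where
  "x_slices U G \<longleftrightarrow> (AE t in lborel. indefinite_integral_of (\<lambda>s. G (s, t)) (\<lambda>s. U (s, t)))"

lemma H1_rep_x_slices:
  assumes "u \<in> H1"
  obtains U G H where "H1_rep u U G H" "x_slices U G"
proof -
  obtain F G H where r: "H1_rep u F G H" by (rule H1_rep_exists[OF assms])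
  note R = H1_repD[OF r]
  show ?thesis
  proof (rule weak_partial_x_slices[OF R(3,4,5,6,7,8,12)])
    fix V assume V: "V \<in> borel_measurable borel" "\<And>z. z \<notin> strip \<Longrightarrow> V z = 0" "AE z in lborel. V z = F z"
      "AE t in lborel. indefinite_integral_of (\<lambda>s. G (s, t)) (\<lambda>s. V (s, t))"
    show thesis
      by (rule that[of V G H]) (use H1_rep_cong[OF r V(1,2,3)] V(4) in \<open>auto simp: x_slices_def\<close>)
  qed
qed

lemma indefinite_integral_of_diff:
  assumes "indefinite_integral_of g v" "indefinite_integral_of g' v'"
  shows "indefinite_integral_of (\<lambda>x. g x - g' x) (\<lambda>x. v x - v' x)"
  unfolding indefinite_integral_of_def
proof (intro allI impI conjI)
  fix x y :: real assume xy: "x \<le> y"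
  note i = indefinite_integral_ofD[OF assms(1) xy] indefinite_integral_ofD[OF assms(2) xy]
  show "set_integrable lborel {x<..y} (\<lambda>x. g x - g' x)" by (rule set_integral_diff(1)[OF i(1,3)])
  show "v y - v' y = v x - v' x + (LINT r:{x<..y}|lborel. g r - g' r)"
    using set_integral_diff(2)[OF i(1,3)] i(2,4) by simp
qed

text \<open>\<open>v 0\<close> is \<open>v x\<close> minus an integral of \<open>g\<close> over a
  part of the unit interval. Squaring and averaging over \<open>x\<close> in \<open>{0<..<1}\<close>
  removes the dependence on \<open>x\<close>.\<close>

lemma point_value_bound:
  fixes v g :: "real \<Rightarrow> complex"
  assumes a: "indefinite_integral_of g v" and [measurable]: "g \<in> borel_measurable borel" "v \<in> borel_measurable borel"
    and i: "integrable lborel (\<lambda>x. (norm (v x))\<^sup>2)" "integrable lborel (\<lambda>x. (norm (g x))\<^sup>2)"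
  shows "(norm (v 0))\<^sup>2 \<le> 2 * (LINT x|lborel. (norm (v x))\<^sup>2) + 2 * (LINT x|lborel. (norm (g x))\<^sup>2)"
proof -
  define Ig where "Ig = (LINT x|lborel. (norm (g x))\<^sup>2)"
  have g1: "set_integrable lborel {0<..<1} g"
    by (rule square_integrable_imp_set_integrable) (use i in auto)
  have g2: "set_integrable lborel {0<..<1} (\<lambda>r. (norm (g r))\<^sup>2)"
    unfolding set_integrable_def by (rule integrable_mult_indicator[OF _ i(2)]) simp
  have b: "(norm (v 0))\<^sup>2 \<le> 2 * (norm (v x))\<^sup>2 + 2 * Ig" if x: "x \<in> {0<..<1}" for x
  proof -
    have xi: "set_integrable lborel {0<..x} g" using indefinite_integral_ofD(1)[OF a, of 0 x] x by simp
    have "norm (LINT r:{0<..x}|lborel. g r) \<le> (LINT r:{0<..x}|lborel. norm (g r))" by (rule set_integral_norm_bound[OF xi])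
    also have "\<dots> \<le> (LINT r:{0<..<1}|lborel. norm (g r))"
      unfolding set_lebesgue_integral_def
      by (rule integral_mono) (use x set_integrable_norm[OF g1] set_integrable_norm[OF xi] in \<open>auto simp: set_integrable_def indicator_def\<close>)
    finally have "(norm (LINT r:{0<..x}|lborel. g r))\<^sup>2 \<le> (LINT r:{0<..<1}|lborel. norm (g r))\<^sup>2" by (intro power_mono) auto
    also have "\<dots> \<le> (LINT r:{0<..<1}|lborel. (norm (g r))\<^sup>2)"
      by (rule integral_square_le[OF set_integrable_norm[OF g1] g2])
    also have "\<dots> \<le> Ig" unfolding Ig_def set_lebesgue_integral_def
      by (rule integral_mono[OF _ i(2)]) (use g2 in \<open>auto simp: set_integrable_def indicator_def\<close>)
    finally have "(norm (LINT r:{0<..x}|lborel. g r))\<^sup>2 \<le> Ig" .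
    moreover have "v 0 = v x - (LINT r:{0<..x}|lborel. g r)" using indefinite_integral_ofD(2)[OF a, of 0 x] x by simp
    ultimately show ?thesis using norm_diff_square_le[of "v x" "LINT r:{0<..x}|lborel. g r"] by simp
  qed
  have v2: "integrable lborel (\<lambda>x. 2 * (norm (v x))\<^sup>2)" using i(1) by simp
  have vi: "set_integrable lborel {0<..<1} (\<lambda>x. 2 * (norm (v x))\<^sup>2)"
    unfolding set_integrable_def by (rule integrable_mult_indicator[OF _ v2]) simp
  have ki: "set_integrable lborel {0<..<1::real} (\<lambda>x. c)" for c :: real by (simp add: set_integrable_def)
  have "(LINT x:{0<..<1::real}|lborel. (norm (v 0))\<^sup>2) \<le> (LINT x:{0<..<1}|lborel. 2 * (norm (v x))\<^sup>2 + 2 * Ig)"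
    by (rule set_integral_mono[OF ki set_integral_add(1)[OF vi ki]]) (rule b)
  also have "\<dots> = (LINT x:{0<..<1}|lborel. 2 * (norm (v x))\<^sup>2) + (LINT x:{0<..<1::real}|lborel. 2 * Ig)"
    by (rule set_integral_add(2)[OF vi ki])
  also have "(LINT x:{0<..<1}|lborel. 2 * (norm (v x))\<^sup>2) \<le> (LINT x|lborel. 2 * (norm (v x))\<^sup>2)"
    unfolding set_lebesgue_integral_def by (rule integral_mono[OF _ v2]) (use vi in \<open>auto simp: indicator_def set_integrable_def\<close>)
  finally show ?thesis by (simp add: set_lebesgue_integral_def Ig_def)
qed

lemma trace_bound:
  assumes s: "x_slices U G" and [measurable]: "U \<in> borel_measurable borel" "G \<in> borel_measurable borel"
    and i: "integrable lborel (\<lambda>z. (norm (U z))\<^sup>2)" "integrable lborel (\<lambda>z. (norm (G z))\<^sup>2)"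
  shows "integrable lborel (\<lambda>t. (norm (U (0, t)))\<^sup>2)"
    "(LINT t|lborel. (norm (U (0, t)))\<^sup>2) \<le> 2 * (LINT z|lborel. (norm (U z))\<^sup>2) + 2 * (LINT z|lborel. (norm (G z))\<^sup>2)"
proof -
  let ?B = "\<lambda>t. 2 * (LINT x|lborel. (norm (U (x, t)))\<^sup>2) + 2 * (LINT x|lborel. (norm (G (x, t)))\<^sup>2)"
  have Bi: "integrable lborel ?B" using lborel2_fubini_snd(2)[OF i(1)] lborel2_fubini_snd(2)[OF i(2)] by auto
  have le: "AE t in lborel. (norm (U (0, t)))\<^sup>2 \<le> ?B t"
    using s[unfolded x_slices_def] lborel2_fubini_snd(1)[OF i(1)] lborel2_fubini_snd(1)[OF i(2)]
  proof eventually_elim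
    case (elim t)
    show ?case by (rule point_value_bound[OF elim(1)]) (use elim in auto)
  qed
  show I: "integrable lborel (\<lambda>t. (norm (U (0, t)))\<^sup>2)"
    by (rule Bochner_Integration.integrable_bound[OF Bi]) (use le in \<open>auto elim!: eventually_mono\<close>)
  have "(LINT t|lborel. (norm (U (0, t)))\<^sup>2) \<le> (LINT t|lborel. ?B t)" by (rule integral_mono_AE[OF I Bi le])
  also have "\<dots> = 2 * (LINT z|lborel. (norm (U z))\<^sup>2) + 2 * (LINT z|lborel. (norm (G z))\<^sup>2)"
    using lborel2_fubini_snd[OF i(1)] lborel2_fubini_snd[OF i(2)] by simp
  finally show "(LINT t|lborel. (norm (U (0, t)))\<^sup>2) \<le> 2 * (LINT z|lborel. (norm (U z))\<^sup>2) + 2 * (LINT z|lborel. (norm (G z))\<^sup>2)" .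
qed

text \<open>\<open>w\<close> is evaluated pointwise on \<open>{x = 0}\<close>, while
  \<open>V\<close> equals \<open>w\<close> only almost everywhere. Both are continuous along almost
  every horizontal line, so there they agree at \<open>0\<close>.\<close>

lemma continuous_H1_trace:
  assumes w: "H1_rep w V G H" "x_slices V G" "continuous_on strip w"
  shows "AE t in lborel. t \<in> {0..1} \<longrightarrow> V (0, t) = w (0, t)"
proof -
  have "AE z in lborel. z \<in> strip \<longrightarrow> w z = V z"
    using H1_repD(2)[OF w(1)] unfolding AE_lebesgue_on_iff[OF strip_borel] .
  from lborel2_AE_slices(1)[OF this] w(2)[unfolded x_slices_def]
  show ?thesis
  proof eventually_elim
    case (elim t)
    show ?case
    proof
      assume t: "t \<in> {0..1}"
      have "continuous_on UNIV (\<lambda>s. w (s, t))"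
        by (rule continuous_on_compose2[OF w(3)]) (use t in \<open>auto intro!: continuous_intros simp: strip_def\<close>)
      then have "continuous_on UNIV (\<lambda>s. V (s, t) - w (s, t))"
        by (intro continuous_intros indefinite_integral_of_continuous[OF elim(2)])
      moreover have "AE s in lborel. s \<in> {-1<..<1} \<longrightarrow> V (s, t) - w (s, t) = 0"
        using elim(1) by eventually_elim (use t in \<open>auto simp: strip_def\<close>)
      ultimately have "V (0, t) - w (0, t) = 0"
        by (rule continuous_AE_zero_imp_zero) auto
      then show "V (0, t) = w (0, t)" by simp
    qed
  qed
qed

lemma x_slices_diff:
  assumes "x_slices U G" "x_slices U' G'"
  shows "x_slices (\<lambda>z. U z - U' z) (\<lambda>z. G z - G' z)"
  using assms unfolding x_slices_def by eventually_elim (rule indefinite_integral_of_diff)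

lemma continuous_trace_distance:
  assumes w: "w \<in> H1" "continuous_on strip w" and u: "H1_rep u U G H" "x_slices U G"
  shows "integrable lborel (\<lambda>t. (norm (indicator {0..1} t *\<^sub>R w (0, t) - U (0, t)))\<^sup>2)"
    "(LINT t|lborel. (norm (indicator {0..1} t *\<^sub>R w (0, t) - U (0, t)))\<^sup>2) \<le> 2 * (H1_norm (\<lambda>z. w z - u z))\<^sup>2"
proof -
  obtain W G' H' where W: "H1_rep w W G' H'" "x_slices W G'" by (rule H1_rep_x_slices[OF w(1)])
  note R = H1_repD[OF H1_rep_diff[OF W(1) u(1)]]
  note tb = trace_bound[OF x_slices_diff[OF W(2) u(2)] R(3,6,5,8)]
  have [measurable]: "W \<in> borel_measurable borel" "U \<in> borel_measurable borel" using H1_repD(3)[OF W(1)] H1_repD(3)[OF u(1)] by auto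
  have "continuous_on {0..1} (\<lambda>t. w (0, t))"
    by (rule continuous_on_compose2[OF w(2)]) (auto intro!: continuous_intros simp: strip_def)
  then have [measurable]: "(\<lambda>t. indicator {0..1} t *\<^sub>R w (0, t)) \<in> borel_measurable borel"
    by (intro borel_measurable_continuous_on_indicator) auto
  have z: "W (0, t) = 0" if "t \<notin> {0..1}" for t using H1_repD(4)[OF W(1), of "(0,t)"] that by (auto simp: strip_def)
  have e: "AE t in lborel. (norm (W (0, t) - U (0, t)))\<^sup>2 = (norm (indicator {0..1} t *\<^sub>R w (0, t) - U (0, t)))\<^sup>2"
    using continuous_H1_trace[OF W w(2)] by eventually_elim (use z in \<open>auto simp: indicator_def\<close>)
  show "integrable lborel (\<lambda>t. (norm (indicator {0..1} t *\<^sub>R w (0, t) - U (0, t)))\<^sup>2)"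
    by (rule integrable_cong_AE_imp[OF tb(1)]) (use e in auto)
  have "(LINT t|lborel. (norm (W (0, t) - U (0, t)))\<^sup>2) = (LINT t|lborel. (norm (indicator {0..1} t *\<^sub>R w (0, t) - U (0, t)))\<^sup>2)"
    by (rule integral_cong_AE[OF _ _ e]) measurable
  moreover have "0 \<le> (LINT z|lborel. (norm (H' z - H z))\<^sup>2)" by (rule Bochner_Integration.integral_nonneg) simp
  moreover have "b \<le> 2 * (x + y + c)" if "a = b" "0 \<le> c" "a \<le> 2 * x + 2 * y" for a b c x y :: real
    using that by simp
  ultimately show "(LINT t|lborel. (norm (indicator {0..1} t *\<^sub>R w (0, t) - U (0, t)))\<^sup>2) \<le> 2 * (H1_norm (\<lambda>z. w z - u z))\<^sup>2"
    using tb(2) unfolding H1_rep_norm(2)[OF H1_rep_diff[OF W(1) u(1)]] by blast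
qed

text \<open>On almost every vertical line \<open>Y\<close> is continuous on \<open>[0, 1]\<close>,
  and its supremum there is bounded by the integrals of \<open>|Y|\<close> and \<open>|H|\<close>
  along the line. This bound is locally integrable in x, so dominated convergence gives continuity
  of the average in both variables at once.\<close>

lemma x_average_continuous:
  assumes h: "h > 0" and [measurable]: "Y \<in> borel_measurable borel" "H \<in> borel_measurable borel"
    and Y0: "\<And>z. z \<notin> strip \<Longrightarrow> Y z = 0" and H0: "\<And>z. z \<notin> strip \<Longrightarrow> H z = 0"
    and i: "integrable lborel (\<lambda>z. (norm (Y z))\<^sup>2)" "integrable lborel (\<lambda>z. (norm (H z))\<^sup>2)"
    and s: "AE s in lborel. \<exists>v. indefinite_integral_of (\<lambda>t. H (s, t)) v \<and> (\<forall>t\<in>{0..1}. Y (s, t) = v t)"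
  shows "continuous_on strip (x_average h Y)"
  unfolding continuous_on_sequentially
proof (intro allI ballI impI, elim conjE)
  fix z :: "nat \<Rightarrow> real \<times> real" and a assume a: "a \<in> strip" and z: "\<forall>n. z n \<in> strip" "z \<longlonglongrightarrow> a"
  have av: "x_average h Y w = (LINT x|lborel. indicator {fst w<..<fst w + h} x *\<^sub>R Y (x, snd w)) /\<^sub>R h" for w
  proof -
    have "(LINT x|lborel. indicator {fst w<..<fst w + h} x *\<^sub>R Y (x, snd w)) =
       h *\<^sub>R (LINT r|lborel. indicator {fst w<..<fst w + h} (fst w + h * r) *\<^sub>R Y (fst w + h * r, snd w))"
      using lborel_integral_real_affine[of h "\<lambda>x. indicator {fst w<..<fst w + h} x *\<^sub>R Y (x, snd w)" "fst w"] h by simp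
    also have "(LINT r|lborel. indicator {fst w<..<fst w + h} (fst w + h * r) *\<^sub>R Y (fst w + h * r, snd w)) = x_average h Y w"
      unfolding x_average_def set_lebesgue_integral_def
      by (intro Bochner_Integration.integral_cong) (use h in \<open>auto simp: indicator_def zero_less_mult_iff\<close>)
    finally show ?thesis using h by simp
  qed
  obtain N where N: "\<And>n. \<bar>fst (z n)\<bar> \<le> N"
  proof -
    have "bounded (range z)" using z(2) by (rule convergent_imp_bounded)
    then obtain N where "\<And>n. norm (z n) \<le> N" unfolding bounded_iff by blast
    then show ?thesis using that norm_fst_le[of "fst (z _)" "snd (z _)"] by (metis order_trans prod.collapse real_norm_def)
  qed
  \<comment> \<open>A box that contains the averaging segments of all points of the convergent
    sequence.\<close>
  define S where "S = {-N..N+h} \<times> {0..1::real}"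
  have Sm[measurable]: "S \<in> sets borel" unfolding S_def by (intro borel_closed closed_Times) auto
  have Sb: "emeasure lborel S < \<infinity>" using emeasure_bounded_finite[of S] by (simp add: S_def bounded_Times)
  have SY: "integrable lborel (\<lambda>z. norm (indicator S z *\<^sub>R Y z))" "integrable lborel (\<lambda>z. norm (indicator S z *\<^sub>R H z))"
  proof -
    have "set_integrable lborel S Y" "set_integrable lborel S H"
      by (rule square_integrable_imp_set_integrable; use i Sb in simp)+
    then show "integrable lborel (\<lambda>z. norm (indicator S z *\<^sub>R Y z))" "integrable lborel (\<lambda>z. norm (indicator S z *\<^sub>R H z))"
      unfolding set_integrable_def by (simp_all only: integrable_norm)
  qed
  \<comment> \<open>Mean of \<open>|Y|\<close> plus the integral of \<open>|H|\<close>: on an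
    interval of length one this bounds the supremum of an absolutely continuous function.\<close>
  define M where "M x = (LINT t|lborel. norm (indicator S (x, t) *\<^sub>R Y (x, t))) + (LINT t|lborel. norm (indicator S (x, t) *\<^sub>R H (x, t)))" for x
  have Mi: "integrable lborel M"
    unfolding M_def using lborel2_fubini_fst(2)[OF SY(1)] lborel2_fubini_fst(2)[OF SY(2)] by auto
  have Yb: "AE x in lborel. x \<in> {-N..N+h} \<longrightarrow> (\<forall>t\<in>{0..1}. norm (Y (x, t)) \<le> M x)"
    using s lborel2_fubini_fst(1)[OF SY(1)] lborel2_fubini_fst(1)[OF SY(2)]
  proof eventually_elim
    case (elim x)
    obtain v where v: "indefinite_integral_of (\<lambda>t. H (x, t)) v" "\<And>t. t \<in> {0..1} \<Longrightarrow> Y (x, t) = v t" using elim(1) by blast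
    show ?case
    proof (intro impI ballI)
      fix t assume x: "x \<in> {-N..N+h}" and t: "t \<in> {0..1::real}"
      define c where "c = (LINT t|lborel. norm (indicator S (x, t) *\<^sub>R H (x, t)))"
      have Hb: "norm (LINT r:{p<..q}|lborel. H (x, r)) \<le> c" if pq: "0 \<le> p" "p \<le> q" "q \<le> 1" for p q
      proof -
        note ii = indefinite_integral_ofD(1)[OF v(1) pq(2)]
        have "norm (LINT r:{p<..q}|lborel. H (x, r)) \<le> (LINT r:{p<..q}|lborel. norm (H (x, r)))" by (rule set_integral_norm_bound[OF ii])
        also have "\<dots> \<le> c" unfolding c_def set_lebesgue_integral_def
          by (rule integral_mono[OF _ elim(3)]) (use set_integrable_norm[OF ii] x pq in \<open>auto simp: set_integrable_def S_def indicator_def\<close>)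
        finally show ?thesis .
      qed
      have pt: "norm (v t) \<le> norm (Y (x, r)) + c" if r: "r \<in> {0..1}" for r
      proof (cases "r \<le> t")
        case True
        then have "v t = v r + (LINT q:{r<..t}|lborel. H (x, q))" using indefinite_integral_ofD(2)[OF v(1)] by blast
        then show ?thesis using Hb[of r t] True r t v(2)[OF r] norm_triangle_ineq[of "v r" "LINT q:{r<..t}|lborel. H (x, q)"] by auto
      next
        case False
        then have "v r = v t + (LINT q:{t<..r}|lborel. H (x, q))" using indefinite_integral_ofD(2)[OF v(1), of t r] by simp
        then have "v t = v r - (LINT q:{t<..r}|lborel. H (x, q))" by simp
        then show ?thesis using Hb[of t r] False r t v(2)[OF r] norm_triangle_ineq4[of "v r" "LINT q:{t<..r}|lborel. H (x, q)"] by auto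
      qed
      have ki: "set_integrable lborel {0..1::real} (\<lambda>r. d)" for d :: real by (simp add: set_integrable_def)
      have yi: "set_integrable lborel {0..1} (\<lambda>r. norm (Y (x, r)))"
        unfolding set_integrable_def
        by (rule Bochner_Integration.integrable_cong[THEN iffD1, OF refl _ elim(2)]) (use x in \<open>auto simp: S_def indicator_def\<close>)
      have "(LINT r:{0..1::real}|lborel. norm (v t)) \<le> (LINT r:{0..1}|lborel. norm (Y (x, r)) + c)"
        by (rule set_integral_mono[OF ki set_integral_add(1)[OF yi ki]]) (rule pt)
      also have "\<dots> = (LINT r:{0..1}|lborel. norm (Y (x, r))) + (LINT r:{0..1::real}|lborel. c)"
        by (rule set_integral_add(2)[OF yi ki])
      also have "(LINT r:{0..1}|lborel. norm (Y (x, r))) = (LINT t|lborel. norm (indicator S (x, t) *\<^sub>R Y (x, t)))"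
        unfolding set_lebesgue_integral_def
        by (rule Bochner_Integration.integral_cong) (use x in \<open>auto simp: S_def indicator_def\<close>)
      finally show "norm (Y (x, t)) \<le> M x" using v(2)[OF t] by (simp add: set_lebesgue_integral_def M_def c_def)
    qed
  qed
  have sn: "snd (z n) \<in> {0..1}" for n using z(1) by (cases "z n") (metis (no_types) mem_Sigma_iff strip_def snd_conv UNIV_I)
  have fl: "(\<lambda>n. fst (z n)) \<longlonglongrightarrow> fst a" and sl: "(\<lambda>n. snd (z n)) \<longlonglongrightarrow> snd a" using z(2) by (auto intro: tendsto_fst tendsto_snd)
  have sa: "snd a \<in> {0..1}" using a by (auto simp: strip_def)
  have "(\<lambda>n. LINT x|lborel. indicator {fst (z n)<..<fst (z n) + h} x *\<^sub>R Y (x, snd (z n))) \<longlonglongrightarrow>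
      (LINT x|lborel. indicator {fst a<..<fst a + h} x *\<^sub>R Y (x, snd a))"
  proof (rule integral_dominated_convergence[where w="\<lambda>x. norm (indicator {-N..N+h} x *\<^sub>R M x)"])
    show "integrable lborel (\<lambda>x. norm (indicator {-N..N+h} x *\<^sub>R M x))" by (intro integrable_norm integrable_mult_indicator Mi) simp
    show "AE x in lborel. norm (indicator {fst (z n)<..<fst (z n) + h} x *\<^sub>R Y (x, snd (z n))) \<le> norm (indicator {-N..N+h} x *\<^sub>R M x)" for n
      using Yb
    proof eventually_elim
      case (elim x)
      show ?case
      proof (cases "x \<in> {fst (z n)<..<fst (z n) + h}")
        case True
        then have "x \<in> {-N..N+h}" using N[of n] by auto
        moreover from this have "norm (Y (x, snd (z n))) \<le> M x" using elim sn[of n] by blast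
        ultimately show ?thesis using True by simp
      qed simp
    qed
    show "AE x in lborel. (\<lambda>n. indicator {fst (z n)<..<fst (z n) + h} x *\<^sub>R Y (x, snd (z n))) \<longlonglongrightarrow> indicator {fst a<..<fst a + h} x *\<^sub>R Y (x, snd a)"
      using s AE_lborel_singleton[of "fst a"] AE_lborel_singleton[of "fst a + h"]
    proof eventually_elim
      case (elim x)
      obtain v where v: "indefinite_integral_of (\<lambda>t. H (x, t)) v" "\<And>t. t \<in> {0..1} \<Longrightarrow> Y (x, t) = v t" using elim(1) by blast
      have "isCont v (snd a)" using indefinite_integral_of_continuous[OF v(1), of UNIV] by (simp add: continuous_on_eq_continuous_at)
      then have "(\<lambda>n. v (snd (z n))) \<longlonglongrightarrow> v (snd a)" using sl by (rule isCont_tendsto_compose)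
      then have Yl: "(\<lambda>n. Y (x, snd (z n))) \<longlonglongrightarrow> Y (x, snd a)" using v(2) sn sa by simp
      have "\<forall>\<^sub>F n in sequentially. indicator {fst (z n)<..<fst (z n) + h} x = (indicator {fst a<..<fst a + h} x :: real)"
      proof -
        have fl': "(\<lambda>n. fst (z n) + h) \<longlonglongrightarrow> fst a + h" by (intro tendsto_intros fl)
        consider "x < fst a" | "fst a < x" "x < fst a + h" | "fst a + h < x" using elim(2,3) by fastforce
        then show ?thesis
        proof cases
          case 1
          then show ?thesis using order_tendstoD(1)[OF fl 1] by (auto elim!: eventually_mono simp: indicator_def)
        next
          case 2
          show ?thesis using order_tendstoD(2)[OF fl 2(1)] order_tendstoD(1)[OF fl' 2(2)]
            by eventually_elim (use 2 in \<open>auto simp: indicator_def\<close>)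
        next
          case 3
          then show ?thesis using order_tendstoD(2)[OF fl' 3] by (auto elim!: eventually_mono simp: indicator_def)
        qed
      qed
      then have "(\<lambda>n. indicator {fst (z n)<..<fst (z n) + h} x :: real) \<longlonglongrightarrow> indicator {fst a<..<fst a + h} x" by (rule tendsto_eventually)
      then show ?case by (intro tendsto_scaleR Yl)
    qed
  qed measurable
  then have "(\<lambda>n. x_average h Y (z n)) \<longlonglongrightarrow> x_average h Y a" unfolding av by (intro tendsto_intros)
  then show "(x_average h Y \<circ> z) \<longlonglongrightarrow> x_average h Y a" by (simp add: o_def)
qed

lemma H1_norm_nonneg: "0 \<le> H1_norm u"
  by (simp add: H1_norm_def)

lemma tendsto_zero_of_power2:
  fixes f :: "nat \<Rightarrow> real"
  assumes "(\<lambda>k. (f k)\<^sup>2) \<longlonglongrightarrow> 0" "\<And>k. 0 \<le> f k"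
  shows "f \<longlonglongrightarrow> 0"
proof -
  have "(\<lambda>k. sqrt ((f k)\<^sup>2)) \<longlonglongrightarrow> sqrt 0" by (intro tendsto_real_sqrt assms)
  then show ?thesis using assms(2) by simp
qed

text \<open>The definition of the trace asks for approximants that are continuous on the closed
  strip. Averages in x of the representative that is absolutely continuous in y have this
  property.\<close>

lemma H1_continuous_approximation:
  assumes r: "H1_rep u U G H"
  obtains w where "\<And>k::nat. w k \<in> H1" "\<And>k. continuous_on strip (w k)" "(\<lambda>k. H1_norm (\<lambda>z. w k z - u z)) \<longlonglongrightarrow> 0"
proof -
  note R = H1_repD[OF r]
  show ?thesis
  proof (rule weak_partial_y_slices[OF R(3,4,5,9,10,11,13)])
    fix V assume V: "V \<in> borel_measurable borel" "AE z in lborel. z \<in> strip \<longrightarrow> V z = U z"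
      "AE s in lborel. indefinite_integral_of (\<lambda>t. H (s, t)) (\<lambda>t. V (s, t))"
    define Y where "Y z = indicator strip z *\<^sub>R V z" for z
    have Ym[measurable]: "Y \<in> borel_measurable borel" unfolding Y_def[abs_def] using V(1) by measurable
    have Y0: "Y z = 0" if "z \<notin> strip" for z using that by (simp add: Y_def)
    have "AE z in lborel. Y z = U z" using V(2)
    proof eventually_elim
      case (elim z)
      then show ?case using R(4)[of z] by (cases "z \<in> strip") (auto simp: Y_def)
    qed
    then have rY: "H1_rep u Y G H" by (intro H1_rep_cong[OF r Ym Y0])
    note S = H1_repD[OF rY]
    define h where "h k = 1 / real (Suc k)" for k
    have a0: "x_average c F z = 0" if "\<And>z. z \<notin> strip \<Longrightarrow> F z = 0" "z \<notin> strip" for c F z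
    proof -
      have "F (fst z + c * r, snd z) = 0" for r by (rule that(1)) (use that(2) in \<open>cases z, auto simp: strip_def\<close>)
      then show ?thesis by (simp add: x_average_def set_lebesgue_integral_def)
    qed
    have rw: "H1_rep (x_average c Y) (x_average c Y) (x_average c G) (x_average c H)" for c
      unfolding H1_rep_def
      using x_average_weak_partial[OF S(3,5,6,8,12), of c] x_average_weak_partial[OF S(3,5,9,11,13), of c]
        x_average_L2(1)[OF S(3,5), of c] x_average_L2(1)[OF S(6,8), of c] x_average_L2(1)[OF S(9,11), of c]
        x_average_measurable[OF S(3), of c] x_average_measurable[OF S(6), of c] x_average_measurable[OF S(9), of c]
        a0[of Y, OF S(4)] a0[of G, OF S(7)] a0[of H, OF S(10)]
        borel_measurable_lebesgue_onI[OF x_average_measurable[OF S(3), of c], of strip] by auto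
    show thesis
    proof (rule that[of "\<lambda>k. x_average (h k) Y"])
      show "x_average (h k) Y \<in> H1" for k by (rule H1_rep_weak_partial(1)[OF rw])
      show "continuous_on strip (x_average (h k) Y)" for k
      proof (rule x_average_continuous[OF _ S(3,9,4,10,5,11)])
        show "0 < h k" by (simp add: h_def)
        show "AE s in lborel. \<exists>v. indefinite_integral_of (\<lambda>t. H (s, t)) v \<and> (\<forall>t\<in>{0..1}. Y (s, t) = v t)"
          using V(3)
        proof eventually_elim
          case (elim s)
          then show ?case by (intro exI[of _ "\<lambda>t. V (s, t)"]) (auto simp: Y_def strip_def)
        qed
      qed
      have eq: "(H1_norm (\<lambda>z. x_average (h k) Y z - u z))\<^sup>2 = (LINT z|lborel. (norm (x_average (h k) Y z - Y z))\<^sup>2)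
          + (LINT z|lborel. (norm (x_average (h k) G z - G z))\<^sup>2) + (LINT z|lborel. (norm (x_average (h k) H z - H z))\<^sup>2)" for k
        by (rule H1_rep_norm(2)[OF H1_rep_diff[OF rw rY]])
      have "(\<lambda>k. (H1_norm (\<lambda>z. x_average (h k) Y z - u z))\<^sup>2) \<longlonglongrightarrow> 0 + 0 + 0"
        unfolding eq unfolding h_def
        by (rule tendsto_add[OF tendsto_add[OF x_average_tendsto_L2[OF S(3,5)] x_average_tendsto_L2[OF S(6,8)]] x_average_tendsto_L2[OF S(9,11)]])
      then have "(\<lambda>k. (H1_norm (\<lambda>z. x_average (h k) Y z - u z))\<^sup>2) \<longlonglongrightarrow> 0" by simp
      then show "(\<lambda>k. H1_norm (\<lambda>z. x_average (h k) Y z - u z)) \<longlonglongrightarrow> 0"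
        by (rule tendsto_zero_of_power2[OF _ H1_norm_nonneg])
    qed
  qed
qed

lemma trace_Ltwo_norm:
  assumes w: "continuous_on strip w" and g: "g \<in> borel_measurable (lebesgue_on {0..1})"
    and g': "g' \<in> borel_measurable borel" "\<And>t. t \<notin> {0..1} \<Longrightarrow> g' t = 0" "AE t in lebesgue_on {0..1}. g t = g' t"
  shows "(Ltwo_norm (lebesgue_on {0..1}) (\<lambda>y. w (0, y) - g y))\<^sup>2 = (LINT t|lborel. (norm (indicator {0..1} t *\<^sub>R w (0, t) - g' t))\<^sup>2)"
proof (rule Ltwo_norm_representative)
  have c: "continuous_on {0..1} (\<lambda>t. w (0, t))"
    by (rule continuous_on_compose2[OF w]) (auto intro!: continuous_intros simp: strip_def)
  then have "(\<lambda>t. w (0, t)) \<in> borel_measurable (lebesgue_on {0..1})"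
    by (rule continuous_imp_measurable_on_sets_lebesgue) simp
  then show "(\<lambda>y. w (0, y) - g y) \<in> borel_measurable (lebesgue_on {0..1})" using g by measurable
  have [measurable]: "(\<lambda>t. indicator {0..1} t *\<^sub>R w (0, t)) \<in> borel_measurable borel"
    using c by (intro borel_measurable_continuous_on_indicator) auto
  show "(\<lambda>t. indicator {0..1} t *\<^sub>R w (0, t) - g' t) \<in> borel_measurable borel" using g'(1) by measurable
  show "AE t in lebesgue_on {0..1}. w (0, t) - g t = indicator {0..1} t *\<^sub>R w (0, t) - g' t"
    using g'(3) AE_lebesgue_on_iff[of "{0..1::real}" "\<lambda>t. t \<in> {0..1}"] by (auto elim: eventually_elim2)
qed (use g' in auto)

text \<open>Along any approximating sequence the values at \<open>x = 0\<close> are controlled by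
  the \<open>H1\<close> distance to \<open>u\<close>, through the trace bound. So whatever
  \<open>SOME\<close> selects is the value at \<open>x = 0\<close> of the representative that is
  absolutely continuous in x; the averages show that there is something to select.\<close>

lemma strip_trace_eq:
  assumes u: "H1_rep u U G H" "x_slices U G"
  shows "strip_trace u \<in> borel_measurable (lebesgue_on {0..1})"
    "AE y in lebesgue_on {0..1}. strip_trace u y = U (0, y)"
    "integrable lborel (\<lambda>t. (norm (U (0, t)))\<^sup>2)"
proof -
  note R = H1_repD[OF u(1)]
  have [measurable]: "U \<in> borel_measurable borel" by (rule R(3))
  have U0m[measurable]: "(\<lambda>t. U (0, t)) \<in> borel_measurable borel" by measurable
  have U0: "U (0, t) = 0" if "t \<notin> {0..1}" for t using R(4)[of "(0,t)"] that by (auto simp: strip_def)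
  show U2: "integrable lborel (\<lambda>t. (norm (U (0, t)))\<^sup>2)" by (rule trace_bound(1)[OF u(2) R(3,6,5,8)])
  have UL: "(\<lambda>t. U (0, t)) \<in> Ltwo (lebesgue_on {0..1})"
    by (rule Ltwo_of_representative[OF _ U0m U0 U2]) auto
  have Ltwo_norm_nonneg: "0 \<le> Ltwo_norm (lebesgue_on {0..1}) f" for f :: "real \<Rightarrow> complex"
    by (simp add: Ltwo_norm_def Bochner_Integration.integral_nonneg)
  have ex: "has_trace u (\<lambda>t. U (0, t))"
  proof (rule H1_continuous_approximation[OF u(1)])
    fix w :: "nat \<Rightarrow> real \<times> real \<Rightarrow> complex"
    assume w: "\<And>k. w k \<in> H1" "\<And>k. continuous_on strip (w k)" "(\<lambda>k. H1_norm (\<lambda>z. w k z - u z)) \<longlonglongrightarrow> 0"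
    have le: "(Ltwo_norm (lebesgue_on {0..1}) (\<lambda>y. w k (0, y) - U (0, y)))\<^sup>2 \<le> 2 * (H1_norm (\<lambda>z. w k z - u z))\<^sup>2" for k
      using continuous_trace_distance(2)[OF w(1,2) u] trace_Ltwo_norm[OF w(2) _ U0m U0] UL by (simp add: Ltwo_def)
    have "(\<lambda>k. 2 * (H1_norm (\<lambda>z. w k z - u z))\<^sup>2) \<longlonglongrightarrow> 2 * 0\<^sup>2" by (intro tendsto_intros w(3))
    then have l0: "(\<lambda>k. 2 * (H1_norm (\<lambda>z. w k z - u z))\<^sup>2) \<longlonglongrightarrow> 0" by simp
    have "(\<lambda>k. (Ltwo_norm (lebesgue_on {0..1}) (\<lambda>y. w k (0, y) - U (0, y)))\<^sup>2) \<longlonglongrightarrow> 0"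
      by (rule tendsto_sandwich[OF _ _ tendsto_const l0]) (simp, rule always_eventually, rule allI, rule le)
    then have "(\<lambda>k. Ltwo_norm (lebesgue_on {0..1}) (\<lambda>y. w k (0, y) - U (0, y))) \<longlonglongrightarrow> 0"
      by (rule tendsto_zero_of_power2[OF _ Ltwo_norm_nonneg])
    with UL w show "has_trace u (\<lambda>t. U (0, t))" unfolding has_trace_def by (intro conjI exI[of _ w] allI) simp_all
  qed
  have uniq: "AE y in lebesgue_on {0..1}. g y = U (0, y)" if g: "has_trace u g" for g
  proof -
    obtain w where w: "\<And>k::nat. w k \<in> H1" "\<And>k. continuous_on strip (w k)" "(\<lambda>k. H1_norm (\<lambda>z. w k z - u z)) \<longlonglongrightarrow> 0"
      "(\<lambda>k. Ltwo_norm (lebesgue_on {0..1}) (\<lambda>y. w k (0, y) - g y)) \<longlonglongrightarrow> 0" and gL: "g \<in> Ltwo (lebesgue_on {0..1})"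
      using g unfolding has_trace_def by blast
    have "{0..1::real} \<in> sets borel" by simp
    then show ?thesis
    proof (rule Ltwo_representative[OF _ gL])
      fix g' assume g': "g' \<in> borel_measurable borel" "\<And>t. t \<notin> {0..1} \<Longrightarrow> g' t = 0" "AE t in lebesgue_on {0..1}. g t = g' t"
        "integrable lborel (\<lambda>t. (norm (g' t))\<^sup>2)"
      have [measurable]: "g' \<in> borel_measurable borel" by (rule g'(1))
      have gm: "g \<in> borel_measurable (lebesgue_on {0..1})" using gL by (simp add: Ltwo_def)
      have id: "integrable lborel (\<lambda>t. (norm (g' t - U (0, t)))\<^sup>2)" using g'(4) U2 by (intro square_integrable_diff) auto
      have le: "(LINT t|lborel. (norm (g' t - U (0, t)))\<^sup>2) \<le> 4 * (H1_norm (\<lambda>z. w k z - u z))\<^sup>2 + 2 * (Ltwo_norm (lebesgue_on {0..1}) (\<lambda>y. w k (0, y) - g y))\<^sup>2" for k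
      proof -
        define f where "f t = indicator {0..1} t *\<^sub>R w k (0, t)" for t
        have c: "continuous_on {0..1} (\<lambda>t. w k (0, t))"
          by (rule continuous_on_compose2[OF w(2)]) (auto intro!: continuous_intros simp: strip_def)
        have [measurable]: "f \<in> borel_measurable borel"
          unfolding f_def[abs_def] using c by (intro borel_measurable_continuous_on_indicator) auto
        have i1: "integrable lborel (\<lambda>t. (norm (f t - U (0, t)))\<^sup>2)" and b1: "(LINT t|lborel. (norm (f t - U (0, t)))\<^sup>2) \<le> 2 * (H1_norm (\<lambda>z. w k z - u z))\<^sup>2"
          unfolding f_def using continuous_trace_distance[OF w(1,2) u] by auto
        have b2: "(Ltwo_norm (lebesgue_on {0..1}) (\<lambda>y. w k (0, y) - g y))\<^sup>2 = (LINT t|lborel. (norm (f t - g' t))\<^sup>2)"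
          unfolding f_def by (rule trace_Ltwo_norm[OF w(2) gm g'(1,2,3)])
        have i2: "integrable lborel (\<lambda>t. (norm (f t - g' t))\<^sup>2)"
          using square_integrable_diff[of "\<lambda>t. f t - U (0, t)" lborel "\<lambda>t. g' t - U (0, t)"] i1 id by simp
        have "(LINT t|lborel. (norm (g' t - U (0, t)))\<^sup>2) \<le> (LINT t|lborel. 2 * (norm (f t - U (0, t)))\<^sup>2 + 2 * (norm (f t - g' t))\<^sup>2)"
        proof (rule integral_mono[OF id])
          show "integrable lborel (\<lambda>t. 2 * (norm (f t - U (0, t)))\<^sup>2 + 2 * (norm (f t - g' t))\<^sup>2)" using i1 i2 by auto
          show "(norm (g' t - U (0, t)))\<^sup>2 \<le> 2 * (norm (f t - U (0, t)))\<^sup>2 + 2 * (norm (f t - g' t))\<^sup>2" for t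
            using norm_diff_square_le[of "f t - U (0, t)" "f t - g' t"] by simp
        qed
        then show ?thesis using i1 i2 b1 b2 by simp
      qed
      have "(\<lambda>k. 4 * (H1_norm (\<lambda>z. w k z - u z))\<^sup>2 + 2 * (Ltwo_norm (lebesgue_on {0..1}) (\<lambda>y. w k (0, y) - g y))\<^sup>2) \<longlonglongrightarrow> 4 * 0\<^sup>2 + 2 * 0\<^sup>2"
        by (intro tendsto_intros w(3,4))
      then have "(LINT t|lborel. (norm (g' t - U (0, t)))\<^sup>2) \<le> 4 * 0\<^sup>2 + 2 * 0\<^sup>2"
        by (rule LIMSEQ_le_const) (use le in blast)
      then have "(LINT t|lborel. (norm (g' t - U (0, t)))\<^sup>2) \<le> 0" by simp
      moreover have "0 \<le> (LINT t|lborel. (norm (g' t - U (0, t)))\<^sup>2)" by (rule Bochner_Integration.integral_nonneg) simp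
      ultimately have "(LINT t|lborel. (norm (g' t - U (0, t)))\<^sup>2) = 0" by (rule antisym)
      then have "AE t in lborel. (norm (g' t - U (0, t)))\<^sup>2 = 0"
        using integral_nonneg_eq_0_iff_AE[OF id] by simp
      then have "AE t in lebesgue_on {0..1}. g' t = U (0, t)"
        by (subst AE_lebesgue_on_iff) (auto elim: eventually_mono)
      with g'(3) show "AE y in lebesgue_on {0..1}. g y = U (0, y)" by eventually_elim simp
    qed
  qed
  have tr: "has_trace u (strip_trace u)" unfolding strip_trace_def by (rule someI[of _ "\<lambda>t. U (0, t)"]) (rule ex)
  then show "strip_trace u \<in> borel_measurable (lebesgue_on {0..1})" by (simp add: has_trace_def Ltwo_def)
  show "AE y in lebesgue_on {0..1}. strip_trace u y = U (0, y)" by (rule uniq[OF tr])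
qed

section \<open>The free soliton in terms of its mass\<close>

text \<open>For \<open>0 < q < 1\<close> the power \<open>s powr q\<close> is concave in
  \<open>s\<close> and lies below its tangent at \<open>R\<close>; Young's inequality is this bound
  in another form. The calibration takes the tangent at the value that the soliton has at the same
  mass.\<close>

lemma tangent_powr:
  fixes q R s :: real
  assumes "0 < q" "q < 1" "0 < R" "0 \<le> s"
  shows "s powr q \<le> R powr q + q * R powr (q - 1) * (s - R)"
proof (cases "s = 0")
  case True
  have "q * (R powr (q - 1) * R) = q * R powr q" using assms by (simp add: powr_mult_base powr_diff)
  then show ?thesis using True assms by (simp add: mult.assoc)
next
  case False
  then have s: "s > 0" using assms by simp
  have "(s / R) powr q * 1 powr (1 - q) \<le> q * (s / R) + (1 - q) * 1"
    by (rule Youngs_inequality_0) (use assms s in auto)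
  then have "(s / R) powr q * R powr q \<le> (q * (s / R) + (1 - q)) * R powr q" by (intro mult_right_mono) auto
  moreover have "(s / R) powr q * R powr q = s powr q" using assms s by (simp add: powr_divide)
  moreover have "(q * (s / R) + (1 - q)) * R powr q = R powr q + q * R powr (q - 1) * (s - R)"
    using assms by (simp add: powr_diff field_simps)
  ultimately show ?thesis by simp
qed

lemma tanh_square_eq: "(tanh x)\<^sup>2 = 1 - 1 / (cosh (x::real))\<^sup>2"
proof -
  have c: "(cosh x)\<^sup>2 \<noteq> 0" by simp
  have "1 - 1 / (cosh x)\<^sup>2 = ((cosh x)\<^sup>2 - 1) / (cosh x)\<^sup>2" using c by (simp add: diff_divide_distrib)
  also have "(cosh x)\<^sup>2 - 1 = (sinh x)\<^sup>2" using hyperbolic_pythagoras[of x] by linarith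
  finally show ?thesis by (simp add: tanh_def power_divide)
qed

lemma distribution_AC:
  fixes f :: "real \<Rightarrow> real"
  assumes f: "integrable lborel f"
  shows "indefinite_integral_of f (\<lambda>x. LINT r:{..x}|lborel. f r)"
  unfolding indefinite_integral_of_def
proof (intro allI impI conjI)
  fix x y :: real assume xy: "x \<le> y"
  have si: "set_integrable lborel A f" if "A \<in> sets borel" for A
    unfolding set_integrable_def by (rule integrable_mult_indicator[OF _ f]) (use that in simp)
  then show "set_integrable lborel {x<..y} f" by simp
  have u: "{..y} = {..x} \<union> {x<..y}" using xy by auto
  show "(LINT r:{..y}|lborel. f r) = (LINT r:{..x}|lborel. f r) + (LINT r:{x<..y}|lborel. f r)"
    unfolding u by (rule set_integral_Un) (auto intro!: si)
qed

locale soliton =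
  fixes q w :: real
  assumes q: "0 < q" "q < 1" and w: "0 < w"
begin

text \<open>With \<open>p = 2q + 1\<close>, the profile is the square root of \<open>rho\<close> glued from two translates, and \<open>tau\<close>
  is the logarithmic derivative of \<open>sqrt rho\<close>.\<close>

definition "k = q * sqrt w"
definition "rho x = ((q + 1) * w) powr (1 / q) * cosh (k * x) powr (- 2 / q)"
definition "tau x = - sqrt w * tanh (k * x)"

lemma k_pos: "k > 0" using q w by (simp add: k_def)

lemma rho_pos: "rho x > 0"
proof -
  have "(q + 1) * w > 0" "cosh (k * x) > 0" using q w by (auto intro: cosh_real_pos)
  then show ?thesis unfolding rho_def by (intro mult_pos_pos powr_gt_zero[THEN iffD2]) (metis less_irrefl)+
qed

lemma tau_bound: "\<bar>tau x\<bar> \<le> sqrt w"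
proof -
  have "\<bar>tanh (k * x)\<bar> \<le> 1" using tanh_real_lt_1[of "k * x"] tanh_real_gt_neg1[of "k * x"] by linarith
  then show ?thesis using w by (simp add: tau_def abs_mult mult_left_le)
qed

lemma DERIV_rho: "(rho has_real_derivative 2 * tau x * rho x) (at x)"
proof -
  have c: "cosh (k * x) > 0" by (rule cosh_real_pos)
  have "((\<lambda>x. cosh (k * x) powr (- 2 / q)) has_real_derivative (- 2 / q) * cosh (k * x) powr (- 2 / q - 1) * (sinh (k * x) * k)) (at x)"
    using c by (auto intro!: derivative_eq_intros)
  then have "(rho has_real_derivative ((q + 1) * w) powr (1 / q) * ((- 2 / q) * cosh (k * x) powr (- 2 / q - 1) * (sinh (k * x) * k))) (at x)"
    unfolding rho_def[abs_def] by (rule DERIV_cmult)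
  moreover have "((q + 1) * w) powr (1 / q) * ((- 2 / q) * cosh (k * x) powr (- 2 / q - 1) * (sinh (k * x) * k)) = 2 * tau x * rho x"
  proof -
    have "cosh (k * x) powr (- 2 / q - 1) = cosh (k * x) powr (- 2 / q) / cosh (k * x)" using c by (simp add: powr_diff)
    then show ?thesis using q c by (simp add: tau_def rho_def tanh_def k_def)
  qed
  ultimately show ?thesis by simp
qed

lemma rho_powr_q: "rho x powr q = (q + 1) * w / (cosh (k * x))\<^sup>2"
proof -
  have c: "cosh (k * x) > 0" and p: "(q + 1) * w > 0" using q w by (auto intro: cosh_real_pos)
  have "rho x powr q = (((q + 1) * w) powr (1 / q)) powr q * (cosh (k * x) powr (- 2 / q)) powr q"
    unfolding rho_def by (rule powr_mult)
  also have "\<dots> = ((q + 1) * w) * cosh (k * x) powr (- 2)" using q p by (simp add: powr_powr)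
  also have "cosh (k * x) powr (- 2) = 1 / (cosh (k * x))\<^sup>2" using c by (simp add: powr_minus_divide powr_numeral)
  finally show ?thesis by simp
qed

text \<open>Together with \<open>tau_square\<close> this is the Riccati form
  \<open>tau' = w - rho^q - tau^2\<close> of the soliton equation.\<close>

lemma DERIV_tau: "(tau has_real_derivative - (q / (q + 1)) * rho x powr q) (at x)"
proof -
  have c: "cosh (k * x) > 0" by (rule cosh_real_pos)
  have "(tau has_real_derivative - sqrt w * ((1 - (tanh (k * x))\<^sup>2) * k)) (at x)"
    unfolding tau_def[abs_def] using c by (auto intro!: derivative_eq_intros)
  moreover have "1 - (tanh (k * x))\<^sup>2 = 1 / (cosh (k * x))\<^sup>2" by (simp add: tanh_square_eq)
  moreover have "- sqrt w * ((1 / (cosh (k * x))\<^sup>2) * k) = - (q / (q + 1)) * rho x powr q"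
  proof -
    have "- sqrt w * ((1 / C) * (q * sqrt w)) = - (q / (q + 1)) * ((q + 1) * w / C)" for C
    proof -
      have "- sqrt w * ((1 / C) * (q * sqrt w)) = - (q * (sqrt w * sqrt w) / C)" by (simp only: mult_ac) simp
      also have "sqrt w * sqrt w = w" using w by simp
      also have "- (q * w / C) = - (q / (q + 1)) * ((q + 1) * w / C)" using q by simp
      finally show ?thesis .
    qed
    then show ?thesis unfolding rho_powr_q k_def .
  qed
  ultimately show ?thesis by simp
qed

text \<open>The first integral \<open>phi'^2 = w phi^2 - phi^(2q+2) / (q+1)\<close> of the soliton
  equation, divided by \<open>phi^2\<close>, where \<open>phi = sqrt rho\<close>.\<close>

lemma tau_square: "(tau x)\<^sup>2 = w - rho x powr q / (q + 1)"
proof -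
  have c: "cosh (k * x) > 0" by (rule cosh_real_pos)
  have "(tanh (k * x))\<^sup>2 = 1 - 1 / (cosh (k * x))\<^sup>2" by (rule tanh_square_eq)
  then have "(tau x)\<^sup>2 = w * (1 - 1 / (cosh (k * x))\<^sup>2)" using w by (simp add: tau_def power_mult_distrib)
  also have "\<dots> = w - (q + 1) * w / (cosh (k * x))\<^sup>2 / (q + 1)" using q by (simp add: right_diff_distrib)
  finally show ?thesis unfolding rho_powr_q .
qed

lemma rho_minus: "rho (- x) = rho x" by (simp add: rho_def)

lemma rho_antimono: "0 \<le> x \<Longrightarrow> x \<le> y \<Longrightarrow> rho y \<le> rho x"
  using q k_pos by (auto simp: rho_def intro!: mult_left_mono powr_mono2' cosh_real_nonneg_le_iff[THEN iffD2] cosh_real_pos)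

lemma rho_antimono_abs: "\<bar>x\<bar> \<le> \<bar>y\<bar> \<Longrightarrow> rho y \<le> rho x"
  using rho_antimono[of "\<bar>x\<bar>" "\<bar>y\<bar>"] rho_minus by (auto simp: abs_if split: if_splits)

lemma rho_continuous: "continuous_on S rho"
  using DERIV_rho by (meson DERIV_isCont continuous_at_imp_continuous_on)

lemma tau_continuous: "continuous_on S tau"
  using DERIV_tau by (meson DERIV_isCont continuous_at_imp_continuous_on)

lemma rho_measurable [measurable]: "rho \<in> borel_measurable borel" "tau \<in> borel_measurable borel"
  by (intro borel_measurable_continuous_onI rho_continuous tau_continuous)+

text \<open>Up to a constant factor \<open>rho powr q\<close> is the derivative of
  \<open>- tau\<close>, which has finite limits at both ends.\<close>

lemma rho_powr_integrable: "integrable lborel (\<lambda>x. rho x powr q)"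
proof -
  have lim: "(tanh \<longlongrightarrow> 1) (at_top :: real filter)" "(tanh \<longlongrightarrow> -1) (at_bot :: real filter)"
    by (rule tanh_real_at_top tanh_real_at_bot)+
  have ft: "filterlim (\<lambda>x. k * x) at_top at_top"
    by (rule filterlim_tendsto_pos_mult_at_top[OF tendsto_const k_pos filterlim_ident])
  have fb: "filterlim (\<lambda>x. k * x) at_bot at_bot"
    by (rule filterlim_tendsto_pos_mult_at_bot[OF tendsto_const k_pos filterlim_ident])
  have t: "((\<lambda>x. - tau x) \<longlongrightarrow> sqrt w) at_top" "((\<lambda>x. - tau x) \<longlongrightarrow> - sqrt w) at_bot"
    using tendsto_mult[OF tendsto_const[of "sqrt w"] filterlim_compose[OF lim(1) ft]]
      tendsto_mult[OF tendsto_const[of "sqrt w"] filterlim_compose[OF lim(2) fb]] by (simp_all add: tau_def[abs_def])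
  have "set_integrable lborel (einterval (-\<infinity>) \<infinity>) (\<lambda>x. (q / (q + 1)) * rho x powr q)"
  proof (rule interval_integral_FTC_nonneg(1)[where F="\<lambda>x. - tau x"])
    show "((\<lambda>x. - tau x) has_real_derivative (q / (q + 1)) * rho x powr q) (at x)" for x
      using DERIV_minus[OF DERIV_tau, of x] by simp
    show "isCont (\<lambda>x. (q / (q + 1)) * rho x powr q) x" for x
      using rho_pos[of x] DERIV_isCont[OF DERIV_rho] by (intro continuous_intros) auto
    show "AE x in lborel. - \<infinity> < ereal x \<longrightarrow> ereal x < \<infinity> \<longrightarrow> 0 \<le> (q / (q + 1)) * rho x powr q"
      using q by auto
    show "(((\<lambda>x. - tau x) \<circ> real_of_ereal) \<longlongrightarrow> - sqrt w) (at_right (- \<infinity>))"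
      using t(2) by (simp add: ereal_tendsto_simps)
    show "(((\<lambda>x. - tau x) \<circ> real_of_ereal) \<longlongrightarrow> sqrt w) (at_left \<infinity>)"
      using t(1) by (simp add: ereal_tendsto_simps)
  qed auto
  then have "integrable lborel (\<lambda>x. (q / (q + 1)) * rho x powr q)" by (simp add: set_integrable_def)
  from integrable_mult_right[OF this, of "(q + 1) / q"] show ?thesis using q by simp
qed

lemma rho_le_max: "rho x \<le> rho 0"
  using rho_antimono_abs[of 0 x] by simp

text \<open>\<open>rho\<close> is bounded and \<open>q < 1\<close>, so \<open>rho\<close> is
  dominated by a multiple of \<open>rho powr q\<close>.\<close>

lemma rho_integrable: "integrable lborel rho"
proof (rule Bochner_Integration.integrable_bound[OF integrable_mult_right[OF rho_powr_integrable, of "rho 0 powr (1 - q)"]])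
  show "AE x in lborel. norm (rho x) \<le> norm (rho 0 powr (1 - q) * rho x powr q)"
  proof (rule AE_I2)
    fix x
    have "rho x = rho x powr (1 - q) * rho x powr q" using rho_pos[of x] by (simp add: powr_add[symmetric])
    also have "\<dots> \<le> rho 0 powr (1 - q) * rho x powr q"
      using rho_le_max[of x] rho_pos[of x] q by (intro mult_right_mono powr_mono2) auto
    finally show "norm (rho x) \<le> norm (rho 0 powr (1 - q) * rho x powr q)" using rho_pos[of x] by simp
  qed
qed measurable

definition "N x = (LINT r:{..x}|lborel. rho r)"
definition "M = (LINT r|lborel. rho r)"

lemma N_AC: "indefinite_integral_of rho N"
  unfolding N_def[abs_def] by (rule distribution_AC[OF rho_integrable])

end

lemma indefinite_integral_of_DERIV_continuous:
  fixes g v :: "real \<Rightarrow> real"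
  assumes a: "indefinite_integral_of g v" and c: "continuous_on UNIV g"
  shows "(v has_real_derivative g x) (at x)"
proof -
  have "((\<lambda>u. integral {x-1..u} g) has_real_derivative g x) (at x within {x-1..x+1})"
    by (rule integral_has_real_derivative) (auto intro: continuous_on_subset[OF c])
  then have "((\<lambda>u. v (x-1) + integral {x-1..u} g) has_real_derivative g x) (at x)"
    by (auto intro!: derivative_eq_intros simp: at_within_interior[of x "{x-1..x+1}"])
  then show ?thesis
    by (rule DERIV_cong_ev[THEN iffD1, OF refl _ refl, rotated])
       (rule eventually_mono[OF eventually_nhds_in_open[of "{x-1<..<x+1}" x]], auto simp: indefinite_integral_of_Icc(3)[OF a, symmetric])
qed

lemma distribution_limits:
  fixes f :: "real \<Rightarrow> real"
  assumes f: "integrable lborel f"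
  shows "((\<lambda>x. LINT r:{..x}|lborel. f r) \<longlongrightarrow> 0) at_bot" "((\<lambda>x. LINT r:{..x}|lborel. f r) \<longlongrightarrow> (LINT r|lborel. f r)) at_top"
proof -
  have [measurable]: "f \<in> borel_measurable borel" using f by simp
  have i: "integrable lborel (\<lambda>r. norm (f r))" using f by simp
  show "((\<lambda>x. LINT r:{..x}|lborel. f r) \<longlongrightarrow> (LINT r|lborel. f r)) at_top"
  proof (rule tendsto_at_topI_sequentially)
    fix X :: "nat \<Rightarrow> real" assume X: "filterlim X at_top sequentially"
    show "(\<lambda>n. LINT r:{..X n}|lborel. f r) \<longlonglongrightarrow> (LINT r|lborel. f r)"
      unfolding set_lebesgue_integral_def
    proof (rule integral_dominated_convergence[OF _ _ i])
      show "AE r in lborel. (\<lambda>n. indicator {..X n} r *\<^sub>R f r) \<longlonglongrightarrow> f r"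
      proof (rule AE_I2)
        fix r
        have "eventually (\<lambda>n. r \<le> X n) sequentially" using X unfolding filterlim_at_top by blast
        then show "(\<lambda>n. indicator {..X n} r *\<^sub>R f r) \<longlonglongrightarrow> f r"
          by (intro tendsto_eventually) (erule eventually_mono, simp)
      qed
    qed (auto simp: indicator_def)
  qed
  have "((\<lambda>x. LINT r:{..- x}|lborel. f r) \<longlongrightarrow> 0) at_top"
  proof (rule tendsto_at_topI_sequentially)
    fix X :: "nat \<Rightarrow> real" assume X: "filterlim X at_top sequentially"
    have "(\<lambda>n. LINT r:{..- X n}|lborel. f r) \<longlonglongrightarrow> (LINT r::real|lborel. (0::real))"
      unfolding set_lebesgue_integral_def
    proof (rule integral_dominated_convergence[OF _ _ i])
      show "AE r in lborel. (\<lambda>n. indicator {..- X n} r *\<^sub>R f r) \<longlonglongrightarrow> 0"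
      proof (rule AE_I2)
        fix r
        have "eventually (\<lambda>n. - r + 1 \<le> X n) sequentially" using X unfolding filterlim_at_top by blast
        then show "(\<lambda>n. indicator {..- X n} r *\<^sub>R f r) \<longlonglongrightarrow> 0"
          by (intro tendsto_eventually) (erule eventually_mono, simp)
      qed
    qed (auto simp: indicator_def)
    then show "(\<lambda>n. LINT r:{..- X n}|lborel. f r) \<longlonglongrightarrow> 0" by simp
  qed
  then show "((\<lambda>x. LINT r:{..x}|lborel. f r) \<longlongrightarrow> 0) at_bot"
    by (subst filterlim_at_bot_mirror)
qed

section \<open>The soliton parametrised by the mass to its left\<close>

context soliton
begin

lemma DERIV_N: "(N has_real_derivative rho x) (at x)"
  by (rule indefinite_integral_of_DERIV_continuous[OF N_AC rho_continuous])

lemma N_strict_mono: "x < y \<Longrightarrow> N x < N y"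
  by (rule DERIV_pos_imp_increasing) (use DERIV_N rho_pos in blast)+

lemma N_limits: "(N \<longlongrightarrow> 0) at_bot" "(N \<longlongrightarrow> M) at_top"
  using distribution_limits[OF rho_integrable] by (simp_all add: N_def[abs_def] M_def)

lemma N_bounds: "0 < N x" "N x < M"
proof -
  have mono: "N x \<le> N y" if "x \<le> y" for x y using N_strict_mono[of x y] that by (cases "x = y") auto
  have "0 \<le> N y" for y
    by (rule tendsto_upperbound[OF N_limits(1)])
       (use mono in \<open>auto simp: eventually_at_bot_linorder\<close>)
  then show "0 < N x" using N_strict_mono[of "x - 1" x] by (meson le_less_trans less_add_one diff_less_eq)
  have "N y \<le> M" for y
    by (rule tendsto_lowerbound[OF N_limits(2)])
       (use mono in \<open>auto simp: eventually_at_top_linorder\<close>)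
  then show "N x < M" using N_strict_mono[of x "x + 1"] by (meson less_le_trans less_add_one)
qed

lemma N_minus: "N (- x) = M - N x"
proof -
  have "((\<lambda>x. N (- x) + N x) has_real_derivative 0) (at x)" for x
    by (rule DERIV_cong[OF DERIV_add[OF DERIV_chain2[OF DERIV_N DERIV_minus[OF DERIV_ident]] DERIV_N]]) (simp add: rho_minus)
  then have c: "N (- x) + N x = N (- y) + N y" for x y
    using DERIV_isconst_all[of "\<lambda>x. N (- x) + N x"] by blast
  have "((\<lambda>y. N (- y) + N y) \<longlongrightarrow> 0 + M) at_top"
    by (intro tendsto_add N_limits filterlim_compose[OF N_limits(1) filterlim_uminus_at_bot_at_top])
  moreover have "(\<lambda>y. N (- y) + N y) = (\<lambda>y. N (- x) + N x)" by (intro ext) (rule c)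
  ultimately have "((\<lambda>y::real. N (- x) + N x) \<longlongrightarrow> M) at_top" by (simp only: add_0_left)
  then have "N (- x) + N x = M" by (simp add: tendsto_const_iff)
  then show ?thesis by simp
qed

text \<open>\<open>X m\<close> is meaningful for \<open>0 < m < M\<close> only, and so are \<open>R m\<close>, \<open>T m\<close> and \<open>K m\<close> below.\<close>

definition "X m = (SOME x. N x = m)"

lemma N_X: "0 < m \<Longrightarrow> m < M \<Longrightarrow> N (X m) = m"
proof -
  assume m: "0 < m" "m < M"
  obtain a where a: "N a < m"
    using eventually_happens[OF order_tendstoD(2)[OF N_limits(1) m(1)]] by (auto simp: trivial_limit_at_bot_linorder)
  obtain b where b: "m < N b"
    using eventually_happens[OF order_tendstoD(1)[OF N_limits(2) m(2)]] by auto
  have "a \<le> b" using a b N_strict_mono[of b a] by (cases "a \<le> b") auto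
  then obtain x where "N x = m"
    using IVT[of N a m b] a b DERIV_isCont[OF DERIV_N] by auto
  then show ?thesis unfolding X_def by (rule someI)
qed

lemma N_inj: "N x = N y \<Longrightarrow> x = y"
  using N_strict_mono[of x y] N_strict_mono[of y x] by (cases x y rule: linorder_cases) auto

lemma X_N: "X (N x) = x"
  using N_X[OF N_bounds] N_inj by blast

lemma DERIV_X: "0 < m \<Longrightarrow> m < M \<Longrightarrow> (X has_real_derivative inverse (rho (X m))) (at m)"
proof (rule DERIV_inverse_function[where f=N and a=0 and b=M])
  assume m: "0 < m" "m < M"
  have "isCont X (N (X m))"
    by (rule isCont_inverse_function[where d=1]) (auto simp: X_N intro: DERIV_isCont[OF DERIV_N])
  then show "isCont X m" using N_X[OF m] by simp
  show "(N has_real_derivative rho (X m)) (at (X m))" by (rule DERIV_N)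
  show "rho (X m) \<noteq> 0" using rho_pos[of "X m"] by simp
qed (auto intro: N_X)

text \<open>\<open>K\<close> is the primitive of \<open>w/2 - q/(2(q + 1)) R\<^sup>q\<close> that vanishes at \<open>0\<close>.\<close>

definition "R m = rho (X m)"
definition "T m = tau (X m)"
definition "K m = w * (2 - q) / (2 * (2 + q)) * m + q / (2 * (2 + q)) * (R m * T m)"

lemma R_pos: "R m > 0" by (simp add: R_def rho_pos)
lemma T_bound: "\<bar>T m\<bar> \<le> sqrt w" by (simp add: T_def tau_bound)
lemma T_square: "(T m)\<^sup>2 = w - R m powr q / (q + 1)" by (simp add: T_def R_def tau_square)

lemma DERIV_R: "0 < m \<Longrightarrow> m < M \<Longrightarrow> (R has_real_derivative 2 * T m) (at m)"
  unfolding R_def[abs_def] T_def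
  by (rule DERIV_cong[OF DERIV_chain2[OF DERIV_rho DERIV_X]]) (use rho_pos[of "X m"] in simp_all)

lemma DERIV_T: "0 < m \<Longrightarrow> m < M \<Longrightarrow> (T has_real_derivative - (q / (q + 1)) * R m powr (q - 1)) (at m)"
  unfolding T_def[abs_def] R_def
  by (rule DERIV_cong[OF DERIV_chain2[OF DERIV_tau DERIV_X]]) (use rho_pos[of "X m"] in \<open>simp_all add: powr_diff divide_inverse\<close>)

text \<open>The product rule and \<open>T_square\<close> give
  \<open>(R T)' = 2 w - (q + 2) / (q + 1) R^q\<close>. The coefficient of \<open>R T\<close> in
  \<open>K\<close> is chosen to produce the required multiple of \<open>R^q\<close>, and the linear
  term corrects the constant to \<open>w / 2\<close>.\<close>

lemma DERIV_K: "0 < m \<Longrightarrow> m < M \<Longrightarrow> (K has_real_derivative w / 2 - q / (2 * (q + 1)) * R m powr q) (at m)"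
proof -
  assume m: "0 < m" "m < M"
  have "(K has_real_derivative w * (2 - q) / (2 * (2 + q)) + q / (2 * (2 + q)) * (2 * T m * T m + R m * (- (q / (q + 1)) * R m powr (q - 1)))) (at m)"
    unfolding K_def[abs_def]
    by (rule DERIV_cong[OF DERIV_add[OF DERIV_cmult[OF DERIV_ident] DERIV_cmult[OF DERIV_mult[OF DERIV_R[OF m] DERIV_T[OF m]]]]])
       (simp add: mult_ac)
  moreover have "w * (2 - q) / (2 * (2 + q)) + q / (2 * (2 + q)) * (2 * T m * T m + R m * (- (q / (q + 1)) * R m powr (q - 1))) = w / 2 - q / (2 * (q + 1)) * R m powr q"
  proof -
    have r: "R m * R m powr (q - 1) = R m powr q" using R_pos[of m] by (simp add: powr_diff)
    have t: "T m * T m = w - R m powr q / (q + 1)" using T_square by (simp add: power2_eq_square)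
    have "R m * (- (q / (q + 1)) * R m powr (q - 1)) = - (q / (q + 1)) * R m powr q" using r by (simp add: algebra_simps)
    moreover have "2 * T m * T m = 2 * (w - R m powr q / (q + 1))" using t by simp
    moreover have "w * (2 - q) / (2 * (2 + q)) + q / (2 * (2 + q)) * (2 * (w - Z / (q + 1)) + - (q / (q + 1)) * Z) = w / 2 - q / (2 * (q + 1)) * Z" for Z
    proof -
      have p: "2 + q > 0" "q + 1 > 0" "4 + 2 * q > 0" using q by auto
      then show ?thesis by (simp add: divide_simps) (simp add: algebra_simps)
    qed
    ultimately show ?thesis by (simp only:)
  qed
  ultimately show ?thesis by simp
qed

lemma rho_tendsto_bot: "(rho \<longlongrightarrow> 0) at_bot"
proof -
  have "filterlim (\<lambda>x. k * x) at_bot at_bot"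
    by (rule filterlim_tendsto_pos_mult_at_bot[OF tendsto_const k_pos filterlim_ident])
  then have "filterlim (\<lambda>x. cosh (k * x)) at_top at_bot" by (rule filterlim_compose[OF cosh_real_at_bot])
  then have "((\<lambda>x. cosh (k * x) powr (- 2 / q)) \<longlongrightarrow> 0) at_bot" using q by (intro tendsto_neg_powr) auto
  then have "((\<lambda>x. ((q + 1) * w) powr (1 / q) * cosh (k * x) powr (- 2 / q)) \<longlongrightarrow> ((q + 1) * w) powr (1 / q) * 0) at_bot" by (intro tendsto_intros)
  then show ?thesis by (simp add: rho_def[abs_def])
qed

text \<open>The difference \<open>2 sqrt w N - rho\<close> has the nonnegative derivative
  \<open>2 (sqrt w - tau) rho\<close> and tends to zero at \<open>-\<infinity>\<close>. The bound
  makes \<open>R m\<close> and \<open>K m\<close> vanish with \<open>m\<close>, so the calibration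
  leaves no boundary term at infinity.\<close>

lemma rho_le_N: "rho x \<le> 2 * sqrt w * N x"
proof -
  define f where "f x = 2 * sqrt w * N x - rho x" for x
  have df: "(f has_real_derivative 2 * (sqrt w - tau x) * rho x) (at x)" for x
    unfolding f_def by (auto intro!: derivative_eq_intros DERIV_N DERIV_rho simp: algebra_simps)
  have "0 \<le> 2 * (sqrt w - tau x) * rho x" for x using tau_bound[of x] rho_pos[of x] by (intro mult_nonneg_nonneg) auto
  then have mono: "f y \<le> f x" if "y \<le> x" for x y
    using that df by (intro DERIV_nonneg_imp_nondecreasing[of y x f]) blast+
  have "(f \<longlongrightarrow> 2 * sqrt w * 0 - 0) at_bot" unfolding f_def[abs_def] by (intro tendsto_intros N_limits rho_tendsto_bot)
  then have "0 \<le> f x"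
    by (intro tendsto_upperbound[where f=f and F=at_bot]) (use mono in \<open>auto simp: eventually_at_bot_linorder\<close>)
  then show ?thesis by (simp add: f_def)
qed

lemma R_le: "0 < m \<Longrightarrow> m < M \<Longrightarrow> R m \<le> 2 * sqrt w * m"
  using rho_le_N[of "X m"] N_X[of m] by (simp add: R_def)

lemma K_bound: "0 < m \<Longrightarrow> m < M \<Longrightarrow> \<bar>K m\<bar> \<le> 3 * w * m"
proof -
  assume m: "0 < m" "m < M"
  have "\<bar>R m * T m\<bar> \<le> (2 * sqrt w * m) * sqrt w"
    unfolding abs_mult using R_le[OF m] R_pos[of m] T_bound[of m] m w by (intro mult_mono) auto
  also have "(2 * sqrt w * m) * sqrt w = 2 * (sqrt w * sqrt w) * m" by (simp only: mult_ac)
  finally have rt: "\<bar>R m * T m\<bar> \<le> 2 * w * m" using w by simp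
  define a where "a = w * (2 - q) / (2 * (2 + q))"
  define b where "b = q / (2 * (2 + q))"
  have c1: "0 \<le> a" "a \<le> w" using q w by (auto simp: a_def divide_simps)
  have c2: "0 \<le> b" "b \<le> 1" using q by (auto simp: b_def divide_simps)
  have "\<bar>K m\<bar> \<le> \<bar>a * m\<bar> + \<bar>b * (R m * T m)\<bar>" unfolding K_def a_def b_def by (rule abs_triangle_ineq)
  also have "\<dots> \<le> w * m + 1 * (2 * w * m)"
    unfolding abs_mult[of a] abs_mult[of b] using c1 c2 rt m w by (intro add_mono mult_mono) auto
  finally show ?thesis by (simp add: mult_ac)
qed

text \<open>As a function of the mass, \<open>R\<close> is even around \<open>M / 2\<close> and
  decreases away from it. For \<open>mu \<le> M\<close> the larger mass \<open>mu / 2 + t\<close> is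
  at least as close to \<open>M / 2\<close> as the smaller one.\<close>

lemma R_symmetric_le:
  assumes "0 \<le> t" "t < mu / 2" "mu \<le> M"
  shows "R (mu / 2 - t) \<le> R (mu / 2 + t)"
proof -
  define x1 where "x1 = X (mu / 2 - t)"
  define x2 where "x2 = X (mu / 2 + t)"
  have n: "N x1 = mu / 2 - t" "N x2 = mu / 2 + t" unfolding x1_def x2_def by (rule N_X; use assms in simp)+
  have le: "N x \<le> N y \<longleftrightarrow> x \<le> y" for x y
    using N_strict_mono[of x y] N_strict_mono[of y x] by (cases x y rule: linorder_cases) auto
  have "x1 \<le> x2" using n assms(1) le[of x1 x2] by simp
  moreover have "x1 \<le> - x2" using n assms le[of x1 "- x2"] N_minus[of x2] by simp
  ultimately have "\<bar>x2\<bar> \<le> \<bar>x1\<bar>" by (auto simp: abs_if)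
  then show ?thesis unfolding R_def x1_def[symmetric] x2_def[symmetric] by (rule rho_antimono_abs)
qed

text \<open>By the first two estimates a total mass \<open>mu\<close> split evenly gives the weakest
  lower bound; the third measures how uneven a split is by the jump of \<open>R\<close>. The first
  two differentiate in \<open>t\<close> and use \<open>R_symmetric_le\<close>: the derivative of
  \<open>T\<close> involves the power \<open>q - 1\<close>, which reverses the order, that of
  \<open>K\<close> the power \<open>q\<close>. The third is the first one integrated.\<close>

lemma symmetric_bounds:
  assumes t: "0 \<le> t" "t < mu / 2" "mu \<le> M"
  shows "2 * T (mu / 2) \<le> T (mu / 2 + t) + T (mu / 2 - t)"
    and "K (mu / 2 + t) + K (mu / 2 - t) \<le> 2 * K (mu / 2)"
    and "4 * T (mu / 2) * t \<le> R (mu / 2 + t) - R (mu / 2 - t)"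
proof -
  have in1: "0 < mu / 2 + s" "mu / 2 + s < M" "0 < mu / 2 - s" "mu / 2 - s < M" if "0 \<le> s" "s \<le> t" for s
    using that t by auto
  have plus: "((\<lambda>s. f (mu / 2 + s)) has_real_derivative d) (at s)" if "(f has_real_derivative d) (at (mu / 2 + s))" for f d s
    using DERIV_chain2[where f=f and g="\<lambda>s. mu / 2 + s", OF that DERIV_add[OF DERIV_const DERIV_ident]] by simp
  have minus: "((\<lambda>s. f (mu / 2 - s)) has_real_derivative - d) (at s)" if "(f has_real_derivative d) (at (mu / 2 - s))" for f d s
    using DERIV_chain2[where f=f and g="\<lambda>s. mu / 2 - s", OF that DERIV_diff[OF DERIV_const DERIV_ident]] by simp
  have T: "2 * T (mu / 2) \<le> T (mu / 2 + r) + T (mu / 2 - r)" if r: "0 \<le> r" "r \<le> t" for r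
  proof -
    have "(\<lambda>s. T (mu / 2 + s) + T (mu / 2 - s)) 0 \<le> (\<lambda>s. T (mu / 2 + s) + T (mu / 2 - s)) r"
    proof (rule DERIV_nonneg_imp_nondecreasing[OF r(1)])
      fix s assume s: "0 \<le> s" "s \<le> r"
      then have st: "0 \<le> s" "s \<le> t" using r by auto
      have "((\<lambda>s. T (mu / 2 + s) + T (mu / 2 - s)) has_real_derivative
        - (q / (q + 1)) * R (mu / 2 + s) powr (q - 1) + - (- (q / (q + 1)) * R (mu / 2 - s) powr (q - 1))) (at s)"
        by (rule DERIV_add[OF plus[OF DERIV_T] minus[OF DERIV_T]]) (use in1[OF st] in auto)
      moreover have "R (mu / 2 + s) powr (q - 1) \<le> R (mu / 2 - s) powr (q - 1)"
        using R_symmetric_le[of s mu] st t R_pos q by (intro powr_mono2') auto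
      then have "0 \<le> - (q / (q + 1)) * R (mu / 2 + s) powr (q - 1) + - (- (q / (q + 1)) * R (mu / 2 - s) powr (q - 1))"
        using q by (simp add: divide_right_mono mult_left_mono)
      ultimately show "\<exists>y. ((\<lambda>s. T (mu / 2 + s) + T (mu / 2 - s)) has_real_derivative y) (at s) \<and> 0 \<le> y" by blast
    qed
    then show ?thesis by simp
  qed
  then show "2 * T (mu / 2) \<le> T (mu / 2 + t) + T (mu / 2 - t)" using t by auto
  have "(\<lambda>s. K (mu / 2 + s) + K (mu / 2 - s)) t \<le> (\<lambda>s. K (mu / 2 + s) + K (mu / 2 - s)) 0"
  proof (rule DERIV_nonpos_imp_nonincreasing[OF t(1)])
    fix s assume s: "0 \<le> s" "s \<le> t"
    have "((\<lambda>s. K (mu / 2 + s) + K (mu / 2 - s)) has_real_derivative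
      (w / 2 - q / (2 * (q + 1)) * R (mu / 2 + s) powr q) + - (w / 2 - q / (2 * (q + 1)) * R (mu / 2 - s) powr q)) (at s)"
      by (rule DERIV_add[OF plus[OF DERIV_K] minus[OF DERIV_K]]) (use in1[OF s] in auto)
    moreover have "R (mu / 2 - s) powr q \<le> R (mu / 2 + s) powr q"
      using R_symmetric_le[of s mu] s t R_pos[of "mu / 2 - s"] q by (intro powr_mono2) auto
    then have "q / (2 * (q + 1)) * R (mu / 2 - s) powr q \<le> q / (2 * (q + 1)) * R (mu / 2 + s) powr q" using q by (intro mult_left_mono) auto
    then have "(w / 2 - q / (2 * (q + 1)) * R (mu / 2 + s) powr q) + - (w / 2 - q / (2 * (q + 1)) * R (mu / 2 - s) powr q) \<le> 0" by linarith
    ultimately show "\<exists>y. ((\<lambda>s. K (mu / 2 + s) + K (mu / 2 - s)) has_real_derivative y) (at s) \<and> y \<le> 0" by blast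
  qed
  then show "K (mu / 2 + t) + K (mu / 2 - t) \<le> 2 * K (mu / 2)" by simp
  have "(\<lambda>s. R (mu / 2 + s) - R (mu / 2 - s) - 4 * T (mu / 2) * s) 0 \<le> (\<lambda>s. R (mu / 2 + s) - R (mu / 2 - s) - 4 * T (mu / 2) * s) t"
  proof (rule DERIV_nonneg_imp_nondecreasing[OF t(1)])
    fix s assume s: "0 \<le> s" "s \<le> t"
    have "((\<lambda>s. R (mu / 2 + s) - R (mu / 2 - s) - 4 * T (mu / 2) * s) has_real_derivative
      2 * T (mu / 2 + s) - - (2 * T (mu / 2 - s)) - 4 * T (mu / 2) * 1) (at s)"
      by (rule DERIV_diff[OF DERIV_diff[OF plus[OF DERIV_R] minus[OF DERIV_R]] DERIV_cmult[OF DERIV_ident]]) (use in1[OF s] in auto)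
    moreover have "0 \<le> 2 * T (mu / 2 + s) - - (2 * T (mu / 2 - s)) - 4 * T (mu / 2) * 1" using T[OF s] by simp
    ultimately show "\<exists>y. ((\<lambda>s. R (mu / 2 + s) - R (mu / 2 - s) - 4 * T (mu / 2) * s) has_real_derivative y) (at s) \<and> 0 \<le> y" by blast
  qed
  then show "4 * T (mu / 2) * t \<le> R (mu / 2 + t) - R (mu / 2 - t)" by simp
qed

end

section \<open>The calibration inequality\<close>

lemma product_integrable_of_squares:
  fixes f g :: "'a \<Rightarrow> real"
  assumes [measurable]: "f \<in> borel_measurable M" "g \<in> borel_measurable M"
    and i: "integrable M (\<lambda>x. (f x)\<^sup>2)" "integrable M (\<lambda>x. (g x)\<^sup>2)"
  shows "integrable M (\<lambda>x. f x * g x)"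
proof (rule Bochner_Integration.integrable_bound[OF Bochner_Integration.integrable_add[OF i]])
  show "AE x in M. norm (f x * g x) \<le> norm ((f x)\<^sup>2 + (g x)\<^sup>2)"
  proof (rule AE_I2)
    fix x
    have "2 * \<bar>f x\<bar> * \<bar>g x\<bar> \<le> (f x)\<^sup>2 + (g x)\<^sup>2" using sum_squares_bound[of "\<bar>f x\<bar>" "\<bar>g x\<bar>"] by simp
    moreover have "0 \<le> \<bar>f x\<bar> * \<bar>g x\<bar>" by simp
    ultimately have "\<bar>f x\<bar> * \<bar>g x\<bar> \<le> (f x)\<^sup>2 + (g x)\<^sup>2" by linarith
    then show "norm (f x * g x) \<le> norm ((f x)\<^sup>2 + (g x)\<^sup>2)" by (simp add: abs_mult)
  qed
qed measurable

locale H1_line =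
  fixes v g :: "real \<Rightarrow> real"
  assumes AC: "indefinite_integral_of g v"
    and gm [measurable]: "g \<in> borel_measurable borel"
    and v2: "integrable lborel (\<lambda>x. (v x)\<^sup>2)" and g2: "integrable lborel (\<lambda>x. (g x)\<^sup>2)"
begin

lemma v_continuous: "continuous_on S v" by (rule indefinite_integral_of_continuous[OF AC])

lemma vm [measurable]: "v \<in> borel_measurable borel" by (intro borel_measurable_continuous_onI v_continuous)

lemma vg_integrable: "integrable lborel (\<lambda>x. v x * g x)"
  by (rule product_integrable_of_squares) (use v2 g2 in auto)

lemma square_AC: "indefinite_integral_of (\<lambda>x. 2 * (v x * g x)) (\<lambda>x. (v x)\<^sup>2)"
  using indefinite_integral_of_mult[OF AC AC] by (simp add: power2_eq_square mult.commute)

text \<open>The derivative \<open>2 v g\<close> of \<open>v^2\<close> is integrable, so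
  \<open>v^2\<close> has a limit at \<open>-\<infinity>\<close>; a positive limit would contradict
  the integrability of \<open>v^2\<close>.\<close>

lemma square_tendsto_bot: "((\<lambda>x. (v x)\<^sup>2) \<longlongrightarrow> 0) at_bot"
proof -
  have i: "integrable lborel (\<lambda>x. 2 * (v x * g x))" using vg_integrable by simp
  define l where "l = (v 0)\<^sup>2 - (LINT x:{..0}|lborel. 2 * (v x * g x))"
  define G where "G x = (LINT r:{..x}|lborel. 2 * (v r * g r))" for x
  have e: "(v x)\<^sup>2 = l + G x" for x
  proof -
    have "(v x)\<^sup>2 - G x = (v 0)\<^sup>2 - G 0"
    proof (cases "x \<le> 0")
      case True
      then show ?thesis using indefinite_integral_ofD(2)[OF square_AC, of x 0] indefinite_integral_ofD(2)[OF distribution_AC[OF i], of x 0] by (simp add: G_def)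
    next
      case False
      then show ?thesis using indefinite_integral_ofD(2)[OF square_AC, of 0 x] indefinite_integral_ofD(2)[OF distribution_AC[OF i], of 0 x] by (simp add: G_def)
    qed
    then show ?thesis by (simp add: l_def G_def)
  qed
  have lim: "((\<lambda>x. (v x)\<^sup>2) \<longlongrightarrow> l) at_bot"
    unfolding e using tendsto_add[OF tendsto_const distribution_limits(1)[OF i], of l] by (simp add: G_def)
  have "0 \<le> l" by (rule tendsto_lowerbound[OF lim]) auto
  moreover have "\<not> 0 < l"
  proof
    assume "0 < l"
    then have "eventually (\<lambda>x. l / 2 < (v x)\<^sup>2) at_bot" using order_tendstoD(1)[OF lim, of "l / 2"] by simp
    then obtain a where a: "\<And>x. x \<le> a \<Longrightarrow> l / 2 < (v x)\<^sup>2" by (auto simp: eventually_at_bot_linorder)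
    have "real n * (l / 2) \<le> (LINT x|lborel. (v x)\<^sup>2)" for n :: nat
    proof -
      have "real n * (l / 2) = (LINT x|lborel. indicator {a - real n..a} x *\<^sub>R (l / 2))" by simp
      also have "\<dots> \<le> (LINT x|lborel. (v x)\<^sup>2)"
      proof (rule integral_mono[OF _ v2])
        show "indicator {a - real n..a} x *\<^sub>R (l / 2) \<le> (v x)\<^sup>2" for x
          using a[of x] by (auto simp: indicator_def)
      qed simp
      finally show ?thesis .
    qed
    moreover obtain n where "(LINT x|lborel. (v x)\<^sup>2) / (l / 2) < real n" using reals_Archimedean2 by blast
    ultimately show False using \<open>0 < l\<close> by (simp add: field_simps not_less[symmetric])
  qed
  ultimately show ?thesis using lim by simp
qed

lemma square_le: "(v x)\<^sup>2 \<le> 2 * (LINT r|lborel. \<bar>v r * g r\<bar>)"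
proof -
  have i: "integrable lborel (\<lambda>x. \<bar>2 * (v x * g x)\<bar>)" using vg_integrable by simp
  have "(v x)\<^sup>2 - (LINT r|lborel. \<bar>2 * (v r * g r)\<bar>) \<le> (v a)\<^sup>2" if "a \<le> x" for a
  proof -
    have "(LINT r:{a<..x}|lborel. 2 * (v r * g r)) \<le> (LINT r|lborel. \<bar>2 * (v r * g r)\<bar>)"
      unfolding set_lebesgue_integral_def
      by (rule integral_mono[OF _ i]) (use indefinite_integral_ofD(1)[OF square_AC that] in \<open>auto simp: set_integrable_def indicator_def\<close>)
    then show ?thesis using indefinite_integral_ofD(2)[OF square_AC that] by simp
  qed
  then have "(v x)\<^sup>2 - (LINT r|lborel. \<bar>2 * (v r * g r)\<bar>) \<le> 0"
    by (intro tendsto_lowerbound[OF square_tendsto_bot]) (auto simp: eventually_at_bot_linorder)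
  then show ?thesis by (simp add: abs_mult)
qed

lemma powr_integrable:
  assumes "0 < (q::real)" shows "integrable lborel (\<lambda>x. ((v x)\<^sup>2) powr (q + 1))"
proof -
  define C where "C = 2 * (LINT r|lborel. \<bar>v r * g r\<bar>)"
  have i: "integrable lborel (\<lambda>x. C powr q * (v x)\<^sup>2)" using v2 by simp
  show ?thesis
  proof (rule Bochner_Integration.integrable_bound[OF i])
    show "AE x in lborel. norm (((v x)\<^sup>2) powr (q + 1)) \<le> norm (C powr q * (v x)\<^sup>2)"
    proof (rule AE_I2)
      fix x
      have "((v x)\<^sup>2) powr (q + 1) = ((v x)\<^sup>2) powr q * (v x)\<^sup>2" using assms by (simp add: powr_add)
      also have "\<dots> \<le> C powr q * (v x)\<^sup>2" using square_le[of x] assms unfolding C_def by (intro mult_right_mono powr_mono2) auto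
      finally show "norm (((v x)\<^sup>2) powr (q + 1)) \<le> norm (C powr q * (v x)\<^sup>2)" by simp
    qed
  qed measurable
qed

definition "mass x = (LINT r:{..x}|lborel. (v r)\<^sup>2)"

lemma DERIV_mass: "(mass has_real_derivative (v x)\<^sup>2) (at x)"
  unfolding mass_def[abs_def]
  by (rule indefinite_integral_of_DERIV_continuous[OF distribution_AC[OF v2]]) (intro continuous_intros v_continuous)

lemma mass_tendsto_bot: "(mass \<longlongrightarrow> 0) at_bot"
  unfolding mass_def[abs_def] by (rule distribution_limits(1)[OF v2])

end

text \<open>The bounds keep the running mass inside \<open>(0, M)\<close>, where \<open>R\<close>,
  \<open>T\<close> and \<open>K\<close> are meaningful and differentiable.\<close>

locale calibration = soliton + H1_line +
  assumes mass_bounds: "0 < mass x" "mass x < M"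
begin

definition "defect x = g x - T (mass x) * v x"

lemma DERIV_T_mass: "((\<lambda>x. T (mass x)) has_real_derivative - (q / (q + 1)) * R (mass x) powr (q - 1) * (v x)\<^sup>2) (at x)"
  by (rule DERIV_chain2[OF DERIV_T[OF mass_bounds] DERIV_mass])

lemma DERIV_R_mass: "((\<lambda>x. R (mass x)) has_real_derivative 2 * T (mass x) * (v x)\<^sup>2) (at x)"
  by (rule DERIV_chain2[OF DERIV_R[OF mass_bounds] DERIV_mass])

lemma DERIV_K_mass: "((\<lambda>x. K (mass x)) has_real_derivative (w / 2 - q / (2 * (q + 1)) * R (mass x) powr q) * (v x)\<^sup>2) (at x)"
  by (rule DERIV_chain2[OF DERIV_K[OF mass_bounds] DERIV_mass])

lemma R_mass_continuous: "continuous_on S (\<lambda>x. R (mass x))"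
  using DERIV_R_mass by (meson DERIV_isCont continuous_at_imp_continuous_on)

lemma T_mass_continuous: "continuous_on S (\<lambda>x. T (mass x))"
  using DERIV_T_mass by (meson DERIV_isCont continuous_at_imp_continuous_on)

lemma calib_measurable [measurable]: "(\<lambda>x. T (mass x)) \<in> borel_measurable borel" "defect \<in> borel_measurable borel"
proof -
  show [measurable]: "(\<lambda>x. T (mass x)) \<in> borel_measurable borel" by (intro borel_measurable_continuous_onI T_mass_continuous)
  show "defect \<in> borel_measurable borel" unfolding defect_def[abs_def] by measurable
qed

lemma R_powr_continuous: "continuous_on S (\<lambda>x. R (mass x) powr a)"
proof -
  have "R (mass x) \<noteq> 0" for x using R_pos[of "mass x"] by simp
  then show ?thesis by (intro continuous_intros R_mass_continuous) auto
qed

lemma T_AC: "indefinite_integral_of (\<lambda>x. - (q / (q + 1)) * R (mass x) powr (q - 1) * (v x)\<^sup>2) (\<lambda>x. T (mass x))"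
  by (rule indefinite_integral_of_DERIV[OF DERIV_T_mass]) (intro continuous_intros R_powr_continuous v_continuous)

lemma R_AC: "indefinite_integral_of (\<lambda>x. 2 * T (mass x) * (v x)\<^sup>2) (\<lambda>x. R (mass x))"
  by (rule indefinite_integral_of_DERIV[OF DERIV_R_mass]) (intro continuous_intros T_mass_continuous v_continuous)

lemma K_AC: "indefinite_integral_of (\<lambda>x. (w / 2 - q / (2 * (q + 1)) * R (mass x) powr q) * (v x)\<^sup>2) (\<lambda>x. K (mass x))"
  by (rule indefinite_integral_of_DERIV[OF DERIV_K_mass]) (intro continuous_intros R_powr_continuous v_continuous)

lemma T_mass_square_le: "(T (mass x))\<^sup>2 \<le> w"
  using T_square[of "mass x"] q by simp

lemma defect_integrable: "integrable lborel (\<lambda>x. (defect x)\<^sup>2)"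
proof (rule Bochner_Integration.integrable_bound)
  show "integrable lborel (\<lambda>x. 2 * (g x)\<^sup>2 + 2 * (w * (v x)\<^sup>2))" using g2 v2 by auto
  show "AE x in lborel. norm ((defect x)\<^sup>2) \<le> norm (2 * (g x)\<^sup>2 + 2 * (w * (v x)\<^sup>2))"
  proof (rule AE_I2)
    fix x
    have "(defect x)\<^sup>2 \<le> 2 * (g x)\<^sup>2 + 2 * (T (mass x) * v x)\<^sup>2"
      using norm_diff_square_le[of "g x" "T (mass x) * v x"] by (simp add: defect_def)
    also have "(T (mass x) * v x)\<^sup>2 \<le> w * (v x)\<^sup>2" unfolding power_mult_distrib by (intro mult_right_mono T_mass_square_le) auto
    finally show "norm ((defect x)\<^sup>2) \<le> norm (2 * (g x)\<^sup>2 + 2 * (w * (v x)\<^sup>2))" by simp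
  qed
qed measurable

text \<open>The choice of \<open>T\<close> and \<open>K\<close> makes the terms of order \<open>v\<^sup>4\<close> cancel.\<close>

lemma calibration_pointwise:
  "v x * g x * T (mass x) + (v x)\<^sup>2 * (- (q / (q + 1)) * R (mass x) powr (q - 1) * (v x)\<^sup>2) / 2
      - (w / 2 - q / (2 * (q + 1)) * R (mass x) powr q) * (v x)\<^sup>2
    \<le> (g x)\<^sup>2 / 2 - ((v x)\<^sup>2) powr (q + 1) / (2 * (q + 1)) - (defect x)\<^sup>2 / 2"
proof -
  define s where "s = (v x)\<^sup>2"
  define r where "r = R (mass x)"
  define P where "P = r powr q"
  define Q where "Q = r powr (q - 1)"
  have rp: "r > 0" unfolding r_def by (rule R_pos)
  have s0: "s \<ge> 0" by (simp add: s_def)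
  have Qr: "Q * r = P" unfolding P_def Q_def using rp by (simp add: powr_diff)
  have "s powr (q + 1) = s powr q * s" using s0 by (simp add: powr_add)
  also have "\<dots> \<le> (P + q * Q * (s - r)) * s"
    unfolding P_def Q_def using tangent_powr[OF q rp s0] s0 by (intro mult_right_mono) auto
  also have "\<dots> = (1 - q) * P * s + q * Q * s\<^sup>2"
    using Qr by (simp add: algebra_simps power2_eq_square flip: Qr)
  finally have 1: "s powr (q + 1) \<le> (1 - q) * P * s + q * Q * s\<^sup>2" .
  have t: "(T (mass x))\<^sup>2 = w - P / (q + 1)" unfolding P_def r_def by (rule T_square)
  have d: "(g x)\<^sup>2 / 2 - (defect x)\<^sup>2 / 2 = v x * g x * T (mass x) - (T (mass x))\<^sup>2 * s / 2"
    unfolding defect_def s_def by (simp add: power2_diff power_mult_distrib field_simps)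
  have "s powr (q + 1) / (2 * (q + 1)) \<le> ((1 - q) * P * s + q * Q * s\<^sup>2) / (2 * (q + 1))"
    using 1 q by (intro divide_right_mono) auto
  moreover have "v x * g x * T (mass x) + s * (- (q / (q + 1)) * Q * s) / 2 - (w / 2 - q / (2 * (q + 1)) * P) * s
     = (v x * g x * T (mass x) - (w - P / (q + 1)) * s / 2) - ((1 - q) * P * s + q * Q * s\<^sup>2) / (2 * (q + 1))"
  proof -
    have "q + 1 > 0" using q by simp
    then show ?thesis by (simp add: divide_simps) (simp add: algebra_simps power2_eq_square)
  qed
  moreover have "L \<le> c - a - e" if "a \<le> b" "L = x - b" "c - e = x" for a b L x c e :: real
    using that by linarith
  ultimately show ?thesis using d unfolding t unfolding s_def[symmetric] r_def[symmetric] P_def[symmetric] Q_def[symmetric] by blast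
qed

text \<open>The left-hand side of \<open>calibration_pointwise\<close> is the derivative of
  \<open>v^2 T(mass) / 2 - K(mass)\<close>. It is integrated from \<open>a\<close> to
  \<open>0\<close>. As \<open>a\<close> tends to \<open>-\<infinity>\<close> nothing is left at the
  lower end, since \<open>v^2\<close> and the mass vanish there and \<open>T\<close> is
  bounded.\<close>

lemma calibration_inequality:
  "(LINT x:{..0}|lborel. (defect x)\<^sup>2) / 2 + (v 0)\<^sup>2 * T (mass 0) / 2 - K (mass 0)
    \<le> (LINT x:{..0}|lborel. (g x)\<^sup>2 / 2 - ((v x)\<^sup>2) powr (q + 1) / (2 * (q + 1)))"
proof -
  define h where "h x = ((g x)\<^sup>2 / 2 - ((v x)\<^sup>2) powr (q + 1) / (2 * (q + 1))) - (defect x)\<^sup>2 / 2" for x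
  define F where "F x = (v x)\<^sup>2 * T (mass x) / 2 - K (mass x)" for x
  define f where "f x = v x * g x * T (mass x) + (v x)\<^sup>2 * (- (q / (q + 1)) * R (mass x) powr (q - 1) * (v x)\<^sup>2) / 2
      - (w / 2 - q / (2 * (q + 1)) * R (mass x) powr q) * (v x)\<^sup>2" for x
  have hi1: "integrable lborel (\<lambda>x. (g x)\<^sup>2 / 2 - ((v x)\<^sup>2) powr (q + 1) / (2 * (q + 1)))"
    using g2 powr_integrable[OF q(1)] by auto
  have hi2: "integrable lborel (\<lambda>x. (defect x)\<^sup>2 / 2)" using defect_integrable by simp
  have hi: "integrable lborel h" unfolding h_def using hi1 hi2 by (rule Bochner_Integration.integrable_diff)
  have si: "set_integrable lborel A u" if "A \<in> sets borel" "integrable lborel u" for A and u :: "real \<Rightarrow> real"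
    unfolding set_integrable_def by (rule integrable_mult_indicator) (use that in auto)
  have FAC: "indefinite_integral_of f F"
  proof -
    have "indefinite_integral_of (\<lambda>x. 2 * (v x * g x) * T (mass x) + (v x)\<^sup>2 * (- (q / (q + 1)) * R (mass x) powr (q - 1) * (v x)\<^sup>2)) (\<lambda>x. (v x)\<^sup>2 * T (mass x))"
      by (rule indefinite_integral_of_mult[OF square_AC T_AC])
    moreover have "indefinite_integral_of (\<lambda>x. 0) (\<lambda>x. 1 / 2 :: real)" by (rule indefinite_integral_of_DERIV) auto
    ultimately have "indefinite_integral_of (\<lambda>x. 0 * ((v x)\<^sup>2 * T (mass x)) + 1 / 2 * (2 * (v x * g x) * T (mass x) + (v x)\<^sup>2 * (- (q / (q + 1)) * R (mass x) powr (q - 1) * (v x)\<^sup>2))) (\<lambda>x. 1 / 2 * ((v x)\<^sup>2 * T (mass x)))"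
      by (rule indefinite_integral_of_mult[rotated])
    from indefinite_integral_of_diff[OF this K_AC] show ?thesis unfolding f_def[abs_def] F_def[abs_def] by (simp add: algebra_simps)
  qed
  have step: "F 0 - F a \<le> (LINT x:{a..0}|lborel. h x)" if a: "a \<le> 0" for a
  proof -
    have "F 0 - F a = (LINT x:{a..0}|lborel. f x)" using indefinite_integral_of_Icc(2)[OF FAC a] by simp
    also have "\<dots> \<le> (LINT x:{a..0}|lborel. h x)"
    proof (rule set_integral_mono[OF indefinite_integral_of_Icc(1)[OF FAC a] si[OF _ hi]])
      show "f x \<le> h x" for x unfolding f_def h_def by (rule calibration_pointwise)
    qed simp
    finally show ?thesis .
  qed
  have Fl: "(F \<longlongrightarrow> 0) at_bot"
  proof -
    have "((\<lambda>x. (v x)\<^sup>2 * T (mass x)) \<longlongrightarrow> 0) at_bot"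
    proof (rule Lim_null_comparison)
      show "((\<lambda>x. (v x)\<^sup>2 * sqrt w) \<longlongrightarrow> 0) at_bot" using tendsto_mult[OF square_tendsto_bot tendsto_const, of "sqrt w"] by simp
      show "\<forall>\<^sub>F x in at_bot. norm ((v x)\<^sup>2 * T (mass x)) \<le> (v x)\<^sup>2 * sqrt w"
        using T_bound by (intro always_eventually allI) (auto simp: abs_mult intro!: mult_left_mono)
    qed
    moreover have "((\<lambda>x. K (mass x)) \<longlongrightarrow> 0) at_bot"
    proof (rule Lim_null_comparison)
      show "((\<lambda>x. 3 * w * mass x) \<longlongrightarrow> 0) at_bot" using tendsto_mult[OF tendsto_const mass_tendsto_bot, of "3 * w"] by simp
      show "\<forall>\<^sub>F x in at_bot. norm (K (mass x)) \<le> 3 * w * mass x"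
        using K_bound[OF mass_bounds] by (intro always_eventually allI) auto
    qed
    ultimately have "(F \<longlongrightarrow> 0 / 2 - 0) at_bot" unfolding F_def[abs_def] by (intro tendsto_intros) auto
    then show ?thesis by simp
  qed
  have "((\<lambda>a. (LINT x:{a..0}|lborel. h x) - (F 0 - F a)) \<longlongrightarrow> (LINT x:{..0}|lborel. h x) - (F 0 - 0)) at_bot"
    by (intro tendsto_intros Fl tendsto_set_lebesgue_integral_at_bot si hi) auto
  then have "0 \<le> (LINT x:{..0}|lborel. h x) - (F 0 - 0)"
    by (rule tendsto_lowerbound) (use step in \<open>auto simp: eventually_at_bot_linorder\<close>)
  then have "F 0 \<le> (LINT x:{..0}|lborel. h x)" by simp
  also have "\<dots> = (LINT x:{..0}|lborel. (g x)\<^sup>2 / 2 - ((v x)\<^sup>2) powr (q + 1) / (2 * (q + 1))) - (LINT x:{..0}|lborel. (defect x)\<^sup>2 / 2)"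
    unfolding h_def by (rule set_integral_diff(2)[OF si[OF _ hi1] si[OF _ hi2]]) auto
  also have "(LINT x:{..0}|lborel. (defect x)\<^sup>2 / 2) = (LINT x:{..0}|lborel. (defect x)\<^sup>2) / 2"
    unfolding set_lebesgue_integral_def by simp
  finally show ?thesis unfolding F_def by simp
qed

text \<open>For vanishing defect \<open>v^2 = R(mass)\<close>, the first order equation of the
  soliton. In general \<open>(v^2 - R(mass))' = 2 v defect\<close>, which Young's inequality with
  free parameter \<open>\<eta>\<close> bounds by integrable terms, and the difference vanishes at
  \<open>-\<infinity>\<close>.\<close>

lemma square_near_R:
  assumes eta: "\<eta> > 0" and x: "x \<le> 0"
  shows "\<bar>(v x)\<^sup>2 - R (mass x)\<bar> \<le> \<eta> * mass 0 + (LINT x:{..0}|lborel. (defect x)\<^sup>2) / \<eta>"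
proof -
  define D where "D x = (v x)\<^sup>2 - R (mass x)" for x
  have DAC: "indefinite_integral_of (\<lambda>x. 2 * (v x * g x) - 2 * T (mass x) * (v x)\<^sup>2) D"
    unfolding D_def by (rule indefinite_integral_of_diff[OF square_AC R_AC])
  define B where "B = \<eta> * mass 0 + (LINT x:{..0}|lborel. (defect x)\<^sup>2) / \<eta>"
  have si: "set_integrable lborel A u" if "A \<in> sets borel" "integrable lborel u" for A and u :: "real \<Rightarrow> real"
    unfolding set_integrable_def by (rule integrable_mult_indicator) (use that in auto)
  have ui: "integrable lborel (\<lambda>x. \<eta> * (v x)\<^sup>2)" "integrable lborel (\<lambda>x. (defect x)\<^sup>2 / \<eta>)" using v2 defect_integrable by auto
  have Beq: "B = (LINT x:{..0}|lborel. \<eta> * (v x)\<^sup>2 + (defect x)\<^sup>2 / \<eta>)"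
    unfolding set_integral_add(2)[OF si[OF _ ui(1)] si[OF _ ui(2)], of "{..0}", simplified]
    by (simp add: B_def mass_def set_lebesgue_integral_def)
  have step: "\<bar>D x\<bar> \<le> B + \<bar>D a\<bar>" if a: "a \<le> x" for a
  proof -
    have b: "norm (2 * (v r * g r) - 2 * T (mass r) * (v r)\<^sup>2) \<le> \<eta> * (v r)\<^sup>2 + (defect r)\<^sup>2 / \<eta>" for r
    proof -
      have "2 * (v r * g r) - 2 * T (mass r) * (v r)\<^sup>2 = 2 * (v r * defect r)"
        by (simp add: defect_def algebra_simps power2_eq_square)
      moreover have "2 * \<bar>v r\<bar> * \<bar>defect r\<bar> \<le> \<eta> * (v r)\<^sup>2 + (defect r)\<^sup>2 / \<eta>"
      proof -
        have "0 \<le> (\<eta> * \<bar>v r\<bar> - \<bar>defect r\<bar>)\<^sup>2 / \<eta>" using eta by simp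
        also have "\<dots> = \<eta> * (v r)\<^sup>2 + (defect r)\<^sup>2 / \<eta> - 2 * \<bar>v r\<bar> * \<bar>defect r\<bar>"
          using eta by (simp add: power2_diff field_simps power2_eq_square)
        finally show ?thesis by simp
      qed
      ultimately show ?thesis by (simp add: abs_mult)
    qed
    note fi = indefinite_integral_ofD(1)[OF DAC a]
    have "\<bar>LINT r:{a<..x}|lborel. 2 * (v r * g r) - 2 * T (mass r) * (v r)\<^sup>2\<bar> \<le> (LINT r:{a<..x}|lborel. norm (2 * (v r * g r) - 2 * T (mass r) * (v r)\<^sup>2))"
      using set_integral_norm_bound[OF fi] by simp
    also have "\<dots> \<le> (LINT r:{a<..x}|lborel. \<eta> * (v r)\<^sup>2 + (defect r)\<^sup>2 / \<eta>)"
      by (rule set_integral_mono[OF set_integrable_norm[OF fi] si b]) (use ui in auto)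
    also have "\<dots> \<le> B" unfolding Beq set_lebesgue_integral_def
    proof (rule integral_mono)
      show "integrable lborel (\<lambda>r. indicator {a<..x} r *\<^sub>R (\<eta> * (v r)\<^sup>2 + (defect r)\<^sup>2 / \<eta>))"
        "integrable lborel (\<lambda>r. indicator {..0} r *\<^sub>R (\<eta> * (v r)\<^sup>2 + (defect r)\<^sup>2 / \<eta>))"
        using si[OF _ Bochner_Integration.integrable_add[OF ui]] by (auto simp: set_integrable_def)
      show "indicator {a<..x} r *\<^sub>R (\<eta> * (v r)\<^sup>2 + (defect r)\<^sup>2 / \<eta>) \<le> indicator {..0} r *\<^sub>R (\<eta> * (v r)\<^sup>2 + (defect r)\<^sup>2 / \<eta>)" for r
        using x eta by (auto simp: indicator_def)
    qed
    finally show ?thesis using indefinite_integral_ofD(2)[OF DAC a] by (simp add: abs_if split: if_splits)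
  qed
  have Dl: "(D \<longlongrightarrow> 0) at_bot"
  proof -
    have "((\<lambda>x. R (mass x)) \<longlongrightarrow> 0) at_bot"
    proof (rule Lim_null_comparison)
      show "((\<lambda>x. 2 * sqrt w * mass x) \<longlongrightarrow> 0) at_bot" using tendsto_mult[OF tendsto_const mass_tendsto_bot, of "2 * sqrt w"] by simp
      show "\<forall>\<^sub>F x in at_bot. norm (R (mass x)) \<le> 2 * sqrt w * mass x"
        using R_le[OF mass_bounds] R_pos by (intro always_eventually allI) (auto simp: less_imp_le)
    qed
    then show ?thesis unfolding D_def[abs_def] using tendsto_diff[OF square_tendsto_bot] by fastforce
  qed
  have "((\<lambda>a. B + \<bar>D a\<bar>) \<longlongrightarrow> B + \<bar>0\<bar>) at_bot" by (intro tendsto_intros Dl)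
  then have "\<bar>D x\<bar> \<le> B + \<bar>0\<bar>"
    by (rule tendsto_lowerbound) (use step in \<open>auto simp: eventually_at_bot_linorder\<close>)
  then show ?thesis by (simp add: D_def B_def)
qed

end

text \<open>The choice is \<open>\<eta> = sqrt d\<close>, which balances the two terms up to the
  constant; for \<open>d = 0\<close> arbitrarily small \<open>\<eta>\<close> take its place.\<close>

lemma le_sqrt_of_le_all:
  fixes a C d :: real
  assumes "\<And>\<eta>. \<eta> > 0 \<Longrightarrow> a \<le> \<eta> * C + d / \<eta>" and d: "0 \<le> d" and C: "0 \<le> C"
  shows "a \<le> (C + 1) * sqrt d"
proof (cases "d = 0")
  case True
  have "a \<le> 0 + e" if "e > 0" for e
  proof -
    have "a \<le> e / (C + 1) * C" using assms(1)[of "e / (C + 1)"] that C True by simp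
    also have "\<dots> \<le> e" using that C by (simp add: field_simps)
    finally show ?thesis by simp
  qed
  then have "a \<le> 0" by (rule field_le_epsilon)
  then show ?thesis using True by simp
next
  case False
  then have "a \<le> sqrt d * C + d / sqrt d" using assms(1)[of "sqrt d"] d by simp
  also have "d / sqrt d = sqrt d" using d by (simp add: real_div_sqrt)
  finally show ?thesis by (simp add: algebra_simps)
qed

section \<open>Stability of the mass equation \<open>m' = R m\<close>\<close>

context soliton
begin

lemma R_lipschitz:
  assumes "0 < a" "a < M" "0 < b" "b < M"
  shows "\<bar>R a - R b\<bar> \<le> 2 * sqrt w * \<bar>a - b\<bar>"
proof -
  have "norm (R a - R b) \<le> 2 * sqrt w * norm (a - b)"
  proof (rule field_differentiable_bound[where S="{0<..<M}" and f'="\<lambda>m. 2 * T m"])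
    show "(R has_field_derivative 2 * T z) (at z within {0<..<M})" if "z \<in> {0<..<M}" for z
      using DERIV_R[of z] that by (auto intro: has_field_derivative_at_within)
    show "norm (2 * T z) \<le> 2 * sqrt w" for z using T_bound[of z] by simp
  qed (use assms in auto)
  then show ?thesis by simp
qed

lemma R_N: "R (N x) = rho x" and T_N: "T (N x) = tau x"
  by (simp_all add: R_def T_def X_N)

end

text \<open>The translate \<open>N (x + xs)\<close> solves \<open>m' = R m\<close> exactly,
  \<open>mass\<close> solves it up to \<open>\<epsilon>\<close>, and \<open>R\<close> is Lipschitz
  with constant \<open>2 sqrt w\<close>. Gronwall's argument runs backwards from \<open>0\<close>,
  so the exponent is nonnegative for \<open>x \<le> 0\<close>.\<close>

lemma (in calibration) mass_gronwall:
  assumes e: "0 \<le> \<epsilon>" and b: "\<And>x. x \<le> 0 \<Longrightarrow> \<bar>(v x)\<^sup>2 - R (mass x)\<bar> \<le> \<epsilon>" and x: "x \<le> 0"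
  shows "(mass x - N (x + xs))\<^sup>2 \<le> ((mass 0 - N xs)\<^sup>2 + \<epsilon>\<^sup>2) * exp (- (4 * sqrt w + 1) * x)"
proof -
  define d where "d x = mass x - N (x + xs)" for x
  define c where "c = 4 * sqrt w + 1"
  define h where "h x = ((d x)\<^sup>2 + \<epsilon>\<^sup>2) * exp (c * x)" for x
  have dd: "(d has_real_derivative (v y)\<^sup>2 - rho (y + xs)) (at y)" for y
    unfolding d_def by (rule DERIV_diff[OF DERIV_mass]) (use DERIV_chain2[OF DERIV_N DERIV_add[OF DERIV_ident DERIV_const]] in simp)
  have dh: "(h has_real_derivative (2 * d y * ((v y)\<^sup>2 - rho (y + xs)) + c * ((d y)\<^sup>2 + \<epsilon>\<^sup>2)) * exp (c * y)) (at y)" for y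
    unfolding h_def by (rule DERIV_cong) (auto intro!: derivative_eq_intros dd simp: algebra_simps)
  have "h x \<le> h 0"
  proof (rule DERIV_nonneg_imp_nondecreasing[OF x])
    fix y assume y: "x \<le> y" "y \<le> 0"
    have "\<bar>R (mass y) - R (N (y + xs))\<bar> \<le> 2 * sqrt w * \<bar>d y\<bar>"
      unfolding d_def by (rule R_lipschitz[OF mass_bounds N_bounds])
    then have "\<bar>(v y)\<^sup>2 - rho (y + xs)\<bar> \<le> \<epsilon> + 2 * sqrt w * \<bar>d y\<bar>"
      using b[OF y(2)] unfolding R_N by linarith
    then have "\<bar>2 * d y\<bar> * \<bar>(v y)\<^sup>2 - rho (y + xs)\<bar> \<le> \<bar>2 * d y\<bar> * (\<epsilon> + 2 * sqrt w * \<bar>d y\<bar>)" by (intro mult_left_mono) auto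
    also have "\<dots> = 2 * \<bar>d y\<bar> * \<epsilon> + 4 * sqrt w * (d y)\<^sup>2" by (simp add: algebra_simps power2_eq_square abs_mult)
    also have "\<dots> \<le> ((d y)\<^sup>2 + \<epsilon>\<^sup>2) + 4 * sqrt w * (d y)\<^sup>2" using sum_squares_bound[of "\<bar>d y\<bar>" \<epsilon>] by simp
    also have "\<dots> \<le> c * ((d y)\<^sup>2 + \<epsilon>\<^sup>2)" using w unfolding c_def by (simp add: algebra_simps)
    finally have "- (2 * d y * ((v y)\<^sup>2 - rho (y + xs))) \<le> c * ((d y)\<^sup>2 + \<epsilon>\<^sup>2)" unfolding abs_mult[symmetric] by linarith
    then have "0 \<le> (2 * d y * ((v y)\<^sup>2 - rho (y + xs)) + c * ((d y)\<^sup>2 + \<epsilon>\<^sup>2)) * exp (c * y)" by (intro mult_nonneg_nonneg) auto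
    then show "\<exists>D. (h has_real_derivative D) (at y) \<and> 0 \<le> D" using dh by blast
  qed
  then have "((d x)\<^sup>2 + \<epsilon>\<^sup>2) * exp (c * x) \<le> (d 0)\<^sup>2 + \<epsilon>\<^sup>2" by (simp add: h_def)
  then have "((d x)\<^sup>2 + \<epsilon>\<^sup>2) * exp (c * x) * exp (- c * x) \<le> ((d 0)\<^sup>2 + \<epsilon>\<^sup>2) * exp (- c * x)" by (intro mult_right_mono) auto
  moreover have "((d x)\<^sup>2 + \<epsilon>\<^sup>2) * exp (c * x) * exp (- c * x) = (d x)\<^sup>2 + \<epsilon>\<^sup>2" by (simp add: mult.assoc flip: exp_add)
  moreover have "(d x)\<^sup>2 \<le> (d x)\<^sup>2 + \<epsilon>\<^sup>2" by simp
  ultimately have "(d x)\<^sup>2 \<le> ((d 0)\<^sup>2 + \<epsilon>\<^sup>2) * exp (- c * x)" by linarith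
  then show ?thesis unfolding d_def c_def by simp
qed

text \<open>\<open>slope\<close> is the logarithmic derivative that the soliton has at the point with the same mass to
  the left, respectively, on the right half-line, with the same mass to the right.\<close>

locale full_line = soliton + H1_line +
  fixes mu
  assumes mu: "mu = (LINT x|lborel. (v x)\<^sup>2)" "mu < M" and nz: "AE x in lborel. v x \<noteq> 0"
begin

definition "slope x = (if x \<le> 0 then T (mass x) else - T (mu - mass x))"
definition "total_defect = (LINT x|lborel. (g x - slope x * v x)\<^sup>2)"

lemma mass_pos: "0 < mass x"
proof -
  have i: "integrable lborel (\<lambda>r. indicator {..x} r *\<^sub>R (v r)\<^sup>2)" by (rule integrable_mult_indicator[OF _ v2]) simp
  have "0 \<le> mass x" unfolding mass_def set_lebesgue_integral_def by (rule Bochner_Integration.integral_nonneg) auto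
  moreover have "mass x \<noteq> 0"
  proof
    assume "mass x = 0"
    then have "AE r in lborel. indicator {..x} r *\<^sub>R (v r)\<^sup>2 = 0"
      using integral_nonneg_eq_0_iff_AE[OF i] by (auto simp: mass_def set_lebesgue_integral_def)
    then have "AE r in lborel. r \<notin> {x-1..x}" using nz by eventually_elim (auto simp: indicator_def split: if_splits)
    then have "{x-1..x} \<in> null_sets lborel" by (subst AE_iff_null_sets) auto
    then show False by (auto simp: null_sets_def)
  qed
  ultimately show ?thesis by simp
qed

lemma mass_le_mu: "mass x \<le> mu"
  unfolding mass_def mu(1) set_lebesgue_integral_def
  by (rule integral_mono[OF integrable_mult_indicator[OF _ v2] v2]) (auto simp: indicator_def)

sublocale left: calibration q w v g
  by unfold_locales (use mass_pos mass_le_mu mu(2) in \<open>auto intro: le_less_trans\<close>)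

lemma reflected: "H1_line (\<lambda>x. v (- x)) (\<lambda>x. - g (- x))"
proof
  show "indefinite_integral_of (\<lambda>x. - g (- x)) (\<lambda>x. v (- x))" by (rule indefinite_integral_of_reflect[OF AC])
  show "integrable lborel (\<lambda>x. (v (- x))\<^sup>2)" "integrable lborel (\<lambda>x. (- g (- x))\<^sup>2)"
    using lborel_integrable_real_affine_iff[of "-1" "\<lambda>x. (v x)\<^sup>2" 0] lborel_integrable_real_affine_iff[of "-1" "\<lambda>x. (g x)\<^sup>2" 0] v2 g2 by simp_all
qed measurable

lemma integral_reflect:
  fixes f :: "real \<Rightarrow> real"
  shows "(LINT x|lborel. f (- x)) = (LINT x|lborel. f x)"
  using lborel_integral_real_affine[of "-1" f 0] by simp

lemma reflected_mass: "H1_line.mass (\<lambda>x. v (- x)) x = mu - mass (- x)"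
proof -
  have "H1_line.mass (\<lambda>x. v (- x)) x = (LINT r|lborel. indicator {- x..} (- r) *\<^sub>R (v (- r))\<^sup>2)"
    unfolding H1_line.mass_def[OF reflected] set_lebesgue_integral_def
    by (intro Bochner_Integration.integral_cong) (auto simp: indicator_def)
  also have "\<dots> = (LINT r|lborel. indicator {- x..} r *\<^sub>R (v r)\<^sup>2)" by (rule integral_reflect)
  also have "\<dots> = (LINT r|lborel. (v r)\<^sup>2 - indicator {..- x} r *\<^sub>R (v r)\<^sup>2)"
  proof (rule integral_cong_AE)
    show "AE r in lborel. indicator {- x..} r *\<^sub>R (v r)\<^sup>2 = (v r)\<^sup>2 - indicator {..- x} r *\<^sub>R (v r)\<^sup>2"
      using AE_lborel_singleton[of "- x"] by eventually_elim (auto simp: indicator_def)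
  qed measurable
  also have "\<dots> = mu - mass (- x)"
    unfolding mu(1) mass_def set_lebesgue_integral_def
    by (rule Bochner_Integration.integral_diff[OF v2 integrable_mult_indicator[OF _ v2]]) simp
  finally show ?thesis .
qed

text \<open>This is \<open>mass_pos\<close> for the reflected function. The instance of
  \<open>full_line\<close> is built by hand because the sublocale \<open>right\<close> below depends
  on this bound.\<close>

lemma mass_less_mu: "mass x < mu"
proof -
  have "0 < H1_line.mass (\<lambda>x. v (- x)) (- x)"
  proof (rule full_line.mass_pos[of q w "\<lambda>x. v (- x)" "\<lambda>x. - g (- x)" mu], intro_locales)
    show "H1_line (\<lambda>x. v (- x)) (\<lambda>x. - g (- x))" by (rule reflected)
    show "full_line_axioms q w (\<lambda>x. v (- x)) mu"
    proof
      show "mu = (LINT x|lborel. (v (- x))\<^sup>2)" unfolding mu(1) by (rule integral_reflect[symmetric])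
      show "AE x in lborel. v (- x) \<noteq> 0"
      proof -
        have "AE x in distr lborel borel uminus. v x \<noteq> 0"
          by (subst lborel_distr_uminus) (rule nz)
        then show ?thesis by (rule AE_distrD[rotated]) simp
      qed
    qed (rule mu(2))
  qed
  then show ?thesis unfolding reflected_mass by simp
qed

sublocale right: calibration q w "\<lambda>x. v (- x)" "\<lambda>x. - g (- x)"
  rewrites "H1_line.mass (\<lambda>x. v (- x)) = (\<lambda>x. mu - mass (- x))"
proof -
  interpret r: H1_line "\<lambda>x. v (- x)" "\<lambda>x. - g (- x)" by (rule reflected)
  show "calibration q w (\<lambda>x. v (- x)) (\<lambda>x. - g (- x))"
  proof (unfold_locales, unfold reflected_mass)
    fix x
    show "0 < mu - mass (- x)" using mass_less_mu[of "- x"] by simp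
    show "mu - mass (- x) < M" using mass_pos[of "- x"] mu(2) by linarith
  qed
  show "H1_line.mass (\<lambda>x. v (- x)) = (\<lambda>x. mu - mass (- x))" by (rule ext) (rule reflected_mass)
qed

lemma mu_pos: "0 < mu" using mass_pos[of 0] mass_less_mu[of 0] by simp

lemma total_defect_split:
  shows "integrable lborel (\<lambda>x. (g x - slope x * v x)\<^sup>2)"
    and "total_defect = (LINT x:{..0}|lborel. (left.defect x)\<^sup>2) + (LINT x:{..0}|lborel. (right.defect x)\<^sup>2)"
proof -
  have i1: "integrable lborel (\<lambda>r. indicator {..0} r *\<^sub>R (left.defect r)\<^sup>2)" by (rule integrable_mult_indicator[OF _ left.defect_integrable]) simp
  have i2: "integrable lborel (\<lambda>r. indicator {..0} r *\<^sub>R (right.defect r)\<^sup>2)" by (rule integrable_mult_indicator[OF _ right.defect_integrable]) simp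
  have i2': "integrable lborel (\<lambda>r. indicator {..0} (- r) *\<^sub>R (right.defect (- r))\<^sup>2)"
    using lborel_integrable_real_affine_iff[of "-1" "\<lambda>r. indicator {..0} r *\<^sub>R (right.defect r)\<^sup>2" 0] i2 by simp
  have [measurable]: "slope \<in> borel_measurable borel"
  proof -
    have "(\<lambda>x. T (mu - mass (- x))) \<in> borel_measurable borel" by (rule right.calib_measurable(1))
    then have [measurable]: "(\<lambda>x. T (mu - mass (- (- x)))) \<in> borel_measurable borel" by measurable
    have "slope = (\<lambda>x. if x \<le> 0 then T (mass x) else - T (mu - mass (- (- x))))" by (auto simp: slope_def)
    then show ?thesis by (simp only:) measurable
  qed
  have e: "AE r in lborel. indicator {..0} r *\<^sub>R (left.defect r)\<^sup>2 + indicator {..0} (- r) *\<^sub>R (right.defect (- r))\<^sup>2 = (g r - slope r * v r)\<^sup>2"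
    using AE_lborel_singleton[of 0]
    by eventually_elim (auto simp: indicator_def left.defect_def right.defect_def slope_def power2_eq_square algebra_simps)
  show "integrable lborel (\<lambda>x. (g x - slope x * v x)\<^sup>2)"
    by (rule integrable_cong_AE_imp[OF Bochner_Integration.integrable_add[OF i1 i2']]) (use e in auto)
  have "total_defect = (LINT r|lborel. indicator {..0} r *\<^sub>R (left.defect r)\<^sup>2 + indicator {..0} (- r) *\<^sub>R (right.defect (- r))\<^sup>2)"
    unfolding total_defect_def by (rule integral_cong_AE) (use e in \<open>auto elim: eventually_mono\<close>)
  also have "\<dots> = (LINT r|lborel. indicator {..0} r *\<^sub>R (left.defect r)\<^sup>2) + (LINT r|lborel. indicator {..0} (- r) *\<^sub>R (right.defect (- r))\<^sup>2)"
    by (rule Bochner_Integration.integral_add[OF i1 i2'])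
  also have "(LINT r|lborel. indicator {..0} (- r) *\<^sub>R (right.defect (- r))\<^sup>2) = (LINT r|lborel. indicator {..0} r *\<^sub>R (right.defect r)\<^sup>2)"
    by (rule integral_reflect)
  finally show "total_defect = (LINT x:{..0}|lborel. (left.defect x)\<^sup>2) + (LINT x:{..0}|lborel. (right.defect x)\<^sup>2)"
    by (simp add: set_lebesgue_integral_def)
qed

lemma half_defects: "0 \<le> (LINT x:{..0}|lborel. (left.defect x)\<^sup>2)" "0 \<le> (LINT x:{..0}|lborel. (right.defect x)\<^sup>2)" "0 \<le> total_defect"
  unfolding set_lebesgue_integral_def total_defect_def by (rule Bochner_Integration.integral_nonneg; simp)+

text \<open>The two calibrations, at the masses to the left and to the right of \<open>0\<close>,
  add up to a bound that depends on how the mass is split. \<open>symmetric_bounds\<close> replaces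
  the split by the even one, for which the bound is weakest.\<close>

lemma energy_lower_bound:
  "total_defect / 2 + (v 0)\<^sup>2 * T (mu / 2) - 2 * K (mu / 2) \<le> (LINT x|lborel. (g x)\<^sup>2 / 2 - ((v x)\<^sup>2) powr (q + 1) / (2 * (q + 1)))"
proof -
  let ?h = "\<lambda>x. (g x)\<^sup>2 / 2 - ((v x)\<^sup>2) powr (q + 1) / (2 * (q + 1))"
  have hi: "integrable lborel ?h" using g2 powr_integrable[OF q(1)] by auto
  have i: "integrable lborel (\<lambda>x. indicator A x *\<^sub>R ?h x)" if "A \<in> sets borel" for A
    by (rule integrable_mult_indicator[OF _ hi]) (use that in simp)
  have i': "integrable lborel (\<lambda>x. indicator {..0} (- x) *\<^sub>R ?h x)"
    by (rule Bochner_Integration.integrable_cong[THEN iffD1, OF refl _ i[of "{0..}"]]) (auto simp: indicator_def)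
  have "(LINT x|lborel. ?h x) = (LINT x|lborel. indicator {..0} x *\<^sub>R ?h x + indicator {..0} (- x) *\<^sub>R ?h x)"
  proof (rule integral_cong_AE)
    show "AE x in lborel. ?h x = indicator {..0} x *\<^sub>R ?h x + indicator {..0} (- x) *\<^sub>R ?h x"
      using AE_lborel_singleton[of 0] by eventually_elim (auto simp: indicator_def)
  qed measurable
  also have "\<dots> = (LINT x|lborel. indicator {..0} x *\<^sub>R ?h x) + (LINT x|lborel. indicator {..0} (- x) *\<^sub>R ?h x)"
    by (rule Bochner_Integration.integral_add[OF i i']) simp
  also have "(LINT x|lborel. indicator {..0} (- x) *\<^sub>R ?h x) = (LINT x|lborel. indicator {..0} x *\<^sub>R ?h (- x))"
    using integral_reflect[of "\<lambda>x. indicator {..0} x *\<^sub>R ?h (- x)"] by simp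
  finally have eq: "(LINT x|lborel. ?h x) = (LINT x:{..0}|lborel. ?h x) + (LINT x:{..0}|lborel. (- g (- x))\<^sup>2 / 2 - ((v (- x))\<^sup>2) powr (q + 1) / (2 * (q + 1)))"
    by (simp add: set_lebesgue_integral_def)
  \<comment> \<open>The masses \<open>mass 0\<close> and \<open>mu - mass 0\<close> are
    \<open>mu / 2 + t\<close> and \<open>mu / 2 - t\<close> in one order or the other.\<close>
  define t where "t = \<bar>mass 0 - mu / 2\<bar>"
  have t: "0 \<le> t" "t < mu / 2" "mu \<le> M" using mass_pos[of 0] mass_less_mu[of 0] mu(2) by (auto simp: t_def abs_if)
  have sym: "f (mass 0) + f (mu - mass 0) = f (mu / 2 + t) + f (mu / 2 - t)" for f :: "real \<Rightarrow> real"
    by (cases "mass 0 \<ge> mu / 2") (auto simp: t_def abs_if algebra_simps)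
  have "(v 0)\<^sup>2 * (2 * T (mu / 2)) \<le> (v 0)\<^sup>2 * (T (mass 0) + T (mu - mass 0))"
    using symmetric_bounds(1)[OF t] sym[of T] by (intro mult_left_mono) auto
  moreover have "K (mass 0) + K (mu - mass 0) \<le> 2 * K (mu / 2)" using symmetric_bounds(2)[OF t] sym[of K] by simp
  moreover have "(A + B) / 2 + V * t - 2 * k \<le> I1 + I2"
    if "V * (2 * t) \<le> V * (t1 + t2)" "k1 + k2 \<le> 2 * k" "A / 2 + V * t1 / 2 - k1 \<le> I1" "B / 2 + V * t2 / 2 - k2 \<le> I2"
    for A B V t t1 t2 k k1 k2 I1 I2 :: real
  proof -
    have "2 * (V * t) \<le> V * t1 + V * t2" using that(1) by (simp add: algebra_simps)
    moreover have "(A + B) / 2 + a - 2 * k \<le> I1 + I2" if "2 * a \<le> b + c" "k1 + k2 \<le> 2 * k" "A / 2 + b / 2 - k1 \<le> I1" "B / 2 + c / 2 - k2 \<le> I2" for a b c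
      using that by (simp add: field_simps)
    ultimately show ?thesis using that(2-4) by blast
  qed
  ultimately show ?thesis
    using left.calibration_inequality right.calibration_inequality unfolding eq total_defect_split(2)
    by (simp only: minus_zero)
qed

lemma square_near_R_left: "x \<le> 0 \<Longrightarrow> \<bar>(v x)\<^sup>2 - R (mass x)\<bar> \<le> (mu + 1) * sqrt total_defect"
  and square_near_R_right: "x \<le> 0 \<Longrightarrow> \<bar>(v (- x))\<^sup>2 - R (mu - mass (- x))\<bar> \<le> (mu + 1) * sqrt total_defect"
proof -
  assume x: "x \<le> 0"
  show "\<bar>(v x)\<^sup>2 - R (mass x)\<bar> \<le> (mu + 1) * sqrt total_defect"
  proof (rule le_sqrt_of_le_all)
    fix \<eta> :: real assume eta: "\<eta> > 0"
    have "(LINT x:{..0}|lborel. (left.defect x)\<^sup>2) / \<eta> \<le> total_defect / \<eta>"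
      using half_defects total_defect_split(2) eta by (intro divide_right_mono) auto
    moreover have "\<eta> * mass 0 \<le> \<eta> * mu" using mass_le_mu[of 0] eta by (intro mult_left_mono) auto
    ultimately show "\<bar>(v x)\<^sup>2 - R (mass x)\<bar> \<le> \<eta> * mu + total_defect / \<eta>" using left.square_near_R[OF eta x] by linarith
  qed (use half_defects mu_pos in auto)
  show "\<bar>(v (- x))\<^sup>2 - R (mu - mass (- x))\<bar> \<le> (mu + 1) * sqrt total_defect"
  proof (rule le_sqrt_of_le_all)
    fix \<eta> :: real assume eta: "\<eta> > 0"
    have "(LINT x:{..0}|lborel. (right.defect x)\<^sup>2) / \<eta> \<le> total_defect / \<eta>"
      using half_defects total_defect_split(2) eta by (intro divide_right_mono) auto
    moreover have "\<eta> * (mu - mass (- 0)) \<le> \<eta> * mu" using mass_pos[of 0] eta by (intro mult_left_mono) auto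
    ultimately show "\<bar>(v (- x))\<^sup>2 - R (mu - mass (- x))\<bar> \<le> \<eta> * mu + total_defect / \<eta>" using right.square_near_R[OF eta x] by linarith
  qed (use half_defects mu_pos in auto)
qed

text \<open>Both one-sided estimates at \<open>0\<close> compare with the same value
  \<open>(v 0)\<^sup>2\<close>, so \<open>R\<close> almost agrees at the two masses. The third part
  of \<open>symmetric_bounds\<close> turns this into closeness of the masses. The estimate carries
  information when \<open>T (mu / 2)\<close> is positive: this is where an attractive delta pins the
  soliton to the origin.\<close>

lemma half_mass_estimate:
  "4 * T (mu / 2) * \<bar>mass 0 - mu / 2\<bar> \<le> 2 * ((mu + 1) * sqrt total_defect)"
proof -
  define t where "t = \<bar>mass 0 - mu / 2\<bar>"
  have t: "0 \<le> t" "t < mu / 2" "mu \<le> M" using mass_pos[of 0] mass_less_mu[of 0] mu(2) by (auto simp: t_def abs_if)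
  have "4 * T (mu / 2) * t \<le> R (mu / 2 + t) - R (mu / 2 - t)" by (rule symmetric_bounds(3)[OF t])
  also have "\<dots> \<le> \<bar>R (mass 0) - R (mu - mass 0)\<bar>"
    by (cases "mass 0 \<ge> mu / 2") (auto simp: t_def abs_if algebra_simps)
  also have "\<dots> \<le> 2 * ((mu + 1) * sqrt total_defect)" using square_near_R_left[of 0] square_near_R_right[of 0] by simp
  finally show ?thesis by (simp add: t_def)
qed

lemma gronwall_left: "x \<le> 0 \<Longrightarrow> (mass x - N (x + xs))\<^sup>2 \<le> ((mass 0 - N xs)\<^sup>2 + ((mu + 1) * sqrt total_defect)\<^sup>2) * exp (- (4 * sqrt w + 1) * x)"
  by (rule left.mass_gronwall) (use square_near_R_left half_defects mu_pos in auto)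

lemma gronwall_right: "x \<le> 0 \<Longrightarrow> (mu - mass (- x) - N (x + xs))\<^sup>2 \<le> ((mu - mass 0 - N xs)\<^sup>2 + ((mu + 1) * sqrt total_defect)\<^sup>2) * exp (- (4 * sqrt w + 1) * x)"
  using right.mass_gronwall[of "(mu + 1) * sqrt total_defect" x xs] square_near_R_right half_defects mu_pos by auto

end

section \<open>The standing wave and its frequency\<close>

lemma tendsto_of_square_bound:
  fixes f :: "nat \<Rightarrow> real"
  assumes "\<And>n. (f n - c)\<^sup>2 \<le> B n" "B \<longlonglongrightarrow> 0"
  shows "f \<longlonglongrightarrow> c"
proof -
  have "(\<lambda>n. (f n - c)\<^sup>2) \<longlonglongrightarrow> 0"
    by (rule tendsto_sandwich[OF _ _ tendsto_const assms(2)]) (use assms(1) in auto)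
  then have "(\<lambda>n. (\<bar>f n - c\<bar>)\<^sup>2) \<longlonglongrightarrow> 0" by simp
  then have "(\<lambda>n. \<bar>f n - c\<bar>) \<longlonglongrightarrow> 0" by (rule tendsto_zero_of_power2) simp
  then show ?thesis by (simp add: LIM_zero_iff tendsto_rabs_zero_iff)
qed

context soliton
begin

lemma isCont_R: "0 < m \<Longrightarrow> m < M \<Longrightarrow> isCont R m" by (rule DERIV_isCont[OF DERIV_R])
lemma isCont_T: "0 < m \<Longrightarrow> m < M \<Longrightarrow> isCont T m" by (rule DERIV_isCont[OF DERIV_T])

text \<open>The masses left of \<open>0\<close> converge to \<open>1/2\<close> because
  \<open>T (mu n / 2)\<close> stays away from zero. Gronwall carries this along both half-lines, so
  the running masses converge at every point; squares and slopes follow by continuity of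
  \<open>R\<close> and \<open>T\<close>.\<close>

lemma slice_convergence:
  fixes v g :: "nat \<Rightarrow> real \<Rightarrow> real"
  assumes fl: "\<And>n. full_line q w (v n) (g n) (mu n)"
    and mu: "mu \<longlonglongrightarrow> 1" and D: "(\<lambda>n. full_line.total_defect q w (v n) (g n) (mu n)) \<longlonglongrightarrow> 0"
    and xs: "N xs = 1 / 2" "0 < tau xs"
  shows "(\<lambda>n. (v n x)\<^sup>2) \<longlonglongrightarrow> rho (xs - \<bar>x\<bar>)"
    and "(\<lambda>n. full_line.slope q w (v n) (mu n) x) \<longlonglongrightarrow> (if x \<le> 0 then tau (x + xs) else - tau (xs - x))"
proof -
  define m where "m n x = H1_line.mass (v n) x" for n x
  define e where "e n = (mu n + 1) * sqrt (full_line.total_defect q w (v n) (g n) (mu n))" for n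
  have el: "e \<longlonglongrightarrow> 0"
    using tendsto_mult[OF tendsto_add[OF mu tendsto_const] tendsto_real_sqrt[OF D], of 1] by (simp add: e_def[abs_def])
  have M1: "0 < (1/2::real)" "1/2 < M" using N_bounds[of xs] xs by auto
  have Tl: "(\<lambda>n. T (mu n / 2)) \<longlonglongrightarrow> tau xs"
    using isCont_tendsto_compose[OF isCont_T[OF M1] tendsto_divide[OF mu tendsto_const, of 2]] T_N[of xs] xs by simp
  have ev: "\<forall>\<^sub>F n in sequentially. tau xs / 2 < T (mu n / 2)" using order_tendstoD(1)[OF Tl, of "tau xs / 2"] xs(2) by simp
  have "(\<lambda>n. \<bar>m n 0 - mu n / 2\<bar>) \<longlonglongrightarrow> 0"
  proof (rule tendsto_sandwich[OF _ _ tendsto_const])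
    show "(\<lambda>n. e n / tau xs) \<longlonglongrightarrow> 0" using tendsto_divide[OF el tendsto_const, of "tau xs"] xs(2) by simp
    show "\<forall>\<^sub>F n in sequentially. \<bar>m n 0 - mu n / 2\<bar> \<le> e n / tau xs"
      using ev
    proof eventually_elim
      case (elim n)
      have "4 * (tau xs / 2) * \<bar>m n 0 - mu n / 2\<bar> \<le> 4 * T (mu n / 2) * \<bar>m n 0 - mu n / 2\<bar>"
        using elim by (intro mult_right_mono) auto
      also have "\<dots> \<le> 2 * e n" using full_line.half_mass_estimate[OF fl, of n] by (simp add: m_def e_def)
      finally show ?case using xs(2) by (simp add: field_simps)
    qed
  qed simp
  then have "(\<lambda>n. m n 0 - mu n / 2) \<longlonglongrightarrow> 0" by (simp add: tendsto_rabs_zero_iff)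
  from tendsto_add[OF this tendsto_divide[OF mu tendsto_const, of 2]] have m0: "(\<lambda>n. m n 0) \<longlonglongrightarrow> N xs" unfolding xs(1) by simp
  have ml: "(\<lambda>n. m n x) \<longlonglongrightarrow> N (x + xs)" if "x \<le> 0" for x
  proof (rule tendsto_of_square_bound)
    show "(m n x - N (x + xs))\<^sup>2 \<le> ((m n 0 - N xs)\<^sup>2 + (e n)\<^sup>2) * exp (- (4 * sqrt w + 1) * x)" for n
      using full_line.gronwall_left[OF fl that] unfolding m_def e_def .
    have "(\<lambda>n. ((m n 0 - N xs)\<^sup>2 + (e n)\<^sup>2) * exp (- (4 * sqrt w + 1) * x)) \<longlonglongrightarrow> ((N xs - N xs)\<^sup>2 + 0\<^sup>2) * exp (- (4 * sqrt w + 1) * x)"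
      by (intro tendsto_intros m0 el)
    then show "(\<lambda>n. ((m n 0 - N xs)\<^sup>2 + (e n)\<^sup>2) * exp (- (4 * sqrt w + 1) * x)) \<longlonglongrightarrow> 0" by simp
  qed
  have mr: "(\<lambda>n. mu n - m n (- x)) \<longlonglongrightarrow> N (x + xs)" if "x \<le> 0" for x
  proof (rule tendsto_of_square_bound)
    show "(mu n - m n (- x) - N (x + xs))\<^sup>2 \<le> ((mu n - m n 0 - N xs)\<^sup>2 + (e n)\<^sup>2) * exp (- (4 * sqrt w + 1) * x)" for n
      using full_line.gronwall_right[OF fl that] unfolding m_def e_def .
    have "(\<lambda>n. ((mu n - m n 0 - N xs)\<^sup>2 + (e n)\<^sup>2) * exp (- (4 * sqrt w + 1) * x)) \<longlonglongrightarrow> ((1 - N xs - N xs)\<^sup>2 + 0\<^sup>2) * exp (- (4 * sqrt w + 1) * x)"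
      by (intro tendsto_intros m0 mu el)
    then show "(\<lambda>n. ((mu n - m n 0 - N xs)\<^sup>2 + (e n)\<^sup>2) * exp (- (4 * sqrt w + 1) * x)) \<longlonglongrightarrow> 0" unfolding xs(1) by simp
  qed
  have sq: "f \<longlonglongrightarrow> rho z" if "\<And>n. \<bar>f n - R (a n)\<bar> \<le> e n" "a \<longlonglongrightarrow> N z" for f a :: "nat \<Rightarrow> real" and z
  proof -
    have "(\<lambda>n. R (a n)) \<longlonglongrightarrow> rho z"
      using isCont_tendsto_compose[OF isCont_R[OF N_bounds] that(2)] by (simp add: R_N)
    moreover have "(\<lambda>n. f n - R (a n)) \<longlonglongrightarrow> 0"
      by (rule Lim_null_comparison[OF _ el]) (use that(1) in auto)
    ultimately show ?thesis using tendsto_add by fastforce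
  qed
  have Tc: "(\<lambda>n. T (a n)) \<longlonglongrightarrow> tau z" if "a \<longlonglongrightarrow> N z" for a :: "nat \<Rightarrow> real" and z
    using isCont_tendsto_compose[OF isCont_T[OF N_bounds] that] by (simp add: T_N)
  show "(\<lambda>n. (v n x)\<^sup>2) \<longlonglongrightarrow> rho (xs - \<bar>x\<bar>)"
  proof (cases "x \<le> 0")
    case True
    have "(\<lambda>n. (v n x)\<^sup>2) \<longlonglongrightarrow> rho (x + xs)"
      by (rule sq[OF _ ml[OF True]]) (use full_line.square_near_R_left[OF fl True] in \<open>simp add: m_def e_def\<close>)
    then show ?thesis using True by (simp add: add.commute)
  next
    case False
    then have x: "- x \<le> 0" by simp
    have "(\<lambda>n. (v n x)\<^sup>2) \<longlonglongrightarrow> rho (- x + xs)"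
      by (rule sq[OF _ mr[OF x]]) (use full_line.square_near_R_right[OF fl x] in \<open>simp add: m_def e_def\<close>)
    then show ?thesis using False by simp
  qed
  show "(\<lambda>n. full_line.slope q w (v n) (mu n) x) \<longlonglongrightarrow> (if x \<le> 0 then tau (x + xs) else - tau (xs - x))"
  proof (cases "x \<le> 0")
    case True
    then show ?thesis using Tc[OF ml[OF True]] by (simp add: full_line.slope_def[OF fl] m_def)
  next
    case False
    then have x: "- x \<le> 0" by simp
    show ?thesis using False tendsto_minus[OF Tc[OF mr[OF x]]] by (simp add: full_line.slope_def[OF fl] m_def)
  qed
qed

section \<open>The glued profile: derivative, mass and energy\<close>

definition "wave xs x = sqrt (rho (xs - \<bar>x\<bar>))"
definition "wave_slope xs x = (if x \<le> 0 then tau (x + xs) else - tau (xs - x))"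

lemma wave_pos: "wave xs x > 0" by (simp add: wave_def rho_pos)
lemma wave_square: "(wave xs x)\<^sup>2 = rho (xs - \<bar>x\<bar>)" using rho_pos[of "xs - \<bar>x\<bar>"] by (simp add: wave_def)

lemma wave_measurable [measurable]: "wave xs \<in> borel_measurable borel" "wave_slope xs \<in> borel_measurable borel"
  unfolding wave_def[abs_def] wave_slope_def[abs_def] by measurable

lemma wave_slope_bound: "\<bar>wave_slope xs x\<bar> \<le> sqrt w"
  using tau_bound[of "x + xs"] tau_bound[of "xs - x"] by (auto simp: wave_slope_def)

lemma rho_shift_AC: "indefinite_integral_of (\<lambda>x. tau (x + xs) * sqrt (rho (x + xs))) (\<lambda>x. sqrt (rho (x + xs)))"
proof (rule indefinite_integral_of_DERIV)
  have p: "0 < rho (x + xs)" for x by (rule rho_pos)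
  show "((\<lambda>x. sqrt (rho (x + xs))) has_real_derivative tau (x + xs) * sqrt (rho (x + xs))) (at x)" for x
  proof -
    have "((\<lambda>x. rho (x + xs)) has_real_derivative 2 * tau (x + xs) * rho (x + xs)) (at x)"
      using DERIV_chain2[OF DERIV_rho DERIV_add[OF DERIV_ident DERIV_const]] by simp
    from DERIV_chain2[OF DERIV_real_sqrt[OF p] this]
    show ?thesis
    proof (rule DERIV_cong)
      have "inverse (sqrt (rho (x + xs))) * rho (x + xs) = sqrt (rho (x + xs))"
        using p[of x] by (simp add: divide_inverse[symmetric] real_div_sqrt mult.commute[of "inverse _"])
      then show "inverse (sqrt (rho (x + xs))) / 2 * (2 * tau (x + xs) * rho (x + xs)) = tau (x + xs) * sqrt (rho (x + xs))"
        by (simp add: algebra_simps)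
    qed
  qed
  show "continuous_on UNIV (\<lambda>x. tau (x + xs) * sqrt (rho (x + xs)))"
    by (intro continuous_intros continuous_on_compose2[OF rho_continuous[of UNIV]] continuous_on_compose2[OF tau_continuous[of UNIV]]) auto
qed

text \<open>The corner at \<open>0\<close> is a jump of \<open>wave_slope\<close>, which absolute
  continuity tolerates. Intervals across \<open>0\<close> are cut there, and on the right half-line
  the reflection of the translate is used.\<close>

lemma wave_AC: "indefinite_integral_of (\<lambda>x. wave_slope xs x * wave xs x) (wave xs)"
proof -
  let ?g = "\<lambda>x. wave_slope xs x * wave xs x"
  have l: "set_integrable lborel {x..y} ?g \<and> wave xs y = wave xs x + (LINT r:{x..y}|lborel. ?g r)" if xy: "x \<le> y" "y \<le> 0" for x y
  proof -
    have eq: "indicator {x..y} r *\<^sub>R ?g r = indicator {x..y} r *\<^sub>R (tau (r + xs) * sqrt (rho (r + xs)))" for r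
      using xy by (auto simp: indicator_def wave_slope_def wave_def add.commute)
    show ?thesis using indefinite_integral_of_Icc(1,2)[OF rho_shift_AC xy(1), of xs] xy
      unfolding set_integrable_def set_lebesgue_integral_def eq by (simp add: wave_def add.commute)
  qed
  have r: "set_integrable lborel {x..y} ?g \<and> wave xs y = wave xs x + (LINT r:{x..y}|lborel. ?g r)" if xy: "0 \<le> x" "x \<le> y" for x y
  proof -
    note A = indefinite_integral_of_reflect[OF rho_shift_AC, of xs]
    have eq: "AE r in lborel. indicator {x..y} r *\<^sub>R (- (tau (- r + xs) * sqrt (rho (- r + xs)))) = indicator {x..y} r *\<^sub>R ?g r"
      using AE_lborel_singleton[of 0] by eventually_elim (use xy in \<open>auto simp: indicator_def wave_slope_def wave_def add.commute\<close>)
    have m: "(\<lambda>r. indicator {x..y} r *\<^sub>R (- (tau (- r + xs) * sqrt (rho (- r + xs))))) \<in> borel_measurable lborel"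
      "(\<lambda>r. indicator {x..y} r *\<^sub>R ?g r) \<in> borel_measurable lborel" by measurable
    show ?thesis using indefinite_integral_of_Icc(1,2)[OF A xy(2)] integrable_cong_AE[OF m eq] integral_cong_AE[OF m eq] xy
      unfolding set_integrable_def set_lebesgue_integral_def by (simp add: wave_def add.commute)
  qed
  show ?thesis
  proof (rule indefinite_integral_of_IccI)
    fix x y :: real assume xy: "x \<le> y"
    have "set_integrable lborel {x..y} ?g \<and> wave xs y = wave xs x + (LINT r:{x..y}|lborel. ?g r)"
    proof (cases "x \<le> 0 \<and> 0 \<le> y")
      case True
      have u: "{x..y} = {x..0} \<union> {0..y}" using True by auto
      have i: "set_integrable lborel ({x..0} \<union> {0..y}) ?g" using l[of x 0] r[of 0 y] True by (intro set_integrable_Un) auto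
      have "(LINT r:{x..y}|lborel. ?g r) = (LINT r:{x..0}|lborel. ?g r) + (LINT r:{0<..y}|lborel. ?g r)"
      proof -
        have u': "{x..y} = {x..0} \<union> {0<..y}" using True by auto
        have "set_integrable lborel {0..y} ?g" using r[of 0 y] True by auto
        then have "set_integrable lborel {0<..y} ?g" by (rule set_integrable_subset) auto
        then show ?thesis unfolding u'
          by (intro set_integral_Un) (use l[of x 0] True in auto)
      qed
      also have "(LINT r:{0<..y}|lborel. ?g r) = (LINT r:{0..y}|lborel. ?g r)" by (rule LINT_Ioc_eq_Icc) (use r[of 0 y] True in auto)
      finally show ?thesis using l[of x 0] r[of 0 y] True i u by simp
    next
      case False
      then show ?thesis using l[of x y] r[of x y] xy by (cases "y \<le> 0") auto
    qed
    then show "set_integrable lborel {x..y} ?g" "wave xs y = wave xs x + (LINT r:{x..y}|lborel. ?g r)" by auto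
  qed
qed

lemma even_integral:
  fixes f :: "real \<Rightarrow> real"
  assumes f: "integrable lborel f" and [measurable]: "h \<in> borel_measurable borel" and h: "\<And>x. h x = f (xs - \<bar>x\<bar>)"
  shows "integrable lborel h" "(LINT x|lborel. h x) = 2 * (LINT x:{..xs}|lborel. f x)"
proof -
  have fm[measurable]: "f \<in> borel_measurable borel" using f by simp
  have i: "integrable lborel (\<lambda>x. indicator {..0} x *\<^sub>R f (xs + x))"
    using lborel_integrable_real_affine_iff[of 1 f xs] f by (intro integrable_mult_indicator) auto
  have i': "integrable lborel (\<lambda>x. indicator {..0} (- x) *\<^sub>R f (xs + - x))"
    using lborel_integrable_real_affine_iff[of "-1" "\<lambda>x. indicator {..0} x *\<^sub>R f (xs + x)" 0] i by simp
  have e: "AE x in lborel. indicator {..0} x *\<^sub>R f (xs + x) + indicator {..0} (- x) *\<^sub>R f (xs + - x) = h x"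
    using AE_lborel_singleton[of 0] by eventually_elim (auto simp: indicator_def h)
  show "integrable lborel h"
    by (rule integrable_cong_AE_imp[OF Bochner_Integration.integrable_add[OF i i']]) (use e in auto)
  have "(LINT x|lborel. h x) = (LINT x|lborel. indicator {..0} x *\<^sub>R f (xs + x) + indicator {..0} (- x) *\<^sub>R f (xs + - x))"
    by (rule integral_cong_AE) (use e in \<open>auto elim: eventually_mono\<close>)
  also have "\<dots> = (LINT x|lborel. indicator {..0} x *\<^sub>R f (xs + x)) + (LINT x|lborel. indicator {..0} (- x) *\<^sub>R f (xs + - x))"
    by (rule Bochner_Integration.integral_add[OF i i'])
  also have "(LINT x|lborel. indicator {..0} (- x) *\<^sub>R f (xs + - x)) = (LINT x|lborel. indicator {..0} x *\<^sub>R f (xs + x))"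
    using lborel_integral_real_affine[of "-1" "\<lambda>x. indicator {..0} x *\<^sub>R f (xs + x)" 0] by simp
  also have "(LINT x|lborel. indicator {..0} x *\<^sub>R f (xs + x)) = (LINT x|lborel. indicator {..xs} (xs + 1 * x) *\<^sub>R f (xs + 1 * x))"
    by (rule Bochner_Integration.integral_cong) (auto simp: indicator_def)
  also have "\<dots> = (LINT x:{..xs}|lborel. f x)"
    using lborel_integral_real_affine[of 1 "\<lambda>x. indicator {..xs} x *\<^sub>R f x" xs] by (simp add: set_lebesgue_integral_def)
  finally show "(LINT x|lborel. h x) = 2 * (LINT x:{..xs}|lborel. f x)" by simp
qed

lemma wave_mass: "integrable lborel (\<lambda>x. (wave xs x)\<^sup>2)" "(LINT x|lborel. (wave xs x)\<^sup>2) = 2 * N xs"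
  unfolding N_def by (rule even_integral[OF rho_integrable]; simp add: wave_square)+

lemma wave_derivative_square: "integrable lborel (\<lambda>x. (wave_slope xs x * wave xs x)\<^sup>2)"
proof (rule Bochner_Integration.integrable_bound[OF integrable_mult_right[OF wave_mass(1), of w]])
  show "AE x in lborel. norm ((wave_slope xs x * wave xs x)\<^sup>2) \<le> norm (w * (wave xs x)\<^sup>2)"
  proof (rule AE_I2)
    fix x
    have "(wave_slope xs x)\<^sup>2 \<le> w" using abs_le_square_iff[of "wave_slope xs x" "sqrt w"] wave_slope_bound[of xs x] w by simp
    then show "norm ((wave_slope xs x * wave xs x)\<^sup>2) \<le> norm (w * (wave xs x)\<^sup>2)"
      using w by (simp add: power_mult_distrib mult_right_mono)
  qed
qed measurable

text \<open>On the wave the calibration is exact: \<open>tau x * rho x / 2 - K (N x)\<close> is a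
  primitive of the energy density of the left half-line. Both halves have mass \<open>1/2\<close>,
  so the value equals the lower bound of \<open>energy_lower_bound\<close> for total mass one, with
  the point term moved to the other side.\<close>

lemma wave_energy:
  assumes xs: "N xs = 1 / 2"
  shows "(LINT x|lborel. (wave_slope xs x * wave xs x)\<^sup>2 / 2 - ((wave xs x)\<^sup>2) powr (q + 1) / (2 * (q + 1))) - tau xs * (wave xs 0)\<^sup>2 = - 2 * K (1 / 2)"
proof -
  define f where "f x = (tau x)\<^sup>2 * rho x / 2 - rho x powr (q + 1) / (2 * (q + 1))" for x
  define F where "F x = tau x * rho x / 2 - K (N x)" for x
  have KN: "((\<lambda>x. K (N x)) has_real_derivative (w / 2 - q / (2 * (q + 1)) * rho x powr q) * rho x) (at x)" for x
    using DERIV_chain2[OF DERIV_K[OF N_bounds] DERIV_N] by (simp add: R_N)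
  have dF: "(F has_real_derivative f x) (at x)" for x
  proof -
    have "(F has_real_derivative ((- (q / (q + 1)) * rho x powr q) * rho x + (2 * tau x * rho x) * tau x) / 2 - (w / 2 - q / (2 * (q + 1)) * rho x powr q) * rho x) (at x)"
      unfolding F_def[abs_def] by (intro DERIV_diff DERIV_cdivide DERIV_mult DERIV_tau DERIV_rho KN)
    moreover have "((- (q / (q + 1)) * rho x powr q) * rho x + (2 * tau x * rho x) * tau x) / 2 - (w / 2 - q / (2 * (q + 1)) * rho x powr q) * rho x = f x"
    proof -
      have pw: "rho x powr (q + 1) = rho x powr q * rho x" using rho_pos[of x] by (simp add: powr_add)
      have ww: "w = (tau x)\<^sup>2 + rho x powr q / (q + 1)" using tau_square[of x] by simp
      have "q + 1 > 0" using q by simp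
      then show ?thesis unfolding f_def pw by (subst ww) (simp add: divide_simps, simp add: algebra_simps power2_eq_square)
    qed
    ultimately show ?thesis by simp
  qed
  have pi: "integrable lborel (\<lambda>x. rho x powr (q + 1))"
  proof (rule Bochner_Integration.integrable_bound[OF integrable_mult_right[OF rho_integrable, of "rho 0 powr q"]])
    show "AE x in lborel. norm (rho x powr (q + 1)) \<le> norm (rho 0 powr q * rho x)"
    proof (rule AE_I2)
      fix x
      have "rho x powr (q + 1) = rho x powr q * rho x" using rho_pos[of x] by (simp add: powr_add)
      also have "\<dots> \<le> rho 0 powr q * rho x" using rho_le_max[of x] rho_pos[of x] q by (intro mult_right_mono powr_mono2) auto
      finally show "norm (rho x powr (q + 1)) \<le> norm (rho 0 powr q * rho x)" using rho_pos[of x] by simp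
    qed
  qed measurable
  have ti: "integrable lborel (\<lambda>x. (tau x)\<^sup>2 * rho x)"
  proof (rule Bochner_Integration.integrable_bound[OF integrable_mult_right[OF rho_integrable, of w]])
    show "AE x in lborel. norm ((tau x)\<^sup>2 * rho x) \<le> norm (w * rho x)"
    proof (rule AE_I2)
      fix x
      have "(tau x)\<^sup>2 \<le> w" using tau_square[of x] q by simp
      from mult_right_mono[OF this less_imp_le[OF rho_pos[of x]]]
      show "norm ((tau x)\<^sup>2 * rho x) \<le> norm (w * rho x)" using w rho_pos[of x] by (simp add: abs_mult)
    qed
  qed measurable
  have fi: "integrable lborel f" unfolding f_def using pi ti by auto
  have fc: "continuous_on UNIV f"
  proof -
    have "rho x \<noteq> 0" for x using rho_pos[of x] by simp
    then show ?thesis unfolding f_def[abs_def] using q by (intro continuous_intros rho_continuous tau_continuous) auto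
  qed
  have FAC: "indefinite_integral_of f F" by (rule indefinite_integral_of_DERIV[OF dF fc])
  have Fl: "(F \<longlongrightarrow> 0) at_bot"
  proof -
    have "((\<lambda>x. tau x * rho x) \<longlongrightarrow> 0) at_bot"
    proof (rule Lim_null_comparison)
      show "((\<lambda>x. sqrt w * rho x) \<longlongrightarrow> 0) at_bot" using tendsto_mult[OF tendsto_const rho_tendsto_bot, of "sqrt w"] by simp
      show "\<forall>\<^sub>F x in at_bot. norm (tau x * rho x) \<le> sqrt w * rho x"
        using tau_bound rho_pos by (intro always_eventually allI) (auto simp: abs_mult less_imp_le intro!: mult_right_mono)
    qed
    moreover have "((\<lambda>x. K (N x)) \<longlongrightarrow> 0) at_bot"
    proof (rule Lim_null_comparison)
      show "((\<lambda>x. 3 * w * N x) \<longlongrightarrow> 0) at_bot" using tendsto_mult[OF tendsto_const N_limits(1), of "3 * w"] by simp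
      show "\<forall>\<^sub>F x in at_bot. norm (K (N x)) \<le> 3 * w * N x"
        using K_bound[OF N_bounds] by (intro always_eventually allI) auto
    qed
    ultimately have "(F \<longlongrightarrow> 0 / 2 - 0) at_bot" unfolding F_def[abs_def] by (intro tendsto_intros) auto
    then show ?thesis by simp
  qed
  have "((\<lambda>a. LINT x:{a..xs}|lborel. f x) \<longlongrightarrow> (LINT x:{..xs}|lborel. f x)) at_bot"
    by (rule tendsto_set_lebesgue_integral_at_bot) (auto simp: set_integrable_def intro!: integrable_mult_indicator[of _ _ f, simplified] fi)
  moreover have "((\<lambda>a. LINT x:{a..xs}|lborel. f x) \<longlongrightarrow> F xs - 0) at_bot"
  proof (rule Lim_transform_eventually)
    show "((\<lambda>a. F xs - F a) \<longlongrightarrow> F xs - 0) at_bot" by (intro tendsto_intros Fl)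
    show "\<forall>\<^sub>F a in at_bot. F xs - F a = (LINT x:{a..xs}|lborel. f x)"
      unfolding eventually_at_bot_linorder
      by (rule exI[of _ xs]) (use indefinite_integral_of_Icc(2)[OF FAC] in simp)
  qed
  ultimately have If: "(LINT x:{..xs}|lborel. f x) = F xs" using tendsto_unique[of at_bot] trivial_limit_at_bot_linorder by fastforce
  have "(LINT x|lborel. (wave_slope xs x * wave xs x)\<^sup>2 / 2 - ((wave xs x)\<^sup>2) powr (q + 1) / (2 * (q + 1))) = 2 * (LINT x:{..xs}|lborel. f x)"
    by (rule even_integral(2)[OF fi]) (auto simp: f_def power_mult_distrib wave_square wave_slope_def add.commute)
  then show ?thesis unfolding If F_def using xs by (simp add: wave_square)
qed

end

section \<open>Fixing the frequency by the mass constraint\<close>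

lemma tanh_artanh_real:
  fixes x :: real
  assumes "- 1 < x" "x < 1"
  shows "tanh (artanh x) = x"
proof -
  have e: "exp (- 2 * artanh x) = (1 - x) / (1 + x)"
    using assms by (simp add: artanh_def exp_minus)
  show ?thesis using assms unfolding tanh_real_altdef e by (simp add: divide_simps)
qed

text \<open>The translation hidden in the closed formula of the profile:
  \<open>k * xshift q \<gamma> w\<close> is its \<open>artanh\<close> term. There \<open>tau\<close>
  equals \<open>- \<gamma> / 2\<close>, which is the jump condition imposed by the delta.\<close>

definition xshift :: "real \<Rightarrow> real \<Rightarrow> real \<Rightarrow> real" where
  "xshift q \<gamma> w = artanh (\<gamma> / (2 * sqrt w)) / (q * sqrt w)"

lemma slope_ratio_bounds:
  fixes \<gamma> w :: real
  assumes "\<gamma> < 0" "\<gamma>\<^sup>2 / 4 < w"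
  shows "0 < w" "- 1 < \<gamma> / (2 * sqrt w)" "\<gamma> / (2 * sqrt w) < 0" "\<gamma> / (2 * sqrt w) < 1"
proof -
  show w: "0 < w" using assms(2) zero_le_power2[of \<gamma>] by linarith
  have "sqrt (\<gamma>\<^sup>2) < sqrt (4 * w)" using assms by (intro real_sqrt_less_mono) simp
  then have "- \<gamma> < 2 * sqrt w" using assms(1) by (simp add: real_sqrt_mult)
  then show "- 1 < \<gamma> / (2 * sqrt w)" using w by (simp add: field_simps)
  show "\<gamma> / (2 * sqrt w) < 0" using assms(1) w by (simp add: field_simps)
  then show "\<gamma> / (2 * sqrt w) < 1" by linarith
qed

context
  fixes q w \<gamma> :: real
  assumes qw: "soliton q w" and g: "\<gamma> < 0" "\<gamma>\<^sup>2 / 4 < w"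
begin

interpretation soliton q w by (rule qw)

lemma tau_xshift: "tau (xshift q \<gamma> w) = - \<gamma> / 2"
proof -
  have "k * xshift q \<gamma> w = artanh (\<gamma> / (2 * sqrt w))" using q w by (simp add: xshift_def k_def)
  moreover have "tanh (artanh (\<gamma> / (2 * sqrt w))) = \<gamma> / (2 * sqrt w)"
    by (rule tanh_artanh_real[OF slope_ratio_bounds(2,4)[OF g]])
  ultimately show ?thesis using w by (simp add: tau_def)
qed

lemma profile_eq_wave: "profile (2 * q + 1) \<gamma> w x = wave (xshift q \<gamma> w) x"
proof -
  define c where "c = cosh (k * (xshift q \<gamma> w - \<bar>x\<bar>))"
  have c: "c > 0" unfolding c_def by (rule cosh_real_pos)
  have a: "(q + 1) * w > 0" using q w by simp
  have "k * (xshift q \<gamma> w - \<bar>x\<bar>) = - ((2 * q + 1 - 1) * sqrt w / 2 * \<bar>x\<bar> - artanh (\<gamma> / (2 * sqrt w)))"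
    using q w by (simp add: xshift_def k_def right_diff_distrib)
  then have c': "cosh ((2 * q + 1 - 1) * sqrt w / 2 * \<bar>x\<bar> - artanh (\<gamma> / (2 * sqrt w))) = c" by (simp add: c_def)
  have "profile (2 * q + 1) \<gamma> w x = (((q + 1) * w) * (1 / c)\<^sup>2) powr (1 / (2 * q))"
  proof -
    have "(2 * q + 1 + 1) * w / 2 * (1 / c)\<^sup>2 = (q + 1) * w * (1 / c)\<^sup>2" by (simp add: algebra_simps)
    then show ?thesis unfolding profile_def c' by (simp only:) simp
  qed
  also have "\<dots> = ((q + 1) * w) powr (1 / (2 * q)) * ((1 / c)\<^sup>2) powr (1 / (2 * q))" by (rule powr_mult)
  also have "(1 / c)\<^sup>2 = c powr (- 2)" using c by (simp add: powr_minus_divide powr_numeral power_divide)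
  also have "((q + 1) * w) powr (1 / (2 * q)) * (c powr (- 2)) powr (1 / (2 * q)) = (((q + 1) * w) powr (1 / q) * c powr (- 2 / q)) powr (1 / 2)"
    using q by (simp add: powr_mult powr_powr mult.commute[of 2 q])
  also have "\<dots> = sqrt (((q + 1) * w) powr (1 / q) * c powr (- 2 / q))" by (rule powr_half_sqrt) simp
  finally show ?thesis by (simp add: wave_def rho_def c_def)
qed

lemma profile_mass: "(Ltwo_norm lebesgue (\<lambda>x. complex_of_real (profile (2 * q + 1) \<gamma> w x)))\<^sup>2 = 2 * N (xshift q \<gamma> w)"
proof -
  have "(LINT x|lebesgue. (norm (complex_of_real (profile (2 * q + 1) \<gamma> w x)))\<^sup>2) = (LINT x|lborel. (wave (xshift q \<gamma> w) x)\<^sup>2)"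
    unfolding profile_eq_wave by (simp add: integral_completion)
  then show ?thesis unfolding Ltwo_norm_def wave_mass(2) using N_bounds(1)[of "xshift q \<gamma> w"] by simp
qed

end

text \<open>Scaling reduces every frequency to \<open>1 / q\<^sup>2\<close>, the one for which
  \<open>k = 1\<close>. The dependence on \<open>w\<close> becomes explicit: a power of
  \<open>w\<close> times one fixed increasing function of the scaled argument.\<close>

lemma N_scaling:
  assumes q: "0 < q" "q < 1" and w: "0 < w"
  shows "soliton.N q w x = ((1 / (1 / q\<^sup>2)) powr (1 / q) / q) * w powr (1 / q - 1 / 2) * soliton.N q (1 / q\<^sup>2) (q * sqrt w * x)"
proof -
  interpret a: soliton q w by unfold_locales (use q w in auto)
  interpret b: soliton q "1 / q\<^sup>2" by unfold_locales (use q in auto)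
  have kb: "b.k = 1" using q by (simp add: b.k_def real_sqrt_divide)
  define W where "W = w / (1 / q\<^sup>2)"
  have W: "W > 0" using q w by (simp add: W_def)
  have r: "a.rho r = W powr (1 / q) * b.rho (a.k * r)" for r
  proof -
    have "(q + 1) * w = W * ((q + 1) * (1 / q\<^sup>2))" using q by (simp add: W_def)
    then have "((q + 1) * w) powr (1 / q) = W powr (1 / q) * ((q + 1) * (1 / q\<^sup>2)) powr (1 / q)" by (simp only: powr_mult)
    then show ?thesis by (simp add: a.rho_def b.rho_def kb)
  qed
  have "b.N (a.k * x) = a.k * (LINT r|lborel. indicator {..a.k * x} (0 + a.k * r) * b.rho (0 + a.k * r))"
    unfolding b.N_def set_lebesgue_integral_def
    using lborel_integral_real_affine[of a.k "\<lambda>r. indicator {..a.k * x} r *\<^sub>R b.rho r" 0] a.k_pos by simp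
  also have "(LINT r|lborel. indicator {..a.k * x} (0 + a.k * r) * b.rho (0 + a.k * r)) = (LINT r|lborel. indicator {..x} r *\<^sub>R b.rho (a.k * r))"
    by (intro Bochner_Integration.integral_cong) (use a.k_pos in \<open>auto simp: indicator_def\<close>)
  finally have "(LINT r:{..x}|lborel. b.rho (a.k * r)) = b.N (a.k * x) / a.k" using a.k_pos by (simp add: set_lebesgue_integral_def)
  then have "a.N x = (W powr (1 / q) / a.k) * b.N (a.k * x)" unfolding a.N_def r by simp
  moreover have "W powr (1 / q) / a.k = ((1 / (1 / q\<^sup>2)) powr (1 / q) / q) * w powr (1 / q - 1 / 2)"
  proof -
    have "W = w * (1 / (1 / q\<^sup>2))" by (simp add: W_def)
    then have "W powr (1 / q) = w powr (1 / q) * (1 / (1 / q\<^sup>2)) powr (1 / q)" by (simp add: powr_mult)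
    moreover have "w powr (1 / q - 1 / 2) = w powr (1 / q) / sqrt w" using w by (simp add: powr_diff powr_half_sqrt)
    ultimately show ?thesis by (simp add: a.k_def)
  qed
  ultimately show ?thesis by (simp only: a.k_def)
qed

text \<open>This secures the \<open>THE\<close> in \<open>omega_tilde\<close>. After scaling, half
  of the mass is \<open>C * w powr s * b.N (A w)\<close>. Here \<open>s\<close> is positive, and
  \<open>A w\<close> increases because \<open>\<gamma> < 0\<close>, so the mass is strictly
  increasing in \<open>w\<close>. It tends to zero at \<open>\<gamma>^2 / 4\<close>, where
  \<open>A\<close> tends to \<open>-\<infinity>\<close>, and is unbounded for large
  \<open>w\<close>.\<close>

lemma omega_tilde_unique:
  assumes q: "0 < q" "q < 1" and \<gamma>: "\<gamma> < 0"
  shows "\<exists>!w. \<gamma>\<^sup>2 / 4 < w \<and> soliton.N q w (xshift q \<gamma> w) = 1 / 2"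
proof -
  interpret b: soliton q "1 / q\<^sup>2" by unfold_locales (use q in auto)
  define C where "C = (1 / (1 / q\<^sup>2)) powr (1 / q) / q"
  have C: "C > 0" using q by (simp add: C_def)
  define s where "s = 1 / q - 1 / 2"
  have s: "s > 0" using q by (simp add: s_def field_simps)
  define A where "A w = artanh (\<gamma> / (2 * sqrt w))" for w
  define G where "G w = C * w powr s * b.N (A w)" for w
  have G: "soliton.N q w (xshift q \<gamma> w) = G w" if "\<gamma>\<^sup>2 / 4 < w" for w
    using slope_ratio_bounds(1)[OF \<gamma> that] q unfolding G_def C_def s_def A_def xshift_def
    by (subst N_scaling) auto
  have bmono: "b.N x \<le> b.N y" if "x \<le> y" for x y using b.N_strict_mono[of x y] that by (cases "x = y") auto
  have Amono: "A w1 \<le> A w2" if w: "\<gamma>\<^sup>2 / 4 < w1" "w1 \<le> w2" for w1 w2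
  proof -
    note b1 = slope_ratio_bounds[OF \<gamma> w(1)]
    have w2: "\<gamma>\<^sup>2 / 4 < w2" using w by simp
    note b2 = slope_ratio_bounds[OF \<gamma> w2]
    have "\<gamma> / (2 * sqrt w1) \<le> \<gamma> / (2 * sqrt w2)"
      using \<gamma> b1(1) w(2) by (intro divide_left_mono_neg) auto
    then have "tanh (A w1) \<le> tanh (A w2)"
      unfolding A_def tanh_artanh_real[OF b1(2,4)] tanh_artanh_real[OF b2(2,4)] .
    then show ?thesis by (simp add: tanh_real_le_iff)
  qed
  have Gmono: "G w1 < G w2" if w: "\<gamma>\<^sup>2 / 4 < w1" "w1 < w2" for w1 w2
  proof -
    have w1: "0 < w1" by (rule slope_ratio_bounds(1)[OF \<gamma> w(1)])
    have "w1 powr s < w2 powr s" using w w1 s by (intro powr_less_mono2) auto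
    then have "C * w1 powr s < C * w2 powr s" using C by simp
    moreover have "b.N (A w1) \<le> b.N (A w2)" using w by (intro bmono Amono) auto
    ultimately show ?thesis unfolding G_def
      by (rule mult_less_le_imp_less) (use C b.N_bounds(1) in auto)
  qed
  have Gcont: "isCont G w" if w: "\<gamma>\<^sup>2 / 4 < w" for w
  proof -
    note b1 = slope_ratio_bounds[OF \<gamma> w]
    have "isCont artanh (\<gamma> / (2 * sqrt w))" using b1 by (intro isCont_artanh) auto
    moreover have "isCont (\<lambda>w. \<gamma> / (2 * sqrt w)) w" using b1 by (intro continuous_intros) auto
    ultimately have "isCont A w" unfolding A_def by (rule isCont_o2[rotated])
    then have "isCont (\<lambda>w. b.N (A w)) w" by (rule isCont_o2) (rule DERIV_isCont[OF b.DERIV_N])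
    then show ?thesis unfolding G_def using b1(1) by (intro continuous_intros) auto
  qed
  have g2: "\<gamma>\<^sup>2 / 4 < \<gamma>\<^sup>2" using \<gamma> by simp
  obtain w2 where w2: "\<gamma>\<^sup>2 \<le> w2" "1 / 2 \<le> G w2"
  proof -
    define n0 where "n0 = b.N (A (\<gamma>\<^sup>2))"
    have n0: "n0 > 0" unfolding n0_def by (rule b.N_bounds)
    \<comment> \<open>The solution of \<open>C * z powr s * n0 = 1 / 2\<close>, where
      \<open>n0\<close> bounds the last factor of \<open>G w\<close> from below for
      \<open>w \<ge> \<gamma>^2\<close>.\<close>
    define z where "z = (1 / (2 * C * n0)) powr (1 / s)"
    define w2 where "w2 = max (\<gamma>\<^sup>2) z"
    have "z powr s = 1 / (2 * C * n0)" using C n0 s by (simp add: z_def powr_powr)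
    moreover have "z powr s \<le> w2 powr s" using s by (intro powr_mono2) (auto simp: w2_def z_def)
    ultimately have "1 / (2 * C * n0) \<le> w2 powr s" by simp
    from mult_left_mono[OF this, of "C * n0"] have "1 / 2 \<le> C * w2 powr s * n0" using C n0 by (simp add: mult_ac)
    also have "\<dots> \<le> G w2" unfolding G_def n0_def using C g2 by (intro mult_left_mono bmono Amono) (auto simp: w2_def)
    finally show ?thesis using that[of w2] by (simp add: w2_def)
  qed
  obtain w1 where w1: "\<gamma>\<^sup>2 / 4 < w1" "w1 \<le> \<gamma>\<^sup>2" "G w1 \<le> 1 / 2"
  proof -
    define P where "P = C * (\<gamma>\<^sup>2) powr s"
    have P: "P > 0" using C \<gamma> by (simp add: P_def)
    obtain A1 where A1: "\<And>x. x \<le> A1 \<Longrightarrow> b.N x < 1 / (2 * P)"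
      using order_tendstoD(2)[OF b.N_limits(1), of "1 / (2 * P)"] P by (auto simp: eventually_at_bot_linorder)
    \<comment> \<open>A value of \<open>A\<close> so negative that the last factor of
      \<open>G\<close> is small. The cap \<open>artanh (- 1 / 2)\<close> is the value of
      \<open>A\<close> at \<open>\<gamma>^2\<close>, hence the frequency with
      \<open>A w1 = B\<close> is at most \<open>\<gamma>^2\<close>.\<close>
    define B where "B = min A1 (artanh (- 1 / 2))"
    have "tanh B \<le> tanh (artanh (- 1 / 2 :: real))" unfolding tanh_real_le_iff by (simp add: B_def)
    also have "tanh (artanh (- 1 / 2)) = (- 1 / 2 :: real)" by (rule tanh_artanh_real) auto
    finally have tB: "tanh B \<le> - 1 / 2" .
    have tB1: "- 1 < tanh B" by (rule tanh_real_gt_neg1)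
    \<comment> \<open>Obtained by solving \<open>\<gamma> / (2 * sqrt w1) = tanh B\<close>.\<close>
    define w1 where "w1 = \<gamma>\<^sup>2 / (4 * (tanh B)\<^sup>2)"
    have t0: "tanh B \<noteq> 0" using tB by auto
    have "(tanh B)\<^sup>2 < 1" using tB tB1 by (simp add: abs_square_less_1)
    then have 1: "\<gamma>\<^sup>2 / 4 < w1" unfolding w1_def using t0 \<gamma> by (simp add: field_simps)
    have "(1/2)\<^sup>2 \<le> (- tanh B)\<^sup>2" using tB by (intro power_mono) auto
    then have "1 \<le> 4 * (tanh B)\<^sup>2" by (simp add: power2_eq_square)
    from mult_left_mono[OF this, of "\<gamma>\<^sup>2"] have "\<gamma>\<^sup>2 \<le> \<gamma>\<^sup>2 * (4 * (tanh B)\<^sup>2)" by simp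
    then have 2: "w1 \<le> \<gamma>\<^sup>2" unfolding w1_def using t0 by (simp add: divide_le_eq)
    have "sqrt w1 = (- \<gamma>) / (2 * (- tanh B))"
      unfolding w1_def using tB \<gamma> by (simp add: real_sqrt_divide real_sqrt_mult)
    then have "\<gamma> = sqrt w1 * (2 * tanh B)" using \<gamma> t0 by (simp add: field_simps)
    moreover have "sqrt w1 > 0" using slope_ratio_bounds(1)[OF \<gamma> 1] by simp
    ultimately have "\<gamma> / (2 * sqrt w1) = tanh B" by (simp add: nonzero_eq_divide_eq)
    then have AB: "A w1 = B" by (simp add: A_def artanh_tanh_real)
    have "w1 powr s \<le> (\<gamma>\<^sup>2) powr s" using 1 2 s slope_ratio_bounds(1)[OF \<gamma> 1] by (intro powr_mono2) auto
    then have "C * w1 powr s \<le> P" unfolding P_def using C by (intro mult_left_mono) auto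
    moreover have "b.N B \<le> 1 / (2 * P)" using A1[of B] by (simp add: B_def)
    ultimately have "G w1 \<le> P * (1 / (2 * P))" unfolding G_def AB using P b.N_bounds(1)[of B] by (intro mult_mono) auto
    then have 3: "G w1 \<le> 1 / 2" using P by simp
    show ?thesis using that 1 2 3 by blast
  qed
  obtain w where w: "w1 \<le> w" "G w = 1 / 2"
    using IVT[of G w1 "1 / 2" w2] w1 w2 Gcont by force
  show ?thesis
  proof (rule ex1I[of _ w])
    show "\<gamma>\<^sup>2 / 4 < w \<and> soliton.N q w (xshift q \<gamma> w) = 1 / 2" using w w1(1) G[of w] by simp
    fix w' assume w': "\<gamma>\<^sup>2 / 4 < w' \<and> soliton.N q w' (xshift q \<gamma> w') = 1 / 2"
    then have "G w' = 1 / 2" using G[of w'] by simp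
    then show "w' = w" using Gmono[of w w'] Gmono[of w' w] w w1(1) w' by (cases w w' rule: linorder_cases) auto
  qed
qed

lemma omega_tilde_properties:
  assumes p: "1 < p" "p < 3" and \<gamma>: "\<gamma> < 0"
  defines "q \<equiv> (p - 1) / 2" and "w \<equiv> omega_tilde p \<gamma>"
  shows "0 < q" "q < 1" "\<gamma>\<^sup>2 / 4 < w" "soliton.N q w (xshift q \<gamma> w) = 1 / 2" "soliton q w"
proof -
  show q: "0 < q" "q < 1" using p by (auto simp: q_def)
  have p': "p = 2 * q + 1" by (simp add: q_def field_simps)
  have sol: "soliton q v" if "\<gamma>\<^sup>2 / 4 < v" for v
    using q slope_ratio_bounds(1)[OF \<gamma> that] by unfold_locales auto
  have eq: "(v > \<gamma>\<^sup>2 / 4 \<and> (Ltwo_norm lebesgue (\<lambda>x. complex_of_real (profile p \<gamma> v x)))\<^sup>2 = 1) \<longleftrightarrow>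
      (\<gamma>\<^sup>2 / 4 < v \<and> soliton.N q v (xshift q \<gamma> v) = 1 / 2)" for v
    using profile_mass[OF sol \<gamma>, of v] unfolding p' by auto
  have "\<gamma>\<^sup>2 / 4 < w \<and> soliton.N q w (xshift q \<gamma> w) = 1 / 2"
    unfolding w_def omega_tilde_def eq by (rule theI'[OF omega_tilde_unique[OF q \<gamma>]])
  then show "\<gamma>\<^sup>2 / 4 < w" "soliton.N q w (xshift q \<gamma> w) = 1 / 2" "soliton q w" using sol by auto
qed

section \<open>Functions on the strip and their slices\<close>

text \<open>\<open>u\<close> itself is complex-valued and real at most almost everywhere; its three
  representatives are real functions on the plane, so that the line results apply to their
  slices.\<close>

locale strip_function =
  fixes u :: "real \<times> real \<Rightarrow> complex" and U G H :: "real \<times> real \<Rightarrow> real"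
  assumes rep: "H1_rep u (\<lambda>z. of_real (U z)) (\<lambda>z. of_real (G z)) (\<lambda>z. of_real (H z))"
    and slices: "AE y in lborel. indefinite_integral_of (\<lambda>x. G (x, y)) (\<lambda>x. U (x, y))"

lemma lborel_weak_partial_Re:
  assumes w: "lborel_weak_partial F v G"
    and F: "F \<in> borel_measurable borel" "integrable lborel (\<lambda>z. (norm (F z))\<^sup>2)"
    and G: "G \<in> borel_measurable borel" "integrable lborel (\<lambda>z. (norm (G z))\<^sup>2)"
  shows "lborel_weak_partial (\<lambda>z. of_real (Re (F z))) v (\<lambda>z. of_real (Re (G z)))"
  unfolding lborel_weak_partial_def
proof
  fix \<theta> assume t: "\<theta> \<in> test_functions"
  have "Re (LINT z|lborel. frechet_derivative \<theta> (at z) v *\<^sub>R F z) = - Re (LINT z|lborel. \<theta> z *\<^sub>R G z)"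
    using w t by (simp add: lborel_weak_partial_def)
  then have "(LINT z|lborel. Re (frechet_derivative \<theta> (at z) v *\<^sub>R F z)) = - (LINT z|lborel. Re (\<theta> z *\<^sub>R G z))"
    using integral_Re[OF test_function_mult_integrable(2)[OF t F, of v]] integral_Re[OF test_function_mult_integrable(1)[OF t G]] by simp
  then have "complex_of_real (LINT z|lborel. frechet_derivative \<theta> (at z) v * Re (F z)) = - complex_of_real (LINT z|lborel. \<theta> z * Re (G z))"
    by simp
  then show "(LINT z|lborel. frechet_derivative \<theta> (at z) v *\<^sub>R complex_of_real (Re (F z))) = - (LINT z|lborel. \<theta> z *\<^sub>R complex_of_real (Re (G z)))"
    unfolding integral_complex_of_real[symmetric] by (simp add: scaleR_conv_of_real)
qed

lemma strip_function_exists: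
  assumes u: "u \<in> H1" and re: "AE z in lebesgue_on strip. Im (u z) = 0"
  obtains U G H where "strip_function u U G H"
proof -
  obtain U G H where r: "H1_rep u U G H" and s: "x_slices U G" by (rule H1_rep_x_slices[OF u])
  note R = H1_repD[OF r]
  have sq: "integrable lborel (\<lambda>z. (norm (complex_of_real (Re (F z))))\<^sup>2)"
    if F: "F \<in> borel_measurable borel" "integrable lborel (\<lambda>z. (norm (F z))\<^sup>2)" for F :: "real \<times> real \<Rightarrow> complex"
  proof (rule Bochner_Integration.integrable_bound[OF F(2)])
    show "AE z in lborel. norm ((norm (complex_of_real (Re (F z))))\<^sup>2) \<le> norm ((norm (F z))\<^sup>2)"
      by (rule AE_I2) (simp add: abs_le_square_iff[symmetric] abs_Re_le_cmod)
  qed (use F(1) in measurable)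
  have eq: "AE z in lebesgue_on strip. u z = complex_of_real (Re (U z))"
    using R(2) re by eventually_elim (simp add: complex_eq_iff)
  have "H1_rep u (\<lambda>z. of_real (Re (U z))) (\<lambda>z. of_real (Re (G z))) (\<lambda>z. of_real (Re (H z)))"
    unfolding H1_rep_def
  proof (intro conjI ballI)
    fix F assume "F \<in> {\<lambda>z. complex_of_real (Re (U z)), \<lambda>z. complex_of_real (Re (G z)), \<lambda>z. complex_of_real (Re (H z))}"
    then obtain F' where F: "F = (\<lambda>z. complex_of_real (Re (F' z)))" "F' \<in> {U, G, H}" by auto
    have [measurable]: "F' \<in> borel_measurable borel" and "\<forall>z. z \<notin> strip \<longrightarrow> F' z = 0" and "integrable lborel (\<lambda>z. (norm (F' z))\<^sup>2)"
      using r F(2) unfolding H1_rep_def by blast+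
    then show "F \<in> borel_measurable borel" "\<forall>z. z \<notin> strip \<longrightarrow> F z = 0" "integrable lborel (\<lambda>z. (norm (F z))\<^sup>2)"
      unfolding F(1) using sq[of F'] by (measurable, auto)
  qed (use R eq lborel_weak_partial_Re in auto)
  moreover have "AE y in lborel. indefinite_integral_of (\<lambda>x. Re (G (x, y))) (\<lambda>x. Re (U (x, y)))"
    using s unfolding x_slices_def by eventually_elim (rule indefinite_integral_of_Re)
  ultimately show ?thesis using that by (simp add: strip_function_def)
qed

lemma indefinite_integral_of_complex:
  fixes v g :: "real \<Rightarrow> real"
  assumes "indefinite_integral_of g v"
  shows "indefinite_integral_of (\<lambda>x. complex_of_real (g x)) (\<lambda>x. complex_of_real (v x))"
  unfolding indefinite_integral_of_def
proof (intro allI impI conjI)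
  fix x y :: real assume xy: "x \<le> y"
  have "integrable lborel (\<lambda>r. complex_of_real (indicator {x<..y} r *\<^sub>R g r))"
    using indefinite_integral_ofD(1)[OF assms xy] unfolding set_integrable_def by (rule integrable_of_real)
  then show "set_integrable lborel {x<..y} (\<lambda>x. complex_of_real (g x))"
    unfolding set_integrable_def by (simp add: scaleR_conv_of_real)
  have "(LINT r:{x<..y}|lborel. complex_of_real (g r)) = of_real (LINT r:{x<..y}|lborel. g r)"
    unfolding set_lebesgue_integral_def integral_complex_of_real[symmetric] by (simp add: scaleR_conv_of_real)
  then show "complex_of_real (v y) = complex_of_real (v x) + (LINT r:{x<..y}|lborel. complex_of_real (g r))"
    using indefinite_integral_ofD(2)[OF assms xy] by simp
qed

context strip_function
begin

lemma measurable_UGH [measurable]: "U \<in> borel_measurable borel" "G \<in> borel_measurable borel" "H \<in> borel_measurable borel"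
proof -
  have *: "F \<in> borel_measurable borel" if "(\<lambda>z. complex_of_real (F z)) \<in> borel_measurable borel" for F :: "real \<times> real \<Rightarrow> real"
  proof -
    have "(\<lambda>z. Re (complex_of_real (F z))) \<in> borel_measurable borel" by (rule measurable_compose[OF that borel_measurable_Re]) 
    then show ?thesis by simp
  qed
  show "U \<in> borel_measurable borel" "G \<in> borel_measurable borel" "H \<in> borel_measurable borel"
    by (rule *[OF H1_repD(3)[OF rep]], rule *[OF H1_repD(6)[OF rep]], rule *[OF H1_repD(9)[OF rep]])
qed

lemma outside: "z \<notin> strip \<Longrightarrow> U z = 0" "z \<notin> strip \<Longrightarrow> G z = 0" "z \<notin> strip \<Longrightarrow> H z = 0"
  using H1_repD(4,7,10)[OF rep] by auto

lemma squares: "integrable lborel (\<lambda>z. (U z)\<^sup>2)" "integrable lborel (\<lambda>z. (G z)\<^sup>2)" "integrable lborel (\<lambda>z. (H z)\<^sup>2)"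
  using H1_repD(5,8,11)[OF rep] by auto

lemma x_slices_UG: "x_slices (\<lambda>z. of_real (U z)) (\<lambda>z. of_real (G z))"
  using slices unfolding x_slices_def by eventually_elim (rule indefinite_integral_of_complex)

lemma trace_square_integrable: "integrable lborel (\<lambda>y. (U (0, y))\<^sup>2)"
  using strip_trace_eq(3)[OF rep x_slices_UG] by simp

lemma energy_eq:
  "energy p \<gamma> L u = (LINT z|lborel. (G z)\<^sup>2 / 2 + (H z)\<^sup>2 / (2 * L\<^sup>2) - \<bar>U z\<bar> powr (p + 1) / (p + 1)) + \<gamma> / 2 * (LINT y|lborel. (U (0, y))\<^sup>2)"
proof -
  note P = H1_rep_weak_partial[OF rep]
  have [measurable]: "weak_partial (1,0) u \<in> borel_measurable (lebesgue_on strip)" "weak_partial (0,1) u \<in> borel_measurable (lebesgue_on strip)"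
    "u \<in> borel_measurable (lebesgue_on strip)"
    using P(2,3) H1_repD(1)[OF rep] by (auto simp: Ltwo_def)
  have 1: "(LINT z|lebesgue_on strip.
        1 / 2 * (norm (weak_partial (1, 0) u z))\<^sup>2 + 1 / (2 * L\<^sup>2) * (norm (weak_partial (0, 1) u z))\<^sup>2 - 1 / (p + 1) * norm (u z) powr (p + 1))
      = (LINT z|lborel. (G z)\<^sup>2 / 2 + (H z)\<^sup>2 / (2 * L\<^sup>2) - \<bar>U z\<bar> powr (p + 1) / (p + 1))"
  proof (rule integral_of_representative(1)[OF strip_borel])
    show "AE z in lebesgue_on strip. 1 / 2 * (norm (weak_partial (1, 0) u z))\<^sup>2 + 1 / (2 * L\<^sup>2) * (norm (weak_partial (0, 1) u z))\<^sup>2 - 1 / (p + 1) * norm (u z) powr (p + 1)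
      = (G z)\<^sup>2 / 2 + (H z)\<^sup>2 / (2 * L\<^sup>2) - \<bar>U z\<bar> powr (p + 1) / (p + 1)"
      using P(4,5) H1_repD(2)[OF rep] by eventually_elim simp
  qed (measurable, simp add: outside)
  have m: "(\<lambda>y. (norm (strip_trace u y))\<^sup>2) \<in> borel_measurable (lebesgue_on {0..1})"
    using strip_trace_eq(1)[OF rep x_slices_UG] by measurable
  have 2: "(LINT y|lebesgue_on {0..1}. (norm (strip_trace u y))\<^sup>2) = (LINT y|lborel. (U (0, y))\<^sup>2)"
  proof (rule integral_of_representative(1)[OF _ m])
    show "AE y in lebesgue_on {0..1}. (norm (strip_trace u y))\<^sup>2 = (U (0, y))\<^sup>2"
      using strip_trace_eq(2)[OF rep x_slices_UG] by eventually_elim simp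
    show "(\<lambda>y. (U (0, y))\<^sup>2) \<in> borel_measurable borel" by measurable
    fix y :: real assume "y \<notin> {0..1}" then show "(U (0, y))\<^sup>2 = 0" using outside(1)[of "(0, y)"] by (auto simp: strip_def)
  qed auto
  show ?thesis unfolding energy_def 1 2 ..
qed

end

section \<open>Slice masses and a priori bounds\<close>

lemma square_deviation:
  fixes v h :: "real \<Rightarrow> real"
  assumes ac: "indefinite_integral_of h v" and [measurable]: "h \<in> borel_measurable borel"
    and y: "y \<in> {0..1}"
  shows "set_integrable lborel {0..1} (\<lambda>t. (v t)\<^sup>2)"
    "\<bar>(v y)\<^sup>2 - (LINT t:{0..1}|lborel. (v t)\<^sup>2)\<bar> \<le> (LINT t:{0..1}|lborel. 2 * \<bar>v t * h t\<bar>)"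
proof -
  have c: "continuous_on S v" for S by (rule indefinite_integral_of_continuous[OF ac])
  have [measurable]: "v \<in> borel_measurable borel" by (intro borel_measurable_continuous_onI c)
  show i: "set_integrable lborel {0..1} (\<lambda>t. (v t)\<^sup>2)"
    unfolding set_integrable_def by (rule borel_integrable_compact) (auto intro!: continuous_intros c)
  let ?b = "LINT t:{0..1}|lborel. 2 * \<bar>v t * h t\<bar>"
  have ac2: "indefinite_integral_of (\<lambda>x. h x * v x + v x * h x) (\<lambda>x. v x * v x)" by (rule indefinite_integral_of_mult[OF ac ac])
  then have ac2: "indefinite_integral_of (\<lambda>x. 2 * (v x * h x)) (\<lambda>x. (v x)\<^sup>2)" by (simp add: power2_eq_square mult_ac)
  have ib: "set_integrable lborel {0..1} (\<lambda>t. 2 * \<bar>v t * h t\<bar>)"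
    using set_integrable_abs[OF indefinite_integral_of_Icc(1)[OF ac2, of 0 1]] by (simp add: abs_mult)
  have step: "\<bar>(v b)\<^sup>2 - (v a)\<^sup>2\<bar> \<le> ?b" if "0 \<le> a" "a \<le> b" "b \<le> 1" for a b
  proof -
    have si: "set_integrable lborel {a..b} (\<lambda>x. 2 * (v x * h x))" by (rule indefinite_integral_of_Icc(1)[OF ac2 that(2)])
    have "(v b)\<^sup>2 - (v a)\<^sup>2 = (LINT x:{a..b}|lborel. 2 * (v x * h x))" using indefinite_integral_of_Icc(2)[OF ac2 that(2)] by simp
    also have "\<bar>\<dots>\<bar> \<le> (LINT x:{a..b}|lborel. \<bar>2 * (v x * h x)\<bar>)"
      using set_integral_norm_bound[OF si] by simp
    also have "\<dots> \<le> (LINT x:{0..1}|lborel. \<bar>2 * (v x * h x)\<bar>)"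
      unfolding set_lebesgue_integral_def using set_integrable_abs[OF si] set_integrable_abs[OF indefinite_integral_of_Icc(1)[OF ac2, of 0 1]] that
      by (intro integral_mono) (auto simp: set_integrable_def indicator_def)
    also have "\<dots> = ?b" by (simp add: abs_mult)
    finally show ?thesis .
  qed
  have dev: "\<bar>(v y)\<^sup>2 - (v t)\<^sup>2\<bar> \<le> ?b" if "t \<in> {0..1}" for t
    using step[of t y] step[of y t] y that by (cases "t \<le> y") (auto simp: abs_minus_commute)
  have c1: "(LINT t:{0..1::real}|lborel. c) = c" for c :: real
    using set_integral_const[of "{0..1::real}" lborel c] by simp
  have ic: "set_integrable lborel {0..1::real} (\<lambda>_. c)" for c :: real
    unfolding set_integrable_def by simp
  have "(LINT t:{0..1}|lborel. (v t)\<^sup>2) \<le> (LINT t:{0..1::real}|lborel. (v y)\<^sup>2 + ?b)"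
    by (rule set_integral_mono[OF i ic]) (use dev in \<open>force simp: abs_le_iff\<close>)
  moreover have "(LINT t:{0..1::real}|lborel. (v y)\<^sup>2 - ?b) \<le> (LINT t:{0..1}|lborel. (v t)\<^sup>2)"
    by (rule set_integral_mono[OF ic i]) (use dev in \<open>force simp: abs_le_iff\<close>)
  ultimately show "\<bar>(v y)\<^sup>2 - (LINT t:{0..1}|lborel. (v t)\<^sup>2)\<bar> \<le> ?b" unfolding c1 by (simp add: abs_le_iff)
qed

lemma (in strip_function) U_mult_integrable:
  "integrable lborel (\<lambda>z. \<bar>U z * G z\<bar>)" "integrable lborel (\<lambda>z. \<bar>U z * H z\<bar>)"
  using product_integrable_of_squares[OF _ _ squares(1,2)] product_integrable_of_squares[OF _ _ squares(1,3)] by auto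

text \<open>Cauchy-Schwarz for an \<open>f\<close> of unit norm, from Young's inequality with a free
  parameter. The optimisation in \<open>le_sqrt_of_le_all\<close> has \<open>C = 1\<close>, which
  accounts for the factor \<open>2\<close> on the right.\<close>

lemma integral_abs_mult_le:
  fixes f g :: "'a \<Rightarrow> real"
  assumes [measurable]: "f \<in> borel_measurable M" "g \<in> borel_measurable M"
    and i: "integrable M (\<lambda>x. (f x)\<^sup>2)" "integrable M (\<lambda>x. (g x)\<^sup>2)" and one: "(LINT x|M. (f x)\<^sup>2) = 1"
  shows "2 * (LINT x|M. \<bar>f x * g x\<bar>) \<le> 2 * sqrt (LINT x|M. (g x)\<^sup>2)"
proof -
  have p: "integrable M (\<lambda>x. \<bar>f x * g x\<bar>)" using product_integrable_of_squares[OF _ _ i] by simp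
  have "2 * (LINT x|M. \<bar>f x * g x\<bar>) \<le> \<eta> * 1 + (LINT x|M. (g x)\<^sup>2) / \<eta>" if \<eta>: "\<eta> > 0" for \<eta>
  proof -
    have pw: "2 * \<bar>f x * g x\<bar> \<le> \<eta> * (f x)\<^sup>2 + (g x)\<^sup>2 / \<eta>" for x
    proof -
      have "\<eta> * (2 * \<bar>f x * g x\<bar>) = 2 * (\<eta> * \<bar>f x\<bar>) * \<bar>g x\<bar>" by (simp add: abs_mult)
      also have "\<dots> \<le> (\<eta> * \<bar>f x\<bar>)\<^sup>2 + \<bar>g x\<bar>\<^sup>2" by (rule sum_squares_bound)
      also have "\<dots> = \<eta> * (\<eta> * (f x)\<^sup>2 + (g x)\<^sup>2 / \<eta>)" using \<eta> by (simp add: distrib_left power_mult_distrib power2_eq_square)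
      finally show ?thesis using \<eta> by simp
    qed
    have "(LINT x|M. 2 * \<bar>f x * g x\<bar>) \<le> (LINT x|M. \<eta> * (f x)\<^sup>2 + (g x)\<^sup>2 / \<eta>)"
      by (rule integral_mono) (use p i pw in auto)
    also have "\<dots> = \<eta> * (LINT x|M. (f x)\<^sup>2) + (LINT x|M. (g x)\<^sup>2) / \<eta>" using i by simp
    finally show ?thesis by (simp add: one)
  qed
  from le_sqrt_of_le_all[OF this] show ?thesis by simp
qed

context strip_function
begin

lemma H1_line_slices: "AE y in lborel. H1_line (\<lambda>x. U (x, y)) (\<lambda>x. G (x, y))"
  using slices lborel2_fubini_snd(1)[OF squares(1)] lborel2_fubini_snd(1)[OF squares(2)]
  by eventually_elim (unfold_locales, auto)

text \<open>The \<open>y\<close>-derivative of the slice mass is \<open>2 \<integral> u \<partial>\<^sub>y u\<close>, which is bounded in \<open>L\<^sup>1\<close> by Cauchy-Schwarz.\<close>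

lemma mass_deviation:
  assumes one: "(LINT z|lborel. (U z)\<^sup>2) = 1"
  shows "AE y in lborel. y \<in> {0..1} \<longrightarrow> \<bar>(LINT x|lborel. (U (x, y))\<^sup>2) - 1\<bar> \<le> 2 * sqrt (LINT z|lborel. (H z)\<^sup>2)"
proof -
  note R = H1_repD[OF rep]
  obtain V where V: "V \<in> borel_measurable borel" "AE z in lborel. z \<in> strip \<longrightarrow> V z = complex_of_real (U z)"
    "AE s in lborel. indefinite_integral_of (\<lambda>t. complex_of_real (H (s, t))) (\<lambda>t. V (s, t))"
    by (rule weak_partial_y_slices[OF R(3,4,5) R(9,10,11) R(13)]) blast
  define m where "m s = (LINT t|lborel. (U (s, t))\<^sup>2)" for s
  define b where "b s = (LINT t|lborel. 2 * \<bar>U (s, t) * H (s, t)\<bar>)" for s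
  have [measurable]: "m \<in> borel_measurable borel" "b \<in> borel_measurable borel" unfolding m_def b_def by measurable
  have "AE s in lborel. AE t in lborel. (s, t) \<in> strip \<longrightarrow> V (s, t) = complex_of_real (U (s, t))"
    by (rule lborel2_AE_slices(2)[OF V(2)])
  then have "AE s in lborel. AE t in lborel. t \<in> {0..1} \<longrightarrow> \<bar>(U (s, t))\<^sup>2 - m s\<bar> \<le> b s"
    using V(3)
  proof eventually_elim
    case (elim s)
    define v where "v t = Re (V (s, t))" for t
    have ac: "indefinite_integral_of (\<lambda>t. H (s, t)) v" using indefinite_integral_of_Re[OF elim(2)] by (simp add: v_def[abs_def])
    have [measurable]: "v \<in> borel_measurable borel" unfolding v_def using V(1) by measurable
    have e: "AE t in lborel. t \<in> {0..1} \<longrightarrow> v t = U (s, t)"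
      using elim(1) by eventually_elim (auto simp: v_def strip_def)
    have 0: "U (s, t) = 0" if "t \<notin> {0..1}" for t using outside(1)[of "(s, t)"] that by (auto simp: strip_def)
    have i1: "(LINT t:{0..1}|lborel. (v t)\<^sup>2) = m s"
      unfolding set_lebesgue_integral_def m_def
    proof (rule integral_cong_AE)
      show "AE t in lborel. indicator {0..1} t *\<^sub>R (v t)\<^sup>2 = (U (s, t))\<^sup>2"
        using e by eventually_elim (use 0 in \<open>auto simp: indicator_def\<close>)
    qed measurable
    have i2: "(LINT t:{0..1}|lborel. 2 * \<bar>v t * H (s, t)\<bar>) = b s"
      unfolding set_lebesgue_integral_def b_def
    proof (rule integral_cong_AE)
      show "AE t in lborel. indicator {0..1} t *\<^sub>R (2 * \<bar>v t * H (s, t)\<bar>) = 2 * \<bar>U (s, t) * H (s, t)\<bar>"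
        using e by eventually_elim (use 0 in \<open>auto simp: indicator_def\<close>)
    qed measurable
    show ?case using e
    proof eventually_elim
      case (elim t)
      have "t \<in> {0..1} \<Longrightarrow> \<bar>(v t)\<^sup>2 - m s\<bar> \<le> b s" using square_deviation(2)[OF ac, of t] unfolding i1 i2 by simp
      then show ?case using elim by simp
    qed
  qed
  moreover have "Measurable.pred borel (\<lambda>z::real \<times> real. snd z \<in> {0..1} \<longrightarrow> \<bar>(U z)\<^sup>2 - m (fst z)\<bar> \<le> b (fst z))"
  proof -
    have [measurable]: "(\<lambda>z::real \<times> real. m (fst z)) \<in> borel_measurable borel" "(\<lambda>z::real \<times> real. b (fst z)) \<in> borel_measurable borel"
      by (rule measurable_compose[OF borel_measurable_fst_real2]; measurable)+
    have [measurable]: "Measurable.pred borel (\<lambda>z::real \<times> real. snd z \<in> {0..1})"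
      by (rule measurable_compose[OF borel_measurable_snd_real2]) measurable
    show ?thesis by measurable
  qed
  \<comment> \<open>The bound is known for almost every \<open>s\<close> and then almost every
    \<open>t\<close>. Passing through the plane exchanges the order, after which it can be
    integrated in \<open>s\<close> along a fixed horizontal line.\<close>
  ultimately have "AE z in lborel. snd z \<in> {0..1} \<longrightarrow> \<bar>(U z)\<^sup>2 - m (fst z)\<bar> \<le> b (fst z)"
    by (subst lborel2_AE(2)) simp_all
  from lborel2_AE_slices(1)[OF this]
  have "AE t in lborel. AE s in lborel. t \<in> {0..1} \<longrightarrow> \<bar>(U (s, t))\<^sup>2 - m s\<bar> \<le> b s" by simp
  then show ?thesis using lborel2_fubini_snd(1)[OF squares(1)]
  proof eventually_elim
    case (elim t)
    have im: "integrable lborel m" "(LINT s|lborel. m s) = 1"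
      using lborel2_fubini_fst(2,3)[OF squares(1)] one unfolding m_def by auto
    have i2: "integrable lborel (\<lambda>z. 2 * \<bar>U z * H z\<bar>)" using U_mult_integrable(2) by simp
    have "integrable lborel b" "(LINT s|lborel. b s) = 2 * (LINT z|lborel. \<bar>U z * H z\<bar>)"
      using lborel2_fubini_fst(2,3)[OF i2] unfolding b_def by auto
    then have ib: "integrable lborel b" "(LINT s|lborel. b s) \<le> 2 * sqrt (LINT z|lborel. (H z)\<^sup>2)"
      using integral_abs_mult_le[OF _ _ squares(1,3) one] by auto
    show ?case
    proof
      assume t: "t \<in> {0..1}"
      have "\<bar>LINT s|lborel. (U (s, t))\<^sup>2 - m s\<bar> \<le> (LINT s|lborel. \<bar>(U (s, t))\<^sup>2 - m s\<bar>)" by (rule integral_abs_bound)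
      also have "\<dots> \<le> (LINT s|lborel. b s)"
        by (rule integral_mono_AE) (use elim t ib im in auto)
      finally show "\<bar>(LINT x|lborel. (U (x, t))\<^sup>2) - 1\<bar> \<le> 2 * sqrt (LINT z|lborel. (H z)\<^sup>2)"
        using elim(2) im ib by simp
    qed
  qed
qed

text \<open>The function \<open>a\<close> dominates the supremum of \<open>U^2\<close> on almost
  every horizontal line and is still integrable in \<open>y\<close>. Both the trace and the fourth
  power are controlled through it.\<close>

lemma slice_sup_integral:
  assumes one: "(LINT z|lborel. (U z)\<^sup>2) = 1"
  defines "a \<equiv> \<lambda>y. 2 * (LINT x|lborel. \<bar>U (x, y) * G (x, y)\<bar>)"
  shows "integrable lborel a" "(LINT y|lborel. a y) \<le> 2 * sqrt (LINT z|lborel. (G z)\<^sup>2)" "\<And>y. 0 \<le> a y"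
    "AE y in lborel. \<forall>x. (U (x, y))\<^sup>2 \<le> a y"
proof -
  show "integrable lborel a" unfolding a_def using lborel2_fubini_snd(2)[OF U_mult_integrable(1)] by simp
  have "(LINT y|lborel. a y) = 2 * (LINT z|lborel. \<bar>U z * G z\<bar>)"
    unfolding a_def using lborel2_fubini_snd(3)[OF U_mult_integrable(1)] by simp
  then show "(LINT y|lborel. a y) \<le> 2 * sqrt (LINT z|lborel. (G z)\<^sup>2)"
    using integral_abs_mult_le[OF _ _ squares(1,2) one] by simp
  show "0 \<le> a y" for y unfolding a_def by simp
  show "AE y in lborel. \<forall>x. (U (x, y))\<^sup>2 \<le> a y"
    using H1_line_slices by eventually_elim (use H1_line.square_le in \<open>auto simp: a_def\<close>)
qed

lemma trace_square_le:
  assumes one: "(LINT z|lborel. (U z)\<^sup>2) = 1"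
  shows "(LINT y|lborel. (U (0, y))\<^sup>2) \<le> 2 * sqrt (LINT z|lborel. (G z)\<^sup>2)"
proof -
  note S = slice_sup_integral[OF one]
  have "(LINT y|lborel. (U (0, y))\<^sup>2) \<le> (LINT y|lborel. 2 * (LINT x|lborel. \<bar>U (x, y) * G (x, y)\<bar>))"
    by (rule integral_mono_AE[OF trace_square_integrable S(1)]) (use S(4) in eventually_elim, simp)
  then show ?thesis using S(2) by simp
qed

text \<open>An anisotropic Gagliardo-Nirenberg inequality: on a line the integral of
  \<open>U^4\<close> is at most the supremum of \<open>U^2\<close> times the slice mass. The slice
  masses are bounded uniformly by \<open>mass_deviation\<close>, and the suprema integrate in
  \<open>y\<close>.\<close>

lemma fourth_power:
  assumes one: "(LINT z|lborel. (U z)\<^sup>2) = 1"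
  shows "integrable lborel (\<lambda>z. ((U z)\<^sup>2)\<^sup>2)"
    "(LINT z|lborel. ((U z)\<^sup>2)\<^sup>2) \<le> (1 + 2 * sqrt (LINT z|lborel. (H z)\<^sup>2)) * (2 * sqrt (LINT z|lborel. (G z)\<^sup>2))"
proof -
  define a where "a y = 2 * (LINT x|lborel. \<bar>U (x, y) * G (x, y)\<bar>)" for y
  note S = slice_sup_integral[OF one, folded a_def]
  define d where "d = 2 * sqrt (LINT z|lborel. (H z)\<^sup>2)"
  have d0: "0 \<le> d" by (simp add: d_def)
  have main: "AE y in lborel. integrable lborel (\<lambda>x. ((U (x, y))\<^sup>2)\<^sup>2) \<and> (LINT x|lborel. ((U (x, y))\<^sup>2)\<^sup>2) \<le> (1 + d) * a y"
    using mass_deviation[OF one, folded d_def] S(4) lborel2_fubini_snd(1)[OF squares(1)]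
  proof eventually_elim
    case (elim y)
    have le: "((U (x, y))\<^sup>2)\<^sup>2 \<le> a y * (U (x, y))\<^sup>2" for x
      using mult_right_mono[OF elim(2)[rule_format, of x], of "(U (x, y))\<^sup>2"] by (simp add: power2_eq_square)
    have i: "integrable lborel (\<lambda>x. ((U (x, y))\<^sup>2)\<^sup>2)"
      by (rule Bochner_Integration.integrable_bound[of _ "\<lambda>x. a y * (U (x, y))\<^sup>2"]) (use elim le S(3)[of y] in auto)
    have "(LINT x|lborel. ((U (x, y))\<^sup>2)\<^sup>2) \<le> (LINT x|lborel. a y * (U (x, y))\<^sup>2)"
      by (rule integral_mono[OF i]) (use elim le in auto)
    also have "\<dots> = a y * (LINT x|lborel. (U (x, y))\<^sup>2)" by simp
    also have "\<dots> \<le> a y * (1 + d)"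
    proof (rule mult_left_mono[OF _ S(3)])
      show "(LINT x|lborel. (U (x, y))\<^sup>2) \<le> 1 + d"
      proof (cases "y \<in> {0..1}")
        case True then show ?thesis using elim(1) by auto
      next
        case False
        then have "U (x, y) = 0" for x using outside(1)[of "(x, y)"] by (auto simp: strip_def)
        then show ?thesis using d0 by simp
      qed
    qed
    finally show ?case using i by (simp add: mult.commute)
  qed
  have ia: "integrable lborel (\<lambda>y. (1 + d) * a y)" using S(1) by simp
  have iy: "integrable lborel (\<lambda>y. LINT x|lborel. norm (((U (x, y))\<^sup>2)\<^sup>2))"
  proof (rule Bochner_Integration.integrable_bound[OF ia])
    show "AE y in lborel. norm (LINT x|lborel. norm (((U (x, y))\<^sup>2)\<^sup>2)) \<le> norm ((1 + d) * a y)"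
      using main by eventually_elim (use d0 S(3) in auto)
  qed measurable
  show i: "integrable lborel (\<lambda>z. ((U z)\<^sup>2)\<^sup>2)"
  proof (rule lborel2_integrable_snd[OF _ _ iy])
    show "AE y in lborel. integrable lborel (\<lambda>x. ((U (x, y))\<^sup>2)\<^sup>2)" using main by eventually_elim simp
  qed measurable
  have "(LINT z|lborel. ((U z)\<^sup>2)\<^sup>2) = (LINT y|lborel. LINT x|lborel. ((U (x, y))\<^sup>2)\<^sup>2)"
    by (rule lborel2_fubini_snd(3)[OF i, symmetric])
  also have "\<dots> \<le> (LINT y|lborel. (1 + d) * a y)"
    by (rule integral_mono_AE[OF lborel2_fubini_snd(2)[OF i] ia]) (use main in eventually_elim, simp)
  also have "\<dots> = (1 + d) * (LINT y|lborel. a y)" by simp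
  also have "\<dots> \<le> (1 + d) * (2 * sqrt (LINT z|lborel. (G z)\<^sup>2))" using S(2) d0 by (intro mult_left_mono) auto
  finally show "(LINT z|lborel. ((U z)\<^sup>2)\<^sup>2) \<le> (1 + 2 * sqrt (LINT z|lborel. (H z)\<^sup>2)) * (2 * sqrt (LINT z|lborel. (G z)\<^sup>2))"
    by (simp add: d_def)
qed

end

text \<open>\<open>R\<close> is chosen so that \<open>R powr (q - 1)\<close>, the decisive factor of
  the tangent slope, is \<open>1/4\<close>. The small quadratic coefficient lets the fourth power be
  absorbed by the gradient terms; \<open>q < 1\<close> makes it available.\<close>

lemma powr_le_quadratic:
  fixes q :: real
  assumes q: "0 < q" "q < 1"
  obtains C where "0 \<le> C" "\<And>s. 0 \<le> s \<Longrightarrow> s powr (q + 1) \<le> s\<^sup>2 / 4 + C * s"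
proof
  define R :: real where "R = 4 powr (1 / (1 - q))"
  have R: "R > 0" by (simp add: R_def)
  have Rq: "R powr (q - 1) = 1 / 4"
  proof -
    have "R powr (q - 1) = 4 powr (1 / (1 - q) * (q - 1))" by (simp add: R_def powr_powr)
    also have "1 / (1 - q) * (q - 1) = - 1" using q by (simp add: field_simps)
    finally show ?thesis by (simp add: powr_minus)
  qed
  show "0 \<le> R powr q" by simp
  fix s :: real assume s: "0 \<le> s"
  have "s powr q \<le> R powr q + q * R powr (q - 1) * (s - R)" by (rule tangent_powr[OF q R s])
  also have "q * R powr (q - 1) * (s - R) \<le> q * R powr (q - 1) * s" using q R by (intro mult_left_mono) auto
  also have "\<dots> \<le> s / 4" unfolding Rq using q s by (simp add: mult_left_le_one_le)
  finally have "s powr q * s \<le> (R powr q + s / 4) * s" using s by (intro mult_right_mono) auto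
  moreover have "s powr (q + 1) = s powr q * s" using s by (cases "s = 0") (auto simp: powr_add)
  ultimately show "s powr (q + 1) \<le> s\<^sup>2 / 4 + R powr q * s" by (simp add: distrib_right power2_eq_square)
qed

lemma abs_powr_eq: "\<bar>x\<bar> powr (2 * q + 2) = (x\<^sup>2) powr (q + 1)" for x q :: real
proof (cases "x = 0")
  case False
  then have "x\<^sup>2 = \<bar>x\<bar> powr 2" by simp
  then show ?thesis by (simp add: powr_powr algebra_simps del: powr_numeral)
qed simp

lemma (in strip_function) powr_bounds:
  assumes q: "0 < q" "q < 1" and one: "(LINT z|lborel. (U z)\<^sup>2) = 1"
    and C: "\<And>s. 0 \<le> s \<Longrightarrow> s powr (q + 1) \<le> s\<^sup>2 / 4 + C * s"
  shows "integrable lborel (\<lambda>z. ((U z)\<^sup>2) powr (q + 1))"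
    "(LINT z|lborel. ((U z)\<^sup>2) powr (q + 1)) \<le> (1 + 2 * sqrt (LINT z|lborel. (H z)\<^sup>2)) * sqrt (LINT z|lborel. (G z)\<^sup>2) / 2 + C"
proof -
  note F = fourth_power[OF one]
  have ib: "integrable lborel (\<lambda>z. ((U z)\<^sup>2)\<^sup>2 / 4 + C * (U z)\<^sup>2)" using F(1) squares(1) by simp
  have le: "((U z)\<^sup>2) powr (q + 1) \<le> ((U z)\<^sup>2)\<^sup>2 / 4 + C * (U z)\<^sup>2" for z by (rule C) simp
  show i: "integrable lborel (\<lambda>z. ((U z)\<^sup>2) powr (q + 1))"
  proof (rule Bochner_Integration.integrable_bound[OF ib])
    show "AE z in lborel. norm (((U z)\<^sup>2) powr (q + 1)) \<le> norm (((U z)\<^sup>2)\<^sup>2 / 4 + C * (U z)\<^sup>2)"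
    proof (rule AE_I2)
      fix z
      have "0 \<le> ((U z)\<^sup>2)\<^sup>2 / 4 + C * (U z)\<^sup>2" by (rule order_trans[OF powr_ge_zero le])
      then show "norm (((U z)\<^sup>2) powr (q + 1)) \<le> norm (((U z)\<^sup>2)\<^sup>2 / 4 + C * (U z)\<^sup>2)"
        by (simp only: real_norm_def abs_of_nonneg[OF powr_ge_zero] abs_of_nonneg le)
    qed
  qed measurable
  have "(LINT z|lborel. ((U z)\<^sup>2) powr (q + 1)) \<le> (LINT z|lborel. ((U z)\<^sup>2)\<^sup>2 / 4 + C * (U z)\<^sup>2)"
    by (rule integral_mono[OF i ib le])
  also have "\<dots> = (LINT z|lborel. ((U z)\<^sup>2)\<^sup>2) / 4 + C" using F(1) squares(1) one by simp
  finally show "(LINT z|lborel. ((U z)\<^sup>2) powr (q + 1)) \<le> (1 + 2 * sqrt (LINT z|lborel. (H z)\<^sup>2)) * sqrt (LINT z|lborel. (G z)\<^sup>2) / 2 + C"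
    using F(2) by simp
qed

lemma (in strip_function) energy_split:
  assumes q: "0 < q" "q < 1" and one: "(LINT z|lborel. (U z)\<^sup>2) = 1"
  shows "energy (2 * q + 1) \<gamma> L u = (LINT z|lborel. (G z)\<^sup>2 / 2 - ((U z)\<^sup>2) powr (q + 1) / (2 * (q + 1)))
      + (LINT z|lborel. (H z)\<^sup>2) / (2 * L\<^sup>2) + \<gamma> / 2 * (LINT y|lborel. (U (0, y))\<^sup>2)"
    and "(LINT z|lborel. (G z)\<^sup>2 / 2 - ((U z)\<^sup>2) powr (q + 1) / (2 * (q + 1)))
      = (LINT z|lborel. (G z)\<^sup>2) / 2 - (LINT z|lborel. ((U z)\<^sup>2) powr (q + 1)) / (2 * (q + 1))"
proof -
  obtain C where "\<And>s. 0 \<le> s \<Longrightarrow> s powr (q + 1) \<le> s\<^sup>2 / 4 + C * s" by (rule powr_le_quadratic[OF q]) blast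
  note i = powr_bounds(1)[OF q one this]
  show 2: "(LINT z|lborel. (G z)\<^sup>2 / 2 - ((U z)\<^sup>2) powr (q + 1) / (2 * (q + 1)))
      = (LINT z|lborel. (G z)\<^sup>2) / 2 - (LINT z|lborel. ((U z)\<^sup>2) powr (q + 1)) / (2 * (q + 1))"
    using i squares(2) by simp
  have "(\<lambda>z. (G z)\<^sup>2 / 2 + (H z)\<^sup>2 / (2 * L\<^sup>2) - \<bar>U z\<bar> powr (2 * q + 1 + 1) / (2 * q + 1 + 1))
      = (\<lambda>z. (G z)\<^sup>2 / 2 + (H z)\<^sup>2 / (2 * L\<^sup>2) - ((U z)\<^sup>2) powr (q + 1) / (2 * (q + 1)))"
    using abs_powr_eq[of _ q] by (simp add: algebra_simps)
  then show "energy (2 * q + 1) \<gamma> L u = (LINT z|lborel. (G z)\<^sup>2 / 2 - ((U z)\<^sup>2) powr (q + 1) / (2 * (q + 1)))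
      + (LINT z|lborel. (H z)\<^sup>2) / (2 * L\<^sup>2) + \<gamma> / 2 * (LINT y|lborel. (U (0, y))\<^sup>2)"
    unfolding energy_eq 2 using i squares by simp
qed

text \<open>To be read with \<open>a\<close> and \<open>b\<close> the norms of the x- and
  y-derivative, \<open>P\<close> the power integral and \<open>t\<close> the squared trace. For
  \<open>L \<le> 1\<close> the weighted term \<open>B = b^2 / L^2\<close> dominates
  \<open>b^2\<close> and absorbs what the mixed term \<open>2 a b\<close> contributes of it; the
  terms linear in \<open>a\<close> go into \<open>a^2\<close>. What is left is
  \<open>a^2 / 8 + B / 4 \<le> E\<close>.\<close>

lemma a_priori_algebra:
  fixes a b L e c C P t \<gamma> q :: real
  assumes le: "a\<^sup>2 / 2 - P / (2 * (q + 1)) + b\<^sup>2 / (2 * L\<^sup>2) + \<gamma> / 2 * t \<le> e"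
    and P: "0 \<le> P" "P \<le> (1 + 2 * b) * a / 2 + C" and t: "0 \<le> t" "t \<le> 2 * a" and q: "0 < q" and L: "0 < L" "L \<le> 1"
    and ab: "0 \<le> a" "0 \<le> b"
  defines "E \<equiv> e + C / 2 + 2 * (\<bar>\<gamma>\<bar> + 1 / 4)\<^sup>2"
  shows "a\<^sup>2 \<le> 8 * E" "b\<^sup>2 \<le> 8 * E * L\<^sup>2"
proof -
  define B where "B = b\<^sup>2 / L\<^sup>2"
  have L2: "0 < L\<^sup>2" "L\<^sup>2 \<le> 1" using L by (auto simp: power_le_one)
  have Bb: "b\<^sup>2 \<le> B" unfolding B_def using L2 by (simp add: le_divide_eq mult_left_le)
  have "P / (2 * (q + 1)) \<le> P / 2" using P(1) q by (intro divide_left_mono) auto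
  moreover have "- (\<gamma> / 2 * t) \<le> \<bar>\<gamma>\<bar> * a"
  proof -
    have "- (\<gamma> / 2 * t) \<le> \<bar>\<gamma>\<bar> / 2 * t" using mult_right_mono[of "-\<gamma>" "\<bar>\<gamma>\<bar>" t] t(1) by simp
    also have "\<dots> \<le> \<bar>\<gamma>\<bar> / 2 * (2 * a)" using t(2) by (intro mult_left_mono) auto
    finally show ?thesis by simp
  qed
  moreover have "(1 + 2 * b) * a \<le> a + (a\<^sup>2 + b\<^sup>2)" using sum_squares_bound[of a b] by (simp add: algebra_simps)
  moreover have "(\<bar>\<gamma>\<bar> + 1 / 4) * a \<le> a\<^sup>2 / 8 + 2 * (\<bar>\<gamma>\<bar> + 1 / 4)\<^sup>2"
  proof -
    have "c * a \<le> a\<^sup>2 / 8 + 2 * c\<^sup>2" for c using zero_le_power2[of "a - 4 * c"] by (simp add: power2_diff power_mult_distrib algebra_simps)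
    then show ?thesis .
  qed
  moreover have "b\<^sup>2 / (2 * L\<^sup>2) = B / 2" by (simp add: B_def)
  moreover have "(\<bar>\<gamma>\<bar> + 1 / 4) * a = \<bar>\<gamma>\<bar> * a + a / 4" by (simp add: distrib_right)
  ultimately have key: "a\<^sup>2 / 8 + B / 4 \<le> E" using le P(2) Bb unfolding E_def by linarith
  have B0: "0 \<le> B" by (simp add: B_def)
  then show "a\<^sup>2 \<le> 8 * E" using key by simp
  have "B \<le> 8 * E" using key B0 zero_le_power2[of a] by linarith
  then show "b\<^sup>2 \<le> 8 * E * L\<^sup>2" unfolding B_def using L2 by (simp add: divide_le_eq)
qed

text \<open>The y-energy enters with weight \<open>1 / (2 * L\<^sup>2)\<close>, so an energy bound
  forces the y-derivative to be of order \<open>L\<close>. The constant is uniform in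
  \<open>u\<close> and \<open>L\<close>.\<close>

lemma a_priori_bound:
  fixes q e \<gamma> :: real
  assumes q: "0 < q" "q < 1"
  obtains C where "\<And>u U G H L. \<lbrakk>strip_function u U G H; (LINT z|lborel. (U z)\<^sup>2) = 1; 0 < L; L \<le> 1; energy (2 * q + 1) \<gamma> L u \<le> e\<rbrakk>
    \<Longrightarrow> (LINT z|lborel. (G z)\<^sup>2) \<le> C \<and> (LINT z|lborel. (H z)\<^sup>2) \<le> C * L\<^sup>2"
proof -
  obtain C where C: "\<And>s. 0 \<le> s \<Longrightarrow> s powr (q + 1) \<le> s\<^sup>2 / 4 + C * s" by (rule powr_le_quadratic[OF q]) blast
  show ?thesis
  proof (rule that)
    fix u U G H and L :: real
    assume "strip_function u U G H" and one: "(LINT z|lborel. (U z)\<^sup>2) = 1" and L: "0 < L" "L \<le> 1" and e: "energy (2 * q + 1) \<gamma> L u \<le> e"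
    interpret strip_function u U G H by fact
    have le: "(sqrt (LINT z|lborel. (G z)\<^sup>2))\<^sup>2 / 2 - (LINT z|lborel. ((U z)\<^sup>2) powr (q + 1)) / (2 * (q + 1))
        + (sqrt (LINT z|lborel. (H z)\<^sup>2))\<^sup>2 / (2 * L\<^sup>2) + \<gamma> / 2 * (LINT y|lborel. (U (0, y))\<^sup>2) \<le> e"
      using e unfolding energy_split[OF q one] by simp
    show "(LINT z|lborel. (G z)\<^sup>2) \<le> 8 * (e + C / 2 + 2 * (\<bar>\<gamma>\<bar> + 1 / 4)\<^sup>2) \<and>
        (LINT z|lborel. (H z)\<^sup>2) \<le> 8 * (e + C / 2 + 2 * (\<bar>\<gamma>\<bar> + 1 / 4)\<^sup>2) * L\<^sup>2"
      using a_priori_algebra[OF le _ powr_bounds(2)[OF q one C] _ trace_square_le[OF one] q(1) L] by simp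
  qed
qed

section \<open>Slope and defect as functions on the strip\<close>

context soliton
begin

text \<open>\<open>T\<close> is cut off where it is junk, so that the slope below is Borel measurable in both variables.\<close>

definition "cut_T m = indicator {0<..<M} m * T m"

lemma cut_T_measurable [measurable]: "cut_T \<in> borel_measurable borel"
proof -
  have "continuous_on {0<..<M} T" by (rule continuous_at_imp_continuous_on) (auto intro: isCont_T)
  then have "(\<lambda>m. indicator {0<..<M} m *\<^sub>R T m) \<in> borel_measurable borel"
    by (intro borel_measurable_continuous_on_indicator) auto
  then show ?thesis by (simp add: cut_T_def[abs_def])
qed

lemma cut_T_bound: "\<bar>cut_T m\<bar> \<le> sqrt w"
  using T_bound[of m] w by (simp add: cut_T_def indicator_def)

definition "line_mass U z = (LINT r|lborel. (if r \<le> fst z then (U (r, snd z))\<^sup>2 else (0::real)))"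
definition "slice_mass U y = (LINT r|lborel. (U (r, y))\<^sup>2 :: real)"
definition "strip_slope U z = (if fst z \<le> (0::real) then cut_T (line_mass U z) else - cut_T (slice_mass U (snd z) - line_mass U z))"

lemma strip_slope_bound: "\<bar>strip_slope U z\<bar> \<le> sqrt w"
  using cut_T_bound by (simp add: strip_slope_def)

lemma strip_slope_measurable [measurable]:
  assumes [measurable]: "U \<in> borel_measurable (borel :: (real \<times> real) measure)"
  shows "strip_slope U \<in> borel_measurable borel"
proof -
  have 1: "(\<lambda>z :: (real \<times> real) \<times> real. fst (fst z)) \<in> borel_measurable borel" "(\<lambda>z :: (real \<times> real) \<times> real. snd (fst z)) \<in> borel_measurable borel"
    "(\<lambda>z :: (real \<times> real) \<times> real. snd z) \<in> borel_measurable borel"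
    by (intro borel_measurable_continuous_onI continuous_intros)+
  have 2: "(\<lambda>z :: (real \<times> real) \<times> real. U (snd z, snd (fst z))) \<in> borel_measurable borel"
    by (rule measurable_compose[of _ borel borel, OF borel_measurable_continuous_onI assms]) (intro continuous_intros)
  have "(\<lambda>z :: (real \<times> real) \<times> real. if snd z \<le> fst (fst z) then (U (snd z, snd (fst z)))\<^sup>2 else 0) \<in> borel_measurable borel"
    using 1 2 by measurable
  then have 3: "(\<lambda>(z :: real \<times> real, r). if r \<le> fst z then (U (r, snd z))\<^sup>2 else 0) \<in> borel_measurable (borel \<Otimes>\<^sub>M lborel)"
    by (simp add: borel_prod[symmetric] split_beta cong: measurable_cong_sets)
  have [measurable]: "line_mass U \<in> borel_measurable borel"
    unfolding line_mass_def[abs_def] by (rule lborel.borel_measurable_lebesgue_integral[OF 3])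
  have "slice_mass U \<in> borel_measurable borel" unfolding slice_mass_def[abs_def] by measurable
  then have [measurable]: "(\<lambda>z::real \<times> real. slice_mass U (snd z)) \<in> borel_measurable borel"
    by (rule measurable_compose[OF borel_measurable_snd_real2])
  show ?thesis unfolding strip_slope_def[abs_def] by measurable
qed

end

text \<open>The last assumption, combined with \<open>mass_deviation\<close>, keeps almost all slice
  masses below the free mass \<open>M\<close> and hence in the range of the calibration.\<close>

locale strip_line = soliton + strip_function +
  assumes one: "(LINT z|lborel. (U z)\<^sup>2) = 1" and pos: "AE z in lborel. z \<in> strip \<longrightarrow> U z > 0"
    and small: "2 * sqrt (LINT z|lborel. (H z)\<^sup>2) < M - 1"
begin

lemma slice_mass_near_one: "AE y in lborel. y \<in> {0..1} \<longrightarrow> \<bar>slice_mass U y - 1\<bar> \<le> 2 * sqrt (LINT z|lborel. (H z)\<^sup>2)"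
  using mass_deviation[OF one] by (simp add: slice_mass_def)

lemma slice_full_line: "AE y in lborel. y \<in> {0..1} \<longrightarrow> full_line q w (\<lambda>x. U (x, y)) (\<lambda>x. G (x, y)) (slice_mass U y)"
  using slice_mass_near_one H1_line_slices lborel2_AE_slices(1)[OF pos]
proof eventually_elim
  case (elim y)
  show ?case
  proof
    assume y: "y \<in> {0..1}"
    have "AE x in lborel. U (x, y) \<noteq> 0" using elim(3) by eventually_elim (use y in \<open>auto simp: strip_def\<close>)
    moreover have "slice_mass U y < M" using elim(1) y small by auto
    ultimately show "full_line q w (\<lambda>x. U (x, y)) (\<lambda>x. G (x, y)) (slice_mass U y)"
      using elim(2) soliton_axioms by (intro full_line.intro full_line_axioms.intro) (auto simp: slice_mass_def)
  qed
qed

definition "strip_defect y = (LINT x|lborel. (G (x, y) - strip_slope U (x, y) * U (x, y))\<^sup>2)"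

text \<open>The running masses of such a slice and their complements lie in \<open>(0, M)\<close>,
  so the cut-off in \<open>cut_T\<close> is invisible on it.\<close>

lemma slice_slope:
  assumes "full_line q w (\<lambda>x. U (x, y)) (\<lambda>x. G (x, y)) (slice_mass U y)"
  shows "full_line.slope q w (\<lambda>x. U (x, y)) (slice_mass U y) x = strip_slope U (x, y)"
    and "full_line.total_defect q w (\<lambda>x. U (x, y)) (\<lambda>x. G (x, y)) (slice_mass U y) = strip_defect y"
proof -
  interpret fl: full_line q w "\<lambda>x. U (x, y)" "\<lambda>x. G (x, y)" "slice_mass U y" by fact
  have m: "fl.mass x = line_mass U (x, y)" for x
    by (auto simp: fl.mass_def line_mass_def set_lebesgue_integral_def indicator_def intro!: Bochner_Integration.integral_cong)
  have b: "0 < fl.mass x" "fl.mass x < slice_mass U y" "slice_mass U y < M" for x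
    using fl.mass_pos fl.mass_less_mu fl.mu(2) by auto
  have s: "fl.slope x = strip_slope U (x, y)" for x
    using b(1,2)[of x] b(3) by (auto simp: fl.slope_def strip_slope_def cut_T_def m)
  then show "fl.slope x = strip_slope U (x, y)" .
  show "fl.total_defect = strip_defect y" by (simp add: fl.total_defect_def strip_defect_def s)
qed

lemma defect_integrable: "integrable lborel (\<lambda>z. (G z - strip_slope U z * U z)\<^sup>2)"
proof (rule Bochner_Integration.integrable_bound)
  show "integrable lborel (\<lambda>z. 2 * (G z)\<^sup>2 + 2 * (w * (U z)\<^sup>2))" using squares by simp
  show "AE z in lborel. norm ((G z - strip_slope U z * U z)\<^sup>2) \<le> norm (2 * (G z)\<^sup>2 + 2 * (w * (U z)\<^sup>2))"
  proof (rule AE_I2)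
    fix z
    have "(strip_slope U z)\<^sup>2 \<le> w" using power_mono[OF strip_slope_bound[of U z], of 2] w by simp
    then have "(strip_slope U z * U z)\<^sup>2 \<le> w * (U z)\<^sup>2" unfolding power_mult_distrib by (intro mult_right_mono) auto
    moreover have "(G z - strip_slope U z * U z)\<^sup>2 \<le> 2 * (G z)\<^sup>2 + 2 * (strip_slope U z * U z)\<^sup>2"
      using norm_diff_square_le[of "G z" "strip_slope U z * U z"] by simp
    ultimately show "norm ((G z - strip_slope U z * U z)\<^sup>2) \<le> norm (2 * (G z)\<^sup>2 + 2 * (w * (U z)\<^sup>2))" by simp
  qed
qed measurable

text \<open>The slice bounds integrate over \<open>y\<close> to a lower bound of the energy in which
  \<open>T\<close> and \<open>K\<close> are taken at half the slice mass instead of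
  \<open>1/2\<close>; \<open>\<eta>\<close> measures this error. The assumed energy bound cancels
  the main terms, with \<open>T (1 / 2)\<close> matched by the point interaction. What remains is
  \<open>\<eta>\<close> times the trace and \<open>\<eta>\<close> times the height of the
  strip.\<close>

lemma defect_bound:
  assumes \<gamma>: "\<gamma> = - 2 * T (1 / 2)" and e: "energy (2 * q + 1) \<gamma> L u \<le> - 2 * K (1 / 2)"
    and \<eta>: "0 \<le> \<eta>" "\<And>m. \<bar>m - 1\<bar> \<le> 2 * sqrt (LINT z|lborel. (H z)\<^sup>2) \<Longrightarrow> \<bar>T (m / 2) - T (1 / 2)\<bar> \<le> \<eta> \<and> \<bar>K (m / 2) - K (1 / 2)\<bar> \<le> \<eta>"
  shows "(LINT y|lborel. strip_defect y) \<le> 4 * \<eta> * (1 + sqrt (LINT z|lborel. (G z)\<^sup>2))"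
proof -
  define F where "F z = (G z)\<^sup>2 / 2 - ((U z)\<^sup>2) powr (q + 1) / (2 * (q + 1))" for z
  obtain C where "\<And>s. 0 \<le> s \<Longrightarrow> s powr (q + 1) \<le> s\<^sup>2 / 4 + C * s" by (rule powr_le_quadratic[OF q]) blast
  note ip = powr_bounds(1)[OF q one this]
  have iF: "integrable lborel F" unfolding F_def using ip squares(2) by simp
  have iD: "integrable lborel strip_defect"
    unfolding strip_defect_def[abs_def] by (rule lborel2_fubini_snd(2)[OF defect_integrable])
  \<comment> \<open>The \<open>K\<close> term carries an indicator because slices outside the strip
    vanish and contribute nothing.\<close>
  have main: "AE y in lborel. strip_defect y / 2 + (T (1 / 2) - \<eta>) * (U (0, y))\<^sup>2 - (2 * K (1 / 2) + 2 * \<eta>) * indicator {0..1} y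
      \<le> (LINT x|lborel. F (x, y))"
    using slice_full_line slice_mass_near_one
  proof eventually_elim
    case (elim y)
    show ?case
    proof (cases "y \<in> {0..1}")
      case False
      then have "U (x, y) = 0" "G (x, y) = 0" for x using outside(1,2)[of "(x, y)"] by (auto simp: strip_def)
      then show ?thesis using False q by (simp add: strip_defect_def F_def)
    next
      case True
      then have f: "full_line q w (\<lambda>x. U (x, y)) (\<lambda>x. G (x, y)) (slice_mass U y)" using elim by simp
      let ?m = "slice_mass U y"
      have 1: "strip_defect y / 2 + (U (0, y))\<^sup>2 * T (?m / 2) - 2 * K (?m / 2) \<le> (LINT x|lborel. F (x, y))"
        using full_line.energy_lower_bound[OF f] unfolding slice_slope(2)[OF f] F_def .
      have 2: "\<bar>T (?m / 2) - T (1 / 2)\<bar> \<le> \<eta>" "\<bar>K (?m / 2) - K (1 / 2)\<bar> \<le> \<eta>"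
        using \<eta>(2)[of ?m] elim(2) True by auto
      have "(U (0, y))\<^sup>2 * (T (1 / 2) - \<eta>) \<le> (U (0, y))\<^sup>2 * T (?m / 2)"
        using 2 by (intro mult_left_mono) (auto simp: abs_le_iff)
      then show ?thesis using 1 2 True by (simp add: abs_le_iff mult.commute)
    qed
  qed
  have i01: "integrable lborel (\<lambda>y::real. indicator {0..1} y :: real)" by simp
  have iL: "integrable lborel (\<lambda>y. strip_defect y / 2 + (T (1 / 2) - \<eta>) * (U (0, y))\<^sup>2 - (2 * K (1 / 2) + 2 * \<eta>) * indicator {0..1} y)"
    using iD trace_square_integrable i01 by simp
  define tr where "tr = (LINT y|lborel. (U (0, y))\<^sup>2)"
  have "(LINT y|lborel. strip_defect y / 2 + (T (1 / 2) - \<eta>) * (U (0, y))\<^sup>2 - (2 * K (1 / 2) + 2 * \<eta>) * indicator {0..1} y)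
      \<le> (LINT y|lborel. LINT x|lborel. F (x, y))"
    by (rule integral_mono_AE[OF iL lborel2_fubini_snd(2)[OF iF] main])
  also have "\<dots> = integral\<^sup>L lborel F" by (rule lborel2_fubini_snd(3)[OF iF])
  also have "(LINT y|lborel. strip_defect y / 2 + (T (1 / 2) - \<eta>) * (U (0, y))\<^sup>2 - (2 * K (1 / 2) + 2 * \<eta>) * indicator {0..1} y)
      = (LINT y|lborel. strip_defect y) / 2 + (T (1 / 2) - \<eta>) * tr - (2 * K (1 / 2) + 2 * \<eta>)"
    using iD trace_square_integrable i01 by (simp add: tr_def)
  finally have 1: "(LINT y|lborel. strip_defect y) / 2 + (T (1 / 2) - \<eta>) * tr - (2 * K (1 / 2) + 2 * \<eta>) \<le> integral\<^sup>L lborel F" .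
  have 2: "integral\<^sup>L lborel F + (LINT z|lborel. (H z)\<^sup>2) / (2 * L\<^sup>2) - T (1 / 2) * tr \<le> - 2 * K (1 / 2)"
    using e unfolding energy_split(1)[OF q one] by (simp add: F_def[abs_def] tr_def \<gamma>)
  have "0 \<le> (LINT z|lborel. (H z)\<^sup>2) / (2 * L\<^sup>2)" by simp
  moreover have "(T (1 / 2) - \<eta>) * tr = T (1 / 2) * tr - \<eta> * tr" by (rule left_diff_distrib)
  ultimately have "(LINT y|lborel. strip_defect y) / 2 \<le> \<eta> * tr + 2 * \<eta>" using 1 2 by linarith
  moreover have "\<eta> * tr \<le> \<eta> * (2 * sqrt (LINT z|lborel. (G z)\<^sup>2))"
    unfolding tr_def by (rule mult_left_mono[OF trace_square_le[OF one] \<eta>(1)])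
  ultimately show ?thesis by (simp add: algebra_simps)
qed

end

section \<open>The extended profile as a competitor\<close>

context soliton
begin

definition "strip_wave xs z = indicator strip z * wave xs (fst z)"
definition "strip_wave_derivative xs z = indicator strip z * (wave_slope xs (fst z) * wave xs (fst z))"

lemma strip_wave_measurable [measurable]:
  "strip_wave xs \<in> borel_measurable borel" "strip_wave_derivative xs \<in> borel_measurable borel"
proof -
  have [measurable]: "(\<lambda>z::real \<times> real. wave xs (fst z)) \<in> borel_measurable borel" "(\<lambda>z::real \<times> real. wave_slope xs (fst z)) \<in> borel_measurable borel"
    by (rule measurable_compose[OF borel_measurable_fst_real2]; rule wave_measurable)+
  show "strip_wave xs \<in> borel_measurable borel" "strip_wave_derivative xs \<in> borel_measurable borel"
    unfolding strip_wave_def[abs_def] strip_wave_derivative_def[abs_def] by measurable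
qed

lemma strip_product_integral:
  fixes f :: "real \<Rightarrow> real"
  assumes f: "integrable lborel f"
  shows "integrable lborel (\<lambda>z. indicator strip z * f (fst z))" "(LINT z|lborel. indicator strip z * f (fst z)) = (LINT x|lborel. f x)"
proof -
  have "integrable lborel (\<lambda>z. f (fst z) *\<^sub>R (indicator {0..1::real} (snd z) :: real))"
    by (rule lborel2_integrable_product[OF f, where g = "indicator {0..1}"]) simp
  moreover have "(\<lambda>z. f (fst z) *\<^sub>R (indicator {0..1::real} (snd z) :: real)) = (\<lambda>z. indicator strip z * f (fst z))"
    by (auto simp: strip_def indicator_def)
  ultimately show i: "integrable lborel (\<lambda>z. indicator strip z * f (fst z))" by simp
  have "(LINT z|lborel. indicator strip z * f (fst z)) = (LINT t|lborel. LINT s|lborel. indicator strip (s, t) * f (fst (s, t)))"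
    by (rule lborel2_fubini_snd(3)[OF i, symmetric])
  also have "\<dots> = (LINT t|lborel. indicator {0..1::real} t * (LINT s|lborel. f s))"
  proof (rule Bochner_Integration.integral_cong[OF refl])
    show "(LINT s|lborel. indicator strip (s, t) * f (fst (s, t))) = indicator {0..1::real} t * (LINT s|lborel. f s)" for t
      by (cases "t \<in> {0..1}") (auto simp: strip_def)
  qed
  also have "\<dots> = (LINT x|lborel. f x)" by simp
  finally show "(LINT z|lborel. indicator strip z * f (fst z)) = (LINT x|lborel. f x)" .
qed

lemma strip_wave_square:
  "(strip_wave xs z)\<^sup>2 = indicator strip z * (wave xs (fst z))\<^sup>2"
  "(strip_wave_derivative xs z)\<^sup>2 = indicator strip z * (wave_slope xs (fst z) * wave xs (fst z))\<^sup>2"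
  by (auto simp: strip_wave_def strip_wave_derivative_def indicator_def)

lemma strip_wave_integrable:
  "integrable lborel (\<lambda>z. (strip_wave xs z)\<^sup>2)" "integrable lborel (\<lambda>z. (strip_wave_derivative xs z)\<^sup>2)"
  "(LINT z|lborel. (strip_wave xs z)\<^sup>2) = 2 * N xs"
  unfolding strip_wave_square
  using strip_product_integral[OF wave_mass(1)] strip_product_integral[OF wave_derivative_square] wave_mass(2) by simp_all

end

lemma integral_of_compactly_supported_derivative:
  fixes v g :: "real \<Rightarrow> real"
  assumes ac: "indefinite_integral_of g v" and R: "\<And>x. r \<le> \<bar>x\<bar> \<Longrightarrow> v x = 0" "\<And>x. r \<le> \<bar>x\<bar> \<Longrightarrow> g x = 0" and r: "0 < r"
  shows "(LINT x|lborel. g x) = 0"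
proof -
  have "(LINT x|lborel. g x) = (LINT x:{-r<..r}|lborel. g x)"
    unfolding set_lebesgue_integral_def
  proof (rule Bochner_Integration.integral_cong[OF refl])
    show "g x = indicator {-r<..r} x *\<^sub>R g x" for x
      by (cases "r \<le> \<bar>x\<bar>") (use R(2)[of x] in \<open>auto simp: indicator_def\<close>)
  qed
  then show ?thesis using indefinite_integral_ofD(2)[OF ac, of "- r" r] R(1)[of r] R(1)[of "- r"] r by simp
qed

lemma test_function_lines:
  assumes t: "\<theta> \<in> test_functions"
  shows "indefinite_integral_of (\<lambda>x. frechet_derivative \<theta> (at (x, y)) (1, 0)) (\<lambda>x. \<theta> (x, y))"
    "indefinite_integral_of (\<lambda>y. frechet_derivative \<theta> (at (x, y)) (0, 1)) (\<lambda>y. \<theta> (x, y))"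
proof -
  note C = test_function_continuous[OF t]
  have lin: "frechet_derivative \<theta> (at z) (c *\<^sub>R v) = frechet_derivative \<theta> (at z) v * c" for z v and c :: real
    using linear_cmul[OF has_derivative_linear[OF C(4)[of z]], of c v] by (simp add: mult.commute)
  show "indefinite_integral_of (\<lambda>x. frechet_derivative \<theta> (at (x, y)) (1, 0)) (\<lambda>x. \<theta> (x, y))"
  proof (rule indefinite_integral_of_DERIV)
    fix x :: real
    have "((\<lambda>x. (x, y)) has_derivative (\<lambda>h. (h, 0))) (at x)" by (auto intro!: derivative_eq_intros)
    from has_derivative_compose[OF this, where g = \<theta> and g' = "frechet_derivative \<theta> (at (x, y))"] C(4)[of "(x, y)"]
    have "((\<lambda>x. \<theta> (x, y)) has_derivative (\<lambda>h. frechet_derivative \<theta> (at (x, y)) (h, 0))) (at x)" by simp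
    show "((\<lambda>x. \<theta> (x, y)) has_real_derivative frechet_derivative \<theta> (at (x, y)) (1, 0)) (at x)"
    proof -
      have "frechet_derivative \<theta> (at (x, y)) (h, 0) = frechet_derivative \<theta> (at (x, y)) (1, 0) * h" for h
        using lin[of "(x, y)" h "(1, 0)"] by simp
      then have "(\<lambda>h. frechet_derivative \<theta> (at (x, y)) (h, 0)) = (*) (frechet_derivative \<theta> (at (x, y)) (1, 0))" by (rule ext)
      then show ?thesis using \<open>((\<lambda>x. \<theta> (x, y)) has_derivative _) _\<close> by (simp only: has_field_derivative_def)
    qed
    show "continuous_on UNIV (\<lambda>x. frechet_derivative \<theta> (at (x, y)) (1, 0))"
      by (rule continuous_on_compose2[OF C(2)]) (auto intro!: continuous_intros)
  qed
  show "indefinite_integral_of (\<lambda>y. frechet_derivative \<theta> (at (x, y)) (0, 1)) (\<lambda>y. \<theta> (x, y))"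
  proof (rule indefinite_integral_of_DERIV)
    fix y :: real
    have "((\<lambda>y. (x, y)) has_derivative (\<lambda>h. (0, h))) (at y)" by (auto intro!: derivative_eq_intros)
    from has_derivative_compose[OF this, where g = \<theta> and g' = "frechet_derivative \<theta> (at (x, y))"] C(4)[of "(x, y)"]
    have "((\<lambda>y. \<theta> (x, y)) has_derivative (\<lambda>h. frechet_derivative \<theta> (at (x, y)) (0, h))) (at y)" by simp
    show "((\<lambda>y. \<theta> (x, y)) has_real_derivative frechet_derivative \<theta> (at (x, y)) (0, 1)) (at y)"
    proof -
      have "frechet_derivative \<theta> (at (x, y)) (0, h) = frechet_derivative \<theta> (at (x, y)) (0, 1) * h" for h
        using lin[of "(x, y)" h "(0, 1)"] by simp
      then have "(\<lambda>h. frechet_derivative \<theta> (at (x, y)) (0, h)) = (*) (frechet_derivative \<theta> (at (x, y)) (0, 1))" by (rule ext)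
      then show ?thesis using \<open>((\<lambda>y. \<theta> (x, y)) has_derivative _) _\<close> by (simp only: has_field_derivative_def)
    qed
    show "continuous_on UNIV (\<lambda>y. frechet_derivative \<theta> (at (x, y)) (0, 1))"
      by (rule continuous_on_compose2[OF C(2)]) (auto intro!: continuous_intros)
  qed
qed

context soliton
begin

text \<open>Integration by parts on each line. Horizontally the product with a test function is
  absolutely continuous across the corner and compactly supported. Vertically the profile is a
  constant factor, and the test function vanishes near the boundary lines.\<close>

lemma strip_wave_function: "strip_function (\<lambda>z. complex_of_real (wave xs (fst z))) (strip_wave xs) (strip_wave_derivative xs) (\<lambda>_. 0)"
proof
  let ?U = "\<lambda>z. complex_of_real (strip_wave xs z)" and ?G = "\<lambda>z. complex_of_real (strip_wave_derivative xs z)"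
  have iU: "?U \<in> borel_measurable borel" "integrable lborel (\<lambda>z. (norm (?U z))\<^sup>2)" using strip_wave_integrable(1) by auto
  have iG: "?G \<in> borel_measurable borel" "integrable lborel (\<lambda>z. (norm (?G z))\<^sup>2)" using strip_wave_integrable(2) by auto
  have wx: "lborel_weak_partial ?U (1, 0) ?G"
    unfolding lborel_weak_partial_def
  proof
    fix \<theta> assume t: "\<theta> \<in> test_functions"
    obtain Q where Q: "compact Q" "Q \<subseteq> UNIV \<times> {0<..<1}" "\<And>z. z \<notin> Q \<Longrightarrow> \<theta> z = 0" "\<And>z v. z \<notin> Q \<Longrightarrow> frechet_derivative \<theta> (at z) v = 0"
      by (rule test_function_support[OF t]) blast
    obtain r where r: "\<And>z. z \<in> Q \<Longrightarrow> norm z < r" "0 < r" using compact_imp_bounded[OF Q(1)] by (auto simp: bounded_pos_less)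
    have notin: "(x, y) \<notin> Q" if "r \<le> \<bar>x\<bar>" for x y using r(1)[of "(x, y)"] norm_fst_le[of x y] that by fastforce
    let ?x = "\<lambda>z. frechet_derivative \<theta> (at z) (1, 0)"
    note i = test_function_mult_integrable(2)[OF t iU, of "(1, 0)"] test_function_mult_integrable(1)[OF t iG]
    have "(LINT z|lborel. ?x z *\<^sub>R ?U z) + (LINT z|lborel. \<theta> z *\<^sub>R ?G z) = (LINT z|lborel. ?x z *\<^sub>R ?U z + \<theta> z *\<^sub>R ?G z)"
      using i by simp
    also have "\<dots> = (LINT y|lborel. LINT x|lborel. ?x (x, y) *\<^sub>R ?U (x, y) + \<theta> (x, y) *\<^sub>R ?G (x, y))"
      by (rule lborel2_fubini_snd(3)[symmetric]) (use i in auto)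
    also have "\<dots> = 0"
    proof -
      have "(LINT x|lborel. ?x (x, y) *\<^sub>R ?U (x, y) + \<theta> (x, y) *\<^sub>R ?G (x, y)) = 0" for y
      proof -
        have ac: "indefinite_integral_of (\<lambda>x. ?x (x, y) * wave xs x + \<theta> (x, y) * (wave_slope xs x * wave xs x)) (\<lambda>x. \<theta> (x, y) * wave xs x)"
          by (rule indefinite_integral_of_mult[OF test_function_lines(1)[OF t] wave_AC])
        have "(LINT x|lborel. ?x (x, y) * wave xs x + \<theta> (x, y) * (wave_slope xs x * wave xs x)) = 0"
          by (rule integral_of_compactly_supported_derivative[OF ac _ _ r(2)]) (use notin Q(3,4) in auto)
        moreover have "(\<lambda>x. ?x (x, y) *\<^sub>R ?U (x, y) + \<theta> (x, y) *\<^sub>R ?G (x, y))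
            = (\<lambda>x. complex_of_real (indicator {0..1} y * (?x (x, y) * wave xs x + \<theta> (x, y) * (wave_slope xs x * wave xs x))))"
          by (auto simp: strip_wave_def strip_wave_derivative_def strip_def indicator_def scaleR_conv_of_real)
        ultimately show ?thesis by (simp only: integral_complex_of_real) simp
      qed
      then show ?thesis by simp
    qed
    finally show "(LINT z|lborel. ?x z *\<^sub>R ?U z) = - (LINT z|lborel. \<theta> z *\<^sub>R ?G z)" by (simp add: eq_neg_iff_add_eq_0)
  qed
  have wy: "lborel_weak_partial ?U (0, 1) (\<lambda>_. complex_of_real 0)"
    unfolding lborel_weak_partial_def
  proof
    fix \<theta> assume t: "\<theta> \<in> test_functions"
    obtain Q where Q: "compact Q" "Q \<subseteq> UNIV \<times> {0<..<1}" "\<And>z. z \<notin> Q \<Longrightarrow> \<theta> z = 0" "\<And>z v. z \<notin> Q \<Longrightarrow> frechet_derivative \<theta> (at z) v = 0"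
      by (rule test_function_support[OF t]) blast
    let ?y = "\<lambda>z. frechet_derivative \<theta> (at z) (0, 1)"
    have notin: "(x, y) \<notin> Q" if "1 \<le> \<bar>y\<bar>" for x y using Q(2) that by auto
    have in_strip: "(x, y) \<notin> Q" if "(x, y) \<notin> strip" for x y using Q(2) that by (auto simp: strip_def)
    have "(LINT z|lborel. ?y z *\<^sub>R ?U z) = (LINT x|lborel. LINT y|lborel. ?y (x, y) *\<^sub>R ?U (x, y))"
      by (rule lborel2_fubini_fst(3)[symmetric, OF test_function_mult_integrable(2)[OF t iU]])
    also have "\<dots> = 0"
    proof -
      have "(LINT y|lborel. ?y (x, y) *\<^sub>R ?U (x, y)) = 0" for x
      proof -
        have "(LINT y|lborel. ?y (x, y)) = 0"
          by (rule integral_of_compactly_supported_derivative[OF test_function_lines(2)[OF t], of 1]) (use notin Q(3,4) in auto)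
        moreover have "(\<lambda>y. ?y (x, y) *\<^sub>R ?U (x, y)) = (\<lambda>y. complex_of_real (?y (x, y) * wave xs x))"
        proof
          fix y show "?y (x, y) *\<^sub>R ?U (x, y) = complex_of_real (?y (x, y) * wave xs x)"
            using in_strip[of x y] Q(4)[of "(x, y)"] by (cases "(x, y) \<in> strip") (auto simp: strip_wave_def scaleR_conv_of_real)
        qed
        ultimately show ?thesis by (simp only: integral_complex_of_real) simp
      qed
      then show ?thesis by simp
    qed
    finally show "(LINT z|lborel. ?y z *\<^sub>R ?U z) = - (LINT z|lborel. \<theta> z *\<^sub>R complex_of_real 0)" by simp
  qed
  show "H1_rep (\<lambda>z. complex_of_real (wave xs (fst z))) ?U ?G (\<lambda>z. complex_of_real 0)"
    unfolding H1_rep_def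
  proof (intro conjI)
    have "(\<lambda>z::real \<times> real. wave xs (fst z)) \<in> borel_measurable borel"
      by (rule measurable_compose[OF borel_measurable_fst_real2]) (rule wave_measurable)
    then show "(\<lambda>z. complex_of_real (wave xs (fst z))) \<in> borel_measurable (lebesgue_on strip)"
      by (intro borel_measurable_lebesgue_onI) measurable
    show "AE z in lebesgue_on strip. complex_of_real (wave xs (fst z)) = ?U z"
      unfolding AE_lebesgue_on_iff[OF strip_borel] by (simp add: strip_wave_def)
  qed (use iU iG wx wy in \<open>auto simp: strip_wave_def strip_wave_derivative_def\<close>)
  show "AE y in lborel. indefinite_integral_of (\<lambda>x. strip_wave_derivative xs (x, y)) (\<lambda>x. strip_wave xs (x, y))"
  proof (rule AE_I2)
    fix y
    have z: "indefinite_integral_of (\<lambda>_. 0) (\<lambda>_. 0 :: real)" unfolding indefinite_integral_of_def set_integrable_def set_lebesgue_integral_def by simp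
    show "indefinite_integral_of (\<lambda>x. strip_wave_derivative xs (x, y)) (\<lambda>x. strip_wave xs (x, y))"
      using wave_AC z by (cases "y \<in> {0..1}") (auto simp: strip_wave_def strip_wave_derivative_def strip_def indicator_def)
  qed
qed

lemma strip_wave_energy:
  assumes xs: "N xs = 1 / 2" and \<gamma>: "\<gamma> = - 2 * tau xs"
  shows "energy (2 * q + 1) \<gamma> L (\<lambda>z. complex_of_real (wave xs (fst z))) = - 2 * K (1 / 2)"
proof -
  interpret S: strip_function "\<lambda>z. complex_of_real (wave xs (fst z))" "strip_wave xs" "strip_wave_derivative xs" "\<lambda>_. 0"
    by (rule strip_wave_function)
  have one: "(LINT z|lborel. (strip_wave xs z)\<^sup>2) = 1" using strip_wave_integrable(3) xs by simp
  define f where "f x = (wave_slope xs x * wave xs x)\<^sup>2 / 2 - ((wave xs x)\<^sup>2) powr (q + 1) / (2 * (q + 1))" for x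
  have "H1_line (wave xs) (\<lambda>x. wave_slope xs x * wave xs x)"
    by unfold_locales (use wave_AC wave_mass(1) wave_derivative_square in auto)
  then have f: "integrable lborel f" unfolding f_def[abs_def]
    using H1_line.powr_integrable[of "wave xs" _ q] q wave_derivative_square by auto
  have "(\<lambda>z. (strip_wave_derivative xs z)\<^sup>2 / 2 - ((strip_wave xs z)\<^sup>2) powr (q + 1) / (2 * (q + 1))) = (\<lambda>z. indicator strip z * f (fst z))"
    using q by (auto simp: strip_wave_square f_def indicator_def)
  then have 1: "(LINT z|lborel. (strip_wave_derivative xs z)\<^sup>2 / 2 - ((strip_wave xs z)\<^sup>2) powr (q + 1) / (2 * (q + 1))) = (LINT x|lborel. f x)"
    using strip_product_integral(2)[OF f] by simp
  have "(\<lambda>y. (strip_wave xs (0, y))\<^sup>2) = (\<lambda>y. indicator {0..1} y * (wave xs 0)\<^sup>2)"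
    by (auto simp: strip_wave_def strip_def indicator_def)
  then have 2: "(LINT y|lborel. (strip_wave xs (0, y))\<^sup>2) = (wave xs 0)\<^sup>2" by simp
  show ?thesis using wave_energy[OF xs] unfolding S.energy_split(1)[OF q one] 1 2 \<gamma> f_def[abs_def] by simp
qed

end

section \<open>Convergence of minimizers\<close>

text \<open>\<open>tau xs > 0\<close> means that \<open>xs\<close> lies to the left of the peak of
  the free soliton. The part beyond \<open>xs\<close> then has mass greater than \<open>1/2\<close>,
  so total masses near \<open>1\<close> are within reach of the calibration.\<close>

lemma (in soliton) N_half_bounds:
  assumes xs: "N xs = 1 / 2" "0 < tau xs"
  shows "1 < M" "T (1 / 2) = tau xs"
proof -
  have "xs < 0"
  proof (rule ccontr)
    assume "\<not> xs < 0"
    then have "0 \<le> tanh (k * xs)" using k_pos by simp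
    then have "tau xs \<le> 0" using w by (simp add: tau_def)
    then show False using xs by simp
  qed
  then have "N xs < N (- xs)" by (intro N_strict_mono) simp
  then show "1 < M" using xs N_minus[of xs] by simp
  show "T (1 / 2) = tau xs" using T_N[of xs] xs by simp
qed

lemma (in soliton) defect_tendsto_zero:
  fixes U G H :: "nat \<Rightarrow> real \<times> real \<Rightarrow> real"
  assumes sl: "\<And>n. strip_line q w (u n) (U n) (G n) (H n)"
    and e: "\<And>n. energy (2 * q + 1) (- 2 * T (1 / 2)) (L n) (u n) \<le> - 2 * K (1 / 2)"
    and H0: "(\<lambda>n. LINT z|lborel. (H n z)\<^sup>2) \<longlonglongrightarrow> 0" and C: "\<And>n. (LINT z|lborel. (G n z)\<^sup>2) \<le> C" and M: "1 < M"
  shows "(\<lambda>n. LINT y|lborel. strip_line.strip_defect q w (U n) (G n) y) \<longlonglongrightarrow> 0"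
proof (rule LIMSEQ_I)
  fix \<epsilon> :: real assume \<epsilon>: "0 < \<epsilon>"
  have C0: "0 \<le> C" using order_trans[OF _ C[of 0]] by simp
  \<comment> \<open>Makes the bound of \<open>defect_bound\<close> equal to
    \<open>\<epsilon> / 2\<close>, with \<open>C\<close> in place of the gradient integral.\<close>
  define \<eta> where "\<eta> = \<epsilon> / (8 * (1 + sqrt C))"
  have c: "0 < 1 + sqrt C" using C0 by (simp add: add_pos_nonneg)
  have "4 * (\<epsilon> / (8 * c)) * c = \<epsilon> / 2" if "0 < c" for c using that by simp
  from this[OF c] have \<eta>2: "4 * \<eta> * (1 + sqrt C) = \<epsilon> / 2" unfolding \<eta>_def .
  have \<eta>1: "0 < \<eta>" unfolding \<eta>_def by (rule divide_pos_pos[OF \<epsilon>]) (use c in simp)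
  note \<eta> = \<eta>1 \<eta>2
  have cont: "isCont T (1 / 2)" "isCont K (1 / 2)" using isCont_T[of "1 / 2"] DERIV_isCont[OF DERIV_K, of "1 / 2"] M by auto
  obtain d1 where d1: "0 < d1" "\<And>m. dist m (1 / 2) < d1 \<Longrightarrow> dist (T m) (T (1 / 2)) < \<eta>"
    using cont(1) \<eta>(1) unfolding continuous_at_eps_delta by blast
  obtain d2 where d2: "0 < d2" "\<And>m. dist m (1 / 2) < d2 \<Longrightarrow> dist (K m) (K (1 / 2)) < \<eta>"
    using cont(2) \<eta>(1) unfolding continuous_at_eps_delta by blast
  define \<delta> where "\<delta> = min d1 d2"
  have \<delta>: "0 < \<delta>" using d1 d2 by (simp add: \<delta>_def)
  have "(\<lambda>n. 2 * sqrt (LINT z|lborel. (H n z)\<^sup>2)) \<longlonglongrightarrow> 2 * sqrt 0"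
    by (rule tendsto_mult[OF tendsto_const tendsto_real_sqrt[OF H0]])
  from LIMSEQ_D[OF this, of \<delta>] \<delta> obtain n0 where n0: "\<And>n. n \<ge> n0 \<Longrightarrow> 2 * sqrt (LINT z|lborel. (H n z)\<^sup>2) < \<delta>" by auto
  show "\<exists>no. \<forall>n\<ge>no. norm ((LINT y|lborel. strip_line.strip_defect q w (U n) (G n) y) - 0) < \<epsilon>"
  proof (intro exI allI impI)
    fix n assume n: "n0 \<le> n"
    interpret S: strip_line q w "u n" "U n" "G n" "H n" by (rule sl)
    have near: "\<bar>T (m / 2) - T (1 / 2)\<bar> \<le> \<eta> \<and> \<bar>K (m / 2) - K (1 / 2)\<bar> \<le> \<eta>" if "\<bar>m - 1\<bar> \<le> 2 * sqrt (LINT z|lborel. (H n z)\<^sup>2)" for m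
    proof -
      have "\<bar>m - 1\<bar> < \<delta>" using that n0[OF n] by simp
      then have "dist (m / 2) (1 / 2) < d1" "dist (m / 2) (1 / 2) < d2" by (auto simp: dist_real_def \<delta>_def)
      then show ?thesis using d1(2)[of "m / 2"] d2(2)[of "m / 2"] by (simp add: dist_real_def)
    qed
    have "(LINT y|lborel. S.strip_defect y) \<le> 4 * \<eta> * (1 + sqrt (LINT z|lborel. (G n z)\<^sup>2))"
      by (rule S.defect_bound[OF refl e _ near]) (use \<eta> in auto)
    also have "\<dots> \<le> 4 * \<eta> * (1 + sqrt C)" using \<eta>(1) C[of n] by (intro mult_left_mono) auto
    finally have "(LINT y|lborel. S.strip_defect y) \<le> \<epsilon> / 2" unfolding \<eta>(2) .
    moreover have "0 \<le> (LINT y|lborel. S.strip_defect y)" by (simp add: S.strip_defect_def)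
    ultimately show "norm ((LINT y|lborel. S.strip_defect y) - 0) < \<epsilon>" using \<epsilon> by simp
  qed
qed

text \<open>The defects are assumed to vanish slice by slice, so \<open>slice_convergence\<close>
  applies on almost every horizontal line of the strip. It yields squares; the positivity of
  \<open>U n\<close> determines the root.\<close>

lemma (in soliton) strip_convergence:
  fixes U G H :: "nat \<Rightarrow> real \<times> real \<Rightarrow> real"
  assumes sl: "\<And>n. strip_line q w (u n) (U n) (G n) (H n)"
    and H0: "(\<lambda>n. LINT z|lborel. (H n z)\<^sup>2) \<longlonglongrightarrow> 0"
    and D: "AE y in lborel. (\<lambda>n. strip_line.strip_defect q w (U n) (G n) y) \<longlonglongrightarrow> 0"
    and xs: "N xs = 1 / 2" "0 < tau xs"
  shows "AE z in lborel. (\<lambda>n. U n z) \<longlonglongrightarrow> strip_wave xs z"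
    and "AE z in lborel. z \<in> strip \<longrightarrow> (\<lambda>n. strip_slope (U n) z) \<longlonglongrightarrow> wave_slope xs (fst z)"
proof -
  note S = strip_line.axioms(2)[OF sl]
  have [measurable]: "U n \<in> borel_measurable borel" for n by (rule strip_function.measurable_UGH(1)[OF S])
  have "AE y in lborel. \<forall>n. y \<in> {0..1} \<longrightarrow> \<bar>slice_mass (U n) y - 1\<bar> \<le> 2 * sqrt (LINT z|lborel. (H n z)\<^sup>2)"
    unfolding AE_all_countable using strip_line.slice_mass_near_one[OF sl] by blast
  moreover have "AE y in lborel. \<forall>n. y \<in> {0..1} \<longrightarrow> full_line q w (\<lambda>x. U n (x, y)) (\<lambda>x. G n (x, y)) (slice_mass (U n) y)"
    unfolding AE_all_countable using strip_line.slice_full_line[OF sl] by blast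
  ultimately have lines: "AE y in lborel. y \<in> {0..1} \<longrightarrow> (\<forall>x. (\<lambda>n. (U n (x, y))\<^sup>2) \<longlonglongrightarrow> (wave xs x)\<^sup>2 \<and> (\<lambda>n. strip_slope (U n) (x, y)) \<longlonglongrightarrow> wave_slope xs x)"
    using D
  proof eventually_elim
    case (elim y)
    show ?case
    proof (intro impI allI)
      fix x assume y: "y \<in> {0..1}"
      have f: "full_line q w (\<lambda>x. U n (x, y)) (\<lambda>x. G n (x, y)) (slice_mass (U n) y)" for n using elim(2) y by blast
      have lim: "(\<lambda>n. 2 * sqrt (LINT z|lborel. (H n z)\<^sup>2)) \<longlonglongrightarrow> 0" using tendsto_mult[OF tendsto_const[of 2] tendsto_real_sqrt[OF H0]] by simp
      have "(\<lambda>n. slice_mass (U n) y - 1) \<longlonglongrightarrow> 0"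
        by (rule tendsto_rabs_zero_cancel, rule tendsto_sandwich[OF _ _ tendsto_const lim]) (use elim(1) y in auto)
      then have mu: "(\<lambda>n. slice_mass (U n) y) \<longlonglongrightarrow> 1" by (simp add: LIM_zero_iff)
      have td: "(\<lambda>n. full_line.total_defect q w (\<lambda>x. U n (x, y)) (\<lambda>x. G n (x, y)) (slice_mass (U n) y)) \<longlonglongrightarrow> 0"
        using elim(3) unfolding strip_line.slice_slope(2)[OF sl f] .
      show "(\<lambda>n. (U n (x, y))\<^sup>2) \<longlonglongrightarrow> (wave xs x)\<^sup>2 \<and> (\<lambda>n. strip_slope (U n) (x, y)) \<longlonglongrightarrow> wave_slope xs x"
        using slice_convergence[OF f mu td xs, of x] unfolding strip_line.slice_slope(1)[OF sl f] wave_square wave_slope_def by simp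
    qed
  qed
  have [measurable]: "(\<lambda>z::real \<times> real. wave xs (fst z)) \<in> borel_measurable borel" "(\<lambda>z::real \<times> real. wave_slope xs (fst z)) \<in> borel_measurable borel"
    by (rule measurable_compose[OF borel_measurable_fst_real2]; rule wave_measurable)+
  have sq: "AE z in lborel. z \<in> strip \<longrightarrow> (\<lambda>n. (U n z)\<^sup>2) \<longlonglongrightarrow> (wave xs (fst z))\<^sup>2"
  proof (subst lborel2_AE(1))
    show "Measurable.pred borel (\<lambda>z. z \<in> strip \<longrightarrow> (\<lambda>n. (U n z)\<^sup>2) \<longlonglongrightarrow> (wave xs (fst z))\<^sup>2)"
      by (intro pred_intros_logic pred_LIMSEQ) measurable
    show "AE t in lborel. AE s in lborel. (s, t) \<in> strip \<longrightarrow> (\<lambda>n. (U n (s, t))\<^sup>2) \<longlonglongrightarrow> (wave xs (fst (s, t)))\<^sup>2"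
      using lines by eventually_elim (auto simp: strip_def)
  qed
  show "AE z in lborel. z \<in> strip \<longrightarrow> (\<lambda>n. strip_slope (U n) z) \<longlonglongrightarrow> wave_slope xs (fst z)"
  proof (subst lborel2_AE(1))
    show "Measurable.pred borel (\<lambda>z. z \<in> strip \<longrightarrow> (\<lambda>n. strip_slope (U n) z) \<longlonglongrightarrow> wave_slope xs (fst z))"
      by (intro pred_intros_logic pred_LIMSEQ) measurable
    show "AE t in lborel. AE s in lborel. (s, t) \<in> strip \<longrightarrow> (\<lambda>n. strip_slope (U n) (s, t)) \<longlonglongrightarrow> wave_slope xs (fst (s, t))"
      using lines by eventually_elim (auto simp: strip_def)
  qed
  have "AE z in lborel. \<forall>n. z \<in> strip \<longrightarrow> U n z > 0" unfolding AE_all_countable using strip_line.pos[OF sl] by blast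
  then show "AE z in lborel. (\<lambda>n. U n z) \<longlonglongrightarrow> strip_wave xs z"
    using sq
  proof eventually_elim
    case (elim z)
    show ?case
    proof (cases "z \<in> strip")
      case True
      have "(\<lambda>n. sqrt ((U n z)\<^sup>2)) \<longlonglongrightarrow> sqrt ((wave xs (fst z))\<^sup>2)" using elim(2) True by (intro tendsto_real_sqrt) blast
      moreover have "sqrt ((U n z)\<^sup>2) = U n z" for n using elim(1) True by (simp add: less_imp_le)
      ultimately show ?thesis using True wave_pos[of xs "fst z"] by (simp add: strip_wave_def)
    next
      case False
      then show ?thesis using strip_function.outside(1)[OF S] by (simp add: strip_wave_def)
    qed
  qed
qed

lemma square_sum3_le:
  fixes a b c B x :: real
  assumes "x = a + b + c" "b\<^sup>2 \<le> B"
  shows "x\<^sup>2 \<le> 3 * a\<^sup>2 + 3 * B + 3 * c\<^sup>2"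
proof -
  have "(a + b + c)\<^sup>2 \<le> 3 * a\<^sup>2 + 3 * b\<^sup>2 + 3 * c\<^sup>2"
    using zero_le_power2[of "a - b"] zero_le_power2[of "b - c"] zero_le_power2[of "a - c"]
    by (simp add: power2_eq_square algebra_simps)
  then show ?thesis using assms by simp
qed

text \<open>For the functions this is Scheffe's argument, since all masses equal one. The
  x-derivative is \<open>strip_slope\<close> times the function up to the defect, and both factors
  converge, so its limit is the slope of the wave times the wave.\<close>

lemma (in soliton) strip_compactness:
  fixes U G H :: "nat \<Rightarrow> real \<times> real \<Rightarrow> real"
  assumes sl: "\<And>n. strip_line q w (u n) (U n) (G n) (H n)"
    and e: "\<And>n. energy (2 * q + 1) (- 2 * tau xs) (L n) (u n) \<le> - 2 * K (1 / 2)"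
    and H0: "(\<lambda>n. LINT z|lborel. (H n z)\<^sup>2) \<longlonglongrightarrow> 0" and C: "\<And>n. (LINT z|lborel. (G n z)\<^sup>2) \<le> C"
    and xs: "N xs = 1 / 2" "0 < tau xs"
  obtains r where "strict_mono r" "(\<lambda>n. LINT z|lborel. (U (r n) z - strip_wave xs z)\<^sup>2) \<longlonglongrightarrow> 0"
    "(\<lambda>n. LINT z|lborel. (G (r n) z - strip_wave_derivative xs z)\<^sup>2) \<longlonglongrightarrow> 0"
proof -
  note hb = N_half_bounds[OF xs]
  note S = strip_line.axioms(2)[OF sl]
  note UG_m[measurable] = strip_function.measurable_UGH[OF S]
  note sq = strip_function.squares[OF S]
  define D where "D n y = strip_line.strip_defect q w (U n) (G n) y" for n y
  have D_eq: "D n y = (LINT x|lborel. (G n (x, y) - strip_slope (U n) (x, y) * U n (x, y))\<^sup>2)" for n y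
    unfolding D_def by (rule strip_line.strip_defect_def[OF sl])
  have D0: "(\<lambda>n. LINT y|lborel. D n y) \<longlonglongrightarrow> 0"
    unfolding D_def by (rule defect_tendsto_zero[OF sl e[folded hb(2)] H0 C hb(1)])
  have iD: "integrable lborel (D n)" for n
    unfolding D_eq[abs_def] by (rule lborel2_fubini_snd(2)[OF strip_line.defect_integrable[OF sl]])
  have "norm (D n y) = D n y" for n y by (simp add: D_eq)
  then have "(\<lambda>n. LINT y|lborel. norm (D n y)) \<longlonglongrightarrow> 0" using D0 by simp
  \<comment> \<open>Apart from dropping finitely many terms, this is where the subsequence arises:
    convergence in mean of the slice defects gives convergence for almost every \<open>y\<close>
    along a subsequence.\<close>
  from tendsto_L1_AE_subseq[OF iD this] obtain r :: "nat \<Rightarrow> nat" where r: "strict_mono r" "AE y in lborel. (\<lambda>n. D (r n) y) \<longlonglongrightarrow> 0" by blast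
  have H0r: "(\<lambda>n. LINT z|lborel. (H (r n) z)\<^sup>2) \<longlonglongrightarrow> 0" using LIMSEQ_subseq_LIMSEQ[OF H0 r(1)] by (simp add: comp_def)
  note conv = strip_convergence[OF sl H0r r(2)[unfolded D_def] xs]
  let ?P = "strip_wave xs" and ?W = "strip_wave_derivative xs"
  have X2: "(\<lambda>n. LINT z|lborel. (U (r n) z - ?P z)\<^sup>2) \<longlonglongrightarrow> 0"
  proof -
    have "(\<lambda>n. LINT z|lborel. (norm (U (r n) z - ?P z))\<^sup>2) \<longlonglongrightarrow> 0"
      by (rule L2_Scheffe) (use sq(1) strip_wave_integrable(1) conv(1) strip_line.one[OF sl] strip_wave_integrable(3)[of xs] xs(1) in auto)
    then show ?thesis by simp
  qed
  have iX2: "integrable lborel (\<lambda>z. (U n z - ?P z)\<^sup>2)" for n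
    using square_integrable_diff[of "U n" lborel ?P] sq(1) strip_wave_integrable(1) by simp
  have iX0: "integrable lborel (\<lambda>z. (G n z - ?W z)\<^sup>2)" for n
    using square_integrable_diff[of "G n" lborel ?W] sq(2) strip_wave_integrable(2) by simp
  have X1: "(\<lambda>n. LINT z|lborel. (G (r n) z - strip_slope (U (r n)) z * U (r n) z)\<^sup>2) \<longlonglongrightarrow> 0"
  proof -
    have "(LINT y|lborel. D n y) = (LINT z|lborel. (G n z - strip_slope (U n) z * U n z)\<^sup>2)" for n
      unfolding D_eq by (rule lborel2_fubini_snd(3)[OF strip_line.defect_integrable[OF sl]])
    then show ?thesis using LIMSEQ_subseq_LIMSEQ[OF D0 r(1)] by (simp add: comp_def)
  qed
  \<comment> \<open>The slopes converge pointwise; this bound, free of \<open>n\<close>, is the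
    majorant for dominated convergence.\<close>
  have bd: "(strip_slope (U n) z * ?P z - ?W z)\<^sup>2 \<le> 4 * w * (?P z)\<^sup>2" for n z
  proof -
    have "strip_slope (U n) z * ?P z - ?W z = (strip_slope (U n) z - wave_slope xs (fst z)) * ?P z"
      by (simp add: strip_wave_def strip_wave_derivative_def algebra_simps)
    moreover have "\<bar>strip_slope (U n) z - wave_slope xs (fst z)\<bar> \<le> 2 * sqrt w"
      using strip_slope_bound[of "U n" z] wave_slope_bound[of xs "fst z"] by linarith
    then have "(strip_slope (U n) z - wave_slope xs (fst z))\<^sup>2 \<le> 4 * w"
      using power_mono[of "\<bar>strip_slope (U n) z - wave_slope xs (fst z)\<bar>" "2 * sqrt w" 2] w by (simp add: power_mult_distrib)
    ultimately show ?thesis by (simp add: power_mult_distrib mult_right_mono)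
  qed
  have ibd: "integrable lborel (\<lambda>z. 4 * w * (?P z)\<^sup>2)" using strip_wave_integrable(1) by simp
  have iX3: "integrable lborel (\<lambda>z. (strip_slope (U n) z * ?P z - ?W z)\<^sup>2)" for n
    by (rule Bochner_Integration.integrable_bound[OF ibd]) (use bd w in auto)
  have X3: "(\<lambda>n. LINT z|lborel. (strip_slope (U (r n)) z * ?P z - ?W z)\<^sup>2) \<longlonglongrightarrow> 0"
  proof -
    have "(\<lambda>n. LINT z|lborel. (strip_slope (U (r n)) z * ?P z - ?W z)\<^sup>2) \<longlonglongrightarrow> (LINT z::real \<times> real|lborel. 0)"
    proof (rule integral_dominated_convergence[OF _ _ ibd])
      show "AE z in lborel. (\<lambda>n. (strip_slope (U (r n)) z * ?P z - ?W z)\<^sup>2) \<longlonglongrightarrow> 0"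
        using conv(2)
      proof eventually_elim
        case (elim z)
        show ?case
        proof (cases "z \<in> strip")
          case True
          have "(\<lambda>n. (strip_slope (U (r n)) z * ?P z - ?W z)\<^sup>2) \<longlonglongrightarrow> (wave_slope xs (fst z) * ?P z - ?W z)\<^sup>2"
            using elim True by (intro tendsto_intros) blast
          then show ?thesis by (simp add: strip_wave_def strip_wave_derivative_def)
        qed (simp add: strip_wave_def strip_wave_derivative_def)
      qed
      show "AE z in lborel. norm ((strip_slope (U (r n)) z * ?P z - ?W z)\<^sup>2) \<le> 4 * w * (?P z)\<^sup>2" for n using bd by simp
    qed measurable
    then show ?thesis by simp
  qed
  have "(\<lambda>n. LINT z|lborel. (G (r n) z - ?W z)\<^sup>2) \<longlonglongrightarrow> 0"
  proof (rule tendsto_sandwich[OF _ _ tendsto_const])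
    show "(\<lambda>n. 3 * (LINT z|lborel. (G (r n) z - strip_slope (U (r n)) z * U (r n) z)\<^sup>2) + 3 * (w * (LINT z|lborel. (U (r n) z - ?P z)\<^sup>2))
        + 3 * (LINT z|lborel. (strip_slope (U (r n)) z * ?P z - ?W z)\<^sup>2)) \<longlonglongrightarrow> 0"
      using tendsto_add[OF tendsto_add[OF tendsto_mult[OF tendsto_const[of 3] X1] tendsto_mult[OF tendsto_const[of 3] tendsto_mult[OF tendsto_const[of w] X2]]] tendsto_mult[OF tendsto_const[of 3] X3]]
      by simp
    have "(LINT z|lborel. (G n z - ?W z)\<^sup>2) \<le> 3 * (LINT z|lborel. (G n z - strip_slope (U n) z * U n z)\<^sup>2) + 3 * (w * (LINT z|lborel. (U n z - ?P z)\<^sup>2))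
        + 3 * (LINT z|lborel. (strip_slope (U n) z * ?P z - ?W z)\<^sup>2)" for n
    proof -
      note i1 = strip_line.defect_integrable[OF sl, of n]
      have "(G n z - ?W z)\<^sup>2 \<le> 3 * (G n z - strip_slope (U n) z * U n z)\<^sup>2 + 3 * (w * (U n z - ?P z)\<^sup>2) + 3 * (strip_slope (U n) z * ?P z - ?W z)\<^sup>2" for z
      proof (rule square_sum3_le)
        \<comment> \<open>Defect, error of the function and error of the slope. The first is
          controlled by the energy, the second by the bounded slope and the convergence in
          \<open>L^2\<close>, the third by dominated convergence.\<close>
        show "G n z - ?W z = (G n z - strip_slope (U n) z * U n z) + strip_slope (U n) z * (U n z - ?P z) + (strip_slope (U n) z * ?P z - ?W z)"
          by (simp add: algebra_simps)
        show "(strip_slope (U n) z * (U n z - ?P z))\<^sup>2 \<le> w * (U n z - ?P z)\<^sup>2"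
          using power_mono[OF strip_slope_bound[of "U n" z], of 2] w unfolding power_mult_distrib by (intro mult_right_mono) auto
      qed
      then have "(LINT z|lborel. (G n z - ?W z)\<^sup>2) \<le> (LINT z|lborel. 3 * (G n z - strip_slope (U n) z * U n z)\<^sup>2 + 3 * (w * (U n z - ?P z)\<^sup>2) + 3 * (strip_slope (U n) z * ?P z - ?W z)\<^sup>2)"
        using i1 iX0 iX2[of n] iX3[of n] by (intro integral_mono) simp_all
      also have "\<dots> = 3 * (LINT z|lborel. (G n z - strip_slope (U n) z * U n z)\<^sup>2) + 3 * (w * (LINT z|lborel. (U n z - ?P z)\<^sup>2))
        + 3 * (LINT z|lborel. (strip_slope (U n) z * ?P z - ?W z)\<^sup>2)"
        using i1 iX2[of n] iX3[of n] by simp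
      finally show ?thesis .
    qed
    then show "\<forall>\<^sub>F n in sequentially. (LINT z|lborel. (G (r n) z - ?W z)\<^sup>2) \<le> 3 * (LINT z|lborel. (G (r n) z - strip_slope (U (r n)) z * U (r n) z)\<^sup>2)
        + 3 * (w * (LINT z|lborel. (U (r n) z - ?P z)\<^sup>2)) + 3 * (LINT z|lborel. (strip_slope (U (r n)) z * ?P z - ?W z)\<^sup>2)" by simp
  qed simp
  then show ?thesis using that[OF r(1) X2] by blast
qed

theorem lemma5p2:
  fixes p \<gamma> :: real
    and L :: "nat \<Rightarrow> real"
    and u :: "nat \<Rightarrow> real \<times> real \<Rightarrow> complex"
  assumes "\<gamma> < 0"
    and "1 < p" and "p < 3"
    and "\<And>n. L n > 0"
    and "L \<longlonglongrightarrow> 0"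
    and "\<And>n. minimizer p \<gamma> (L n) (u n)"
    and "\<And>n. AE z in lebesgue_on strip. Im (u n z) = 0 \<and> Re (u n z) > 0"
  shows "\<exists>r :: nat \<Rightarrow> nat. strict_mono r \<and>
    (\<lambda>n. H1_norm (\<lambda>z. u (r n) z - strip_profile p \<gamma> (omega_tilde p \<gamma>) z)) \<longlonglongrightarrow> 0"
proof -
  define q where "q = (p - 1) / 2"
  define w where "w = omega_tilde p \<gamma>"
  define xs where "xs = xshift q \<gamma> w"
  note om = omega_tilde_properties[OF assms(2,3,1), folded q_def w_def]
  have p: "p = 2 * q + 1" by (simp add: q_def field_simps)
  interpret soliton q w by (rule om(5))
  have xs: "N xs = 1 / 2" using om(4) by (simp add: xs_def)
  have tau: "tau xs = - \<gamma> / 2" unfolding xs_def by (rule tau_xshift[OF om(5) assms(1) om(3)])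
  then have tau0: "0 < tau xs" and \<gamma>: "\<gamma> = - 2 * tau xs" using assms(1) by simp_all
  have M: "1 < M" by (rule N_half_bounds(1)[OF xs tau0])
  have prof: "strip_profile p \<gamma> (omega_tilde p \<gamma>) = (\<lambda>z. complex_of_real (wave xs (fst z)))"
  proof -
    have "strip_profile (2 * q + 1) \<gamma> w = (\<lambda>z. complex_of_real (wave xs (fst z)))"
      unfolding strip_profile_def xs_def using profile_eq_wave[OF om(5) assms(1) om(3)] by (simp add: fun_eq_iff)
    then show ?thesis by (simp only: p[symmetric] w_def[symmetric])
  qed
  interpret P: strip_function "\<lambda>z. complex_of_real (wave xs (fst z))" "strip_wave xs" "strip_wave_derivative xs" "\<lambda>_. 0"
    by (rule strip_wave_function)
  have adm: "(\<lambda>z. complex_of_real (wave xs (fst z))) \<in> admissible"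
    unfolding admissible_def using H1_rep_weak_partial(1)[OF P.rep] H1_rep_norm(1)[OF P.rep] strip_wave_integrable(3)[of xs] xs by simp
  \<comment> \<open>The competitor does not depend on y, so its energy is the same for every
    \<open>L n\<close>, and the bound on the minimizers is uniform in \<open>n\<close>.\<close>
  have e: "energy (2 * q + 1) (- 2 * tau xs) (L n) (u n) \<le> - 2 * K (1 / 2)" for n
  proof -
    have "ereal (energy p \<gamma> (L n) (u n)) \<le> ereal (energy p \<gamma> (L n) (\<lambda>z. complex_of_real (wave xs (fst z))))"
      using assms(6)[of n] adm unfolding minimizer_def min_energy_def by (auto intro: INF_lower)
    then show ?thesis using strip_wave_energy[OF xs \<gamma>, of "L n"] unfolding p \<gamma>[symmetric] by simp
  qed
  have adm_u: "u n \<in> H1" "(Ltwo_norm (lebesgue_on strip) (u n))\<^sup>2 = 1" for n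
    using assms(6)[of n] by (auto simp: minimizer_def admissible_def)
  have "\<forall>n. \<exists>U G H. strip_function (u n) U G H"
  proof
    fix n
    have "AE z in lebesgue_on strip. Im (u n z) = 0" using assms(7)[of n] by eventually_elim simp
    from strip_function_exists[OF adm_u(1) this] show "\<exists>U G H. strip_function (u n) U G H" by blast
  qed
  then obtain U G H where SF: "\<And>n. strip_function (u n) (U n) (G n) (H n)" by metis
  note rep = strip_function.rep[OF SF]
  have one: "(LINT z|lborel. (U n z)\<^sup>2) = 1" for n using H1_rep_norm(1)[OF rep[of n]] adm_u(2)[of n] by simp
  obtain C where C: "\<And>u U G H L. \<lbrakk>strip_function u U G H; (LINT z|lborel. (U z)\<^sup>2) = 1; 0 < L; L \<le> 1; energy (2 * q + 1) (- 2 * tau xs) L u \<le> - 2 * K (1 / 2)\<rbrakk>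
    \<Longrightarrow> (LINT z|lborel. (G z)\<^sup>2) \<le> C \<and> (LINT z|lborel. (H z)\<^sup>2) \<le> C * L\<^sup>2"
    by (rule a_priori_bound[OF q]) blast
  have ev1: "\<forall>\<^sub>F n in sequentially. L n \<le> 1" using order_tendstoD(2)[OF assms(5), of 1] by (auto elim: eventually_mono)
  have H0: "(\<lambda>n. LINT z|lborel. (H n z)\<^sup>2) \<longlonglongrightarrow> 0"
  proof (rule tendsto_sandwich[OF _ _ tendsto_const])
    show "\<forall>\<^sub>F n in sequentially. (LINT z|lborel. (H n z)\<^sup>2) \<le> C * (L n)\<^sup>2"
      using ev1 by eventually_elim (use C[OF SF one assms(4) _ e] in blast)
    show "(\<lambda>n. C * (L n)\<^sup>2) \<longlonglongrightarrow> 0" using tendsto_mult[OF tendsto_const[of C] tendsto_power[OF assms(5), of 2]] by simp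
  qed simp
  have "(\<lambda>n. 2 * sqrt (LINT z|lborel. (H n z)\<^sup>2)) \<longlonglongrightarrow> 0" using tendsto_mult[OF tendsto_const[of 2] tendsto_real_sqrt[OF H0]] by simp
  then have "\<forall>\<^sub>F n in sequentially. 2 * sqrt (LINT z|lborel. (H n z)\<^sup>2) < M - 1" by (rule order_tendstoD(2)) (use M in simp)
  with ev1 have "\<forall>\<^sub>F n in sequentially. L n \<le> 1 \<and> 2 * sqrt (LINT z|lborel. (H n z)\<^sup>2) < M - 1" by eventually_elim simp
  then obtain n0 where n0: "\<And>n. n \<ge> n0 \<Longrightarrow> L n \<le> 1 \<and> 2 * sqrt (LINT z|lborel. (H n z)\<^sup>2) < M - 1" unfolding eventually_sequentially by blast
  \<comment> \<open>Both \<open>L n \<le> 1\<close> and the smallness required by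
    \<open>strip_line\<close> hold from \<open>n0\<close> on, so the first \<open>n0\<close> terms
    are dropped.\<close>
  define s where "s n = n + n0" for n
  have sl: "strip_line q w (u (s n)) (U (s n)) (G (s n)) (H (s n))" for n
  proof (intro strip_line.intro strip_line_axioms.intro)
    have "AE z in lebesgue_on strip. U (s n) z > 0"
      using assms(7)[of "s n"] H1_repD(2)[OF rep[of "s n"]] by eventually_elim simp
    then show "AE z in lborel. z \<in> strip \<longrightarrow> U (s n) z > 0" unfolding AE_lebesgue_on_iff[OF strip_borel] .
    show "2 * sqrt (LINT z|lborel. (H (s n) z)\<^sup>2) < M - 1" using n0[of "s n"] by (simp add: s_def)
  qed (use soliton_axioms SF one in auto)
  have Cs: "(LINT z|lborel. (G (s n) z)\<^sup>2) \<le> C" for n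
    using C[OF SF one assms(4) _ e, of "s n"] n0[of "s n"] by (simp add: s_def)
  have H0s: "(\<lambda>n. LINT z|lborel. (H (s n) z)\<^sup>2) \<longlonglongrightarrow> 0" unfolding s_def by (rule LIMSEQ_ignore_initial_segment[OF H0])
  obtain r :: "nat \<Rightarrow> nat" where r: "strict_mono r" "(\<lambda>n. LINT z|lborel. (U (s (r n)) z - strip_wave xs z)\<^sup>2) \<longlonglongrightarrow> 0"
    "(\<lambda>n. LINT z|lborel. (G (s (r n)) z - strip_wave_derivative xs z)\<^sup>2) \<longlonglongrightarrow> 0"
    by (rule strip_compactness[OF sl e H0s Cs xs tau0]) blast
  have H0r: "(\<lambda>n. LINT z|lborel. (H (s (r n)) z)\<^sup>2) \<longlonglongrightarrow> 0" using LIMSEQ_subseq_LIMSEQ[OF H0s r(1)] by (simp add: comp_def)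
  have n2: "(norm (complex_of_real a - complex_of_real b))\<^sup>2 = (a - b)\<^sup>2" for a b by (simp flip: of_real_diff)
  have norm_eq: "(H1_norm (\<lambda>z. u n z - complex_of_real (wave xs (fst z))))\<^sup>2
      = (LINT z|lborel. (U n z - strip_wave xs z)\<^sup>2) + (LINT z|lborel. (G n z - strip_wave_derivative xs z)\<^sup>2) + (LINT z|lborel. (H n z)\<^sup>2)" for n
    using H1_rep_norm(2)[OF H1_rep_diff[OF rep[of n] P.rep]] unfolding n2 by simp
  have "(\<lambda>n. (H1_norm (\<lambda>z. u (s (r n)) z - complex_of_real (wave xs (fst z))))\<^sup>2) \<longlonglongrightarrow> 0"
    unfolding norm_eq using tendsto_add[OF tendsto_add[OF r(2,3)] H0r] by simp
  then have "(\<lambda>n. H1_norm (\<lambda>z. u (s (r n)) z - strip_profile p \<gamma> (omega_tilde p \<gamma>) z)) \<longlonglongrightarrow> 0"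
    unfolding prof by (rule tendsto_zero_of_power2) (rule H1_norm_nonneg)
  moreover have "strict_mono (\<lambda>n. s (r n))" using r(1) by (auto simp: strict_mono_def s_def)
  ultimately show ?thesis by blast
qed

end
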